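(* Let $(W,S)$ be a Coxeter system, with $R$, $\Lambda$, $RE_q(W)$, the quiver $Q$ with relations $\mathcal J\subseteq RQ$, the Hasse quiver $\tilde Q$, and the elements $\tilde\rho_{I_\bullet}\in R\tilde Q$ as defined in the context. Let $\tilde{\mathcal J}$ be the subset of $R\tilde Q$ defined by the following relations. ($\tilde{\mathrm J}$1) Idempotent relations: $\tilde\delta_{J,I}\tilde\upsilon_{I,J}=\tilde e_J$ for all $I,J\in\Lambda$ with $I\sqsubset J$. ($\tilde{\mathrm J}$2) Sandwich relations: $\tilde\upsilon_{I,J}\tilde\upsilon_{J,K}=\tilde\upsilon_{I,J'}\tilde\upsilon_{J',K}$ and $\tilde\delta_{K,J}\tilde\delta_{J,I}=\tilde\delta_{K,J'}\tilde\delta_{J',I}$ for all $I,J,J',K\in\Lambda$ with $I\sqsubset J\sqsubset K$ and $I\sqsubset J'\sqsubset K$. ($\tilde{\mathrm J}$3) Extended braid relations: $\tilde\upsilon_{\emptyset,I_1}\cdots\tilde\upsilon_{I_{m-1},I}\,\tilde\delta_{I,I_{m-1}}\cdots\tilde\delta_{I_2,I_1}\tilde\delta_{I_1,\emptyset}=\tilde\rho_{I_\bullet}$ for all $I\in\Lambda^*$ with $|I|>1$ and every ordering $I_\bullet:\emptyset=I_0\sqsubset I_1\sqsubset\cdots\sqsubset I_m=I$. Then there are $R$-algebra isomorphisms $RE_q(W)\cong RQ/\langle\mathcal J\rangle\cong R\tilde Q/\langle\tilde{\mathcal J}\rangle$.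
   Context: $(W,S)$ is a Coxeter system with $S$ finite, $\ell$ is the length function, and $m_{s,t}$ is the order of $st$. For $I\subseteq S$ let $W_I=\langle I\rangle$; $I$ is finitary if $W_I$ is finite, and then $w_I$ is its longest element. $\Lambda$ is the set of finitary subsets of $S$ (including $\emptyset$), and $\Lambda^*=\Lambda\setminus\{\emptyset\}$. $I\sqsubset J$ means $I\subset J$ and $|I|=|J|-1$. The Hecke algebra $H_q=H_q(W)$ is the $\mathbb Z[q]$-algebra with free basis $\{T_w\}_{w\in W}$, generated by $T_s$ ($s\in S$) subject to $T_s^2=(q-1)T_s+q$ and the braid relations $T_sT_tT_s\cdots=T_tT_sT_t\cdots$ ($m_{s,t}$ factors each side, for $s\ne t$ with $m_{s,t}<\infty$); $T_w=T_{s_1}\cdots T_{s_l}$ for a reduced expression $w=s_1\cdots s_l$. For $I\in\Lambda$ put $x_I=\sum_{w\in W_I}T_w$ and $\pi(I)=\sum_{w\in W_I}q^{\ell(w)}$; write $x_s=x_{\{s\}}=T_s+1$. The Hecke endomorphism algebra is $E_q(W)=\mathrm{End}_{H_q}\big(\bigoplus_{I\in\Lambda}x_IH_q\big)$ (right modules). $R=\{f/(1+qg): f,g\in\mathbb Z[q]\}$ is the localisation of $\mathbb Z[q]$ at the set of polynomials with constant term $1$; $RH_q=R\otimes_{\mathbb Z[q]}H_q$, $RE_q(W)=R\otimes_{\mathbb Z[q]}E_q(W)$, and $p_I=x_I/\pi(I)\in RH_q$. Path algebras: the product $\alpha\beta$ of paths is concatenation if the starting vertex of $\alpha$ is the ending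 vertex of $\beta$, and $0$ otherwise; $\langle\cdot\rangle$ is the two-sided ideal generated. The quiver $Q$ has vertex set $\Lambda$ with trivial paths $e_I$, and for each $I\in\Lambda^*$ arrows $\upsilon_I$ from $I$ to $\emptyset$ and $\delta_I$ from $\emptyset$ to $I$. Put $\tau_s=(1+q)\upsilon_{\{s\}}\delta_{\{s\}}-e_\emptyset$. Then $\mathcal J$ consists of the braid relations on the $\tau_s$, $s\in S$, and the relations $\upsilon_I\delta_I=p_I|_{\{\tau_s\}_{s\in S}}$, $\delta_I\upsilon_I=e_I$ for all $I\in\Lambda^*$; here $p_I|_{\{\tau_s\}}$ is obtained from $p_I=\pi(I)^{-1}\sum_{w\in W_I}T_w$ by replacing each $T_s$ by $\tau_s$ (with $1$ replaced by $e_\emptyset$, each $T_w$ written using a reduced expression). The Hasse quiver $\tilde Q$ has vertex set $\Lambda$ (trivial paths $\tilde e_K$) and, for all $I\sqsubset J$ in $\Lambda$, arrows $\tilde\upsilon_{I,J}$ from $J$ to $I$ and $\tilde\delta_{J,I}$ from $I$ to $J$. Put $\tilde\chi_s=(q+1)\tilde\upsilon_{\emptyset,\{s\}}\tilde\delta_{\{s\},\emptyset}$. For $I\in\Lambda$, an ordering of $I$ is a chain $I_\bullet:\emptyset=I_0\sqsubset I_1\sqsubset\cdots\sqsubset I_m=I$. For each $I_\bullet$ fix a reduced expression $w_I=s_ls_{l-1}\cdots s_1$ such that for every $i$ the element $w_{I_i}$ equals $s_{j_i}s_{j_i-1}\cdots s_1$ for some $j_i$; put $\underline w_{I_\bullet}=(s_l,\ldots,s_1)$.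 For a sequence $\underline y=(t_k,\ldots,t_1)$ in $S$ put $x_{\underline y}=x_{t_k}\cdots x_{t_1}$ and $\tilde\chi_{\underline y}=\tilde\chi_{t_k}\cdots\tilde\chi_{t_1}$; $\underline y<\underline w$ means that $\underline y$ is obtained from $\underline w$ by removing some terms. Fix polynomials $a_{\underline y,\underline w_{I_\bullet}}\in\mathbb Z[q]$ (they exist) with $x_I=x_{\underline w_{I_\bullet}}+q\sum_{\underline y<\underline w_{I_\bullet}}a_{\underline y,\underline w_{I_\bullet}}x_{\underline y}$ in $H_q$. Set $\tilde\chi_{I_\bullet}=\tilde\chi_{\underline w_{I_\bullet}}+q\sum_{\underline y<\underline w_{I_\bullet}}a_{\underline y,\underline w_{I_\bullet}}\tilde\chi_{\underline y}$ and $\tilde\rho_{I_\bullet}=\tilde\chi_{I_\bullet}/\pi(I)$. *)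

theory Defs
  imports
    "HOL-Algebra.Multiplicative_Group"
    "HOL-Algebra.Generated_Groups"
    "HOL-Algebra.Module"
    "HOL-Algebra.QuotRing"
    "HOL-Library.Poly_Mapping"
    "HOL-Library.Sublist"
    "HOL-Computational_Algebra.Polynomial"
    "HOL-Computational_Algebra.Fraction_Field"
    "Graph_Theory.Arc_Walk"
begin

section \<open>The localisation of the integer polynomials\<close>

abbreviation qq :: "int poly"
  where "qq \<equiv> [:0, 1:]"

lemma const_one_nonzero [simp]: "1 + qq * g \<noteq> 0" for g :: "int poly"
proof
  assume "1 + qq * g = 0"
  then have "poly (1 + qq * g) 0 = 0" by simp
  then show False by simp
qed

lemma const_one_mult: "(1 + qq * g) * (1 + qq * h) = 1 + qq * (g + h + qq * g * h)"
  for g h :: "int poly"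
  by (simp only: distrib_left distrib_right mult_1_left mult_1_right ac_simps)

text \<open>As \<open>int poly\<close> is a domain and every \<open>1 + q g\<close> is nonzero, the localisation is a subring
  of the field of fractions.\<close>

typedef zq_loc = "{x. \<exists>f g. x = Fract f (1 + qq * g)}"
  by blast

setup_lifting type_definition_zq_loc

instantiation zq_loc :: comm_ring_1
begin

lift_definition zero_zq_loc :: zq_loc is 0
  by (intro exI[of _ 0]) (simp add: Zero_fract_def)

lift_definition one_zq_loc :: zq_loc is 1
  by (rule exI[of _ 1], rule exI[of _ 0]) (simp add: One_fract_def)

lift_definition plus_zq_loc :: "zq_loc \<Rightarrow> zq_loc \<Rightarrow> zq_loc" is "(+)"
proof -
  fix x y :: "int poly fract"
  assume "\<exists>f g. x = Fract f (1 + qq * g)" "\<exists>f g. y = Fract f (1 + qq * g)"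
  then obtain f g f' g' where "x = Fract f (1 + qq * g)" "y = Fract f' (1 + qq * g')"
    by blast
  then have "x + y = Fract (f * (1 + qq * g') + f' * (1 + qq * g)) ((1 + qq * g) * (1 + qq * g'))"
    by (simp only: add_fract const_one_nonzero not_False_eq_True)
  then show "\<exists>f g. x + y = Fract f (1 + qq * g)"
    unfolding const_one_mult by blast
qed

lift_definition times_zq_loc :: "zq_loc \<Rightarrow> zq_loc \<Rightarrow> zq_loc" is "(*)"
proof -
  fix x y :: "int poly fract"
  assume "\<exists>f g. x = Fract f (1 + qq * g)" "\<exists>f g. y = Fract f (1 + qq * g)"
  then obtain f g f' g' where "x = Fract f (1 + qq * g)" "y = Fract f' (1 + qq * g')"
    by blast
  then have "x * y = Fract (f * f') ((1 + qq * g) * (1 + qq * g'))"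
    by (simp only: mult_fract)
  then show "\<exists>f g. x * y = Fract f (1 + qq * g)"
    unfolding const_one_mult by blast
qed

lift_definition uminus_zq_loc :: "zq_loc \<Rightarrow> zq_loc" is uminus
proof -
  fix x :: "int poly fract"
  assume "\<exists>f g. x = Fract f (1 + qq * g)"
  then obtain f g where "x = Fract f (1 + qq * g)"
    by blast
  then have "- x = Fract (- f) (1 + qq * g)"
    by (simp only: minus_fract)
  then show "\<exists>f g. - x = Fract f (1 + qq * g)"
    by blast
qed

definition minus_zq_loc :: "zq_loc \<Rightarrow> zq_loc \<Rightarrow> zq_loc"
  where "minus_zq_loc x y = x + - y"

instance
  by standard (unfold minus_zq_loc_def, (transfer, simp add: algebra_simps)+)

end

text \<open>Meaningful only for denominators with constant term 1, which is all it is used for.\<close>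

definition zq_frac :: "int poly \<Rightarrow> int poly \<Rightarrow> zq_loc"
  where "zq_frac f h = Abs_zq_loc (Fract f h)"

abbreviation of_zq :: "int poly \<Rightarrow> zq_loc"
  where "of_zq f \<equiv> zq_frac f 1"

section \<open>Algebras\<close>

text \<open>An algebra over a commutative ring type \<open>'k\<close>, not necessarily commutative, is a record
  \<open>('k, 'a) module\<close>.\<close>

definition alg_isomorphic :: "('k, 'a) module \<Rightarrow> ('k, 'b) module \<Rightarrow> bool"
  where "alg_isomorphic A B \<longleftrightarrow>
    (\<exists>h \<in> ring_iso A B. \<forall>r. \<forall>x \<in> carrier A. h (r \<odot>\<^bsub>A\<^esub> x) = r \<odot>\<^bsub>B\<^esub> h x)"

text \<open>The quotient by the two-sided ideal generated by \<open>X\<close>. The operation \<open>\<odot>\<close> on cosets is given in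
  the style of \<^const>\<open>rcoset_mult\<close>.\<close>

definition quot_algebra :: "('k, 'a) module \<Rightarrow> 'a set \<Rightarrow> ('k, 'a set) module"
  where "quot_algebra A X = (let I = Idl\<^bsub>A\<^esub> X in
    ring.extend (A Quot I) (module.fields (\<lambda>r Y. \<Union>y\<in>Y. I +>\<^bsub>A\<^esub> (r \<odot>\<^bsub>A\<^esub> y))))"

definition quot_class :: "('k, 'a) module \<Rightarrow> 'a set \<Rightarrow> 'a \<Rightarrow> 'a set"
  where "quot_class A X x = (Idl\<^bsub>A\<^esub> X) +>\<^bsub>A\<^esub> x"

text \<open>The product of \<open>f t\<close> over the letters \<open>t\<close> of a word, with the empty word giving \<open>e\<close>; the
  parameter \<open>e\<close> is needed for products in a corner \<open>e A e\<close>.\<close>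

definition word_prod :: "('a, 'm) monoid_scheme \<Rightarrow> 'a \<Rightarrow> ('s \<Rightarrow> 'a) \<Rightarrow> 's list \<Rightarrow> 'a"
  where "word_prod A e f ts = foldr (\<lambda>t x. f t \<otimes>\<^bsub>A\<^esub> x) ts e"

definition pm_scale :: "'k::comm_ring_1 \<Rightarrow> ('b \<Rightarrow>\<^sub>0 'k) \<Rightarrow> ('b \<Rightarrow>\<^sub>0 'k)"
  where "pm_scale c f = Poly_Mapping.map (\<lambda>x. c * x) f"

definition bilinear_ext ::
    "('b \<Rightarrow> 'b \<Rightarrow> ('b \<Rightarrow>\<^sub>0 'k)) \<Rightarrow> ('b \<Rightarrow>\<^sub>0 'k::comm_ring_1) \<Rightarrow> ('b \<Rightarrow>\<^sub>0 'k) \<Rightarrow> ('b \<Rightarrow>\<^sub>0 'k)"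
  where "bilinear_ext m f g =
    (\<Sum>x\<in>Poly_Mapping.keys f. \<Sum>y\<in>Poly_Mapping.keys g.
       pm_scale (Poly_Mapping.lookup f x * Poly_Mapping.lookup g y) (m x y))"

definition free_algebra :: "'s set \<Rightarrow> ('k::comm_ring_1, 's list \<Rightarrow>\<^sub>0 'k) module"
  where "free_algebra S =
    \<lparr>carrier = {f. Poly_Mapping.keys f \<subseteq> lists S},
     monoid.mult = bilinear_ext (\<lambda>u v. Poly_Mapping.single (u @ v) 1),
     one = Poly_Mapping.single [] 1,
     zero = 0, add = (+), module.smult = pm_scale\<rparr>"

subsection \<open>Extension of scalars\<close>

text \<open>For a ring homomorphism \<open>\<phi> : 'k \<rightarrow> 'r\<close> and a \<open>'k\<close>-algebra \<open>A\<close>, the tensor product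
  \<open>'r \<otimes> A\<close> over \<open>'k\<close> is the free abelian group on the pairs \<open>(r, a)\<close> modulo
  the usual relations. The free group is given the product \<open>(r, a) (r', a') = (r r', a a')\<close>; with
  it the subgroup generated by the relations is already a two-sided ideal.\<close>

definition tensor_free :: "('k, 'a) module \<Rightarrow> ('r::comm_ring_1, ('r \<times> 'a) \<Rightarrow>\<^sub>0 int) module"
  where "tensor_free A =
    \<lparr>carrier = {f. Poly_Mapping.keys f \<subseteq> UNIV \<times> carrier A},
     monoid.mult = bilinear_ext (\<lambda>(r, a) (r', a'). Poly_Mapping.single (r * r', a \<otimes>\<^bsub>A\<^esub> a') 1),
     one = Poly_Mapping.single (1, \<one>\<^bsub>A\<^esub>) 1,
     zero = 0, add = (+),
     module.smult = (\<lambda>r f. \<Sum>(r', a)\<in>Poly_Mapping.keys f.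
       Poly_Mapping.single (r * r', a) (Poly_Mapping.lookup f (r', a)))\<rparr>"

definition tensor_relations ::
    "('k \<Rightarrow> 'r::comm_ring_1) \<Rightarrow> ('k, 'a) module \<Rightarrow> (('r \<times> 'a) \<Rightarrow>\<^sub>0 int) set"
  where "tensor_relations \<phi> A =
    (let pt = (\<lambda>r a. Poly_Mapping.single (r, a) 1) in
      {pt (r + r') a - pt r a - pt r' a | r r' a. a \<in> carrier A} \<union>
      {pt r (a \<oplus>\<^bsub>A\<^esub> a') - pt r a - pt r a' | r a a'. a \<in> carrier A \<and> a' \<in> carrier A} \<union>
      {pt (r * \<phi> c) a - pt r (c \<odot>\<^bsub>A\<^esub> a) | r c a. a \<in> carrier A})"

definition extend_scalars ::
    "('k \<Rightarrow> 'r::comm_ring_1) \<Rightarrow> ('k, 'a) module \<Rightarrow> ('r, (('r \<times> 'a) \<Rightarrow>\<^sub>0 int) set) module"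
  where "extend_scalars \<phi> A = quot_algebra (tensor_free A) (tensor_relations \<phi> A)"

subsection \<open>Path algebras\<close>

text \<open>A path is a triple (starting vertex, arrows in the order in which they are traversed, ending
  vertex). In the product \<open>\<alpha>\<beta>\<close> the path \<open>\<beta>\<close> is traversed first.\<close>

definition path_mult ::
    "'v \<times> 'e list \<times> 'v \<Rightarrow> 'v \<times> 'e list \<times> 'v \<Rightarrow> ('v \<times> 'e list \<times> 'v) \<Rightarrow>\<^sub>0 'k::comm_ring_1"
  where "path_mult = (\<lambda>(u, p, v) (u', p', v').
    if u = v' then Poly_Mapping.single (u', p' @ p, v) 1 else 0)"

definition triv_path :: "'v \<Rightarrow> ('v \<times> 'e list \<times> 'v) \<Rightarrow>\<^sub>0 'k::comm_ring_1"
  where "triv_path v = Poly_Mapping.single (v, [], v) 1"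

definition arrow :: "('v, 'e) pre_digraph \<Rightarrow> 'e \<Rightarrow> ('v \<times> 'e list \<times> 'v) \<Rightarrow>\<^sub>0 'k::comm_ring_1"
  where "arrow G e = Poly_Mapping.single (tail G e, [e], head G e) 1"

text \<open>The unit is as stated when the vertex set is finite.\<close>

definition path_algebra ::
    "('v, 'e) pre_digraph \<Rightarrow> ('k::comm_ring_1, ('v \<times> 'e list \<times> 'v) \<Rightarrow>\<^sub>0 'k) module"
  where "path_algebra G =
    \<lparr>carrier = {f. Poly_Mapping.keys f \<subseteq> {(u, p, v). pre_digraph.awalk G u p v}},
     monoid.mult = bilinear_ext path_mult,
     one = (\<Sum>v\<in>verts G. triv_path v),
     zero = 0, add = (+), module.smult = pm_scale\<rparr>"

section \<open>Coxeter systems\<close>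

definition cox_m :: "('w, 'm) monoid_scheme \<Rightarrow> 'w \<Rightarrow> 'w \<Rightarrow> nat"
  where "cox_m W s t = group.ord W (s \<otimes>\<^bsub>W\<^esub> t)"

abbreviation eval_word :: "('w, 'm) monoid_scheme \<Rightarrow> 'w list \<Rightarrow> 'w"
  where "eval_word W \<equiv> word_prod W \<one>\<^bsub>W\<^esub> (\<lambda>s. s)"

text \<open>One application of a defining relation \<open>(s t)\<^bsup>m(s,t)\<^esup> = 1\<close> in the middle of a word. The
  value \<open>cox_m W s t = 0\<close> stands for an infinite order, and the relation is then empty; the case
  \<open>s = t\<close>, where \<open>cox_m W s s = 1\<close>, gives \<open>s s = 1\<close>.\<close>

definition cox_step :: "('w, 'm) monoid_scheme \<Rightarrow> 'w set \<Rightarrow> 'w list \<Rightarrow> 'w list \<Rightarrow> bool"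
  where "cox_step W S u v \<longleftrightarrow> (\<exists>a b s t. a \<in> lists S \<and> b \<in> lists S \<and> s \<in> S \<and> t \<in> S \<and>
    u = a @ concat (replicate (cox_m W s t) [s, t]) @ b \<and> v = a @ b)"

text \<open>The last clause says that \<open>W\<close> is presented by the generators \<open>S\<close> and the relations
  \<open>(s t)\<^bsup>m(s,t)\<^esup> = 1\<close>. As the generators are involutions, words without inverses suffice.\<close>

definition coxeter_system :: "('w, 'm) monoid_scheme \<Rightarrow> 'w set \<Rightarrow> bool"
  where "coxeter_system W S \<longleftrightarrow> group W \<and> S \<subseteq> carrier W \<and> generate W S = carrier W \<and>
    (\<forall>s\<in>S. group.ord W s = 2) \<and>
    (\<forall>u\<in>lists S. \<forall>v\<in>lists S.
       eval_word W u = eval_word W v \<longrightarrow> equivclp (cox_step W S) u v)"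

definition cox_len :: "('w, 'm) monoid_scheme \<Rightarrow> 'w set \<Rightarrow> 'w \<Rightarrow> nat"
  where "cox_len W S w = (LEAST n. \<exists>ws\<in>lists S. length ws = n \<and> eval_word W ws = w)"

definition reduced_expr :: "('w, 'm) monoid_scheme \<Rightarrow> 'w set \<Rightarrow> 'w \<Rightarrow> 'w list \<Rightarrow> bool"
  where "reduced_expr W S w ws \<longleftrightarrow>
    ws \<in> lists S \<and> eval_word W ws = w \<and> length ws = cox_len W S w"

definition fin_subsets :: "('w, 'm) monoid_scheme \<Rightarrow> 'w set \<Rightarrow> 'w set set"
  where "fin_subsets W S = {I. I \<subseteq> S \<and> finite (generate W I)}"

definition longest_elt :: "('w, 'm) monoid_scheme \<Rightarrow> 'w set \<Rightarrow> 'w set \<Rightarrow> 'w"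
  where "longest_elt W S I = arg_max_on (cox_len W S) (generate W I)"

definition poincare :: "('w, 'm) monoid_scheme \<Rightarrow> 'w set \<Rightarrow> 'w set \<Rightarrow> int poly"
  where "poincare W S I = (\<Sum>w\<in>generate W I. qq ^ cox_len W S w)"

definition covered :: "'a set \<Rightarrow> 'a set \<Rightarrow> bool"  (infix \<open>\<sqsubset>c\<close> 50)
  where "I \<sqsubset>c J \<longleftrightarrow> I \<subset> J \<and> card J = card I + 1"

definition is_ordering :: "'a set \<Rightarrow> 'a set list \<Rightarrow> bool"
  where "is_ordering I Is \<longleftrightarrow>
    Is \<noteq> [] \<and> hd Is = {} \<and> last Is = I \<and> successively (\<sqsubset>c) Is"

text \<open>A reduced expression \<open>s\<^sub>l \<dots> s\<^sub>1\<close> of \<open>w\<^sub>I\<close> is the list \<open>[s\<^sub>l, \<dots>, s\<^sub>1]\<close>, so its parts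
  \<open>s\<^sub>j \<dots> s\<^sub>1\<close> are the suffixes of that list.\<close>

definition adapted_expr ::
    "('w, 'm) monoid_scheme \<Rightarrow> 'w set \<Rightarrow> 'w set list \<Rightarrow> 'w list \<Rightarrow> bool"
  where "adapted_expr W S Is ws \<longleftrightarrow>
    reduced_expr W S (longest_elt W S (last Is)) ws \<and>
    (\<forall>I\<in>set Is. \<exists>v. suffix v ws \<and> longest_elt W S I = eval_word W v)"

text \<open>The word \<open>s t s \<dots>\<close> with \<open>n\<close> letters.\<close>

fun alt_word :: "nat \<Rightarrow> 's \<Rightarrow> 's \<Rightarrow> 's list"
  where
    "alt_word 0 s t = []"
  | "alt_word (Suc n) s t = s # alt_word n t s"

section \<open>The Hecke algebra and the Hecke endomorphism algebra\<close>

definition hecke_relations :: "('w, 'm) monoid_scheme \<Rightarrow> 'w set \<Rightarrow> ('w list \<Rightarrow>\<^sub>0 int poly) set"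
  where "hecke_relations W S =
    {Poly_Mapping.single [s, s] 1 - Poly_Mapping.single [s] (qq - 1) - Poly_Mapping.single [] qq
       | s. s \<in> S} \<union>
    {Poly_Mapping.single (alt_word (cox_m W s t) s t) 1
       - Poly_Mapping.single (alt_word (cox_m W s t) t s) 1
       | s t. s \<in> S \<and> t \<in> S \<and> s \<noteq> t \<and> cox_m W s t > 0}"

definition hecke ::
    "('w, 'm) monoid_scheme \<Rightarrow> 'w set \<Rightarrow> (int poly, ('w list \<Rightarrow>\<^sub>0 int poly) set) module"
  where "hecke W S = quot_algebra (free_algebra S) (hecke_relations W S)"

definition hecke_gen ::
    "('w, 'm) monoid_scheme \<Rightarrow> 'w set \<Rightarrow> 'w \<Rightarrow> ('w list \<Rightarrow>\<^sub>0 int poly) set"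
  where "hecke_gen W S s =
    quot_class (free_algebra S) (hecke_relations W S) (Poly_Mapping.single [s] 1)"

text \<open>By Matsumoto's theorem \<open>T\<^sub>w\<close> does not depend on the choice of a reduced expression; the
  \<open>T\<^sub>w\<close> form a basis of the Hecke algebra.\<close>

definition hecke_T ::
    "('w, 'm) monoid_scheme \<Rightarrow> 'w set \<Rightarrow> 'w \<Rightarrow> ('w list \<Rightarrow>\<^sub>0 int poly) set"
  where "hecke_T W S w =
    word_prod (hecke W S) \<one>\<^bsub>hecke W S\<^esub> (hecke_gen W S) (SOME ws. reduced_expr W S w ws)"

definition hecke_x ::
    "('w, 'm) monoid_scheme \<Rightarrow> 'w set \<Rightarrow> 'w set \<Rightarrow> ('w list \<Rightarrow>\<^sub>0 int poly) set"
  where "hecke_x W S I = finsum (hecke W S) (hecke_T W S) (generate W I)"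

definition hecke_x_word ::
    "('w, 'm) monoid_scheme \<Rightarrow> 'w set \<Rightarrow> 'w list \<Rightarrow> ('w list \<Rightarrow>\<^sub>0 int poly) set"
  where "hecke_x_word W S ys =
    word_prod (hecke W S) \<one>\<^bsub>hecke W S\<^esub> (\<lambda>s. hecke_x W S {s}) ys"

text \<open>The endomorphism algebra of the direct sum of the right ideals \<open>x i A\<close>, \<open>i \<in> L\<close>, of \<open>A\<close>,
  for finite \<open>L\<close>. Elements of the sum are families, endomorphisms are functions on such families,
  both extensional.\<close>

definition right_ideal_sum :: "('k, 'h) module \<Rightarrow> 'i set \<Rightarrow> ('i \<Rightarrow> 'h) \<Rightarrow> ('i \<Rightarrow> 'h) set"
  where "right_ideal_sum A L x = (\<Pi>\<^sub>E i\<in>L. {x i \<otimes>\<^bsub>A\<^esub> h | h. h \<in> carrier A})"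

definition end_algebra ::
    "('k, 'h) module \<Rightarrow> 'i set \<Rightarrow> ('i \<Rightarrow> 'h) \<Rightarrow> ('k, ('i \<Rightarrow> 'h) \<Rightarrow> ('i \<Rightarrow> 'h)) module"
  where "end_algebra A L x =
    (let M = right_ideal_sum A L x;
         plus = (\<lambda>u v. \<lambda>i\<in>L. u i \<oplus>\<^bsub>A\<^esub> v i);
         act = (\<lambda>v h. \<lambda>i\<in>L. v i \<otimes>\<^bsub>A\<^esub> h)
     in \<lparr>carrier = {\<phi> \<in> M \<rightarrow>\<^sub>E M.
           (\<forall>u\<in>M. \<forall>v\<in>M. \<phi> (plus u v) = plus (\<phi> u) (\<phi> v)) \<and>
           (\<forall>v\<in>M. \<forall>h\<in>carrier A. \<phi> (act v h) = act (\<phi> v) h)},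
         monoid.mult = compose M,
         one = (\<lambda>v\<in>M. v),
         zero = (\<lambda>v\<in>M. \<lambda>i\<in>L. \<zero>\<^bsub>A\<^esub>),
         add = (\<lambda>\<phi> \<psi>. \<lambda>v\<in>M. plus (\<phi> v) (\<psi> v)),
         module.smult = (\<lambda>c \<phi>. \<lambda>v\<in>M. \<lambda>i\<in>L. c \<odot>\<^bsub>A\<^esub> \<phi> v i)\<rparr>)"

definition hecke_end where
  "hecke_end W S = end_algebra (hecke W S) (fin_subsets W S) (hecke_x W S)"

section \<open>The first quiver\<close>

text \<open>\<open>Ups I\<close> is the arrow from \<open>I\<close> to \<open>{}\<close> and \<open>Del I\<close> the arrow from \<open>{}\<close> to \<open>I\<close>.\<close>

datatype 'w q_arrow = Ups "'w set" | Del "'w set"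

definition q_quiver :: "('w, 'm) monoid_scheme \<Rightarrow> 'w set \<Rightarrow> ('w set, 'w q_arrow) pre_digraph"
  where "q_quiver W S =
    \<lparr>verts = fin_subsets W S,
     arcs = Ups ` (fin_subsets W S - {{}}) \<union> Del ` (fin_subsets W S - {{}}),
     tail = (\<lambda>e. case e of Ups I \<Rightarrow> I | Del I \<Rightarrow> {}),
     head = (\<lambda>e. case e of Ups I \<Rightarrow> {} | Del I \<Rightarrow> I)\<rparr>"

type_synonym 'w q_elt = "('w set \<times> 'w q_arrow list \<times> 'w set) \<Rightarrow>\<^sub>0 zq_loc"

definition RQ :: "('w, 'm) monoid_scheme \<Rightarrow> 'w set \<Rightarrow> (zq_loc, 'w q_elt) module"
  where "RQ W S = path_algebra (q_quiver W S)"

definition ups :: "('w, 'm) monoid_scheme \<Rightarrow> 'w set \<Rightarrow> 'w set \<Rightarrow> 'w q_elt"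
  where "ups W S I = arrow (q_quiver W S) (Ups I)"

definition del :: "('w, 'm) monoid_scheme \<Rightarrow> 'w set \<Rightarrow> 'w set \<Rightarrow> 'w q_elt"
  where "del W S I = arrow (q_quiver W S) (Del I)"

definition tau :: "('w, 'm) monoid_scheme \<Rightarrow> 'w set \<Rightarrow> 'w \<Rightarrow> 'w q_elt"
  where "tau W S s =
    of_zq (1 + qq) \<odot>\<^bsub>RQ W S\<^esub> (ups W S {s} \<otimes>\<^bsub>RQ W S\<^esub> del W S {s}) - triv_path {}"

definition tau_word :: "('w, 'm) monoid_scheme \<Rightarrow> 'w set \<Rightarrow> 'w list \<Rightarrow> 'w q_elt"
  where "tau_word W S ws = word_prod (RQ W S) (triv_path {}) (tau W S) ws"

text \<open>\<open>p\<^sub>I\<close> with each \<open>T\<^sub>s\<close> replaced by \<open>\<tau>\<^sub>s\<close>, where \<open>red w\<close> is the reduced expression used for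
  \<open>T\<^sub>w\<close>.\<close>

definition p_at_tau ::
    "('w, 'm) monoid_scheme \<Rightarrow> 'w set \<Rightarrow> ('w \<Rightarrow> 'w list) \<Rightarrow> 'w set \<Rightarrow> 'w q_elt"
  where "p_at_tau W S red I =
    zq_frac 1 (poincare W S I) \<odot>\<^bsub>RQ W S\<^esub> (\<Sum>w\<in>generate W I. tau_word W S (red w))"

text \<open>A relation \<open>a = b\<close> is rendered as the element \<open>a - b\<close>.\<close>

definition J_relations ::
    "('w, 'm) monoid_scheme \<Rightarrow> 'w set \<Rightarrow> ('w \<Rightarrow> 'w list) \<Rightarrow> 'w q_elt set"
  where "J_relations W S red =
    {tau_word W S (alt_word (cox_m W s t) s t) - tau_word W S (alt_word (cox_m W s t) t s)
       | s t. s \<in> S \<and> t \<in> S \<and> s \<noteq> t \<and> cox_m W s t > 0} \<union>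
    {ups W S I \<otimes>\<^bsub>RQ W S\<^esub> del W S I - p_at_tau W S red I | I. I \<in> fin_subsets W S - {{}}} \<union>
    {del W S I \<otimes>\<^bsub>RQ W S\<^esub> ups W S I - triv_path I | I. I \<in> fin_subsets W S - {{}}}"

section \<open>The Hasse quiver\<close>

text \<open>\<open>HUps I J\<close> is the arrow from \<open>J\<close> to \<open>I\<close> and \<open>HDel J I\<close> the arrow from \<open>I\<close> to \<open>J\<close>.\<close>

datatype 'w h_arrow = HUps "'w set" "'w set" | HDel "'w set" "'w set"

definition hasse_quiver ::
    "('w, 'm) monoid_scheme \<Rightarrow> 'w set \<Rightarrow> ('w set, 'w h_arrow) pre_digraph"
  where "hasse_quiver W S =
    \<lparr>verts = fin_subsets W S,
     arcs = {HUps I J | I J. I \<in> fin_subsets W S \<and> J \<in> fin_subsets W S \<and> I \<sqsubset>c J} \<union>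
            {HDel J I | I J. I \<in> fin_subsets W S \<and> J \<in> fin_subsets W S \<and> I \<sqsubset>c J},
     tail = (\<lambda>e. case e of HUps I J \<Rightarrow> J | HDel J I \<Rightarrow> I),
     head = (\<lambda>e. case e of HUps I J \<Rightarrow> I | HDel J I \<Rightarrow> J)\<rparr>"

type_synonym 'w h_elt = "('w set \<times> 'w h_arrow list \<times> 'w set) \<Rightarrow>\<^sub>0 zq_loc"

definition RHasse :: "('w, 'm) monoid_scheme \<Rightarrow> 'w set \<Rightarrow> (zq_loc, 'w h_elt) module"
  where "RHasse W S = path_algebra (hasse_quiver W S)"

definition hups :: "('w, 'm) monoid_scheme \<Rightarrow> 'w set \<Rightarrow> 'w set \<Rightarrow> 'w set \<Rightarrow> 'w h_elt"
  where "hups W S I J = arrow (hasse_quiver W S) (HUps I J)"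

definition hdel :: "('w, 'm) monoid_scheme \<Rightarrow> 'w set \<Rightarrow> 'w set \<Rightarrow> 'w set \<Rightarrow> 'w h_elt"
  where "hdel W S J I = arrow (hasse_quiver W S) (HDel J I)"

definition chi :: "('w, 'm) monoid_scheme \<Rightarrow> 'w set \<Rightarrow> 'w \<Rightarrow> 'w h_elt"
  where "chi W S s =
    of_zq (qq + 1) \<odot>\<^bsub>RHasse W S\<^esub> (hups W S {} {s} \<otimes>\<^bsub>RHasse W S\<^esub> hdel W S {s} {})"

definition chi_word :: "('w, 'm) monoid_scheme \<Rightarrow> 'w set \<Rightarrow> 'w list \<Rightarrow> 'w h_elt"
  where "chi_word W S ys = word_prod (RHasse W S) (triv_path {}) (chi W S) ys"

text \<open>\<open>a y ws\<close> is the coefficient indexed by the sequences \<open>y < ws\<close>, and \<open>ws\<close> is the sequence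
  attached to an ordering of \<open>I\<close>.\<close>

definition rho ::
    "('w, 'm) monoid_scheme \<Rightarrow> 'w set \<Rightarrow> ('w list \<Rightarrow> 'w list \<Rightarrow> int poly)
     \<Rightarrow> 'w set \<Rightarrow> 'w list \<Rightarrow> 'w h_elt"
  where "rho W S a I ws =
    zq_frac 1 (poincare W S I) \<odot>\<^bsub>RHasse W S\<^esub>
      (chi_word W S ws + of_zq qq \<odot>\<^bsub>RHasse W S\<^esub>
         (\<Sum>y\<in>{y. strict_subseq y ws}. of_zq (a y ws) \<odot>\<^bsub>RHasse W S\<^esub> chi_word W S y))"

text \<open>The identity that the coefficients \<open>a\<close> are required to satisfy in the Hecke algebra.\<close>

definition x_expansion ::
    "('w, 'm) monoid_scheme \<Rightarrow> 'w set \<Rightarrow> ('w list \<Rightarrow> 'w list \<Rightarrow> int poly)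
     \<Rightarrow> 'w set \<Rightarrow> 'w list \<Rightarrow> bool"
  where "x_expansion W S a I ws \<longleftrightarrow>
    hecke_x W S I =
      hecke_x_word W S ws \<oplus>\<^bsub>hecke W S\<^esub> (qq \<odot>\<^bsub>hecke W S\<^esub>
        finsum (hecke W S) (\<lambda>y. a y ws \<odot>\<^bsub>hecke W S\<^esub> hecke_x_word W S y) {y. strict_subseq y ws})"

text \<open>The left hand side of the extended braid relation for the chain \<open>Is = [I\<^sub>0, \<dots>, I\<^sub>m]\<close>.\<close>

definition chain_path :: "('w, 'm) monoid_scheme \<Rightarrow> 'w set \<Rightarrow> 'w set list \<Rightarrow> 'w h_elt"
  where "chain_path W S Is =
    word_prod (RHasse W S) \<one>\<^bsub>RHasse W S\<^esub> (\<lambda>x. x)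
      (map (\<lambda>i. hups W S (Is ! i) (Is ! Suc i)) [0..<length Is - 1] @
       map (\<lambda>i. hdel W S (Is ! Suc i) (Is ! i)) (rev [0..<length Is - 1]))"

definition HJ_relations ::
    "('w, 'm) monoid_scheme \<Rightarrow> 'w set \<Rightarrow> ('w set list \<Rightarrow> 'w list)
     \<Rightarrow> ('w list \<Rightarrow> 'w list \<Rightarrow> int poly) \<Rightarrow> 'w h_elt set"
  where "HJ_relations W S rw a =
    (let \<Lambda> = fin_subsets W S; A = RHasse W S; \<upsilon> = hups W S; \<delta> = hdel W S in
      {\<delta> J I \<otimes>\<^bsub>A\<^esub> \<upsilon> I J - triv_path J | I J. I \<in> \<Lambda> \<and> J \<in> \<Lambda> \<and> I \<sqsubset>c J} \<union>
      {\<upsilon> I J \<otimes>\<^bsub>A\<^esub> \<upsilon> J K - \<upsilon> I J' \<otimes>\<^bsub>A\<^esub> \<upsilon> J' K | I J J' K.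
         {I, J, J', K} \<subseteq> \<Lambda> \<and> I \<sqsubset>c J \<and> J \<sqsubset>c K \<and> I \<sqsubset>c J' \<and> J' \<sqsubset>c K} \<union>
      {\<delta> K J \<otimes>\<^bsub>A\<^esub> \<delta> J I - \<delta> K J' \<otimes>\<^bsub>A\<^esub> \<delta> J' I | I J J' K.
         {I, J, J', K} \<subseteq> \<Lambda> \<and> I \<sqsubset>c J \<and> J \<sqsubset>c K \<and> I \<sqsubset>c J' \<and> J' \<sqsubset>c K} \<union>
      {chain_path W S Is - rho W S a I (rw Is) | I Is.
         I \<in> \<Lambda> \<and> card I > 1 \<and> is_ordering I Is})"

end

(* The idempotent e_{} cuts out of RQ/<J> a corner that receives a map iota from the Hecke algebra,
  T_s |-> tau_s: the quadratic relation holds because upsilon_s delta_s is idempotent. On the other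
  side upsilon_I corresponds to the inclusion x_I H -> H and delta_I to left multiplication by
  x_I/pi(I), and an endomorphism phi is recovered in RQ/<J> as the sum over I, K of
  pi(I)^(-1) delta_K iota(phi_KI) upsilon_I, where phi_KI is the K-component of phi(x_I). Multiplicativity
  rests on x_I x_J = pi(I) x_J = x_J x_I for I <= J.

  For the Hasse quiver, v_{I,J} = delta_I upsilon_J in one direction; in the other, upsilon_I and
  delta_I are products along an ordering of I, independent of it by the sandwich relations and induction
  on |I|: orderings ending with J < I and J' < I are compared through J Int J'. The braid relation for
  s, t comes from the extended braid relations of the two orderings of I = {s,t}, which equate two words
  in the generators with leading terms the two reduced words of w_I. Modulo the quadratic relations the
  remaining terms reduce to shorter alternating words, and their coefficients agree on both sides
  because the corresponding T_w are linearly independent in the Hecke algebra. *)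

theory Submission
  imports Defs
begin

text \<open>Both quotients are presented by generators and relations, so a map out of either is
  obtained by exhibiting the relations in the target. The locales \<open>qrep\<close> and
  \<open>hrep\<close> hold such data in an arbitrary algebra; one derivation then serves for a
  quotient and for the endomorphism algebra alike. The obstacle is that the Hecke algebra, too, is
  only presented: a map out of it needs the braid relations, which are not among the Hasse
  relations. Hence words stay in the free algebra until those are known, and the independence of the
  T_w must be proved: left and right multiplication operators on the free module over W commute by
  the exchange condition, and exchange comes from counting the reflections of a word modulo 2, a
  count that Coxeter relators preserve. Division by pi(I) is possible because only the identity has
  length 0, so pi(I) has constant term 1. The corner at the empty set is read over Z[q] through
  \<open>of_zq\<close>, so that it can receive the Hecke algebra. The endomorphism algebra comes
  without a presentation; the map out of it is defined by matrix entries at the generators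
  x_I.\<close>

lemma of_zq_rep: "Rep_zq_loc (zq_frac f (1 + qq * g)) = Fract f (1 + qq * g)"
  unfolding zq_frac_def by (rule Abs_zq_loc_inverse) blast

lemma of_zq_rep1: "Rep_zq_loc (of_zq f) = Fract f 1"
  using of_zq_rep[of f 0] by simp

lemma of_zq_simps:
  "of_zq (f + g) = of_zq f + of_zq g" "of_zq (f * g) = of_zq f * of_zq g"
  "of_zq 1 = 1" "of_zq 0 = 0" "of_zq (- f) = - of_zq f"
  by (simp_all add: Rep_zq_loc_inject[symmetric] plus_zq_loc.rep_eq times_zq_loc.rep_eq
      one_zq_loc.rep_eq zero_zq_loc.rep_eq uminus_zq_loc.rep_eq of_zq_rep1 One_fract_def Zero_fract_def)

lemma of_zq_diff: "of_zq (f - g) = of_zq f - of_zq g"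
  using of_zq_simps(1)[of f "- g"] by (simp add: of_zq_simps(5))

text \<open>A polynomial with constant term 1 has the form 1 + q g, so it is one of the denominators
  of the localisation. This is what makes 1/pi(I) available later.\<close>

lemma zq_frac_inverse:
  assumes "poly.coeff h 0 = 1"
  shows "zq_frac 1 h * of_zq h = 1"
proof -
  obtain g where h: "h = pCons 1 g"
    using assms by (cases h) auto
  have h': "h = 1 + qq * g"
    by (simp add: h one_pCons)
  have "h \<noteq> 0" using assms by auto
  moreover have "Rep_zq_loc (zq_frac 1 h) = Fract 1 h"
    unfolding h' by (rule of_zq_rep)
  ultimately show ?thesis
    by (simp add: Rep_zq_loc_inject[symmetric] times_zq_loc.rep_eq of_zq_rep1 one_zq_loc.rep_eq
        One_fract_def eq_fract)
qed

section \<open>Formal linear combinations and bilinear products on them\<close>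

lemma lookup_pm_scale [simp]: "Poly_Mapping.lookup (pm_scale c f) k = c * Poly_Mapping.lookup f k"
  unfolding pm_scale_def by (auto simp: Poly_Mapping.map.rep_eq when_def)

lemma pm_scale_simps:
  "pm_scale c (f + g) = pm_scale c f + pm_scale c g"
  "pm_scale (c + d) f = pm_scale c f + pm_scale d f"
  "pm_scale c (pm_scale d f) = pm_scale (c * d) f"
  "pm_scale 1 f = f" "pm_scale 0 f = 0" "pm_scale c 0 = 0"
  "pm_scale c (Poly_Mapping.single k x) = Poly_Mapping.single k (c * x)"
  "pm_scale c (- f) = - pm_scale c f"
  "pm_scale c (f - g) = pm_scale c f - pm_scale c g"
  by (auto intro!: poly_mapping_eqI simp: lookup_add lookup_minus algebra_simps lookup_single when_def)

lemma pm_scale_sum: "pm_scale c (sum f X) = (\<Sum>x\<in>X. pm_scale c (f x))"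
  by (induction X rule: infinite_finite_induct) (auto simp: pm_scale_simps)

lemma keys_pm_scale: "Poly_Mapping.keys (pm_scale c f) \<subseteq> Poly_Mapping.keys f"
  by (auto simp: in_keys_iff)

lemma keys_minus: "Poly_Mapping.keys (f - g :: 'b \<Rightarrow>\<^sub>0 'k::ab_group_add)
    \<subseteq> Poly_Mapping.keys f \<union> Poly_Mapping.keys g"
  by (auto simp: in_keys_iff lookup_minus)

lemma keys_sum_subset:
  "(\<And>x. x \<in> X \<Longrightarrow> Poly_Mapping.keys (f x) \<subseteq> Y) \<Longrightarrow> Poly_Mapping.keys (sum f X) \<subseteq> Y"
  by (induction X rule: infinite_finite_induct) (auto dest!: keys_add[THEN subsetD])

lemma pm_sum_single: "(\<Sum>k\<in>Poly_Mapping.keys f. Poly_Mapping.single k (Poly_Mapping.lookup f k)) = f"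
proof (rule poly_mapping_eqI)
  fix k
  show "Poly_Mapping.lookup (\<Sum>k\<in>Poly_Mapping.keys f. Poly_Mapping.single k (Poly_Mapping.lookup f k)) k
      = Poly_Mapping.lookup f k"
    by (cases "k \<in> Poly_Mapping.keys f")
      (simp_all add: lookup_sum lookup_single when_def in_keys_iff)
qed

text \<open>Every combination is the finite sum of its monomials. The support bound \<open>X\<close>
  is kept in the addition case because the carriers of free, path and tensor algebras are all given
  by a bound on the support.\<close>

lemma pm_induct [consumes 1, case_names zero single add]:
  fixes f :: "'b \<Rightarrow>\<^sub>0 'k::comm_ring_1"
  assumes "Poly_Mapping.keys f \<subseteq> X"
    and "P 0"
    and "\<And>x c. x \<in> X \<Longrightarrow> P (Poly_Mapping.single x c)"
    and add: "\<And>f g. Poly_Mapping.keys f \<subseteq> X \<Longrightarrow> Poly_Mapping.keys g \<subseteq> X \<Longrightarrow> P f \<Longrightarrow> P g \<Longrightarrow> P (f + g)"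
  shows "P f"
proof -
  have "P (\<Sum>k\<in>K. Poly_Mapping.single k (Poly_Mapping.lookup f k))"
    if "finite K" "K \<subseteq> Poly_Mapping.keys f" for K
    using that
  proof (induction K rule: finite_induct)
    case (insert x K)
    then show ?case
      using assms(1) by (auto intro!: add keys_sum_subset assms(3) split: if_splits)
  qed (simp add: assms(2))
  from this[of "Poly_Mapping.keys f"] show ?thesis
    by (simp add: pm_sum_single)
qed

text \<open>Indices outside the supports contribute zero coefficients. Fixed larger index sets are
  needed because cancellation can make the support of a sum smaller than the union of the
  supports.\<close>

lemma bilinear_ext_superset:
  assumes "finite X" "Poly_Mapping.keys f \<subseteq> X" "finite Y" "Poly_Mapping.keys g \<subseteq> Y"
  shows "bilinear_ext m f g = (\<Sum>x\<in>X. \<Sum>y\<in>Y.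
    pm_scale (Poly_Mapping.lookup f x * Poly_Mapping.lookup g y) (m x y))"
proof -
  have "(\<Sum>y\<in>Y. pm_scale (Poly_Mapping.lookup f x * Poly_Mapping.lookup g y) (m x y)) =
     (\<Sum>y\<in>Poly_Mapping.keys g. pm_scale (Poly_Mapping.lookup f x * Poly_Mapping.lookup g y) (m x y))" for x
    using assms by (intro sum.mono_neutral_right) (auto simp: in_keys_iff pm_scale_simps)
  then show ?thesis
    unfolding bilinear_ext_def using assms
    by (simp, intro sum.mono_neutral_left) (auto simp: in_keys_iff pm_scale_simps)
qed

lemma bilinear_ext_add_left: "bilinear_ext m (f + f') g = bilinear_ext m f g + bilinear_ext m f' g"
proof -
  let ?X = "Poly_Mapping.keys f \<union> Poly_Mapping.keys f'" and ?Y = "Poly_Mapping.keys g"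
  have "Poly_Mapping.keys (f + f') \<subseteq> ?X" by (rule keys_add)
  then show ?thesis
    by (simp add: bilinear_ext_superset[where X = ?X and Y = ?Y] lookup_add algebra_simps
        pm_scale_simps sum.distrib)
qed

lemma bilinear_ext_add_right: "bilinear_ext m f (g + g') = bilinear_ext m f g + bilinear_ext m f g'"
proof -
  let ?Y = "Poly_Mapping.keys g \<union> Poly_Mapping.keys g'" and ?X = "Poly_Mapping.keys f"
  have "Poly_Mapping.keys (g + g') \<subseteq> ?Y" by (rule keys_add)
  then show ?thesis
    by (simp add: bilinear_ext_superset[where X = ?X and Y = ?Y] lookup_add algebra_simps
        pm_scale_simps sum.distrib)
qed

lemma bilinear_ext_scale_left: "bilinear_ext m (pm_scale c f) g = pm_scale c (bilinear_ext m f g)"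
  by (simp add: bilinear_ext_superset[where X = "Poly_Mapping.keys f" and Y = "Poly_Mapping.keys g"]
      keys_pm_scale pm_scale_sum pm_scale_simps mult.assoc)

lemma bilinear_ext_scale_right: "bilinear_ext m f (pm_scale c g) = pm_scale c (bilinear_ext m f g)"
  by (simp add: bilinear_ext_superset[where X = "Poly_Mapping.keys f" and Y = "Poly_Mapping.keys g"]
      keys_pm_scale pm_scale_sum pm_scale_simps mult.assoc mult.left_commute)

lemma bilinear_ext_zero [simp]: "bilinear_ext m 0 g = 0" "bilinear_ext m f 0 = 0"
  by (simp_all add: bilinear_ext_def)

lemma bilinear_ext_single [simp]:
  "bilinear_ext m (Poly_Mapping.single x c) (Poly_Mapping.single y d) = pm_scale (c * d) (m x y)"
  by (subst bilinear_ext_superset[where X = "{x}" and Y = "{y}"]) auto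

lemma keys_bilinear_ext:
  assumes "\<And>x y. x \<in> X \<Longrightarrow> y \<in> X \<Longrightarrow> Poly_Mapping.keys (m x y) \<subseteq> X"
    and "Poly_Mapping.keys f \<subseteq> X" "Poly_Mapping.keys g \<subseteq> X"
  shows "Poly_Mapping.keys (bilinear_ext m f g) \<subseteq> X"
  unfolding bilinear_ext_def
  using assms by (intro keys_sum_subset order_trans[OF keys_pm_scale]) auto

text \<open>The ring axioms see only carrier, product, unit, zero and sum. This moves them from the
  factor ring to the module record built over it, which is a different record type.\<close>

lemma ring_cong:
  fixes A :: "('a, 'm) ring_scheme" and B :: "('a, 'n) ring_scheme"
  assumes "ring A" "carrier B = carrier A" "monoid.mult B = monoid.mult A" "one B = one A"
    "zero B = zero A" "add B = add A"
  shows "ring B"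
proof -
  interpret ring A by fact
  show ?thesis
  proof (intro ringI abelian_groupI monoidI)
    fix x assume "x \<in> carrier B"
    then show "\<exists>y\<in>carrier B. y \<oplus>\<^bsub>B\<^esub> x = \<zero>\<^bsub>B\<^esub>"
      using assms by (auto intro!: bexI[of _ "\<ominus>\<^bsub>A\<^esub> x"] simp: l_neg)
  qed (use assms in \<open>auto simp: a_ac m_assoc l_distr r_distr\<close>)
qed

text \<open>Associativity is trilinear and the unit laws are linear, so basis elements suffice. The
  unit \<open>u\<close> may be any combination, since in a path algebra it is a sum of trivial
  paths.\<close>

lemma ring_pmI:
  fixes A :: "('b \<Rightarrow>\<^sub>0 'k::comm_ring_1, 'm) ring_scheme"
  assumes A: "carrier A = {f. Poly_Mapping.keys f \<subseteq> X}" "monoid.mult A = bilinear_ext m" "one A = u"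
      "zero A = 0" "add A = (+)"
    and m: "\<And>x y. x \<in> X \<Longrightarrow> y \<in> X \<Longrightarrow> Poly_Mapping.keys (m x y) \<subseteq> X"
    and u: "Poly_Mapping.keys u \<subseteq> X"
    and assoc: "\<And>x y z. x \<in> X \<Longrightarrow> y \<in> X \<Longrightarrow> z \<in> X \<Longrightarrow>
      bilinear_ext m (m x y) (Poly_Mapping.single z 1) = bilinear_ext m (Poly_Mapping.single x 1) (m y z)"
    and unit: "\<And>x. x \<in> X \<Longrightarrow> bilinear_ext m u (Poly_Mapping.single x 1) = Poly_Mapping.single x 1"
      "\<And>x. x \<in> X \<Longrightarrow> bilinear_ext m (Poly_Mapping.single x 1) u = Poly_Mapping.single x 1"
  shows "ring A"
proof -
  have sc: "Poly_Mapping.single x c = pm_scale c (Poly_Mapping.single x 1)" for x :: 'b and c :: 'k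
    by (simp add: pm_scale_simps)
  have kadd: "Poly_Mapping.keys (f + g) \<subseteq> X" if "Poly_Mapping.keys f \<subseteq> X" "Poly_Mapping.keys g \<subseteq> X"
    for f g :: "'b \<Rightarrow>\<^sub>0 'k"
    using keys_add[of f g] that by blast
  have assoc': "bilinear_ext m (bilinear_ext m f g) h = bilinear_ext m f (bilinear_ext m g h)"
    if "Poly_Mapping.keys f \<subseteq> X" "Poly_Mapping.keys g \<subseteq> X" "Poly_Mapping.keys h \<subseteq> X" for f g h
    using that(1)
  proof (induction f rule: pm_induct)
    case (single x c)
    show ?case using that(2)
    proof (induction g rule: pm_induct)
      case (single y d)
      show ?case using that(3)
      proof (induction h rule: pm_induct)
        case (single z e)
        have "bilinear_ext m (pm_scale (c * d) (m x y)) (Poly_Mapping.single z e)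
           = pm_scale (c * d * e) (bilinear_ext m (m x y) (Poly_Mapping.single z 1))"
          by (subst sc) (simp add: bilinear_ext_scale_left bilinear_ext_scale_right pm_scale_simps(3) ac_simps)
        moreover have "bilinear_ext m (Poly_Mapping.single x c) (pm_scale (d * e) (m y z))
           = pm_scale (c * d * e) (bilinear_ext m (Poly_Mapping.single x 1) (m y z))"
          by (subst sc) (simp add: bilinear_ext_scale_left bilinear_ext_scale_right pm_scale_simps(3) ac_simps)
        ultimately show ?case
          using assoc[of x y z] \<open>x \<in> X\<close> \<open>y \<in> X\<close> \<open>z \<in> X\<close> by simp
      qed (simp_all add: bilinear_ext_add_right)
    qed (simp_all add: bilinear_ext_add_right bilinear_ext_add_left)
  qed (simp_all add: bilinear_ext_add_left)
  have l1: "bilinear_ext m u f = f" if "Poly_Mapping.keys f \<subseteq> X" for f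
    using that
  proof (induction f rule: pm_induct)
    case (single x c)
    show ?case by (subst (1 2) sc) (simp only: bilinear_ext_scale_right unit(1)[OF single])
  qed (simp_all add: bilinear_ext_add_right)
  have r1: "bilinear_ext m f u = f" if "Poly_Mapping.keys f \<subseteq> X" for f
    using that
  proof (induction f rule: pm_induct)
    case (single x c)
    show ?case by (subst (1 2) sc) (simp only: bilinear_ext_scale_left unit(2)[OF single])
  qed (simp_all add: bilinear_ext_add_left)
  show ?thesis
  proof (intro ringI abelian_groupI monoidI)
    fix x assume "x \<in> carrier A"
    then show "\<exists>y\<in>carrier A. y \<oplus>\<^bsub>A\<^esub> x = \<zero>\<^bsub>A\<^esub>"
      by (intro bexI[of _ "- x"]) (auto simp: A)
  qed (use kadd keys_bilinear_ext[OF m] in \<open>auto simp: A assoc' l1 r1 u bilinear_ext_add_left bilinear_ext_add_right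
        ac_simps\<close>)
qed

subsection \<open>Algebras\<close>

text \<open>The product need not commute, so compatibility with scalars is demanded in both factors;
  together the two laws say that scalars act centrally.\<close>

locale alg = ring A for A :: "('k::comm_ring_1, 'a) module" (structure) +
  assumes smult_closed [simp, intro]: "x \<in> carrier A \<Longrightarrow> r \<odot> x \<in> carrier A"
    and smult_l_distr: "x \<in> carrier A \<Longrightarrow> (r + s) \<odot> x = r \<odot> x \<oplus> s \<odot> x"
    and smult_r_distr: "x \<in> carrier A \<Longrightarrow> y \<in> carrier A \<Longrightarrow> r \<odot> (x \<oplus> y) = r \<odot> x \<oplus> r \<odot> y"
    and smult_assoc: "x \<in> carrier A \<Longrightarrow> (r * s) \<odot> x = r \<odot> (s \<odot> x)"
    and smult_one [simp]: "x \<in> carrier A \<Longrightarrow> 1 \<odot> x = x"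
    and smult_mult_l: "x \<in> carrier A \<Longrightarrow> y \<in> carrier A \<Longrightarrow> (r \<odot> x) \<otimes> y = r \<odot> (x \<otimes> y)"
    and smult_mult_r: "x \<in> carrier A \<Longrightarrow> y \<in> carrier A \<Longrightarrow> x \<otimes> (r \<odot> y) = r \<odot> (x \<otimes> y)"
begin

lemma smult_zero_r [simp]: "r \<odot> \<zero> = \<zero>"
  by (metis add.r_cancel_one' smult_closed smult_r_distr zero_closed r_zero)

lemma smult_zero_l [simp]: "x \<in> carrier A \<Longrightarrow> 0 \<odot> x = \<zero>"
  by (metis add.r_cancel_one' smult_closed smult_l_distr add_0)

lemma smult_minus_l: "x \<in> carrier A \<Longrightarrow> (- r) \<odot> x = \<ominus> (r \<odot> x)"
  by (metis minus_equality smult_closed smult_l_distr smult_zero_l add.left_inverse)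

lemma finsum_smult:
  "f \<in> X \<rightarrow> carrier A \<Longrightarrow> r \<odot> finsum A f X = finsum A (\<lambda>x. r \<odot> f x) X"
proof (induction X rule: infinite_finite_induct)
  case (insert x X)
  then show ?case
    by (subst (1 2) finsum_insert) (auto simp: smult_r_distr)
qed auto

lemma finsum_smult_l:
  "x \<in> carrier A \<Longrightarrow> (\<Sum>i\<in>X. f i) \<odot> x = finsum A (\<lambda>i. f i \<odot> x) X"
  by (induction X rule: infinite_finite_induct) (auto simp: smult_l_distr)

lemma smult_left_commute: "x \<in> carrier A \<Longrightarrow> r \<odot> (s \<odot> x) = s \<odot> (r \<odot> x)"
  by (metis smult_assoc mult.commute)

end

text \<open>This is the linear map out of the free module on the basis \<open>'b\<close> with
  prescribed values \<open>F\<close> on the basis.\<close>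

definition lext :: "('k::comm_ring_1, 'a) module \<Rightarrow> ('b \<Rightarrow> 'a) \<Rightarrow> ('b \<Rightarrow>\<^sub>0 'k) \<Rightarrow> 'a"
  where "lext B F f = finsum B (\<lambda>x. Poly_Mapping.lookup f x \<odot>\<^bsub>B\<^esub> F x) (Poly_Mapping.keys f)"

context alg
begin

lemma lext_superset:
  assumes "F \<in> X \<rightarrow> carrier A" "finite X" "Poly_Mapping.keys f \<subseteq> X"
  shows "lext A F f = finsum A (\<lambda>x. Poly_Mapping.lookup f x \<odot> F x) X"
  unfolding lext_def using assms
  by (intro add.finprod_mono_neutral_cong_left) (auto simp: in_keys_iff Pi_iff)

lemma lext_closed: "F \<in> X \<rightarrow> carrier A \<Longrightarrow> Poly_Mapping.keys f \<subseteq> X \<Longrightarrow> lext A F f \<in> carrier A"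
  unfolding lext_def by (intro finsum_closed) auto

lemma lext_zero [simp]: "lext A F 0 = \<zero>"
  by (simp add: lext_def)

lemma lext_single: "F x \<in> carrier A \<Longrightarrow> lext A F (Poly_Mapping.single x c) = c \<odot> F x"
  by (subst lext_superset[where X = "{x}"]) auto

lemma lext_add:
  assumes "F \<in> X \<rightarrow> carrier A" "Poly_Mapping.keys f \<subseteq> X" "Poly_Mapping.keys g \<subseteq> X"
  shows "lext A F (f + g) = lext A F f \<oplus> lext A F g"
proof -
  let ?Y = "Poly_Mapping.keys f \<union> Poly_Mapping.keys g"
  have F: "F \<in> ?Y \<rightarrow> carrier A" using assms by auto
  have "lext A F (f + g) = finsum A (\<lambda>x. Poly_Mapping.lookup f x \<odot> F x \<oplus> Poly_Mapping.lookup g x \<odot> F x) ?Y"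
    using F keys_add[of f g]
    by (subst lext_superset[OF F], simp, simp, intro finsum_cong')
      (auto simp: lookup_add smult_l_distr Pi_iff)
  also have "\<dots> = lext A F f \<oplus> lext A F g"
    using F by (subst finsum_addf) (auto simp: lext_superset[OF F] Pi_iff)
  finally show ?thesis .
qed

lemma lext_scale:
  assumes "F \<in> X \<rightarrow> carrier A" "Poly_Mapping.keys f \<subseteq> X"
  shows "lext A F (pm_scale c f) = c \<odot> lext A F f"
proof -
  have F: "F \<in> Poly_Mapping.keys f \<rightarrow> carrier A" using assms by auto
  show ?thesis
    using F keys_pm_scale[of c f]
    by (simp add: lext_superset[OF F])
      (subst finsum_smult, auto simp: smult_assoc Pi_iff intro!: finsum_cong')
qed

text \<open>Both sides are bilinear in \<open>f\<close> and \<open>g\<close>, so multiplicativity on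
  basis pairs (\<open>Fm\<close>) is enough. The universal properties of free algebras, path
  algebras and scalar extensions all rest on it.\<close>

lemma lext_mult:
  assumes F: "F \<in> X \<rightarrow> carrier A"
    and m: "\<And>x y. x \<in> X \<Longrightarrow> y \<in> X \<Longrightarrow> Poly_Mapping.keys (m x y) \<subseteq> X"
    and Fm: "\<And>x y. x \<in> X \<Longrightarrow> y \<in> X \<Longrightarrow> F x \<otimes> F y = lext A F (m x y)"
    and f: "Poly_Mapping.keys f \<subseteq> X" and g: "Poly_Mapping.keys g \<subseteq> X"
  shows "lext A F (bilinear_ext m f g) = lext A F f \<otimes> lext A F g"
  using f
proof (induction f rule: pm_induct)
  case (single x c)
  have Fx: "F x \<in> carrier A" using F single by auto
  show ?case using g
  proof (induction g rule: pm_induct)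
    case (single y d)
    have Fy: "F y \<in> carrier A" using F single by auto
    show ?case
      using F m[OF \<open>x \<in> X\<close> \<open>y \<in> X\<close>] Fx Fy Fm[OF \<open>x \<in> X\<close> \<open>y \<in> X\<close>, symmetric]
      by (simp add: lext_scale[of F X] lext_single smult_mult_l smult_mult_r smult_assoc smult_left_commute)
  qed (use single keys_bilinear_ext[OF m] Fx lext_closed[OF F] in
      \<open>auto simp: bilinear_ext_add_right lext_add[OF F] lext_single r_distr split: if_splits\<close>)
qed (use g keys_bilinear_ext[OF m] lext_closed[OF F] in
    \<open>auto simp: bilinear_ext_add_left lext_add[OF F] l_distr\<close>)

end


subsection \<open>Quotients\<close>

definition alg_hom :: "('k, 'a) module \<Rightarrow> ('k, 'b) module \<Rightarrow> ('a \<Rightarrow> 'b) \<Rightarrow> bool"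
  where "alg_hom A B h \<longleftrightarrow> h \<in> ring_hom A B \<and> (\<forall>r. \<forall>x\<in>carrier A. h (r \<odot>\<^bsub>A\<^esub> x) = r \<odot>\<^bsub>B\<^esub> h x)"

lemma alg_hom_simps:
  assumes "alg_hom A B h"
  shows "x \<in> carrier A \<Longrightarrow> h x \<in> carrier B"
    "x \<in> carrier A \<Longrightarrow> y \<in> carrier A \<Longrightarrow> h (x \<otimes>\<^bsub>A\<^esub> y) = h x \<otimes>\<^bsub>B\<^esub> h y"
    "x \<in> carrier A \<Longrightarrow> y \<in> carrier A \<Longrightarrow> h (x \<oplus>\<^bsub>A\<^esub> y) = h x \<oplus>\<^bsub>B\<^esub> h y"
    "h \<one>\<^bsub>A\<^esub> = \<one>\<^bsub>B\<^esub>"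
    "x \<in> carrier A \<Longrightarrow> h (r \<odot>\<^bsub>A\<^esub> x) = r \<odot>\<^bsub>B\<^esub> h x"
  using assms unfolding alg_hom_def ring_hom_def by auto

lemma alg_homI:
  assumes "\<And>x. x \<in> carrier A \<Longrightarrow> h x \<in> carrier B"
    "\<And>x y. x \<in> carrier A \<Longrightarrow> y \<in> carrier A \<Longrightarrow> h (x \<otimes>\<^bsub>A\<^esub> y) = h x \<otimes>\<^bsub>B\<^esub> h y"
    "\<And>x y. x \<in> carrier A \<Longrightarrow> y \<in> carrier A \<Longrightarrow> h (x \<oplus>\<^bsub>A\<^esub> y) = h x \<oplus>\<^bsub>B\<^esub> h y"
    "h \<one>\<^bsub>A\<^esub> = \<one>\<^bsub>B\<^esub>"
    "\<And>x r. x \<in> carrier A \<Longrightarrow> h (r \<odot>\<^bsub>A\<^esub> x) = r \<odot>\<^bsub>B\<^esub> h x"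
  shows "alg_hom A B h"
  using assms unfolding alg_hom_def by (auto intro!: ring_hom_memI)

text \<open>Only additivity is asked for, because some of the maps used below are not ring
  homomorphisms: the inclusion of a corner does not preserve the unit, and a single block of a
  matrix does not preserve products.\<close>

lemma additive_finsum:
  assumes "ring A" "ring B"
    and "\<And>x. x \<in> carrier A \<Longrightarrow> h x \<in> carrier B"
    and "\<And>x y. x \<in> carrier A \<Longrightarrow> y \<in> carrier A \<Longrightarrow> h (x \<oplus>\<^bsub>A\<^esub> y) = h x \<oplus>\<^bsub>B\<^esub> h y"
  shows "h \<zero>\<^bsub>A\<^esub> = \<zero>\<^bsub>B\<^esub>"
    and "x \<in> carrier A \<Longrightarrow> h (\<ominus>\<^bsub>A\<^esub> x) = \<ominus>\<^bsub>B\<^esub> h x"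
    and "f \<in> X \<rightarrow> carrier A \<Longrightarrow> h (finsum A f X) = finsum B (\<lambda>x. h (f x)) X"
proof -
  interpret A: ring A by fact
  interpret B: ring B by fact
  show z: "h \<zero>\<^bsub>A\<^esub> = \<zero>\<^bsub>B\<^esub>"
    using assms(4)[of "\<zero>\<^bsub>A\<^esub>" "\<zero>\<^bsub>A\<^esub>"] assms(3)[of "\<zero>\<^bsub>A\<^esub>"]
      B.add.l_cancel_one[of "h \<zero>\<^bsub>A\<^esub>" "h \<zero>\<^bsub>A\<^esub>"] by simp
  show "h (\<ominus>\<^bsub>A\<^esub> x) = \<ominus>\<^bsub>B\<^esub> h x" if "x \<in> carrier A"
    using that assms(4)[of "\<ominus>\<^bsub>A\<^esub> x" x] assms(3)[of x] assms(3)[of "\<ominus>\<^bsub>A\<^esub> x"] z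
    by (intro B.minus_equality[symmetric]) (auto simp: A.l_neg)
  show "h (finsum A f X) = finsum B (\<lambda>x. h (f x)) X" if "f \<in> X \<rightarrow> carrier A"
    using that
  proof (induction X rule: infinite_finite_induct)
    case (insert x X)
    then show ?case
      by (simp add: Pi_iff assms A.finsum_closed)
  qed (simp_all add: z)
qed

lemma finsum_pm:
  fixes A :: "('b \<Rightarrow>\<^sub>0 'k::comm_ring_1, 'm) ring_scheme"
  assumes "ring A" "zero A = 0" "add A = (+)" "f \<in> X \<rightarrow> carrier A"
  shows "finsum A f X = sum f X"
  using assms(4)
proof (induction X rule: infinite_finite_induct)
  case (insert x X)
  interpret ring A by fact
  from insert show ?case by (simp add: Pi_iff assms(3))
qed (simp_all add: assms(1,2) abelian_monoid.finsum_empty abelian_monoid.finsum_infinite ring.is_abelian_group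
    abelian_group.axioms)

lemma hom_word_prod:
  assumes "monoid A" "h \<in> carrier A \<rightarrow> carrier B"
    and "\<And>x y. x \<in> carrier A \<Longrightarrow> y \<in> carrier A \<Longrightarrow> h (x \<otimes>\<^bsub>A\<^esub> y) = h x \<otimes>\<^bsub>B\<^esub> h y"
    and "e \<in> carrier A" "f \<in> set ws \<rightarrow> carrier A"
  shows "h (word_prod A e f ws) = word_prod B (h e) (\<lambda>s. h (f s)) ws \<and> word_prod A e f ws \<in> carrier A"
  using assms(5)
  by (induction ws) (auto simp: word_prod_def assms monoid.m_closed)

lemma (in monoid) word_prod_closed [simp, intro]:
  "e \<in> carrier G \<Longrightarrow> (\<And>s. s \<in> set ws \<Longrightarrow> f s \<in> carrier G) \<Longrightarrow> word_prod G e f ws \<in> carrier G"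
  by (induction ws) (auto simp: word_prod_def)

lemma word_prod_simps [simp]:
  "word_prod A e f [] = e" "word_prod A e f (s # ws) = f s \<otimes>\<^bsub>A\<^esub> word_prod A e f ws"
  by (simp_all add: word_prod_def)

lemma word_prod_cong:
  "e = e' \<Longrightarrow> ws = ws' \<Longrightarrow> (\<And>s. s \<in> set ws' \<Longrightarrow> f s = g s) \<Longrightarrow> word_prod A e f ws = word_prod A e' g ws'"
  by (simp, induction ws' arbitrary: ws) auto

lemma word_prod_append: "word_prod A e f (us @ ws) = word_prod A (word_prod A e f ws) f us"
  by (simp add: word_prod_def)

text \<open>It is enough that \<open>e\<close> is a left unit for the particular \<open>x\<close>.
  So \<open>e\<close> may be the idempotent of a vertex, not only the unit of the algebra.\<close>

lemma (in monoid) word_prod_unit: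
  assumes "e \<in> carrier G" "f \<in> set us \<rightarrow> carrier G" "x \<in> carrier G" "e \<otimes> x = x"
  shows "word_prod G x f us = word_prod G e f us \<otimes> x"
  using assms by (induction us) (auto simp: m_assoc Pi_iff)

text \<open>Asking only that scalars act as left multiplication by elements \<open>c r\<close> is
  enough for ideals to be stable under them. This also covers \<open>tensor_free\<close>, where
  before the quotient is taken the scalar action is not additive in the scalar.\<close>

locale quot_alg = ring A for A :: "('k, 'a) module" (structure) +
  fixes X :: "'a set" and c :: "'k \<Rightarrow> 'a"
  assumes X: "X \<subseteq> carrier A" and c: "c r \<in> carrier A"
    and smult_c: "x \<in> carrier A \<Longrightarrow> r \<odot> x = c r \<otimes> x"
begin

abbreviation "I \<equiv> Idl X"
abbreviation "Q \<equiv> quot_algebra A X"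
abbreviation "cls \<equiv> quot_class A X"

lemma ideal_I: "ideal I A"
  by (rule genideal_ideal[OF X])

lemma Q_fields:
  "carrier Q = carrier (A Quot I)" "monoid.mult Q = monoid.mult (A Quot I)" "one Q = one (A Quot I)"
  "zero Q = zero (A Quot I)" "add Q = add (A Quot I)"
  "r \<odot>\<^bsub>Q\<^esub> Y = (\<Union>y\<in>Y. I +>\<^bsub>A\<^esub> (r \<odot>\<^bsub>A\<^esub> y))"
  by (simp_all add: quot_algebra_def Let_def ring.defs module.defs)

lemma ring_Q: "ring Q"
  by (rule ring_cong[OF ideal.quotient_is_ring[OF ideal_I]]) (simp_all add: Q_fields)

lemma cls_hom: "cls \<in> ring_hom A Q"
  using ideal.rcos_ring_hom[OF ideal_I] by (simp add: ring_hom_def Q_fields quot_class_def Pi_iff)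

lemma cls_simps:
  "x \<in> carrier A \<Longrightarrow> cls x \<in> carrier Q"
  "x \<in> carrier A \<Longrightarrow> y \<in> carrier A \<Longrightarrow> cls (x \<otimes> y) = cls x \<otimes>\<^bsub>Q\<^esub> cls y"
  "x \<in> carrier A \<Longrightarrow> y \<in> carrier A \<Longrightarrow> cls (x \<oplus> y) = cls x \<oplus>\<^bsub>Q\<^esub> cls y"
  "cls \<one> = \<one>\<^bsub>Q\<^esub>"
  using cls_hom by (simp_all add: ring_hom_def Pi_iff)

lemma cls_surj: "y \<in> carrier Q \<Longrightarrow> \<exists>x\<in>carrier A. y = cls x"
  by (auto simp: Q_fields FactRing_def A_RCOSETS_def' quot_class_def)

lemma cls_eq_iff:
  assumes "x \<in> carrier A" "y \<in> carrier A"
  shows "cls x = cls y \<longleftrightarrow> x \<ominus> y \<in> I"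
  using assms ideal_I quotient_eq_iff_same_a_r_cos[of I x y] by (auto simp: quot_class_def)

lemma cls_zero: assumes "x \<in> X" shows "cls x = \<zero>\<^bsub>Q\<^esub>"
proof -
  have "x \<in> I" using genideal_self[OF X] assms by blast
  then show ?thesis
    using a_rcos_zero[OF ideal_I] by (simp add: quot_class_def Q_fields FactRing_def)
qed

text \<open>A member \<open>i \<oplus> x\<close> of the coset is scaled to
  \<open>r \<odot> x\<close> plus \<open>c r \<otimes> i\<close>, and the latter lies in the ideal.
  So all cosets in the union that defines scaling in the quotient coincide.\<close>

lemma cls_smult:
  assumes "x \<in> carrier A"
  shows "r \<odot>\<^bsub>Q\<^esub> cls x = cls (r \<odot> x)"
proof -
  interpret I: ideal I A by (rule ideal_I)
  have "I +> (r \<odot> y) = I +> (r \<odot> x)" if yx: "y \<in> I +> x" for y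
  proof -
    obtain i where i: "i \<in> I" "y = i \<oplus> x"
      using yx unfolding a_r_coset_def' by blast
    have ic: "i \<in> carrier A" using i I.a_subset by blast
    have "r \<odot> y = c r \<otimes> i \<oplus> r \<odot> x"
      using i ic assms by (simp add: smult_c c r_distr)
    moreover have "c r \<otimes> i \<in> I" using i c by (simp add: I.I_l_closed)
    ultimately have "r \<odot> y \<in> I +> (r \<odot> x)"
      by (auto simp: a_r_coset_def')
    then show ?thesis
      using a_repr_independence[of "r \<odot> y" I "r \<odot> x"] assms c I.a_subgroup by (simp add: smult_c)
  qed
  moreover have "x \<in> I +> x" using assms by (rule I.a_rcos_self)
  ultimately show ?thesis
    unfolding Q_fields quot_class_def by blast
qed

lemma lift_hom:
  assumes B: "ring B" and h: "h \<in> ring_hom A B" and hX: "\<And>x. x \<in> X \<Longrightarrow> h x = \<zero>\<^bsub>B\<^esub>"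
  shows "\<exists>h'\<in>ring_hom Q B. \<forall>x\<in>carrier A. h' (cls x) = h x"
proof -
  interpret B: ring B by fact
  interpret h: ring_hom_ring A B h
    by (rule ring_hom_ringI2[OF ring_axioms B h])
  have "X \<subseteq> a_kernel A B h"
    using X hX unfolding a_kernel_def' by blast
  then have "I \<subseteq> a_kernel A B h"
    by (rule genideal_minimal[OF h.kernel_is_ideal])
  then have ker: "h i = \<zero>\<^bsub>B\<^esub>" if "i \<in> I" for i
    using that unfolding a_kernel_def' by blast
  have eq: "h x = h y" if "x \<in> carrier A" "y \<in> carrier A" "cls x = cls y" for x y
  proof -
    have "h x \<ominus>\<^bsub>B\<^esub> h y = h (x \<ominus> y)"
      using that by (simp add: a_minus_def)
    also have "\<dots> = \<zero>\<^bsub>B\<^esub>"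
      using that(3) cls_eq_iff[OF that(1,2)] by (intro ker) simp
    finally show ?thesis using that by simp
  qed
  \<comment> \<open>By \<open>eq\<close> the value does not depend on the representative that is
    chosen here.\<close>
  define h' where "h' Y = h (SOME x. x \<in> carrier A \<and> Y = cls x)" for Y
  have h': "h' (cls x) = h x" if x: "x \<in> carrier A" for x
  proof -
    define y where "y = (SOME y. y \<in> carrier A \<and> cls x = cls y)"
    have "y \<in> carrier A \<and> cls x = cls y"
      unfolding y_def using x by (intro someI[of "\<lambda>y. y \<in> carrier A \<and> cls x = cls y" x]) simp
    then have "h x = h y" using eq[of x y] x by simp
    then show ?thesis unfolding h'_def y_def by simp
  qed
  have "h' \<in> ring_hom Q B"
  proof (rule ring_hom_memI)
    show "h' \<one>\<^bsub>Q\<^esub> = \<one>\<^bsub>B\<^esub>" using h'[of \<one>] by (simp add: cls_simps)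
  next
    fix x assume "x \<in> carrier Q"
    then obtain x' where x: "x' \<in> carrier A" "x = cls x'"
      using cls_surj by blast
    then show "h' x \<in> carrier B" by (simp add: h')
    fix y assume "y \<in> carrier Q"
    then obtain y' where y: "y' \<in> carrier A" "y = cls y'"
      using cls_surj by blast
    show "h' (x \<otimes>\<^bsub>Q\<^esub> y) = h' x \<otimes>\<^bsub>B\<^esub> h' y"
      using h'[of "x' \<otimes> y'"] x y by (simp add: h' cls_simps(2))
    show "h' (x \<oplus>\<^bsub>Q\<^esub> y) = h' x \<oplus>\<^bsub>B\<^esub> h' y"
      using h'[of "x' \<oplus> y'"] x y by (simp add: h' cls_simps(3))
  qed
  then show ?thesis using h' by (intro bexI[of _ h']) auto
qed

end

locale quot_alg' = alg A for A :: "('k::comm_ring_1, 'a) module" (structure) +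
  fixes X :: "'a set"
  assumes X_carrier: "X \<subseteq> carrier A"

sublocale quot_alg' \<subseteq> quot_alg A X "\<lambda>r. r \<odot> \<one>"
  by standard (use X_carrier smult_mult_l[of \<one>] in auto)

context quot_alg'
begin

lemma alg_Q: "alg Q"
proof -
  interpret Q: ring Q by (rule ring_Q)
  show ?thesis
  proof
    fix x y r s
    assume "x \<in> carrier Q"
    then obtain x' where x: "x' \<in> carrier A" "x = cls x'"
      using cls_surj by blast
    show "r \<odot>\<^bsub>Q\<^esub> x \<in> carrier Q" "(r + s) \<odot>\<^bsub>Q\<^esub> x = r \<odot>\<^bsub>Q\<^esub> x \<oplus>\<^bsub>Q\<^esub> s \<odot>\<^bsub>Q\<^esub> x"
      "1 \<odot>\<^bsub>Q\<^esub> x = x" "(r * s) \<odot>\<^bsub>Q\<^esub> x = r \<odot>\<^bsub>Q\<^esub> (s \<odot>\<^bsub>Q\<^esub> x)"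
      using x by (simp_all add: cls_smult smult_l_distr smult_assoc cls_simps)
    assume "y \<in> carrier Q"
    then obtain y' where y: "y' \<in> carrier A" "y = cls y'"
      using cls_surj by blast
    show "r \<odot>\<^bsub>Q\<^esub> (x \<oplus>\<^bsub>Q\<^esub> y) = r \<odot>\<^bsub>Q\<^esub> x \<oplus>\<^bsub>Q\<^esub> r \<odot>\<^bsub>Q\<^esub> y"
      "(r \<odot>\<^bsub>Q\<^esub> x) \<otimes>\<^bsub>Q\<^esub> y = r \<odot>\<^bsub>Q\<^esub> (x \<otimes>\<^bsub>Q\<^esub> y)" "x \<otimes>\<^bsub>Q\<^esub> (r \<odot>\<^bsub>Q\<^esub> y) = r \<odot>\<^bsub>Q\<^esub> (x \<otimes>\<^bsub>Q\<^esub> y)"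
      using x y by (simp_all add: cls_smult smult_r_distr smult_mult_l smult_mult_r
          cls_simps(2,3)[symmetric])
  qed
qed

lemma alg_hom_cls: "alg_hom A Q cls"
  by (simp add: alg_hom_def cls_hom cls_smult)

lemma lift_alg_hom:
  assumes B: "alg B" and h: "alg_hom A B h" and hX: "\<And>x. x \<in> X \<Longrightarrow> h x = \<zero>\<^bsub>B\<^esub>"
  shows "\<exists>h'. alg_hom Q B h' \<and> (\<forall>x\<in>carrier A. h' (cls x) = h x)"
proof -
  obtain h' where h': "h' \<in> ring_hom Q B" "\<forall>x\<in>carrier A. h' (cls x) = h x"
  proof -
    have "h \<in> ring_hom A B" using h by (simp add: alg_hom_def)
    from lift_hom[OF alg.axioms(1)[OF B] this hX] show ?thesis using that by blast
  qed
  have "alg_hom Q B h'"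
    unfolding alg_hom_def
    using h' h by (auto dest!: cls_surj simp: cls_smult alg_hom_def)
  then show ?thesis using h' by blast
qed

lemma cls_diff:
  assumes "x \<in> carrier A" "y \<in> carrier A" "x \<ominus> y \<in> X"
  shows "cls x = cls y"
  using cls_eq_iff[OF assms(1,2)] subsetD[OF genideal_self[OF X] assms(3)] by simp

end


subsection \<open>Universal properties\<close>

lemma alg_hom_id: "alg A \<Longrightarrow> alg_hom A A (\<lambda>x. x)"
  by (rule alg_homI) auto

lemma alg_hom_comp: "alg_hom A B f \<Longrightarrow> alg_hom B C g \<Longrightarrow> alg_hom A C (\<lambda>x. g (f x))"
  by (rule alg_homI) (auto simp: alg_hom_simps)

lemma alg_isomorphicI:
  assumes f: "alg_hom A B f" and g: "alg_hom B A g"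
    and gf: "\<And>x. x \<in> carrier A \<Longrightarrow> g (f x) = x" and fg: "\<And>x. x \<in> carrier B \<Longrightarrow> f (g x) = x"
  shows "alg_isomorphic A B"
proof -
  have "bij_betw f (carrier A) (carrier B)"
    by (rule bij_betw_byWitness[where f' = g]) (auto simp: gf fg alg_hom_simps[OF f] alg_hom_simps[OF g])
  then show ?thesis
    using f by (auto simp: alg_isomorphic_def ring_iso_def alg_hom_def)
qed

lemma alg_pmI:
  fixes A :: "('k::comm_ring_1, 'b \<Rightarrow>\<^sub>0 'k) module"
  assumes "ring A" "carrier A = {f. Poly_Mapping.keys f \<subseteq> X}" "monoid.mult A = bilinear_ext m"
    "add A = (+)" "module.smult A = pm_scale"
  shows "alg A"
proof -
  interpret ring A by fact
  show ?thesis
    by standard (simp_all add: assms(2-5) pm_scale_simps bilinear_ext_scale_left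
        bilinear_ext_scale_right order_trans[OF keys_pm_scale])
qed

section \<open>Free algebras\<close>

lemma free_algebra_fields:
  "carrier (free_algebra S) = {f. Poly_Mapping.keys f \<subseteq> lists S}"
  "monoid.mult (free_algebra S) = bilinear_ext (\<lambda>u v. Poly_Mapping.single (u @ v) 1)"
  "one (free_algebra S) = Poly_Mapping.single [] 1" "zero (free_algebra S) = 0"
  "add (free_algebra S) = (+)" "module.smult (free_algebra S) = pm_scale"
  by (simp_all add: free_algebra_def)

lemma alg_free: "alg (free_algebra S :: ('k::comm_ring_1, 's list \<Rightarrow>\<^sub>0 'k) module)"
proof (rule alg_pmI)
  show "ring (free_algebra S :: ('k, 's list \<Rightarrow>\<^sub>0 'k) module)"
    by (rule ring_pmI[OF free_algebra_fields(1-5)]) (auto simp: pm_scale_simps)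
qed (simp_all add: free_algebra_fields)

lemma free_word_prod:
  "ws \<in> lists S \<Longrightarrow> word_prod (free_algebra S) \<one>\<^bsub>free_algebra S\<^esub> (\<lambda>s. Poly_Mapping.single [s] 1) ws
    = (Poly_Mapping.single ws 1 :: 's list \<Rightarrow>\<^sub>0 'k::comm_ring_1)"
  by (induction ws) (auto simp: free_algebra_fields pm_scale_simps)

lemma free_algebra_lift:
  fixes B :: "('k::comm_ring_1, 'a) module"
  assumes B: "alg B" and F: "F \<in> S \<rightarrow> carrier B"
  shows "\<exists>h. alg_hom (free_algebra S) B h \<and>
    (\<forall>w\<in>lists S. \<forall>c. h (Poly_Mapping.single w c) = c \<odot>\<^bsub>B\<^esub> word_prod B \<one>\<^bsub>B\<^esub> F w)"
proof -
  interpret B: alg B by fact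
  let ?G = "word_prod B \<one>\<^bsub>B\<^esub> F"
  have G: "?G \<in> lists S \<rightarrow> carrier B"
    using F by (auto intro!: B.word_prod_closed)
  have Gapp: "?G (u @ v) = ?G u \<otimes>\<^bsub>B\<^esub> ?G v" if "u \<in> lists S" "v \<in> lists S" for u v
    unfolding word_prod_append
    using that F G[THEN funcset_mem, OF that(2)] by (intro B.word_prod_unit) auto
  have "alg_hom (free_algebra S) B (lext B ?G)"
  proof (rule alg_homI)
    fix x y r assume x: "x \<in> carrier (free_algebra S :: ('k, _) module)"
    then show "lext B ?G x \<in> carrier B"
      by (auto simp: free_algebra_fields intro!: B.lext_closed[OF G])
    show "lext B ?G (r \<odot>\<^bsub>free_algebra S\<^esub> x) = r \<odot>\<^bsub>B\<^esub> lext B ?G x"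
      using x by (simp add: free_algebra_fields B.lext_scale[OF G])
    assume y: "y \<in> carrier (free_algebra S :: ('k, _) module)"
    show "lext B ?G (x \<oplus>\<^bsub>free_algebra S\<^esub> y) = lext B ?G x \<oplus>\<^bsub>B\<^esub> lext B ?G y"
      using x y by (simp add: free_algebra_fields B.lext_add[OF G])
    have "?G u \<otimes>\<^bsub>B\<^esub> ?G v = lext B ?G (Poly_Mapping.single (u @ v) 1)" if "u \<in> lists S" "v \<in> lists S" for u v
      using that Gapp G funcset_mem[OF G, of "u @ v"] by (subst B.lext_single) auto
    then show "lext B ?G (x \<otimes>\<^bsub>free_algebra S\<^esub> y) = lext B ?G x \<otimes>\<^bsub>B\<^esub> lext B ?G y"
      unfolding free_algebra_fields using x y
      by (intro B.lext_mult[OF G]) (auto simp: free_algebra_fields)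
  next
    show "lext B ?G \<one>\<^bsub>free_algebra S\<^esub> = \<one>\<^bsub>B\<^esub>"
      by (simp add: free_algebra_fields B.lext_single)
  qed
  moreover have "lext B ?G (Poly_Mapping.single w c) = c \<odot>\<^bsub>B\<^esub> ?G w" if "w \<in> lists S" for w c
    using G that by (intro B.lext_single) auto
  ultimately show ?thesis by blast
qed

lemma free_algebra_ext:
  fixes B :: "('k::comm_ring_1, 'a) module"
  assumes B: "alg B" and f: "alg_hom (free_algebra S) B f" and g: "alg_hom (free_algebra S) B g"
    and eq: "\<And>s. s \<in> S \<Longrightarrow> f (Poly_Mapping.single [s] 1) = g (Poly_Mapping.single [s] 1)"
    and x: "x \<in> carrier (free_algebra S)"
  shows "f x = g x"
proof -
  interpret F: alg "free_algebra S :: ('k, _) module" by (rule alg_free)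
  have w: "f (Poly_Mapping.single w 1) = g (Poly_Mapping.single w 1)" if "w \<in> lists S" for w
    using that
  proof (induction w)
    case Nil
    show ?case using alg_hom_simps(4)[OF f] alg_hom_simps(4)[OF g] by (simp add: free_algebra_fields)
  next
    case (Cons s w)
    have *: "Poly_Mapping.single (s # w) 1 = Poly_Mapping.single [s] 1 \<otimes>\<^bsub>free_algebra S\<^esub> Poly_Mapping.single w (1::'k)"
      by (simp add: free_algebra_fields pm_scale_simps)
    have c: "Poly_Mapping.single [s] 1 \<in> carrier (free_algebra S :: ('k, _) module)"
      "Poly_Mapping.single w 1 \<in> carrier (free_algebra S :: ('k, _) module)"
      using Cons.hyps by (auto simp: free_algebra_fields)
    show ?case unfolding *
      using alg_hom_simps(2)[OF f c] alg_hom_simps(2)[OF g c] Cons.IH eq Cons.hyps by simp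
  qed
  have "Poly_Mapping.keys x \<subseteq> lists S" using x by (simp add: free_algebra_fields)
  then show ?thesis
  proof (induction x rule: pm_induct)
    case zero
    have "f \<zero>\<^bsub>free_algebra S\<^esub> = g \<zero>\<^bsub>free_algebra S\<^esub>"
      using additive_finsum(1)[OF F.ring_axioms alg.axioms(1)[OF B]] alg_hom_simps(1,3)[OF f]
        alg_hom_simps(1,3)[OF g] by metis
    then show ?case by (simp add: free_algebra_fields)
  next
    case (single w c)
    have *: "Poly_Mapping.single w c = c \<odot>\<^bsub>free_algebra S\<^esub> Poly_Mapping.single w (1::'k)"
      by (simp add: free_algebra_fields pm_scale_simps)
    have "Poly_Mapping.single w 1 \<in> carrier (free_algebra S :: ('k, _) module)"
      using single by (auto simp: free_algebra_fields)
    then show ?case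
      unfolding * using single w by (simp only: alg_hom_simps(5)[OF f] alg_hom_simps(5)[OF g])
  next
    case (add x y)
    then show ?case
      using alg_hom_simps(3)[OF f, of x y] alg_hom_simps(3)[OF g, of x y]
      by (simp add: free_algebra_fields)
  qed
qed

section \<open>Path algebras\<close>

lemma path_algebra_fields:
  "carrier (path_algebra G) = {f. Poly_Mapping.keys f \<subseteq> {(u, p, v). pre_digraph.awalk G u p v}}"
  "monoid.mult (path_algebra G) = bilinear_ext path_mult"
  "one (path_algebra G) = (\<Sum>v\<in>verts G. triv_path v)" "zero (path_algebra G) = 0"
  "add (path_algebra G) = (+)" "module.smult (path_algebra G) = pm_scale"
  by (simp_all add: path_algebra_def)

locale fin_quiver = wf_digraph G for G :: "('v, 'e) pre_digraph" +
  assumes fin_verts: "finite (verts G)"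
begin

lemma bilinear_ext_sum_left: "bilinear_ext m (sum f X) g = (\<Sum>x\<in>X. bilinear_ext m (f x) g)"
  by (induction X rule: infinite_finite_induct) (auto simp: bilinear_ext_add_left)

lemma bilinear_ext_sum_right: "bilinear_ext m g (sum f X) = (\<Sum>x\<in>X. bilinear_ext m g (f x))"
  by (induction X rule: infinite_finite_induct) (auto simp: bilinear_ext_add_right)

lemma alg_path: "alg (path_algebra G :: ('k::comm_ring_1, _) module)"
proof (rule alg_pmI)
  show "ring (path_algebra G :: ('k, _) module)"
  proof (rule ring_pmI[OF path_algebra_fields(1-5)], goal_cases)
    case (1 x y)
    then show ?case by (auto simp: path_mult_def intro: awalk_appendI split: if_splits)
  next
    case 2
    then show ?case by (intro keys_sum_subset) (auto simp: triv_path_def awalk_Nil_iff)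
  next
    case (3 x y z)
    then show ?case by (auto simp: path_mult_def pm_scale_simps split: prod.splits)
  next
    case (4 x)
    obtain u p v where x: "x = (u, p, v)" by (cases x)
    have "v \<in> verts G" using 4 x awlast_in_verts awalk_last_in_verts by auto
    have "bilinear_ext path_mult (triv_path v') (Poly_Mapping.single x 1)
       = (if v' = v then Poly_Mapping.single x 1 else (0 :: _ \<Rightarrow>\<^sub>0 'k))" for v'
      by (auto simp: triv_path_def path_mult_def x pm_scale_simps)
    then show ?case
      using \<open>v \<in> verts G\<close> fin_verts by (simp add: bilinear_ext_sum_left)
  next
    case (5 x)
    obtain u p v where x: "x = (u, p, v)" by (cases x)
    have "u \<in> verts G" using 5 x awalk_hd_in_verts by auto
    have "bilinear_ext path_mult (Poly_Mapping.single x 1) (triv_path v')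
       = (if v' = u then Poly_Mapping.single x 1 else (0 :: _ \<Rightarrow>\<^sub>0 'k))" for v'
      by (auto simp: triv_path_def path_mult_def x pm_scale_simps)
    then show ?case
      using \<open>u \<in> verts G\<close> fin_verts by (simp add: bilinear_ext_sum_right)
  qed
qed (simp_all add: path_algebra_fields)

lemma path_gens [simp]:
  "v \<in> verts G \<Longrightarrow> triv_path v \<in> carrier (path_algebra G)"
  "e \<in> arcs G \<Longrightarrow> arrow G e \<in> carrier (path_algebra G)"
  by (auto simp: path_algebra_fields triv_path_def arrow_def awalk_Nil_iff arc_implies_awalk)

text \<open>Orthogonality of the \<open>E v\<close> kills the products of paths that do not compose,
  and \<open>FE\<close>, \<open>EF\<close> place each \<open>F a\<close> in the block of its end
  points, so composable paths multiply by concatenation. \<open>E1\<close> takes care of the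
  unit.\<close>

lemma path_algebra_lift:
  fixes B :: "('k::comm_ring_1, 'a) module" and E :: "'v \<Rightarrow> 'a" and F :: "'e \<Rightarrow> 'a"
  assumes B: "alg B" and E: "E \<in> verts G \<rightarrow> carrier B" and F: "F \<in> arcs G \<rightarrow> carrier B"
    and EE: "\<And>u v. u \<in> verts G \<Longrightarrow> v \<in> verts G \<Longrightarrow> E u \<otimes>\<^bsub>B\<^esub> E v = (if u = v then E u else \<zero>\<^bsub>B\<^esub>)"
    and E1: "finsum B E (verts G) = \<one>\<^bsub>B\<^esub>"
    and FE: "\<And>a. a \<in> arcs G \<Longrightarrow> F a \<otimes>\<^bsub>B\<^esub> E (tail G a) = F a"
    and EF: "\<And>a. a \<in> arcs G \<Longrightarrow> E (head G a) \<otimes>\<^bsub>B\<^esub> F a = F a"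
  shows "\<exists>h. alg_hom (path_algebra G) B h \<and> (\<forall>v\<in>verts G. h (triv_path v) = E v) \<and>
    (\<forall>a\<in>arcs G. h (arrow G a) = F a)"
proof -
  interpret B: alg B by fact
  define X where "X = {(u, p, v). awalk u p v}"
  \<comment> \<open>The arrow traversed first stands on the right of a product, hence
    \<open>rev\<close>. The idempotent of the starting vertex ends the product, so that the trivial
    path is sent to it.\<close>
  define P where "P = (\<lambda>(u, p, v::'v). word_prod B (E u) F (rev p))"
  have F': "F a \<in> carrier B" if "a \<in> arcs G" for a using F that by auto
  have E': "E v \<in> carrier B" if "v \<in> verts G" for v using E that by auto
  have Pc: "P (u, p, v) \<in> carrier B" if "awalk u p v" for u p v
    using that unfolding P_def by (auto intro!: B.word_prod_closed E' F' simp: awalk_def)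
  then have P: "P \<in> X \<rightarrow> carrier B" by (auto simp: X_def)
  have EP: "E v \<otimes>\<^bsub>B\<^esub> P (u, p, v) = P (u, p, v)" if "awalk u p v" for u p v
  proof (cases p rule: rev_cases)
    case Nil
    with that show ?thesis by (auto simp: P_def awalk_Nil_iff EE)
  next
    case (snoc q a)
    with that have a: "a \<in> arcs G" "head G a = v" "awalk u q (tail G a)"
      by (auto simp: awalk_Cons_iff awalk_Nil_iff)
    then show ?thesis
      using Pc[OF a(3)] EF[OF a(1)] E'[of v]
      by (auto simp: P_def snoc B.m_assoc[symmetric] F' )
  qed
  have PP: "P x \<otimes>\<^bsub>B\<^esub> P y = lext B P (path_mult x y)" if "x \<in> X" "y \<in> X" for x y
  proof -
    obtain u p v u' p' v' where xy: "x = (u, p, v)" "y = (u', p', v')"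
      by (cases x, cases y) auto
    have w: "awalk u p v" "awalk u' p' v'" using that by (auto simp: X_def xy)
    have us: "u \<in> verts G" "v' \<in> verts G" "set p \<subseteq> arcs G" using w by auto
    \<comment> \<open>The last factor \<open>E u\<close> of \<open>P x\<close> is idempotent, so a
      second copy may be handed to \<open>P y\<close>, where it meets \<open>E v'\<close> and
      decides whether the paths compose.\<close>
    have 1: "P x \<otimes>\<^bsub>B\<^esub> P y = word_prod B (E u) F (rev p) \<otimes>\<^bsub>B\<^esub> (E u \<otimes>\<^bsub>B\<^esub> P y)"
    proof -
      have "word_prod B (E u) F (rev p) = word_prod B \<one>\<^bsub>B\<^esub> F (rev p) \<otimes>\<^bsub>B\<^esub> E u"
        using us by (intro B.word_prod_unit) (auto simp: E' F')
      moreover have "word_prod B \<one>\<^bsub>B\<^esub> F (rev p) \<in> carrier B"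
        using us by (auto intro!: B.word_prod_closed F')
      ultimately show ?thesis
        using us Pc[OF w(2)] EE[of u u]
        by (simp add: P_def xy B.m_assoc E' F' B.m_assoc[symmetric, of "E u" "E u"])
    qed
    show ?thesis
    proof (cases "u = v'")
      case True
      have "word_prod B (P y) F (rev p) = word_prod B (E u) F (rev p) \<otimes>\<^bsub>B\<^esub> P y"
        using us Pc[OF w(2)] EP[OF w(2)] True
        by (intro B.word_prod_unit) (auto simp: E' F' xy)
      moreover have "awalk u' (p' @ p) v" using w True by (auto intro: awalk_appendI)
      ultimately show ?thesis
        using w True Pc[of u' "p' @ p" v]
        by (auto simp: path_mult_def xy P_def word_prod_append B.lext_single)
    next
      case False
      have "E u \<otimes>\<^bsub>B\<^esub> P y = E u \<otimes>\<^bsub>B\<^esub> (E v' \<otimes>\<^bsub>B\<^esub> P y)" using EP[OF w(2)] by (simp add: xy)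
      also have "\<dots> = (E u \<otimes>\<^bsub>B\<^esub> E v') \<otimes>\<^bsub>B\<^esub> P y"
        using us Pc[OF w(2)] by (simp add: B.m_assoc E' xy)
      also have "\<dots> = \<zero>\<^bsub>B\<^esub>" using us False EE Pc[OF w(2)] by (simp add: xy)
      moreover have "P x \<in> carrier B" using w(1) by (simp add: xy Pc)
      ultimately show ?thesis using False 1 by (simp add: path_mult_def xy P_def)
    qed
  qed
  have keys: "Poly_Mapping.keys (path_mult x y :: _ \<Rightarrow>\<^sub>0 'k) \<subseteq> X" if "x \<in> X" "y \<in> X" for x y
    using that by (auto simp: path_mult_def X_def intro: awalk_appendI split: if_splits)
  have carr: "x \<in> carrier (path_algebra G :: ('k, _) module) \<longleftrightarrow> Poly_Mapping.keys x \<subseteq> X" for x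
    by (simp add: path_algebra_fields X_def)
  have triv: "lext B P (triv_path v) = E v" if "v \<in> verts G" for v
    using that unfolding triv_path_def by (subst B.lext_single) (auto simp: P_def E')
  have "alg_hom (path_algebra G) B (lext B P)"
  proof (rule alg_homI)
    fix x y r assume x: "x \<in> carrier (path_algebra G :: ('k, _) module)"
    then show "lext B P x \<in> carrier B"
      by (auto simp: carr intro!: B.lext_closed[OF P])
    show "lext B P (r \<odot>\<^bsub>path_algebra G\<^esub> x) = r \<odot>\<^bsub>B\<^esub> lext B P x"
      using x by (simp add: carr path_algebra_fields(6) B.lext_scale[OF P])
    assume y: "y \<in> carrier (path_algebra G :: ('k, _) module)"
    show "lext B P (x \<oplus>\<^bsub>path_algebra G\<^esub> y) = lext B P x \<oplus>\<^bsub>B\<^esub> lext B P y"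
      using x y by (simp add: carr path_algebra_fields(5) B.lext_add[OF P])
    show "lext B P (x \<otimes>\<^bsub>path_algebra G\<^esub> y) = lext B P x \<otimes>\<^bsub>B\<^esub> lext B P y"
      unfolding path_algebra_fields(2) using x y
      by (intro B.lext_mult[OF P keys PP]) (auto simp: carr)
  next
    interpret PA: alg "path_algebra G :: ('k, _) module" by (rule alg_path)
    have "lext B P (\<Sum>v\<in>V. triv_path v) = finsum B E V" if "finite V" "V \<subseteq> verts G" for V
      using that
    proof (induction V rule: finite_induct)
      case (insert v V)
      have *: "Poly_Mapping.keys (triv_path v :: _ \<Rightarrow>\<^sub>0 'k) \<subseteq> X" if "v \<in> verts G" for v
        using that by (simp add: triv_path_def X_def awalk_Nil_iff)
      have "Poly_Mapping.keys (\<Sum>v\<in>V. triv_path v :: _ \<Rightarrow>\<^sub>0 'k) \<subseteq> X"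
        using insert.prems * by (intro keys_sum_subset) auto
      moreover have "E \<in> V \<rightarrow> carrier B" using insert.prems E' by auto
      ultimately show ?case
        using insert triv[of v] *[of v] E' by (simp add: B.lext_add[OF P])
    qed simp
    from this[OF fin_verts] show "lext B P \<one>\<^bsub>path_algebra G\<^esub> = \<one>\<^bsub>B\<^esub>"
      by (simp add: path_algebra_fields(3) E1)
  qed
  moreover have "lext B P (arrow G a) = F a" if "a \<in> arcs G" for a
    using that FE[OF that] F' unfolding arrow_def by (subst B.lext_single) (auto simp: P_def)
  ultimately show ?thesis using triv by blast
qed

lemma path_algebra_ext:
  fixes B :: "('k::comm_ring_1, 'a) module"
  assumes B: "alg B" and f: "alg_hom (path_algebra G) B f" and g: "alg_hom (path_algebra G) B g"
    and v: "\<And>v. v \<in> verts G \<Longrightarrow> f (triv_path v) = g (triv_path v)"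
    and a: "\<And>a. a \<in> arcs G \<Longrightarrow> f (arrow G a) = g (arrow G a)"
    and x: "x \<in> carrier (path_algebra G)"
  shows "f x = g x"
proof -
  interpret F: alg "path_algebra G :: ('k, _) module" by (rule alg_path)
  have w: "f (Poly_Mapping.single (s, p, t) 1) = g (Poly_Mapping.single (s, p, t) 1)" if "awalk s p t" for s p t
    using that
  proof (induction p arbitrary: s)
    case Nil
    then show ?case using v[of t] by (auto simp: awalk_Nil_iff triv_path_def)
  next
    case (Cons e p)
    then have e: "e \<in> arcs G" "s = tail G e" "awalk (head G e) p t"
      by (auto simp: awalk_Cons_iff)
    have *: "Poly_Mapping.single (s, e # p, t) 1 =
        Poly_Mapping.single (head G e, p, t) (1::'k) \<otimes>\<^bsub>path_algebra G\<^esub> arrow G e"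
      by (simp add: path_algebra_fields pm_scale_simps arrow_def path_mult_def e)
    have c: "Poly_Mapping.single (head G e, p, t) 1 \<in> carrier (path_algebra G :: ('k, _) module)"
      "arrow G e \<in> carrier (path_algebra G :: ('k, _) module)"
      using e by (simp_all add: path_algebra_fields(1) arrow_def arc_implies_awalk)
    show ?case unfolding *
      using alg_hom_simps(2)[OF f c] alg_hom_simps(2)[OF g c] Cons.IH[OF e(3)] a[OF e(1)] by simp
  qed
  have "Poly_Mapping.keys x \<subseteq> {(u, p, v). awalk u p v}" using x by (simp add: path_algebra_fields)
  then show ?thesis
  proof (induction x rule: pm_induct)
    case zero
    have "f \<zero>\<^bsub>path_algebra G\<^esub> = g \<zero>\<^bsub>path_algebra G\<^esub>"
      using additive_finsum(1)[OF F.ring_axioms alg.axioms(1)[OF B]] alg_hom_simps(1,3)[OF f]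
        alg_hom_simps(1,3)[OF g] by metis
    then show ?case by (simp add: path_algebra_fields)
  next
    case (single w c)
    have *: "Poly_Mapping.single w c = c \<odot>\<^bsub>path_algebra G\<^esub> Poly_Mapping.single w (1::'k)"
      by (simp add: path_algebra_fields pm_scale_simps)
    have "Poly_Mapping.single w 1 \<in> carrier (path_algebra G :: ('k, _) module)"
      using single by (auto simp: path_algebra_fields)
    then show ?case
      unfolding * using single w by (auto simp only: alg_hom_simps(5)[OF f] alg_hom_simps(5)[OF g])
  next
    case (add x y)
    then show ?case
      using alg_hom_simps(3)[OF f, of x y] alg_hom_simps(3)[OF g, of x y]
      by (simp add: path_algebra_fields)
  qed
qed

end

subsection \<open>Coxeter systems\<close>

declare in_lists_conv_set [simp]

locale cox = group W for W :: "('w, 'm) monoid_scheme" (structure) +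
  fixes S :: "'w set"
  assumes coxeter: "coxeter_system W S"
begin

abbreviation "ev \<equiv> eval_word W"
abbreviation "len \<equiv> cox_len W S"

lemma S_carrier [simp]: "s \<in> S \<Longrightarrow> s \<in> carrier W"
  using coxeter by (auto simp: coxeter_system_def)

lemma ord_S: "s \<in> S \<Longrightarrow> ord s = 2"
  using coxeter by (auto simp: coxeter_system_def)

lemma S_square [simp]: "s \<in> S \<Longrightarrow> s \<otimes> s = \<one>"
  using pow_ord_eq_1[of s] by (simp add: ord_S numeral_2_eq_2)

lemma S_not_one: "s \<in> S \<Longrightarrow> s \<noteq> \<one>"
  using ord_S[of s] by auto

lemma inv_S [simp]: "s \<in> S \<Longrightarrow> inv s = s"
  by (simp add: inv_equality)

lemma S_cancel [simp]: "s \<in> S \<Longrightarrow> x \<in> carrier W \<Longrightarrow> s \<otimes> (s \<otimes> x) = x"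
  by (simp add: m_assoc[symmetric])

lemma S_cancel_right [simp]: "s \<in> S \<Longrightarrow> x \<in> carrier W \<Longrightarrow> x \<otimes> s \<otimes> s = x"
  by (simp add: m_assoc)

lemma ev_closed [simp]: "u \<in> lists S \<Longrightarrow> ev u \<in> carrier W"
  by (induction u) auto

lemma ev_append [simp]: "u \<in> lists S \<Longrightarrow> v \<in> lists S \<Longrightarrow> ev (u @ v) = ev u \<otimes> ev v"
  by (induction u) (auto simp: m_assoc)

lemma ev_rev: "u \<in> lists S \<Longrightarrow> ev (rev u) = inv (ev u)"
  by (induction u) (auto simp: inv_mult_group)

lemma generate_word:
  assumes "w \<in> generate W I" "I \<subseteq> S"
  shows "\<exists>u\<in>lists I. ev u = w"
  using assms
proof (induction rule: generate.induct)
  case one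
  show ?case by (rule bexI[of _ "[]"]) auto
next
  case (incl h)
  then show ?case by (intro bexI[of _ "[h]"]) auto
next
  case (inv h)
  then show ?case by (intro bexI[of _ "[h]"]) (auto simp: subset_iff)
next
  case (eng h1 h2)
  then obtain u v where uv: "u \<in> lists I" "ev u = h1" "v \<in> lists I" "ev v = h2" by auto
  then have "ev (u @ v) = h1 \<otimes> h2"
    using eng.prems by (subst ev_append) auto
  with uv show ?case by (intro bexI[of _ "u @ v"]) auto
qed

lemma generate_S: "generate W S = carrier W"
  using coxeter by (simp add: coxeter_system_def)

lemma len_le: "u \<in> lists S \<Longrightarrow> len (ev u) \<le> length u"
  unfolding cox_len_def by (rule Least_le) auto

lemma reduced_exists:
  assumes "w \<in> carrier W"
  shows "\<exists>u. reduced_expr W S w u"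
proof -
  obtain u where "u \<in> lists S" "ev u = w"
    using generate_word[of w S] assms generate_S by auto
  then have "\<exists>ws\<in>lists S. length ws = length u \<and> ev ws = w" by blast
  then have "\<exists>ws\<in>lists S. length ws = len w \<and> ev ws = w"
    unfolding cox_len_def by (rule LeastI)
  then show ?thesis by (auto simp: reduced_expr_def)
qed

definition rdc :: "'w list \<Rightarrow> bool"
  where "rdc u \<longleftrightarrow> reduced_expr W S (ev u) u"

lemma rdcD: "rdc u \<Longrightarrow> u \<in> lists S" "rdc u \<Longrightarrow> len (ev u) = length u"
  by (auto simp: rdc_def reduced_expr_def)

lemma rdcI: "u \<in> lists S \<Longrightarrow> length u \<le> len (ev u) \<Longrightarrow> rdc u"
  using len_le[of u] by (auto simp: rdc_def reduced_expr_def)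

lemma reduced_expr_iff: "reduced_expr W S w u \<longleftrightarrow> rdc u \<and> ev u = w"
  by (auto simp: rdc_def reduced_expr_def)

lemma len_zero_iff: "w \<in> carrier W \<Longrightarrow> len w = 0 \<longleftrightarrow> w = \<one>"
proof
  assume "w \<in> carrier W" "len w = 0"
  then obtain u where "reduced_expr W S w u" using reduced_exists by blast
  with \<open>len w = 0\<close> show "w = \<one>" by (auto simp: reduced_expr_def)
qed (use len_le[of "[]"] in auto)

subsection \<open>Reflections\<close>

text \<open>For the word s_1 ... s_k the i-th entry is the reflection s_1 ... s_{i-1} s_i s_{i-1}
  ... s_1. For a reduced word these are the reflections that shorten its value by multiplication
  from the left.\<close>

primrec refls :: "'w list \<Rightarrow> 'w list" where
  "refls [] = []"
| "refls (s # u) = s # map (\<lambda>x. s \<otimes> x \<otimes> s) (refls u)"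

lemma length_refls [simp]: "length (refls u) = length u"
  by (induction u) auto

lemma refls_closed: "u \<in> lists S \<Longrightarrow> x \<in> set (refls u) \<Longrightarrow> x \<in> carrier W"
  by (induction u arbitrary: x) auto

lemma refls_append:
  "u \<in> lists S \<Longrightarrow> v \<in> lists S \<Longrightarrow>
    refls (u @ v) = refls u @ map (\<lambda>x. ev u \<otimes> x \<otimes> inv (ev u)) (refls v)"
  by (induction u) (auto simp: refls_closed inv_mult_group m_assoc intro!: map_idI[symmetric])

lemma conj_pow:
  assumes "p \<in> S" "r \<in> S"
  shows "p \<otimes> (r \<otimes> p) [^] (n::nat) \<otimes> r = (p \<otimes> r) [^] Suc n"
proof (induction n)
  case (Suc n)
  have "p \<otimes> (r \<otimes> p) [^] Suc n \<otimes> r = p \<otimes> (r \<otimes> p) [^] n \<otimes> r \<otimes> (p \<otimes> r)"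
    using assms by (simp add: m_assoc)
  then show ?case using Suc by simp
qed (use assms in simp)

lemma set_alt_word: "set (alt_word n p r) \<subseteq> {p, r}"
proof (induction n arbitrary: p r)
  case (Suc n)
  then show ?case using Suc[of r p] by auto
qed simp

lemma alt_word_lists: "p \<in> I \<Longrightarrow> r \<in> I \<Longrightarrow> alt_word n p r \<in> lists I"
  using set_alt_word[of n p r] by auto

lemma length_alt_word [simp]: "length (alt_word n p r) = n"
  by (induction n arbitrary: p r) auto

lemma refls_alt_word:
  "p \<in> S \<Longrightarrow> r \<in> S \<Longrightarrow> refls (alt_word n p r) = map (\<lambda>i. (p \<otimes> r) [^] i \<otimes> p) [0..<n]"
proof (induction n arbitrary: p r)
  case (Suc n)
  have "p \<otimes> ((r \<otimes> p) [^] i \<otimes> r) \<otimes> p = (p \<otimes> r) [^] Suc i \<otimes> p" for i :: nat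
    using Suc.prems conj_pow[OF Suc.prems, of i] by (simp add: m_assoc)
  moreover have "[0..<Suc n] = 0 # map Suc [0..<n]"
    by (simp add: map_Suc_upt upt_conv_Cons del: upt_Suc)
  ultimately show ?case
    using Suc.prems Suc.IH[OF Suc.prems(2,1)] by (simp add: comp_def del: upt_Suc nat_pow_Suc)
qed simp

lemma concat_alt_word: "concat (replicate k [p, r]) = alt_word (2 * k) p r"
  by (induction k) auto

text \<open>The i-th reflection of the alternating word is
  \<open>(p \<otimes> r) [^] i \<otimes> p\<close>, and it repeats after \<open>cox_m W p r\<close>
  positions since that power of \<open>p \<otimes> r\<close> is trivial. So the relator runs through
  the same list twice. For infinite order the relator is the empty word.\<close>

lemma refls_relator:
  assumes "p \<in> S" "r \<in> S"
  shows "\<exists>L. refls (concat (replicate (cox_m W p r) [p, r])) = L @ L"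
proof -
  let ?c = "p \<otimes> r" and ?m = "cox_m W p r"
  let ?f = "\<lambda>i::nat. ?c [^] i \<otimes> p"
  have m: "?c [^] ?m = \<one>"
    unfolding cox_m_def using assms by (intro pow_ord_eq_1) simp
  have c: "?c \<in> carrier W" using assms by simp
  have f: "?f (i + ?m) = ?f i" for i
    using nat_pow_mult[OF c, of i ?m, symmetric] m c by simp
  have "map ?f [?m..<?m + ?m] = map ?f (map (\<lambda>i. i + ?m) [0..<?m])"
    by (simp only: map_add_upt)
  also have "\<dots> = map ?f [0..<?m]"
    by (simp only: map_map comp_def f)
  finally have "map ?f [?m..<?m + ?m] = map ?f [0..<?m]" .
  then have "map ?f [0..<2 * ?m] = map ?f [0..<?m] @ map ?f [0..<?m]"
    by (simp only: mult_2 upt_add_eq_append[of 0 ?m ?m] le0 map_append)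
  then have "refls (concat (replicate ?m [p, r])) = map ?f [0..<?m] @ map ?f [0..<?m]"
    by (simp only: concat_alt_word refls_alt_word[OF assms])
  then show ?thesis by blast
qed

lemma ev_alt_word_diff:
  "p \<in> S \<Longrightarrow> r \<in> S \<Longrightarrow> ev (alt_word n p r) \<otimes> inv (ev (alt_word n r p)) = (p \<otimes> r) [^] n"
proof (induction n arbitrary: p r)
  case (Suc n)
  have c: "ev (alt_word n p r) \<in> carrier W" "ev (alt_word n r p) \<in> carrier W"
    using Suc.prems alt_word_lists[of p S r n] alt_word_lists[of r S p n] by auto
  have "ev (alt_word (Suc n) p r) \<otimes> inv (ev (alt_word (Suc n) r p)) =
      p \<otimes> (ev (alt_word n r p) \<otimes> inv (ev (alt_word n p r))) \<otimes> r"
    using Suc.prems c by (simp add: inv_mult_group m_assoc)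
  then show ?case using Suc.IH[of r p] Suc.prems conj_pow[of p r n] by simp
qed simp

lemma ev_relator:
  assumes "p \<in> S" "r \<in> S"
  shows "ev (concat (replicate (cox_m W p r) [p, r])) = \<one>"
proof -
  have "ev (concat (replicate k [p, r])) = (p \<otimes> r) [^] k" for k
  proof (induction k)
    case (Suc k)
    then show ?case using assms nat_pow_Suc2[of "p \<otimes> r" k] by (simp add: m_assoc)
  qed simp
  then show ?thesis unfolding cox_m_def using assms pow_ord_eq_1 by simp
qed

text \<open>The relator has value 1, so inserting it leaves the reflections of the letters behind it
  unchanged; its own reflections come in equal pairs.\<close>

lemma count_refls_step:
  assumes "cox_step W S u v"
  shows "even (count_list (refls u) t) \<longleftrightarrow> even (count_list (refls v) t)"
proof -
  obtain a b p r where ab: "a \<in> lists S" "b \<in> lists S" "p \<in> S" "r \<in> S"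
      "u = a @ concat (replicate (cox_m W p r) [p, r]) @ b" "v = a @ b"
    using assms by (auto simp: cox_step_def)
  let ?w = "concat (replicate (cox_m W p r) [p, r])"
  have w: "?w \<in> lists S" unfolding concat_alt_word by (rule alt_word_lists[OF ab(3,4)])
  have "map (\<lambda>x. ev ?w \<otimes> x \<otimes> inv (ev ?w)) (refls b) = refls b"
    using ev_relator[OF ab(3,4)] refls_closed[OF ab(2)] by (intro map_idI) simp
  then have wb: "refls (?w @ b) = refls ?w @ refls b"
    using refls_append[OF w ab(2)] by simp
  obtain L where L: "refls ?w = L @ L" using refls_relator[OF ab(3,4)] by blast
  have "?w @ b \<in> lists S" using w ab(2) by (simp only: append_in_lists_conv)
  then have "refls u = refls a @ map (\<lambda>x. ev a \<otimes> x \<otimes> inv (ev a)) (L @ L @ refls b)"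
    unfolding ab(5) by (subst refls_append[OF ab(1)]) (simp_all only: wb L append_assoc)
  moreover have "refls v = refls a @ map (\<lambda>x. ev a \<otimes> x \<otimes> inv (ev a)) (refls b)"
    unfolding ab(6) by (rule refls_append[OF ab(1,2)])
  ultimately have "count_list (refls u) t =
      count_list (refls v) t + 2 * count_list (map (\<lambda>x. ev a \<otimes> x \<otimes> inv (ev a)) L) t"
    by simp
  then show ?thesis by simp
qed

text \<open>Here the presentation of W enters: words with equal values are linked by inserting and
  deleting relators. Thus for each t the parity of its occurrences is a function of the group
  element.\<close>

lemma count_refls_inv:
  assumes "u \<in> lists S" "v \<in> lists S" "ev u = ev v"
  shows "even (count_list (refls u) t) \<longleftrightarrow> even (count_list (refls v) t)"
proof -
  have "equivclp (cox_step W S) u v" using coxeter assms by (auto simp: coxeter_system_def)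
  then show ?thesis
    by (induction rule: equivclp_induct) (use count_refls_step in blast)+
qed

lemma refls_delete:
  "u \<in> lists S \<Longrightarrow> t \<in> set (refls u) \<Longrightarrow> \<exists>a x b. u = a @ x # b \<and> t \<otimes> ev u = ev (a @ b)"
proof (induction u arbitrary: t)
  case (Cons s u)
  then have s: "s \<in> S" "u \<in> lists S" by auto
  show ?case
  proof (cases "t = s")
    case True
    then show ?thesis using s by (intro exI[of _ "[]"] exI[of _ s] exI[of _ u]) simp
  next
    case False
    then obtain t' where t: "t' \<in> set (refls u)" "t = s \<otimes> t' \<otimes> s" using Cons.prems by auto
    then obtain a x b where a: "u = a @ x # b" "t' \<otimes> ev u = ev (a @ b)"
      using Cons.IH s by blast
    have "t \<otimes> ev (s # u) = s \<otimes> (t' \<otimes> ev u)"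
      using s t refls_closed[OF s(2) t(1)] by (simp add: m_assoc)
    then show ?thesis
      using a by (intro exI[of _ "s # a"] exI[of _ x] exI[of _ b]) simp
  qed
qed simp

lemma refls_cons_mem:
  assumes "u \<in> lists S" "s \<in> S" "s \<in> set (map (\<lambda>x. s \<otimes> x \<otimes> s) (refls u))"
  shows "s \<in> set (refls u)"
proof -
  obtain x where x: "x \<in> set (refls u)" "s = s \<otimes> x \<otimes> s" using assms by auto
  have xc: "x \<in> carrier W" using refls_closed[OF assms(1) x(1)] .
  have "s \<otimes> s \<otimes> s = s \<otimes> (s \<otimes> x \<otimes> s) \<otimes> s" using x by simp
  then have "s = x" using assms xc by (simp add: m_assoc)
  then show ?thesis using x by simp
qed

lemma conj_inj_on: "s \<in> S \<Longrightarrow> inj_on (\<lambda>x. s \<otimes> x \<otimes> s) (carrier W)"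
  by (rule inj_on_inverseI[where g = "\<lambda>x. s \<otimes> x \<otimes> s"]) (simp add: m_assoc)

text \<open>This is the deletion condition: a coincidence with the first letter \<open>s\<close>
  puts \<open>s\<close> among the reflections of the tail, and then \<open>s\<close> times the tail
  loses a letter. The shorter word uses only letters of the old one, which matters for parabolic
  subgroups.\<close>

lemma not_distinct_refls:
  "u \<in> lists S \<Longrightarrow> \<not> distinct (refls u) \<Longrightarrow> \<exists>v\<in>lists (set u). ev v = ev u \<and> length v < length u"
proof (induction u)
  case (Cons s u)
  then have s: "s \<in> S" "u \<in> lists S" by auto
  show ?case
  proof (cases "distinct (refls u)")
    case False
    then obtain v where "v \<in> lists (set u)" "ev v = ev u" "length v < length u"
      using Cons.IH s by blast
    then show ?thesis by (intro bexI[of _ "s # v"]) auto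
  next
    case True
    have "inj_on (\<lambda>x. s \<otimes> x \<otimes> s) (set (refls u))"
      using conj_inj_on[OF s(1)] by (rule inj_on_subset) (use refls_closed[OF s(2)] in blast)
    then have "s \<in> set (map (\<lambda>x. s \<otimes> x \<otimes> s) (refls u))"
      using Cons.prems(2) True by (auto simp: distinct_map)
    then have "s \<in> set (refls u)" using refls_cons_mem s by blast
    then obtain a x b where ab: "u = a @ x # b" "s \<otimes> ev u = ev (a @ b)"
      using refls_delete s by blast
    then show ?thesis by (intro bexI[of _ "a @ b"]) auto
  qed
qed simp

lemma count_list_distinct: "distinct xs \<Longrightarrow> count_list xs x = (if x \<in> set xs then 1 else 0)"
  by (induction xs) auto

lemma rdc_distinct: assumes "rdc u" shows "distinct (refls u)"
proof (rule ccontr)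
  assume "\<not> distinct (refls u)"
  then obtain v where v: "v \<in> lists (set u)" "ev v = ev u" "length v < length u"
    using not_distinct_refls rdcD(1)[OF assms] by blast
  have "v \<in> lists S" using v(1) rdcD(1)[OF assms] by auto
  then show False using len_le[of v] v rdcD(2)[OF assms] by simp
qed

text \<open>In a list without repetition a count is 0 or 1, so the parity determines
  membership.\<close>

lemma rdc_set_refls:
  assumes "distinct (refls u)" "distinct (refls v)" "ev u = ev v" "u \<in> lists S" "v \<in> lists S"
  shows "set (refls u) = set (refls v)"
proof -
  have "x \<in> set (refls u) \<longleftrightarrow> x \<in> set (refls v)" for x
    using count_refls_inv[OF assms(4,5,3), of x] assms(1,2) by (simp add: count_list_distinct split: if_splits)
  then show ?thesis by blast
qed

text \<open>Compared with a reduced word of the same value, the sets of reflections agree, and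
  without repetitions their size is the length of the word.\<close>

lemma distinct_rdc: assumes "u \<in> lists S" "distinct (refls u)" shows "rdc u"
proof -
  obtain v where v: "rdc v" "ev v = ev u"
    using reduced_exists[of "ev u"] assms by (auto simp: reduced_expr_iff)
  have "set (refls u) = set (refls v)"
    using assms v rdc_distinct rdcD(1) by (intro rdc_set_refls) auto
  then have "length u = length v"
    using distinct_card[OF assms(2)] distinct_card[OF rdc_distinct[OF v(1)]] by simp
  then show ?thesis using v rdcD(2)[OF v(1)] assms by (intro rdcI) auto
qed

text \<open>This is the exchange condition. The reflections of \<open>u\<close> are distinct, so if
  \<open>s # u\<close> is not reduced, the repetition must involve \<open>s\<close> itself, and then
  \<open>refls_delete\<close> applies.\<close>

lemma exchange:
  assumes "rdc u" "s \<in> S" "\<not> rdc (s # u)"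
  shows "\<exists>a x b. u = a @ x # b \<and> s \<otimes> ev u = ev (a @ b)"
proof -
  have u: "u \<in> lists S" using assms rdcD by blast
  then have "\<not> distinct (refls (s # u))" using distinct_rdc[of "s # u"] assms by auto
  moreover have "inj_on (\<lambda>x. s \<otimes> x \<otimes> s) (set (refls u))"
    using conj_inj_on[OF assms(2)] by (rule inj_on_subset) (use refls_closed[OF u] in blast)
  ultimately have "s \<in> set (map (\<lambda>x. s \<otimes> x \<otimes> s) (refls u))"
    using rdc_distinct[OF assms(1)] by (auto simp: distinct_map)
  then show ?thesis using refls_cons_mem refls_delete u assms(2) by blast
qed

lemma rdc_ConsD: assumes "rdc (s # u)" shows "rdc u"
proof -
  have u: "s \<in> S" "u \<in> lists S" using rdcD(1)[OF assms] by simp_all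
  show ?thesis
  proof (rule distinct_rdc[OF u(2)])
    show "distinct (refls u)" using rdc_distinct[OF assms] by (simp add: distinct_map)
  qed
qed

text \<open>Either prepending \<open>s\<close> keeps a word reduced, or exchange removes a letter;
  multiplying by \<open>s\<close> once more shows that the length cannot drop by more than
  one.\<close>

lemma len_mult_cases:
  assumes "w \<in> carrier W" "s \<in> S"
  shows "len (s \<otimes> w) = Suc (len w) \<or> len w = Suc (len (s \<otimes> w))"
proof -
  obtain u where u: "rdc u" "ev u = w" using reduced_exists[OF assms(1)] by (auto simp: reduced_expr_iff)
  show ?thesis
  proof (cases "rdc (s # u)")
    case True
    then show ?thesis using rdcD(2)[OF True] rdcD(2)[OF u(1)] u by simp
  next
    case False
    then obtain a x b where ab: "u = a @ x # b" "s \<otimes> ev u = ev (a @ b)" using exchange u assms by blast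
    have "a @ b \<in> lists S" using ab rdcD(1)[OF u(1)] by auto
    then have le: "Suc (len (s \<otimes> w)) \<le> len w" using len_le[of "a @ b"] ab u rdcD(2)[OF u(1)] by simp
    obtain v where v: "rdc v" "ev v = s \<otimes> w" using reduced_exists[of "s \<otimes> w"] assms by (auto simp: reduced_expr_iff)
    have "ev (s # v) = w" using v assms by simp
    then have "len w \<le> Suc (len (s \<otimes> w))"
      using len_le[of "s # v"] v rdcD[OF v(1)] assms by simp
    with le show ?thesis by simp
  qed
qed

lemma len_inv: assumes "w \<in> carrier W" shows "len (inv w) = len w"
proof -
  have "len (inv x) \<le> len x" if x: "x \<in> carrier W" for x
  proof -
    obtain u where u: "rdc u" "ev u = x" using reduced_exists[OF x] by (auto simp: reduced_expr_iff)
    then show ?thesis using len_le[of "rev u"] rdcD[OF u(1)] ev_rev by simp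
  qed
  from this[of w] this[of "inv w"] show ?thesis using assms by simp
qed

lemma len_mult_right_cases:
  assumes "w \<in> carrier W" "s \<in> S"
  shows "len (w \<otimes> s) = Suc (len w) \<or> len w = Suc (len (w \<otimes> s))"
  using len_mult_cases[of "inv w" s] len_inv[of "w \<otimes> s"] len_inv[of w] assms by (simp add: inv_mult_group)

lemma rdc_Cons: "w \<in> carrier W \<Longrightarrow> s \<in> S \<Longrightarrow> rdc u \<Longrightarrow> ev u = w \<Longrightarrow> len w < len (s \<otimes> w) \<Longrightarrow> rdc (s # u)"
  using rdcD[of u] by (intro rdcI) auto

lemma rdc_snoc: "w \<in> carrier W \<Longrightarrow> s \<in> S \<Longrightarrow> rdc u \<Longrightarrow> ev u = w \<Longrightarrow> len w < len (w \<otimes> s) \<Longrightarrow> rdc (u @ [s])"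
  using rdcD[of u] by (intro rdcI) auto

text \<open>A reduced word of \<open>w \<otimes> t\<close> is one of \<open>w\<close> followed by
  \<open>t\<close>. Prepending \<open>s\<close> does not give a reduced word, so a letter is
  exchanged. If it lay inside the word of \<open>w\<close>, then \<open>s \<otimes> w\<close> would
  be too short; so it is the final \<open>t\<close>, which is the claim.\<close>

lemma exchange_commute_up:
  assumes w: "w \<in> carrier W" and s: "s \<in> S" and t: "t \<in> S"
    and up: "len (s \<otimes> w) = Suc (len w)" "len (w \<otimes> t) = Suc (len w)" and eq: "len (s \<otimes> w \<otimes> t) = len w"
  shows "s \<otimes> w = w \<otimes> t"
proof -
  obtain u where u: "rdc u" "ev u = w" using reduced_exists[OF w] by (auto simp: reduced_expr_iff)
  have uS: "u \<in> lists S" using u rdcD by blast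
  have r: "rdc (u @ [t])" using rdc_snoc[OF w t u] up by simp
  have "\<not> rdc (s # u @ [t])"
  proof
    assume "rdc (s # u @ [t])"
    from rdcD(2)[OF this] show False using u uS s t w eq rdcD(2)[OF u(1)] by (simp add: m_assoc)
  qed
  then obtain a x b where ab: "u @ [t] = a @ x # b" "s \<otimes> ev (u @ [t]) = ev (a @ b)"
    using exchange[OF r s] by blast
  show ?thesis
  proof (cases b rule: rev_cases)
    case Nil
    then have "s \<otimes> (w \<otimes> t) = w" using ab u uS t by simp
    then have "s \<otimes> (s \<otimes> (w \<otimes> t)) = s \<otimes> w" by simp
    then show ?thesis using s t w by simp
  next
    case (snoc b' y)
    then have y: "y = t" "u = a @ x # b'" using ab(1) by simp_all
    have l: "a \<in> lists S" "b' \<in> lists S" using uS y by auto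
    have "ev (u @ [t]) = w \<otimes> t" using u uS t by simp
    moreover have "ev ((a @ b') @ [t]) = ev (a @ b') \<otimes> ev [t]"
      using l t by (intro ev_append) auto
    then have "ev (a @ b) = ev (a @ b') \<otimes> t"
      using t snoc y by (simp del: ev_append)
    ultimately have "s \<otimes> w \<otimes> t = ev (a @ b') \<otimes> t"
      using ab(2) s t w by (simp add: m_assoc del: ev_append)
    then have "s \<otimes> w = ev (a @ b')" using s t w l by simp
    then have "len (s \<otimes> w) \<le> length (a @ b')"
      using l by (metis append_in_lists_conv len_le)
    then show ?thesis using up(1) rdcD(2)[OF u(1)] u y by simp
  qed
qed

text \<open>When \<open>s\<close> shortens \<open>w\<close>, the ascending case applies to
  \<open>s \<otimes> w\<close> instead. The lemma describes the only situation in which left and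
  right ascents influence each other.\<close>

lemma exchange_commute:
  assumes w: "w \<in> carrier W" and s: "s \<in> S" and t: "t \<in> S"
    and "len (s \<otimes> w) = len (w \<otimes> t)" and "len (s \<otimes> w \<otimes> t) = len w"
  shows "s \<otimes> w = w \<otimes> t"
proof (cases "len (s \<otimes> w) = Suc (len w)")
  case True
  then show ?thesis using exchange_commute_up assms by simp
next
  case False
  then have "len w = Suc (len (s \<otimes> w))" using len_mult_cases[OF w s] by simp
  then have "s \<otimes> (s \<otimes> w) = s \<otimes> w \<otimes> t"
    using assms len_mult_cases[OF w s] by (intro exchange_commute_up) auto
  then have "s \<otimes> w = s \<otimes> (s \<otimes> w \<otimes> t)" using w s t by (metis S_cancel S_carrier m_closed)
  then show ?thesis using w s t by (simp add: m_assoc)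
qed

subsection \<open>Parabolic subgroups\<close>

text \<open>A shortest word with letters in \<open>I\<close> has distinct reflections, because the
  deletion condition shortens a word without leaving its letters; so it is reduced in the whole
  group.\<close>

lemma parabolic_word:
  assumes "I \<subseteq> S" "w \<in> generate W I"
  shows "\<exists>u\<in>lists I. rdc u \<and> ev u = w"
proof -
  obtain u0 where "u0 \<in> lists I \<and> ev u0 = w" using generate_word assms by blast
  then obtain u where u: "u \<in> lists I" "ev u = w"
    and min: "\<And>v. v \<in> lists I \<and> ev v = w \<Longrightarrow> length u \<le> length v"
    using ex_has_least_nat[of "\<lambda>u. u \<in> lists I \<and> ev u = w" u0 length] by blast
  have uS: "u \<in> lists S" using u assms by auto
  have "distinct (refls u)"
  proof (rule ccontr)
    assume "\<not> distinct (refls u)"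
    then obtain v where "v \<in> lists (set u)" "ev v = ev u" "length v < length u"
      using not_distinct_refls uS by blast
    moreover from this have "v \<in> lists I" using u by auto
    ultimately show False using min[of v] u by simp
  qed
  then show ?thesis using u distinct_rdc uS by blast
qed

lemma generate_closed: "I \<subseteq> S \<Longrightarrow> w \<in> generate W I \<Longrightarrow> w \<in> carrier W"
  using generate_incl[of I] S_carrier by blast

lemma parabolic_simple:
  assumes "I \<subseteq> S" "s \<in> S" "s \<in> generate W I"
  shows "s \<in> I"
proof -
  obtain u where u: "u \<in> lists I" "rdc u" "ev u = s" using parabolic_word assms by blast
  have "len s \<le> 1" using len_le[of "[s]"] assms by simp
  moreover have "len s \<noteq> 0" using len_zero_iff[of s] S_not_one assms by simp
  ultimately have "length u = 1" using rdcD(2)[OF u(2)] u by (cases u) auto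
  then obtain x where "u = [x]" by (auto simp: length_Suc_conv)
  then show ?thesis using u assms by auto
qed

lemma refls_parabolic:
  assumes "I \<subseteq> S" shows "u \<in> lists I \<Longrightarrow> set (refls u) \<subseteq> generate W I"
  by (induction u) (use assms in \<open>auto intro!: generate.eng intro: generate.incl\<close>)

text \<open>The first letter of a reduced word is one of its reflections, and the set of reflections
  depends only on the value. A word in \<open>I\<close> with that value shows that the letter lies
  in the subgroup, hence in \<open>I\<close>.\<close>

lemma parabolic_reduced:
  assumes I: "I \<subseteq> S" shows "rdc u \<Longrightarrow> ev u \<in> generate W I \<Longrightarrow> u \<in> lists I"
proof (induction u)
  case (Cons s u)
  have su: "s \<in> S" "u \<in> lists S" using rdcD(1)[OF Cons.prems(1)] by auto
  obtain v where v: "v \<in> lists I" "rdc v" "ev v = ev (s # u)"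
    using parabolic_word[OF I Cons.prems(2)] by blast
  have "set (refls (s # u)) = set (refls v)"
    by (rule rdc_set_refls[OF rdc_distinct[OF Cons.prems(1)] rdc_distinct[OF v(2)] v(3)[symmetric]
          rdcD(1)[OF Cons.prems(1)] rdcD(1)[OF v(2)]])
  then have sI: "s \<in> generate W I" using refls_parabolic[OF I v(1)] by auto
  then have "s \<otimes> ev (s # u) \<in> generate W I" using Cons.prems(2) by (rule generate.eng)
  then have "u \<in> lists I" using Cons rdc_ConsD su by auto
  then show ?case using parabolic_simple[OF I su(1) sI] by simp
qed simp

subsection \<open>Dihedral words\<close>

text \<open>The reflections \<open>(p \<otimes> r) [^] i \<otimes> p\<close> with i < n are distinct
  as long as n does not exceed the order of \<open>p \<otimes> r\<close>.\<close>

lemma alt_word_rdc: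
  assumes "p \<in> S" "r \<in> S" "cox_m W p r > 0" "n \<le> cox_m W p r"
  shows "rdc (alt_word n p r)"
proof (rule distinct_rdc)
  have c: "p \<otimes> r \<in> carrier W" using assms by simp
  have ne: "(p \<otimes> r) [^] i \<otimes> p \<noteq> (p \<otimes> r) [^] j \<otimes> p" if "i < j" "j < n" for i j :: nat
  proof
    assume "(p \<otimes> r) [^] i \<otimes> p = (p \<otimes> r) [^] j \<otimes> p"
    then have "(p \<otimes> r) [^] i = (p \<otimes> r) [^] j" using assms c by simp
    also have "\<dots> = (p \<otimes> r) [^] i \<otimes> (p \<otimes> r) [^] (j - i)" using c that by (simp add: nat_pow_mult)
    finally have "(p \<otimes> r) [^] (j - i) = \<one>" using c
      by (metis l_cancel_one' nat_pow_closed)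
    then have "cox_m W p r dvd j - i" using c by (simp add: pow_eq_id cox_m_def)
    then show False using that assms by (auto dest: dvd_imp_le)
  qed
  show "distinct (refls (alt_word n p r))"
    using assms(1,2) ne by (auto simp: refls_alt_word distinct_map inj_on_def) (metis nat_neq_iff)
qed (rule alt_word_lists[OF assms(1,2)])

text \<open>In a longer word the reflections at the positions 0 and \<open>cox_m W p r\<close> are
  both equal to \<open>p\<close>.\<close>

lemma alt_word_rdc_le:
  assumes "p \<in> S" "r \<in> S" "cox_m W p r > 0" "rdc (alt_word n p r)"
  shows "n \<le> cox_m W p r"
proof (rule ccontr)
  let ?m = "cox_m W p r"
  assume "\<not> n \<le> ?m"
  then have "0 \<in> {0..<n}" "?m \<in> {0..<n}" by auto
  moreover have "inj_on (\<lambda>i. (p \<otimes> r) [^] i \<otimes> p) {0..<n}"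
    using rdc_distinct[OF assms(4)] assms(1,2) by (simp add: refls_alt_word distinct_map)
  moreover have "(p \<otimes> r) [^] ?m = \<one>"
    unfolding cox_m_def using assms by (intro pow_ord_eq_1) simp
  ultimately have "?m = 0" using assms by (simp add: inj_on_def)
  then show False using assms by simp
qed

lemma alt_word_ev_eq:
  assumes "p \<in> S" "r \<in> S" "ev (alt_word n p r) = ev (alt_word n r p)"
  shows "cox_m W p r dvd n"
proof -
  have "alt_word n r p \<in> lists S" using assms by (intro alt_word_lists)
  then have "(p \<otimes> r) [^] n = \<one>"
    using ev_alt_word_diff[OF assms(1,2), of n] assms by simp
  then show ?thesis using assms by (simp add: pow_eq_id cox_m_def)
qed

text \<open>Equality of the two alternating words forces the order of \<open>p \<otimes> r\<close>
  to divide n, reducedness bounds n by this order.\<close>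

lemma alt_word_braid_len:
  assumes "p \<in> S" "r \<in> S" "ev (alt_word n p r) = ev (alt_word n r p)" "rdc (alt_word n p r)" "n > 0"
  shows "n = cox_m W p r"
proof -
  have d: "cox_m W p r dvd n" using alt_word_ev_eq assms by blast
  then have "cox_m W p r > 0" using assms by (auto intro: Nat.gr0I)
  then show ?thesis using alt_word_rdc_le assms d by (auto dest: dvd_imp_le intro: antisym)
qed

lemma cox_m_sym: assumes "p \<in> S" "r \<in> S" shows "cox_m W p r = cox_m W r p"
proof -
  have "r \<otimes> p = inv (p \<otimes> r)" using assms by (simp add: inv_mult_group)
  then show ?thesis using assms unfolding cox_m_def by (simp add: ord_inv)
qed

lemma ev_alt_word_braid:
  assumes "p \<in> S" "r \<in> S"
  shows "ev (alt_word (cox_m W p r) p r) = ev (alt_word (cox_m W p r) r p)"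
proof -
  have c: "ev (alt_word (cox_m W p r) p r) \<in> carrier W" "ev (alt_word (cox_m W p r) r p) \<in> carrier W"
    using assms by (simp_all only: ev_closed alt_word_lists)
  have "ev (alt_word (cox_m W p r) p r) \<otimes> inv (ev (alt_word (cox_m W p r) r p)) = \<one>"
    unfolding ev_alt_word_diff[OF assms] unfolding cox_m_def using assms by (intro pow_ord_eq_1) simp
  then show ?thesis using c by (metis inv_closed inv_equality inv_inv)
qed

lemma rdc_dihedral:
  assumes "p \<in> S" "r \<in> S" "u \<in> lists {p, r}" "rdc u"
  shows "u = alt_word (length u) p r \<or> u = alt_word (length u) r p"
  using assms(3,4)
proof (induction u rule: list.induct)
  case (Cons x u)
  have IH: "u = alt_word (length u) p r \<or> u = alt_word (length u) r p"
    using Cons rdc_ConsD by auto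
  show ?case
  proof (cases u)
    case u: (Cons y v)
    have "x \<noteq> y"
    proof
      assume "x = y"
      have v: "v \<in> lists S" "x \<in> S" using rdcD(1)[OF Cons.prems(2)] u by auto
      have "ev (x # u) = ev v" using u \<open>x = y\<close> v by simp
      then show False using len_le[OF v(1)] rdcD(2)[OF Cons.prems(2)] u by simp
    qed
    then show ?thesis using IH Cons.prems(1) u by auto
  qed (use Cons in auto)
qed simp

text \<open>Every element has a reduced word in the two letters; such a word alternates and has
  length at most \<open>cox_m W p r\<close>.\<close>

lemma finite_dihedral:
  assumes "p \<in> S" "r \<in> S" "cox_m W p r > 0"
  shows "finite (generate W {p, r})"
proof (rule finite_subset)
  let ?m = "cox_m W p r"
  show "generate W {p, r} \<subseteq> (\<lambda>n. ev (alt_word n p r)) ` {..?m} \<union> (\<lambda>n. ev (alt_word n r p)) ` {..?m}"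
  proof
    fix w assume "w \<in> generate W {p, r}"
    then obtain u where u: "u \<in> lists {p, r}" "rdc u" "ev u = w"
      using parabolic_word[of "{p, r}"] assms by blast
    then consider "u = alt_word (length u) p r" | "u = alt_word (length u) r p"
      using rdc_dihedral assms by blast
    then show "w \<in> (\<lambda>n. ev (alt_word n p r)) ` {..?m} \<union> (\<lambda>n. ev (alt_word n r p)) ` {..?m}"
    proof cases
      case 1
      then have "length u \<le> ?m" using alt_word_rdc_le[OF assms, of "length u"] u by simp
      then show ?thesis using 1 u by (intro UnI1 image_eqI[of _ _ "length u"]) auto
    next
      case 2
      then have "length u \<le> ?m"
        using alt_word_rdc_le[of r p "length u"] assms cox_m_sym[of p r] u by simp
      then show ?thesis using 2 u by (intro UnI2 image_eqI[of _ _ "length u"]) auto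
    qed
  qed
qed simp

subsection \<open>Matsumoto's theorem\<close>

text \<open>\<open>F\<close> stands for evaluation in any monoid in which the braid relations hold;
  only its fibres matter, which must be stable under adding a letter at either end. By induction on
  the length, words that share their first or their last letter agree under \<open>F\<close>. A
  disagreement is then pushed, by repeated exchange, to a pair of alternating words, where it
  contradicts a braid relation.\<close>

theorem matsumoto:
  fixes F :: "'w list \<Rightarrow> 'b"
  assumes F_Cons: "\<And>s u v. s \<in> S \<Longrightarrow> u \<in> lists S \<Longrightarrow> v \<in> lists S \<Longrightarrow> F u = F v \<Longrightarrow> F (s # u) = F (s # v)"
    and F_snoc: "\<And>s u v. s \<in> S \<Longrightarrow> u \<in> lists S \<Longrightarrow> v \<in> lists S \<Longrightarrow> F u = F v \<Longrightarrow> F (u @ [s]) = F (v @ [s])"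
    and braid: "\<And>s t. s \<in> S \<Longrightarrow> t \<in> S \<Longrightarrow> s \<noteq> t \<Longrightarrow> cox_m W s t > 0 \<Longrightarrow>
      F (alt_word (cox_m W s t) s t) = F (alt_word (cox_m W s t) t s)"
  shows "rdc u \<Longrightarrow> rdc v \<Longrightarrow> ev u = ev v \<Longrightarrow> F u = F v"
proof (induction "length u" arbitrary: u v rule: less_induct)
  case less
  define q where "q = length u"
  define w where "w = ev u"
  define G where "G z \<longleftrightarrow> rdc z \<and> ev z = w" for z
  have G: "z \<in> lists S" "length z = q" if "G z" for z
    using that rdcD[of z] rdcD[OF less.prems(1)] by (auto simp: G_def w_def q_def)
  have Guv: "G u" "G v" using less.prems by (auto simp: G_def w_def)
  have tail: "F (x # z) = F (x # z')" if g: "G (x # z)" "G (x # z')" for x z z'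
  proof -
    have l: "x \<in> S" "z \<in> lists S" "z' \<in> lists S" using G[OF g(1)] G[OF g(2)] by auto
    have "x \<otimes> ev z = x \<otimes> ev z'" using g by (simp add: G_def)
    then have "ev z = ev z'" using l by simp
    then have "F z = F z'"
      using g l rdc_ConsD G(2)[OF g(1)] by (intro less.hyps) (auto simp: G_def q_def)
    then show ?thesis using F_Cons l by blast
  qed
  have rdc_butlast: "rdc z" if "rdc (z @ [x])" for z x
  proof -
    have l: "z \<in> lists S" "x \<in> S" using rdcD(1)[OF that] by auto
    show ?thesis using that l len_mult_right_cases[of "ev z" x] rdcD(2)[OF that] by (intro rdcI) auto
  qed
  have front: "F (z @ [x]) = F (z' @ [x])" if g: "G (z @ [x])" "G (z' @ [x])" for x z z'
  proof -
    have l: "x \<in> S" "z \<in> lists S" "z' \<in> lists S" using G[OF g(1)] G[OF g(2)] by auto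
    have "ev z \<otimes> x = ev z' \<otimes> x" using g l by (simp add: G_def)
    then have "ev z = ev z'" using l by simp
    then have "F z = F z'"
      using g l rdc_butlast G(2)[OF g(1)] by (intro less.hyps) (auto simp: G_def q_def)
    then show ?thesis using F_snoc l by blast
  qed
  \<comment> \<open>Multiplication by \<open>x\<close> shortens the common value, so exchange
    removes a letter of \<open>z\<close> after \<open>x\<close> is put in front. The new word starts
    like \<open>x # z'\<close>. If the removed letter were not the last, it would also end like
    \<open>z\<close>, and \<open>tail\<close> with \<open>front\<close> would give
    \<open>F z = F (x # z')\<close>.\<close>
  have shift: "G (x # butlast z) \<and> F (x # butlast z) \<noteq> F z" if g: "G z" "G (x # z')" "F z \<noteq> F (x # z')" for z z' x
  proof -
    have l: "x \<in> S" "z \<in> lists S" "z' \<in> lists S" using G[OF g(1)] G[OF g(2)] by auto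
    have "\<not> rdc (x # z)"
    proof
      assume "rdc (x # z)"
      then have "len (x \<otimes> w) = Suc q" using rdcD(2)[of "x # z"] g G(2)[OF g(1)] by (simp add: G_def)
      moreover have "x \<otimes> w = ev z'"
      proof -
        have "x \<otimes> w = x \<otimes> (x \<otimes> ev z')" using g(2) by (simp add: G_def)
        then show ?thesis using l by simp
      qed
      ultimately show False using len_le[OF l(3)] G(2)[OF g(2)] by simp
    qed
    then obtain a y b where ab: "z = a @ y # b" "x \<otimes> ev z = ev (a @ b)"
      using exchange[of z x] g l by (auto simp: G_def)
    have abl: "a @ b \<in> lists S" using ab l by auto
    have e: "ev (x # a @ b) = w"
    proof -
      have "ev (x # a @ b) = x \<otimes> (x \<otimes> ev z)" using ab by simp
      moreover have "ev z \<in> carrier W" using l by simp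
      ultimately show ?thesis using l g(1) S_cancel[of x "ev z"] by (simp only: G_def)
    qed
    have len: "length (x # a @ b) = q" using ab G(2)[OF g(1)] by simp
    have "len w = q" using rdcD(2)[OF less.prems(1)] by (simp only: w_def q_def)
    moreover have "x # a @ b \<in> lists S" using abl l(1) by simp
    ultimately have "rdc (x # a @ b)" using e len by (intro rdcI) simp_all
    then have Gn: "G (x # a @ b)" using e by (simp only: G_def)
    then have Fv: "F (x # a @ b) = F (x # z')" using tail g by blast
    have "b = []"
    proof (rule ccontr)
      assume "b \<noteq> []"
      then obtain b' c where b: "b = b' @ [c]" by (metis rev_exhaust)
      have "F ((x # a @ b') @ [c]) = F ((a @ y # b') @ [c])"
        using Gn g(1) b ab by (intro front) auto
      then show False using Fv g(3) b ab by simp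
    qed
    then show ?thesis using Gn Fv g(3) ab by simp
  qed
  show ?case
  proof (rule ccontr)
    assume ne: "F u \<noteq> F v"
    have "u \<noteq> []" using ne Guv G(2)[of v] by (auto simp: q_def)
    then have q: "q > 0" by (simp add: q_def)
    then obtain y u' x v' where uv: "u = y # u'" "v = x # v'"
      using G(2)[OF Guv(2)] \<open>u \<noteq> []\<close> by (cases u; cases v) auto
    have "x \<noteq> y" using tail ne Guv uv by blast
    have xy: "x \<in> S" "y \<in> S" using G(1)[OF Guv(1)] G(1)[OF Guv(2)] uv by auto
    \<comment> \<open>Using \<open>shift\<close> with the two first letters in turn replaces the
      word from the front: after k rounds an alternating prefix of length k precedes the first q - k
      letters of \<open>u\<close>. At k = q nothing of \<open>u\<close> is left.\<close>
    have chain: "\<exists>p r z z'. {p, r} = {x, y} \<and> z = alt_word k p r @ take (q - k) u \<and> G z \<and> G (r # z') \<and> F z \<noteq> F (r # z')"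
      if "1 \<le> k" "k \<le> q" for k
      using that
    proof (induction k rule: dec_induct)
      case base
      have "G (x # butlast u) \<and> F (x # butlast u) \<noteq> F u"
        using shift[of u x v'] Guv ne uv by simp
      moreover have "x # butlast u = alt_word 1 x y @ take (q - 1) u"
        by (simp add: butlast_conv_take q_def)
      ultimately show ?case
        using Guv uv by (intro exI[of _ x] exI[of _ y] exI[of _ "x # butlast u"] exI[of _ u']) auto
    next
      case (step k)
      then obtain p r z z' where z: "{p, r} = {x, y}" "z = alt_word k p r @ take (q - k) u"
          "G z" "G (r # z')" "F z \<noteq> F (r # z')" by auto
      have sh: "G (r # butlast z) \<and> F (r # butlast z) \<noteq> F z" using shift z by blast
      have "take (q - k) u \<noteq> []" using step q by (auto simp: q_def)
      then have "r # butlast z = alt_word (Suc k) r p @ take (q - Suc k) u"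
        using z(2) by (simp add: butlast_append butlast_take q_def)
      moreover have "\<exists>z''. z = p # z''" using z(2) step by (cases k) auto
      ultimately show ?case
        using sh z(1,3) by (metis insert_commute)
    qed
    obtain p r z z' where z: "{p, r} = {x, y}" "z = alt_word q p r"
          "G z" "G (r # z')" "F z \<noteq> F (r # z')" using chain[of q] q by auto
    have sh: "G (r # butlast z) \<and> F (r # butlast z) \<noteq> F z" using shift z by blast
    have but: "butlast (alt_word (Suc n) p r) = alt_word n p r" for n p r
      by (induction n arbitrary: p r) auto
    obtain n where n: "q = Suc n" using q by (cases q) auto
    have "r # butlast z = alt_word q r p" unfolding z(2) n but by simp
    then have g: "G (alt_word q r p)" "F (alt_word q r p) \<noteq> F (alt_word q p r)" "G (alt_word q p r)"
      using sh z by auto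
    have pr: "p \<in> S" "r \<in> S" "p \<noteq> r" using z(1) xy \<open>x \<noteq> y\<close> by (auto simp: doubleton_eq_iff)
    have "q = cox_m W p r" using g pr q by (intro alt_word_braid_len) (auto simp: G_def)
    then show False using braid[OF pr] g q by simp
  qed
qed

text \<open>Only the identity has length 0, so it alone contributes to the constant term.\<close>

lemma poincare_const:
  assumes "I \<subseteq> S" "finite (generate W I)"
  shows "poly.coeff (poincare W S I) 0 = 1"
proof -
  have "poly.coeff (poincare W S I) 0 = (\<Sum>w\<in>generate W I. (0::int) ^ len w)"
    unfolding poincare_def by (simp add: poly_0_coeff_0[symmetric] poly_sum)
  also have "\<dots> = (\<Sum>w\<in>generate W I. if w = \<one> then 1 else 0)"
    using generate_closed[OF assms(1)] len_zero_iff by (intro sum.cong) (auto simp: power_0_left)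
  also have "\<dots> = 1" using assms(2) generate.one[of W I] by simp
  finally show ?thesis .
qed

end

subsection \<open>Corners and linear endomorphisms\<close>

text \<open>The scalars are restricted along \<open>\<phi>\<close> in the same step. With
  \<open>of_zq\<close> a corner of an R-algebra becomes a Z[q]-algebra, the kind of target a map
  from the Hecke algebra needs.\<close>

definition corner :: "('c \<Rightarrow> 'k) \<Rightarrow> ('k, 'a) module \<Rightarrow> 'a \<Rightarrow> ('c, 'a) module"
  where "corner \<phi> B e = \<lparr>carrier = {x \<in> carrier B. e \<otimes>\<^bsub>B\<^esub> x = x \<and> x \<otimes>\<^bsub>B\<^esub> e = x},
    monoid.mult = monoid.mult B, one = e, zero = zero B, add = add B,
    module.smult = (\<lambda>c x. \<phi> c \<odot>\<^bsub>B\<^esub> x)\<rparr>"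

lemma corner_fields:
  "x \<in> carrier (corner \<phi> B e) \<longleftrightarrow> x \<in> carrier B \<and> e \<otimes>\<^bsub>B\<^esub> x = x \<and> x \<otimes>\<^bsub>B\<^esub> e = x"
  "monoid.mult (corner \<phi> B e) = monoid.mult B" "one (corner \<phi> B e) = e" "zero (corner \<phi> B e) = zero B"
  "add (corner \<phi> B e) = add B" "c \<odot>\<^bsub>corner \<phi> B e\<^esub> x = \<phi> c \<odot>\<^bsub>B\<^esub> x"
  by (simp_all add: corner_def)

lemma word_prod_corner [simp]: "word_prod (corner \<phi> B e) = word_prod B"
  by (intro ext) (simp add: word_prod_def corner_fields)

lemma alg_corner:
  fixes B :: "('k::comm_ring_1, 'a) module" and \<phi> :: "'c::comm_ring_1 \<Rightarrow> 'k"
  assumes B: "alg B" and e: "e \<in> carrier B" "e \<otimes>\<^bsub>B\<^esub> e = e"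
    and \<phi>: "\<And>a b. \<phi> (a + b) = \<phi> a + \<phi> b" "\<And>a b. \<phi> (a * b) = \<phi> a * \<phi> b" "\<phi> 1 = 1"
  shows "alg (corner \<phi> B e)"
proof -
  interpret B: alg B by fact
  have "ring (corner \<phi> B e)"
  proof (intro ringI abelian_groupI monoidI)
    fix x assume "x \<in> carrier (corner \<phi> B e)"
    then show "\<exists>y\<in>carrier (corner \<phi> B e). y \<oplus>\<^bsub>corner \<phi> B e\<^esub> x = \<zero>\<^bsub>corner \<phi> B e\<^esub>"
      using e by (intro bexI[of _ "\<ominus>\<^bsub>B\<^esub> x"]) (auto simp: corner_fields B.l_neg B.l_minus B.r_minus)
  next
    fix x y assume "x \<in> carrier (corner \<phi> B e)" "y \<in> carrier (corner \<phi> B e)"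
    then have xy: "x \<in> carrier B" "y \<in> carrier B" "e \<otimes>\<^bsub>B\<^esub> x = x" "y \<otimes>\<^bsub>B\<^esub> e = y"
      by (auto simp: corner_fields)
    have "e \<otimes>\<^bsub>B\<^esub> (x \<otimes>\<^bsub>B\<^esub> y) = x \<otimes>\<^bsub>B\<^esub> y" "x \<otimes>\<^bsub>B\<^esub> y \<otimes>\<^bsub>B\<^esub> e = x \<otimes>\<^bsub>B\<^esub> y"
      using xy e B.m_assoc[of e x y] B.m_assoc[of x y e] by simp_all
    then show "x \<otimes>\<^bsub>corner \<phi> B e\<^esub> y \<in> carrier (corner \<phi> B e)"
      using xy by (simp add: corner_fields)
  qed (use e in \<open>auto simp: corner_fields B.l_distr B.r_distr B.m_assoc B.a_ac\<close>)
  then interpret ring "corner \<phi> B e" .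
  show ?thesis
    by standard (simp_all add: corner_fields \<phi> e(1) B.smult_l_distr B.smult_r_distr B.smult_assoc
        B.smult_mult_l B.smult_mult_r)
qed

lemma alg_hom_diff:
  fixes x y :: "'b \<Rightarrow>\<^sub>0 'k::comm_ring_1"
  assumes A: "ring A" "add A = (+)" and B: "ring B" and h: "alg_hom A B h"
    and x: "x \<in> carrier A" "y \<in> carrier A" "x - y \<in> carrier A"
  shows "h (x - y) = h x \<ominus>\<^bsub>B\<^esub> h y"
proof -
  interpret B: ring B by fact
  have c: "h x \<in> carrier B" "h y \<in> carrier B" "h (x - y) \<in> carrier B"
    using x alg_hom_simps(1)[OF h] by auto
  have "h x = h (x - y) \<oplus>\<^bsub>B\<^esub> h y"
    using alg_hom_simps(3)[OF h x(3,2)] by (simp add: A(2))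
  then show ?thesis using c by (simp add: a_minus_def B.a_assoc B.r_neg)
qed

text \<open>The operators act on combinations over the whole type \<open>'b\<close>, so they are
  plain functions that compose by \<open>\<circ>\<close>, with no condition outside a
  carrier.\<close>

definition lin_end :: "('k::comm_ring_1, ('b \<Rightarrow>\<^sub>0 'k) \<Rightarrow> ('b \<Rightarrow>\<^sub>0 'k)) module"
  where "lin_end = \<lparr>carrier = {f. (\<forall>x y. f (x + y) = f x + f y) \<and> (\<forall>c x. f (pm_scale c x) = pm_scale c (f x))},
    monoid.mult = (\<circ>), one = id, zero = (\<lambda>x. 0), add = (\<lambda>f g x. f x + g x),
    module.smult = (\<lambda>c f x. pm_scale c (f x))\<rparr>"

lemma lin_end_fields:
  "f \<in> carrier lin_end \<longleftrightarrow> (\<forall>x y. f (x + y) = f x + f y) \<and> (\<forall>c x. f (pm_scale c x) = pm_scale c (f x))"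
  "monoid.mult lin_end = (\<circ>)" "one lin_end = id" "zero lin_end = (\<lambda>x. 0)"
  "add lin_end = (\<lambda>f g x. f x + g x)" "module.smult lin_end = (\<lambda>c f x. pm_scale c (f x))"
  by (simp_all add: lin_end_def)

lemma alg_lin_end: "alg (lin_end :: ('k::comm_ring_1, ('b \<Rightarrow>\<^sub>0 'k) \<Rightarrow> _) module)"
proof -
  have "ring (lin_end :: ('k, ('b \<Rightarrow>\<^sub>0 'k) \<Rightarrow> _) module)"
  proof (intro ringI abelian_groupI monoidI)
    fix f :: "('b \<Rightarrow>\<^sub>0 'k) \<Rightarrow> ('b \<Rightarrow>\<^sub>0 'k)"
    assume "f \<in> carrier lin_end"
    then show "\<exists>g\<in>carrier lin_end. g \<oplus>\<^bsub>lin_end\<^esub> f = \<zero>\<^bsub>lin_end\<^esub>"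
      by (intro bexI[of _ "\<lambda>x. - f x"]) (auto simp: lin_end_fields pm_scale_simps)
  qed (auto simp: lin_end_fields fun_eq_iff pm_scale_simps ac_simps)
  then interpret ring "lin_end :: ('k, ('b \<Rightarrow>\<^sub>0 'k) \<Rightarrow> _) module" .
  show ?thesis
    by standard (auto simp: lin_end_fields fun_eq_iff pm_scale_simps ac_simps)
qed

lemma lin_end_ext:
  assumes f: "f \<in> carrier lin_end" and g: "g \<in> carrier lin_end"
    and eq: "\<And>w. w \<in> X \<Longrightarrow> f (Poly_Mapping.single w 1) = g (Poly_Mapping.single w 1)"
    and x: "Poly_Mapping.keys x \<subseteq> X"
  shows "f x = g x"
  using x
proof (induction x rule: pm_induct)
  case zero
  have "f 0 = 0" "g 0 = 0" using f g by (metis lin_end_fields(1) add_cancel_right_right)+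
  then show ?case by simp
next
  case (single w c)
  have *: "Poly_Mapping.single w c = pm_scale c (Poly_Mapping.single w 1)" by (simp add: pm_scale_simps)
  show ?case unfolding * using f g eq[OF single] by (simp add: lin_end_fields)
qed (use f g in \<open>simp_all add: lin_end_fields\<close>)

text \<open>The linear extension is written as a bilinear one with a dummy second argument, and
  inherits linearity from it.\<close>

definition plext :: "('b \<Rightarrow> ('b \<Rightarrow>\<^sub>0 'k::comm_ring_1)) \<Rightarrow> ('b \<Rightarrow>\<^sub>0 'k) \<Rightarrow> ('b \<Rightarrow>\<^sub>0 'k)"
  where "plext F f = bilinear_ext (\<lambda>x y. F x) f (Poly_Mapping.single undefined 1)"

lemma plext_lin [simp]: "plext F \<in> carrier lin_end"
  by (simp add: plext_def lin_end_fields bilinear_ext_add_left bilinear_ext_scale_left)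

lemma plext_simps [simp]:
  "plext F (f + g) = plext F f + plext F g" "plext F (pm_scale c f) = pm_scale c (plext F f)"
  "plext F (Poly_Mapping.single w c) = pm_scale c (F w)"
  by (simp_all add: plext_def bilinear_ext_add_left bilinear_ext_scale_left)

lemma keys_plext:
  "(\<And>w. w \<in> X \<Longrightarrow> Poly_Mapping.keys (F w) \<subseteq> X) \<Longrightarrow> Poly_Mapping.keys f \<subseteq> X \<Longrightarrow> Poly_Mapping.keys (plext F f) \<subseteq> X"
  unfolding plext_def bilinear_ext_def
  by (intro keys_sum_subset order_trans[OF keys_pm_scale]) auto

section \<open>The Hecke algebra: universal property and the elements T_w\<close>

context cox
begin

abbreviation "H \<equiv> hecke W S"
abbreviation "FA \<equiv> (free_algebra S :: (int poly, 'w list \<Rightarrow>\<^sub>0 int poly) module)"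
abbreviation "Tg \<equiv> hecke_gen W S"
abbreviation "hcls \<equiv> quot_class FA (hecke_relations W S)"

lemma free_single [simp]: "Poly_Mapping.single u c \<in> carrier FA \<longleftrightarrow> c = 0 \<or> u \<in> lists S"
  by (auto simp: free_algebra_fields)

lemma free_diff: "x \<in> carrier FA \<Longrightarrow> y \<in> carrier FA \<Longrightarrow> x - y \<in> carrier FA"
  using keys_minus[of x y] by (auto simp: free_algebra_fields)

lemma hecke_relations_carrier: "hecke_relations W S \<subseteq> carrier FA"
  using alt_word_lists[of _ S]
  by (auto simp: hecke_relations_def simp del: in_lists_conv_set intro!: free_diff)

lemma quot_hecke: "quot_alg' FA (hecke_relations W S)"
  using alg_free hecke_relations_carrier by (intro quot_alg'.intro quot_alg'_axioms.intro)

end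

sublocale cox \<subseteq> HQ: quot_alg' "free_algebra S :: (int poly, 'w list \<Rightarrow>\<^sub>0 int poly) module" "hecke_relations W S"
  by (rule quot_hecke)

context cox
begin

lemma hecke_eq: "quot_algebra FA (hecke_relations W S) = H"
  by (simp add: hecke_def)

end

sublocale cox \<subseteq> H: alg "hecke W S"
  using HQ.alg_Q by (simp add: hecke_def)

context cox
begin

lemma hcls_hom: "alg_hom FA H hcls"
  using HQ.alg_hom_cls by (simp add: hecke_def)

lemma Tg_closed [simp]: "s \<in> S \<Longrightarrow> Tg s \<in> carrier H"
  using alg_hom_simps(1)[OF hcls_hom] by (simp add: hecke_gen_def)

lemma hcls_word: "u \<in> lists S \<Longrightarrow> hcls (Poly_Mapping.single u 1) = word_prod H \<one>\<^bsub>H\<^esub> Tg u"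
proof -
  assume u: "u \<in> lists S"
  have "hcls (word_prod FA \<one>\<^bsub>FA\<^esub> (\<lambda>s. Poly_Mapping.single [s] 1) u) =
      word_prod H (hcls \<one>\<^bsub>FA\<^esub>) (\<lambda>s. hcls (Poly_Mapping.single [s] 1)) u"
    using u alg_hom_simps(1,2)[OF hcls_hom]
    by (intro conjunct1[OF hom_word_prod]) (auto simp: HQ.monoid_axioms)
  moreover have "(\<lambda>s. hcls (Poly_Mapping.single [s] 1)) = Tg"
    by (simp add: fun_eq_iff hecke_gen_def)
  ultimately show ?thesis using u by (simp add: free_word_prod alg_hom_simps(4)[OF hcls_hom])
qed

abbreviation "Tw \<equiv> word_prod H \<one>\<^bsub>H\<^esub> Tg"

lemma Tw_closed [simp]: "u \<in> lists S \<Longrightarrow> Tw u \<in> carrier H"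
  by (intro H.word_prod_closed) auto

lemma Tw_append: "u \<in> lists S \<Longrightarrow> v \<in> lists S \<Longrightarrow> Tw (u @ v) = Tw u \<otimes>\<^bsub>H\<^esub> Tw v"
  unfolding word_prod_append by (intro H.word_prod_unit) auto

lemma hcls_single: "u \<in> lists S \<Longrightarrow> hcls (Poly_Mapping.single u c) = c \<odot>\<^bsub>H\<^esub> Tw u"
  using alg_hom_simps(5)[OF hcls_hom, of "Poly_Mapping.single u 1" c] hcls_word
  by (simp add: free_algebra_fields pm_scale_simps)

lemma Tg_quadratic:
  assumes "s \<in> S"
  shows "Tg s \<otimes>\<^bsub>H\<^esub> Tg s = (qq - 1) \<odot>\<^bsub>H\<^esub> Tg s \<oplus>\<^bsub>H\<^esub> qq \<odot>\<^bsub>H\<^esub> \<one>\<^bsub>H\<^esub>"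
proof -
  let ?x = "Poly_Mapping.single [s, s] 1 :: 'w list \<Rightarrow>\<^sub>0 int poly"
  let ?y = "Poly_Mapping.single [s] (qq - 1) :: 'w list \<Rightarrow>\<^sub>0 int poly"
  let ?z = "Poly_Mapping.single [] qq :: 'w list \<Rightarrow>\<^sub>0 int poly"
  have "?x - ?y - ?z \<in> hecke_relations W S"
    using assms unfolding hecke_relations_def by blast
  then have "hcls (?x - ?y - ?z) = \<zero>\<^bsub>H\<^esub>" using HQ.cls_zero by (simp add: hecke_def)
  moreover have c: "?x \<in> carrier FA" "?y \<in> carrier FA" "?z \<in> carrier FA" "?x - ?y \<in> carrier FA" "?x - ?y - ?z \<in> carrier FA"
    using assms by (auto intro!: free_diff)
  have "hcls (?x - ?y - ?z) = hcls ?x \<ominus>\<^bsub>H\<^esub> hcls ?y \<ominus>\<^bsub>H\<^esub> hcls ?z"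
    using alg_hom_diff[OF HQ.ring_axioms _ H.ring_axioms hcls_hom] c by (simp add: free_algebra_fields(5))
  moreover have "hcls ?x = Tg s \<otimes>\<^bsub>H\<^esub> Tg s" "hcls ?y = (qq - 1) \<odot>\<^bsub>H\<^esub> Tg s" "hcls ?z = qq \<odot>\<^bsub>H\<^esub> \<one>\<^bsub>H\<^esub>"
    using assms by (subst hcls_single; simp)+
  ultimately have "Tg s \<otimes>\<^bsub>H\<^esub> Tg s \<ominus>\<^bsub>H\<^esub> (qq - 1) \<odot>\<^bsub>H\<^esub> Tg s \<ominus>\<^bsub>H\<^esub> qq \<odot>\<^bsub>H\<^esub> \<one>\<^bsub>H\<^esub> = \<zero>\<^bsub>H\<^esub>"
    by (simp only:)
  then have "Tg s \<otimes>\<^bsub>H\<^esub> Tg s \<ominus>\<^bsub>H\<^esub> (qq - 1) \<odot>\<^bsub>H\<^esub> Tg s = qq \<odot>\<^bsub>H\<^esub> \<one>\<^bsub>H\<^esub>"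
    using assms by (subst (asm) H.r_right_minus_eq) auto
  moreover have "x = y \<oplus>\<^bsub>H\<^esub> (x \<ominus>\<^bsub>H\<^esub> y)" if "x \<in> carrier H" "y \<in> carrier H" for x y
    using that by (simp add: a_minus_def H.a_lcomm[of y x] H.r_neg)
  ultimately show ?thesis using assms by (metis H.m_closed H.smult_closed Tg_closed)
qed

lemma Tg_braid:
  assumes "s \<in> S" "t \<in> S" "s \<noteq> t" "cox_m W s t > 0"
  shows "Tw (alt_word (cox_m W s t) s t) = Tw (alt_word (cox_m W s t) t s)"
proof -
  let ?x = "Poly_Mapping.single (alt_word (cox_m W s t) s t) 1 :: 'w list \<Rightarrow>\<^sub>0 int poly"
  let ?y = "Poly_Mapping.single (alt_word (cox_m W s t) t s) 1 :: 'w list \<Rightarrow>\<^sub>0 int poly"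
  have l: "alt_word (cox_m W s t) s t \<in> lists S" "alt_word (cox_m W s t) t s \<in> lists S"
    using assms by (intro alt_word_lists; simp)+
  have "?x - ?y \<in> hecke_relations W S"
    using assms unfolding hecke_relations_def by blast
  then have "hcls (?x - ?y) = \<zero>\<^bsub>H\<^esub>" using HQ.cls_zero by (simp add: hecke_def)
  moreover have c: "?x \<in> carrier FA" "?y \<in> carrier FA" "?x - ?y \<in> carrier FA"
    using l by (auto intro!: free_diff simp del: in_lists_conv_set)
  have "hcls (?x - ?y) = hcls ?x \<ominus>\<^bsub>H\<^esub> hcls ?y"
    using alg_hom_diff[OF HQ.ring_axioms _ H.ring_axioms hcls_hom] c by (simp add: free_algebra_fields(5))
  ultimately show ?thesis
    using l by (simp add: hcls_word H.r_right_minus_eq del: in_lists_conv_set)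
qed

lemma hecke_lift:
  fixes B :: "(int poly, 'a) module"
  assumes B: "alg B" and t: "\<And>s. s \<in> S \<Longrightarrow> t s \<in> carrier B"
    and quad: "\<And>s. s \<in> S \<Longrightarrow> t s \<otimes>\<^bsub>B\<^esub> t s = (qq - 1) \<odot>\<^bsub>B\<^esub> t s \<oplus>\<^bsub>B\<^esub> qq \<odot>\<^bsub>B\<^esub> \<one>\<^bsub>B\<^esub>"
    and braid: "\<And>p r. p \<in> S \<Longrightarrow> r \<in> S \<Longrightarrow> p \<noteq> r \<Longrightarrow> cox_m W p r > 0 \<Longrightarrow>
      word_prod B \<one>\<^bsub>B\<^esub> t (alt_word (cox_m W p r) p r) = word_prod B \<one>\<^bsub>B\<^esub> t (alt_word (cox_m W p r) r p)"
  shows "\<exists>h. alg_hom H B h \<and> (\<forall>s\<in>S. h (Tg s) = t s)"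
proof -
  interpret B: alg B by fact
  obtain h where h: "alg_hom FA B h"
      "\<And>w c. w \<in> lists S \<Longrightarrow> h (Poly_Mapping.single w c) = c \<odot>\<^bsub>B\<^esub> word_prod B \<one>\<^bsub>B\<^esub> t w"
    using free_algebra_lift[OF B, of t S] t by auto
  have diff: "h (x - y) = h x \<ominus>\<^bsub>B\<^esub> h y" if "x \<in> carrier FA" "y \<in> carrier FA" for x y
    using alg_hom_diff[OF HQ.ring_axioms _ B.ring_axioms h(1)] that free_diff by (simp add: free_algebra_fields(5))
  have "h x = \<zero>\<^bsub>B\<^esub>" if "x \<in> hecke_relations W S" for x
    using that unfolding hecke_relations_def
  proof (elim UnE CollectE exE conjE)
    fix s assume s: "s \<in> S" and x: "x = Poly_Mapping.single [s, s] 1 - Poly_Mapping.single [s] (qq - 1) - Poly_Mapping.single [] qq"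
    have e: "h (Poly_Mapping.single [s, s] 1) = t s \<otimes>\<^bsub>B\<^esub> t s"
      "h (Poly_Mapping.single [s] (qq - 1)) = (qq - 1) \<odot>\<^bsub>B\<^esub> t s" "h (Poly_Mapping.single [] qq) = qq \<odot>\<^bsub>B\<^esub> \<one>\<^bsub>B\<^esub>"
      using s t by (subst h(2); simp)+
    have "h x = h (Poly_Mapping.single [s, s] 1) \<ominus>\<^bsub>B\<^esub> h (Poly_Mapping.single [s] (qq - 1)) \<ominus>\<^bsub>B\<^esub> h (Poly_Mapping.single [] qq)"
      unfolding x using s by (subst diff; (subst diff)?; auto intro!: free_diff)
    also have "\<dots> = \<zero>\<^bsub>B\<^esub>"
      unfolding e quad[OF s] using t[OF s]
      by (simp add: a_minus_def B.a_assoc B.r_neg B.a_lcomm[of _ "qq \<odot>\<^bsub>B\<^esub> \<one>\<^bsub>B\<^esub>"])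
        (simp add: B.a_assoc[symmetric] B.r_neg B.a_comm B.r_neg1 B.r_neg2 B.minus_add)?
    finally show ?thesis .
  next
    fix p r assume pr: "p \<in> S" "r \<in> S" "p \<noteq> r" "0 < cox_m W p r"
      and x: "x = Poly_Mapping.single (alt_word (cox_m W p r) p r) 1 - Poly_Mapping.single (alt_word (cox_m W p r) r p) 1"
    have l: "alt_word (cox_m W p r) p r \<in> lists S" "alt_word (cox_m W p r) r p \<in> lists S"
      using pr by (intro alt_word_lists; simp)+
    have "h x = h (Poly_Mapping.single (alt_word (cox_m W p r) p r) 1) \<ominus>\<^bsub>B\<^esub> h (Poly_Mapping.single (alt_word (cox_m W p r) r p) 1)"
      unfolding x using l by (intro diff) (auto simp del: in_lists_conv_set)
    moreover have "word_prod B \<one>\<^bsub>B\<^esub> t (alt_word (cox_m W p r) p r) \<in> carrier B"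
      using l(1) t by (intro B.word_prod_closed) auto
    ultimately show ?thesis
      using h(2)[OF l(1), of 1] h(2)[OF l(2), of 1] braid[OF pr] by (simp add: B.r_right_minus_eq)
  qed
  then obtain h' where h': "alg_hom H B h'" "\<And>x. x \<in> carrier FA \<Longrightarrow> h' (hcls x) = h x"
    using HQ.lift_alg_hom[OF B h(1)] by (auto simp: hecke_def)
  have "h' (Tg s) = t s" if "s \<in> S" for s
    using h'(2)[of "Poly_Mapping.single [s] 1"] h(2)[of "[s]" 1] that t by (simp add: hecke_gen_def)
  then show ?thesis using h'(1) by blast
qed

text \<open>The value \<open>Tw\<close> of a word satisfies the conditions on \<open>F\<close> in
  \<open>matsumoto\<close>, so the reduced word chosen in the definition of \<open>hecke_T\<close>
  may be replaced by any other.\<close>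

lemma hecke_T_rdc: assumes "rdc u" shows "hecke_T W S (ev u) = Tw u"
proof -
  let ?v = "SOME ws. reduced_expr W S (ev u) ws"
  have "reduced_expr W S (ev u) ?v"
    using assms unfolding rdc_def by (rule someI)
  then have v: "rdc ?v" "ev ?v = ev u" by (simp_all add: reduced_expr_iff)
  have "Tw ?v = Tw u"
  proof (rule matsumoto[OF _ _ _ v(1) assms v(2)])
    fix s u v assume "s \<in> S" "u \<in> lists S" "v \<in> lists S" "Tw u = Tw v"
    then show "Tw (u @ [s]) = Tw (v @ [s])" by (simp only: Tw_append lists.intros)
  qed (use Tg_braid in auto)
  then show ?thesis by (simp add: hecke_T_def)
qed

abbreviation "TT \<equiv> hecke_T W S"

lemma TT_obtain: assumes "w \<in> carrier W" obtains u where "rdc u" "ev u = w" "TT w = Tw u"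
  using reduced_exists[OF assms] hecke_T_rdc by (auto simp: reduced_expr_iff)

lemma TT_closed [simp]: "w \<in> carrier W \<Longrightarrow> TT w \<in> carrier H"
  by (erule TT_obtain) (use rdcD(1) in auto)

lemma TT_one [simp]: "TT \<one> = \<one>\<^bsub>H\<^esub>"
proof -
  have "rdc []" by (rule rdcI) auto
  from hecke_T_rdc[OF this] show ?thesis by simp
qed

lemma rdc_single: "s \<in> S \<Longrightarrow> rdc [s]"
  using len_zero_iff[of s] S_not_one[of s] by (intro rdcI) auto

lemma TT_S [simp]: "s \<in> S \<Longrightarrow> TT s = Tg s"
  using hecke_T_rdc[OF rdc_single] by simp

lemma Tg_TT_up:
  assumes w: "w \<in> carrier W" and s: "s \<in> S" and up: "len w < len (s \<otimes> w)"
  shows "Tg s \<otimes>\<^bsub>H\<^esub> TT w = TT (s \<otimes> w)"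
proof -
  obtain u where u: "rdc u" "ev u = w" "TT w = Tw u" using TT_obtain[OF w] .
  have "rdc (s # u)" using rdc_Cons[OF w s u(1,2) up] .
  from hecke_T_rdc[OF this] show ?thesis using u by simp
qed

lemma TT_Tg_up:
  assumes w: "w \<in> carrier W" and s: "s \<in> S" and up: "len w < len (w \<otimes> s)"
  shows "TT w \<otimes>\<^bsub>H\<^esub> Tg s = TT (w \<otimes> s)"
proof -
  obtain u where u: "rdc u" "ev u = w" "TT w = Tw u" using TT_obtain[OF w] .
  have uS: "u \<in> lists S" using rdcD u by blast
  have "rdc (u @ [s])" using rdc_snoc[OF w s u(1,2) up] .
  from hecke_T_rdc[OF this] show ?thesis using u uS s Tw_append[of u "[s]"] by simp
qed

lemma Tg_TT_down:
  assumes w: "w \<in> carrier W" and s: "s \<in> S" and down: "len (s \<otimes> w) < len w"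
  shows "Tg s \<otimes>\<^bsub>H\<^esub> TT w = (qq - 1) \<odot>\<^bsub>H\<^esub> TT w \<oplus>\<^bsub>H\<^esub> qq \<odot>\<^bsub>H\<^esub> TT (s \<otimes> w)"
proof -
  let ?v = "s \<otimes> w"
  have v: "?v \<in> carrier W" "TT ?v \<in> carrier H" using w s by auto
  have *: "Tg s \<otimes>\<^bsub>H\<^esub> TT ?v = TT w" using Tg_TT_up[OF v(1) s] down w s by simp
  have "Tg s \<otimes>\<^bsub>H\<^esub> TT w = Tg s \<otimes>\<^bsub>H\<^esub> Tg s \<otimes>\<^bsub>H\<^esub> TT ?v"
    using s v by (simp add: H.m_assoc *)
  also have "\<dots> = (qq - 1) \<odot>\<^bsub>H\<^esub> TT w \<oplus>\<^bsub>H\<^esub> qq \<odot>\<^bsub>H\<^esub> TT ?v"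
    using s v by (simp add: Tg_quadratic H.l_distr H.smult_mult_l *)
  finally show ?thesis .
qed

lemma TT_Tg_down:
  assumes w: "w \<in> carrier W" and s: "s \<in> S" and down: "len (w \<otimes> s) < len w"
  shows "TT w \<otimes>\<^bsub>H\<^esub> Tg s = (qq - 1) \<odot>\<^bsub>H\<^esub> TT w \<oplus>\<^bsub>H\<^esub> qq \<odot>\<^bsub>H\<^esub> TT (w \<otimes> s)"
proof -
  let ?v = "w \<otimes> s"
  have v: "?v \<in> carrier W" "TT ?v \<in> carrier H" using w s by auto
  have *: "TT ?v \<otimes>\<^bsub>H\<^esub> Tg s = TT w" using TT_Tg_up[OF v(1) s] down w s by simp
  have "TT w \<otimes>\<^bsub>H\<^esub> Tg s = TT ?v \<otimes>\<^bsub>H\<^esub> (Tg s \<otimes>\<^bsub>H\<^esub> Tg s)"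
    using s v by (simp add: H.m_assoc[symmetric] *)
  also have "\<dots> = (qq - 1) \<odot>\<^bsub>H\<^esub> TT w \<oplus>\<^bsub>H\<^esub> qq \<odot>\<^bsub>H\<^esub> TT ?v"
    using s v by (simp add: Tg_quadratic H.r_distr H.smult_mult_r *)
  finally show ?thesis .
qed

section \<open>The elements x_I\<close>

abbreviation "xx \<equiv> hecke_x W S"

lemma xx_closed [simp]: "I \<subseteq> S \<Longrightarrow> xx I \<in> carrier H"
  unfolding hecke_x_def by (intro H.finsum_closed) (auto dest: generate_closed)

text \<open>\<open>D\<close> marks descents and \<open>\<sigma>\<close> exchanges each descent with
  its ascent. With a and b the sums of \<open>f\<close> over descents and ascents, the ascents
  contribute a and the descents (q - 1) a + q b, which is q (a + b) in total. Left and right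
  multiplication by a generator are both instances.\<close>

lemma finsum_double:
  assumes "finite X" "bij_betw \<sigma> X X" "\<And>w. w \<in> X \<Longrightarrow> D (\<sigma> w) \<longleftrightarrow> \<not> D w" "f \<in> X \<rightarrow> carrier H"
    and g: "\<And>w. w \<in> X \<Longrightarrow> \<not> D w \<Longrightarrow> g w = f (\<sigma> w)"
      "\<And>w. w \<in> X \<Longrightarrow> D w \<Longrightarrow> g w = (qq - 1) \<odot>\<^bsub>H\<^esub> f w \<oplus>\<^bsub>H\<^esub> qq \<odot>\<^bsub>H\<^esub> f (\<sigma> w)"
  shows "finsum H g X = qq \<odot>\<^bsub>H\<^esub> finsum H f X"
proof -
  define A where "A = {w \<in> X. D w}"
  define B where "B = {w \<in> X. \<not> D w}"
  have X: "X = A \<union> B" "A \<inter> B = {}" "finite A" "finite B" using assms(1) by (auto simp: A_def B_def)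
  have \<sigma>: "\<sigma> ` X = X" "inj_on \<sigma> X" using assms(2) by (auto simp: bij_betw_def)
  have \<sigma>B: "\<sigma> ` B = A"
  proof
    show "\<sigma> ` B \<subseteq> A" using \<sigma> assms(3) by (auto simp: A_def B_def)
    show "A \<subseteq> \<sigma> ` B"
    proof
      fix x assume "x \<in> A"
      then obtain y where "y \<in> X" "x = \<sigma> y" using \<sigma> by (auto simp: A_def)
      then show "x \<in> \<sigma> ` B" using \<open>x \<in> A\<close> assms(3) by (auto simp: A_def B_def)
    qed
  qed
  have \<sigma>A: "\<sigma> ` A = B"
  proof
    show "\<sigma> ` A \<subseteq> B" using \<sigma> assms(3) by (auto simp: A_def B_def)
    show "B \<subseteq> \<sigma> ` A"
    proof
      fix x assume "x \<in> B"
      then obtain y where "y \<in> X" "x = \<sigma> y" using \<sigma> by (auto simp: B_def)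
      then show "x \<in> \<sigma> ` A" using \<open>x \<in> B\<close> assms(3) by (auto simp: A_def B_def)
    qed
  qed
  have inj: "inj_on \<sigma> A" "inj_on \<sigma> B" using \<sigma>(2) X(1) by (auto intro: inj_on_subset)
  have fA: "f \<in> A \<rightarrow> carrier H" "f \<in> B \<rightarrow> carrier H" using assms(4) by (auto simp: A_def B_def)
  have f\<sigma>: "(\<lambda>w. f (\<sigma> w)) \<in> A \<rightarrow> carrier H" "(\<lambda>w. f (\<sigma> w)) \<in> B \<rightarrow> carrier H"
    using assms(4) \<sigma> X(1) by auto
  have cl: "f w \<in> carrier H" "f (\<sigma> w) \<in> carrier H" if "w \<in> A" for w using fA f\<sigma> that by auto
  have gAw: "g w = (qq - 1) \<odot>\<^bsub>H\<^esub> f w \<oplus>\<^bsub>H\<^esub> qq \<odot>\<^bsub>H\<^esub> f (\<sigma> w)" if "w \<in> A" for w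
    using that g(2) by (simp add: A_def)
  have gA: "g \<in> A \<rightarrow> carrier H" "g \<in> B \<rightarrow> carrier H"
    using gAw cl g(1) f\<sigma>(2) by (auto simp: B_def)
  let ?a = "finsum H f A" and ?b = "finsum H f B"
  have ab: "?a \<in> carrier H" "?b \<in> carrier H" using fA by auto
  have "finsum H g B = finsum H (\<lambda>w. f (\<sigma> w)) B"
    using f\<sigma> g by (intro H.finsum_cong') (auto simp: B_def)
  also have "\<dots> = ?a" using H.finsum_reindex[of f \<sigma> B] inj fA \<sigma>B by simp
  finally have gB: "finsum H g B = ?a" .
  have "finsum H g A = finsum H (\<lambda>w. (qq - 1) \<odot>\<^bsub>H\<^esub> f w \<oplus>\<^bsub>H\<^esub> qq \<odot>\<^bsub>H\<^esub> f (\<sigma> w)) A"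
    using gAw cl by (intro H.finsum_cong') auto
  also have "\<dots> = finsum H (\<lambda>w. (qq - 1) \<odot>\<^bsub>H\<^esub> f w) A \<oplus>\<^bsub>H\<^esub> finsum H (\<lambda>w. qq \<odot>\<^bsub>H\<^esub> f (\<sigma> w)) A"
    using f\<sigma> fA by (intro H.finsum_addf) auto
  also have "\<dots> = (qq - 1) \<odot>\<^bsub>H\<^esub> ?a \<oplus>\<^bsub>H\<^esub> qq \<odot>\<^bsub>H\<^esub> finsum H (\<lambda>w. f (\<sigma> w)) A"
    using f\<sigma> fA by (simp add: H.finsum_smult)
  also have "finsum H (\<lambda>w. f (\<sigma> w)) A = ?b" using H.finsum_reindex[of f \<sigma> A] inj fA \<sigma>A by simp
  finally have gA': "finsum H g A = (qq - 1) \<odot>\<^bsub>H\<^esub> ?a \<oplus>\<^bsub>H\<^esub> qq \<odot>\<^bsub>H\<^esub> ?b" .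
  have "finsum H g X = finsum H g A \<oplus>\<^bsub>H\<^esub> finsum H g B"
    unfolding X(1) using X gA by (intro H.finsum_Un_disjoint) auto
  also have "\<dots> = (qq - 1) \<odot>\<^bsub>H\<^esub> ?a \<oplus>\<^bsub>H\<^esub> 1 \<odot>\<^bsub>H\<^esub> ?a \<oplus>\<^bsub>H\<^esub> qq \<odot>\<^bsub>H\<^esub> ?b"
    unfolding gB gA' using ab by (simp add: H.a_ac)
  also have "\<dots> = qq \<odot>\<^bsub>H\<^esub> ?a \<oplus>\<^bsub>H\<^esub> qq \<odot>\<^bsub>H\<^esub> ?b"
    using H.smult_l_distr[OF ab(1), of "qq - 1" 1] by simp
  also have "\<dots> = qq \<odot>\<^bsub>H\<^esub> finsum H f X"
    unfolding X(1) using X fA ab by (subst H.finsum_Un_disjoint) (auto simp: H.smult_r_distr)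
  finally show ?thesis .
qed

lemma mult_bij:
  assumes "I \<subseteq> S" "s \<in> I"
  shows "bij_betw (\<lambda>w. s \<otimes> w) (generate W I) (generate W I)"
    "bij_betw (\<lambda>w. w \<otimes> s) (generate W I) (generate W I)"
  using assms generate_closed[OF assms(1)]
  by (intro bij_betw_byWitness[where f' = "\<lambda>w. s \<otimes> w"] bij_betw_byWitness[where f' = "\<lambda>w. w \<otimes> s"];
      auto intro: generate.eng generate.incl simp: subset_iff)+

lemma Tg_xx:
  assumes I: "I \<subseteq> S" "finite (generate W I)" and s: "s \<in> I"
  shows "Tg s \<otimes>\<^bsub>H\<^esub> xx I = qq \<odot>\<^bsub>H\<^esub> xx I" "xx I \<otimes>\<^bsub>H\<^esub> Tg s = qq \<odot>\<^bsub>H\<^esub> xx I"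
proof -
  have sS: "s \<in> S" using I s by auto
  have c: "w \<in> carrier W" if "w \<in> generate W I" for w using that generate_closed[OF I(1)] by blast
  have "Tg s \<otimes>\<^bsub>H\<^esub> xx I = finsum H (\<lambda>w. Tg s \<otimes>\<^bsub>H\<^esub> TT w) (generate W I)"
    unfolding hecke_x_def using I sS c by (intro H.finsum_rdistr) auto
  also have "\<dots> = qq \<odot>\<^bsub>H\<^esub> xx I"
    unfolding hecke_x_def
  proof (rule finsum_double[where \<sigma> = "\<lambda>w. s \<otimes> w" and D = "\<lambda>w. len (s \<otimes> w) < len w"])
    fix w assume w: "w \<in> generate W I"
    show "(len (s \<otimes> (s \<otimes> w)) < len (s \<otimes> w)) = (\<not> len (s \<otimes> w) < len w)"
      using len_mult_cases[OF c[OF w] sS] c[OF w] sS by auto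
    show "Tg s \<otimes>\<^bsub>H\<^esub> TT w = TT (s \<otimes> w)" if "\<not> len (s \<otimes> w) < len w"
      using that len_mult_cases[OF c[OF w] sS] by (intro Tg_TT_up c[OF w] sS) auto
    show "Tg s \<otimes>\<^bsub>H\<^esub> TT w = (qq - 1) \<odot>\<^bsub>H\<^esub> TT w \<oplus>\<^bsub>H\<^esub> qq \<odot>\<^bsub>H\<^esub> TT (s \<otimes> w)" if "len (s \<otimes> w) < len w"
      using that by (intro Tg_TT_down c[OF w] sS)
  qed (use I s c mult_bij in auto)
  finally show "Tg s \<otimes>\<^bsub>H\<^esub> xx I = qq \<odot>\<^bsub>H\<^esub> xx I" .
  have "xx I \<otimes>\<^bsub>H\<^esub> Tg s = finsum H (\<lambda>w. TT w \<otimes>\<^bsub>H\<^esub> Tg s) (generate W I)"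
    unfolding hecke_x_def using I sS c by (intro H.finsum_ldistr) auto
  also have "\<dots> = qq \<odot>\<^bsub>H\<^esub> xx I"
    unfolding hecke_x_def
  proof (rule finsum_double[where \<sigma> = "\<lambda>w. w \<otimes> s" and D = "\<lambda>w. len (w \<otimes> s) < len w"])
    fix w assume w: "w \<in> generate W I"
    show "(len (w \<otimes> s \<otimes> s) < len (w \<otimes> s)) = (\<not> len (w \<otimes> s) < len w)"
      using len_mult_right_cases[OF c[OF w] sS] c[OF w] sS by auto
    show "TT w \<otimes>\<^bsub>H\<^esub> Tg s = TT (w \<otimes> s)" if "\<not> len (w \<otimes> s) < len w"
      using that len_mult_right_cases[OF c[OF w] sS] by (intro TT_Tg_up c[OF w] sS) auto
    show "TT w \<otimes>\<^bsub>H\<^esub> Tg s = (qq - 1) \<odot>\<^bsub>H\<^esub> TT w \<oplus>\<^bsub>H\<^esub> qq \<odot>\<^bsub>H\<^esub> TT (w \<otimes> s)" if "len (w \<otimes> s) < len w"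
      using that by (intro TT_Tg_down c[OF w] sS)
  qed (use I s c mult_bij in auto)
  finally show "xx I \<otimes>\<^bsub>H\<^esub> Tg s = qq \<odot>\<^bsub>H\<^esub> xx I" .
qed

lemma Tw_xx:
  assumes I: "I \<subseteq> S" "finite (generate W I)"
  shows "u \<in> lists I \<Longrightarrow> Tw u \<otimes>\<^bsub>H\<^esub> xx I = qq ^ length u \<odot>\<^bsub>H\<^esub> xx I \<and>
    xx I \<otimes>\<^bsub>H\<^esub> Tw u = qq ^ length u \<odot>\<^bsub>H\<^esub> xx I"
proof (induction u)
  case (Cons s u)
  have "u \<in> lists S" using Cons.prems I(1) by auto
  then have c: "s \<in> S" "Tw u \<in> carrier H" "Tg s \<in> carrier H" "xx I \<in> carrier H" "s \<in> I" "u \<in> lists I"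
    using Cons.prems I(1) Tw_closed by auto
  note IH = Cons.IH[OF c(6)]
  have "Tw (s # u) \<otimes>\<^bsub>H\<^esub> xx I = Tg s \<otimes>\<^bsub>H\<^esub> (Tw u \<otimes>\<^bsub>H\<^esub> xx I)"
    using c by (simp add: H.m_assoc)
  moreover have "xx I \<otimes>\<^bsub>H\<^esub> Tw (s # u) = (xx I \<otimes>\<^bsub>H\<^esub> Tg s) \<otimes>\<^bsub>H\<^esub> Tw u"
    using c by (simp add: H.m_assoc)
  ultimately show ?case
    using IH c Tg_xx[OF I c(5)]
    by (simp add: H.smult_mult_l H.smult_mult_r H.smult_assoc[symmetric] mult.commute del: mult_pCons_left mult_pCons_right)
qed (use I in auto)

text \<open>An element of \<open>generate W I\<close> has a reduced word with letters in
  \<open>I \<subseteq> J\<close>, and each letter scales \<open>xx J\<close> by q; summing the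
  powers of q over the subgroup gives the Poincare polynomial.\<close>

lemma xx_mult:
  assumes IJ: "I \<subseteq> J" and J: "J \<subseteq> S" "finite (generate W J)"
  shows "xx I \<otimes>\<^bsub>H\<^esub> xx J = poincare W S I \<odot>\<^bsub>H\<^esub> xx J" "xx J \<otimes>\<^bsub>H\<^esub> xx I = poincare W S I \<odot>\<^bsub>H\<^esub> xx J"
proof -
  have I: "I \<subseteq> S" using IJ J by blast
  have c: "w \<in> carrier W" if "w \<in> generate W I" for w using that generate_closed[OF I] by blast
  have fin: "finite (generate W I)" using J(2) mono_generate[OF IJ] by (rule rev_finite_subset)
  have T: "TT w \<otimes>\<^bsub>H\<^esub> xx J = qq ^ len w \<odot>\<^bsub>H\<^esub> xx J \<and> xx J \<otimes>\<^bsub>H\<^esub> TT w = qq ^ len w \<odot>\<^bsub>H\<^esub> xx J"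
    if w: "w \<in> generate W I" for w
  proof -
    obtain u where u: "u \<in> lists I" "rdc u" "ev u = w" using parabolic_word[OF I w] by blast
    have "u \<in> lists J" using u(1) IJ by auto
    then show ?thesis
      using Tw_xx[OF J, of u] hecke_T_rdc[OF u(2)] u(3) rdcD(2)[OF u(2)] by (simp del: in_lists_conv_set)
  qed
  have "xx I \<otimes>\<^bsub>H\<^esub> xx J = finsum H (\<lambda>w. TT w \<otimes>\<^bsub>H\<^esub> xx J) (generate W I)"
    unfolding hecke_x_def[of W S I] using fin J c by (intro H.finsum_ldistr) auto
  also have "\<dots> = finsum H (\<lambda>w. qq ^ len w \<odot>\<^bsub>H\<^esub> xx J) (generate W I)"
    using T J by (intro H.finsum_cong') auto
  also have "\<dots> = poincare W S I \<odot>\<^bsub>H\<^esub> xx J"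
    unfolding poincare_def using J by (subst H.finsum_smult_l) auto
  finally show "xx I \<otimes>\<^bsub>H\<^esub> xx J = poincare W S I \<odot>\<^bsub>H\<^esub> xx J" .
  have "xx J \<otimes>\<^bsub>H\<^esub> xx I = finsum H (\<lambda>w. xx J \<otimes>\<^bsub>H\<^esub> TT w) (generate W I)"
    unfolding hecke_x_def[of W S I] using fin J c by (intro H.finsum_rdistr) auto
  also have "\<dots> = finsum H (\<lambda>w. qq ^ len w \<odot>\<^bsub>H\<^esub> xx J) (generate W I)"
    using T J by (intro H.finsum_cong') auto
  also have "\<dots> = poincare W S I \<odot>\<^bsub>H\<^esub> xx J"
    unfolding poincare_def using J by (subst H.finsum_smult_l) auto
  finally show "xx J \<otimes>\<^bsub>H\<^esub> xx I = poincare W S I \<odot>\<^bsub>H\<^esub> xx J" .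
qed

lemma generate_empty_set: "generate W {} = {\<one>}"
  using generate_empty by simp

lemma xx_empty [simp]: "xx {} = \<one>\<^bsub>H\<^esub>"
  unfolding hecke_x_def generate_empty_set by (simp add: H.finsum_insert)

lemma generate_single: assumes "s \<in> S" shows "generate W {s} = {\<one>, s}"
proof
  have "ev u \<in> {\<one>, s}" if "u \<in> lists {s}" for u
    using that by (induction u) (use assms in auto)
  then show "generate W {s} \<subseteq> {\<one>, s}" using generate_word[of _ "{s}"] assms by blast
qed (auto intro: generate.intros)

lemma xx_single: "s \<in> S \<Longrightarrow> xx {s} = \<one>\<^bsub>H\<^esub> \<oplus>\<^bsub>H\<^esub> Tg s"
  unfolding hecke_x_def using S_not_one[of s] by (simp add: generate_single)

subsection \<open>The regular representation\<close>

text \<open>The value outside the carrier makes the quadratic relation hold on all functions.\<close>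

definition lam :: "'w \<Rightarrow> ('w \<Rightarrow>\<^sub>0 int poly) \<Rightarrow> ('w \<Rightarrow>\<^sub>0 int poly)"
  where "lam s = plext (\<lambda>w. if w \<notin> carrier W then Poly_Mapping.single w qq
    else if len w < len (s \<otimes> w) then Poly_Mapping.single (s \<otimes> w) 1
    else Poly_Mapping.single w (qq - 1) + Poly_Mapping.single (s \<otimes> w) qq)"

text \<open>No guard for elements outside the carrier is built in, as this operator is only compared
  with others on combinations supported in the group.\<close>

definition rgt :: "'w \<Rightarrow> ('w \<Rightarrow>\<^sub>0 int poly) \<Rightarrow> ('w \<Rightarrow>\<^sub>0 int poly)"
  where "rgt s = plext (\<lambda>w. if len w < len (w \<otimes> s) then Poly_Mapping.single (w \<otimes> s) 1
    else Poly_Mapping.single w (qq - 1) + Poly_Mapping.single (w \<otimes> s) qq)"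

lemma lam_lin [simp]: "lam s \<in> carrier lin_end" "rgt s \<in> carrier lin_end"
  by (simp_all add: lam_def rgt_def)

lemma lam_simps [simp]:
  "lam s (f + g) = lam s f + lam s g" "lam s (pm_scale c f) = pm_scale c (lam s f)"
  "rgt s (f + g) = rgt s f + rgt s g" "rgt s (pm_scale c f) = pm_scale c (rgt s f)"
  by (simp_all add: lam_def rgt_def)

lemma lam_diff [simp]: "lam s (f - g) = lam s f - lam s g"
  using lam_simps(1)[of s "f - g" g] by (simp del: lam_simps)

lemma lam_single:
  "w \<in> carrier W \<Longrightarrow> len w < len (s \<otimes> w) \<Longrightarrow> lam s (Poly_Mapping.single w c) = Poly_Mapping.single (s \<otimes> w) c"
  "w \<in> carrier W \<Longrightarrow> \<not> len w < len (s \<otimes> w) \<Longrightarrow>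
    lam s (Poly_Mapping.single w c) = Poly_Mapping.single w (c * (qq - 1)) + Poly_Mapping.single (s \<otimes> w) (c * qq)"
  "w \<notin> carrier W \<Longrightarrow> lam s (Poly_Mapping.single w c) = Poly_Mapping.single w (c * qq)"
  "len w < len (w \<otimes> s) \<Longrightarrow> rgt s (Poly_Mapping.single w c) = Poly_Mapping.single (w \<otimes> s) c"
  "\<not> len w < len (w \<otimes> s) \<Longrightarrow>
    rgt s (Poly_Mapping.single w c) = Poly_Mapping.single w (c * (qq - 1)) + Poly_Mapping.single (w \<otimes> s) (c * qq)"
  by (simp_all add: lam_def rgt_def pm_scale_simps del: mult_pCons_left mult_pCons_right)

lemma lam_quadratic:
  assumes s: "s \<in> S"
  shows "lam s (lam s (Poly_Mapping.single w 1)) =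
    pm_scale (qq - 1) (lam s (Poly_Mapping.single w 1)) + pm_scale qq (Poly_Mapping.single w 1)"
proof (cases "w \<in> carrier W")
  case False
  then show ?thesis
    by (simp add: lam_single pm_scale_simps single_add[symmetric] algebra_simps del: mult_pCons_left mult_pCons_right)
next
  case True
  then have ss: "s \<otimes> (s \<otimes> w) = w" "s \<otimes> w \<in> carrier W" using s by auto
  show ?thesis
  proof (cases "len w < len (s \<otimes> w)")
    case up: True
    then show ?thesis
      using True ss by (simp add: lam_single pm_scale_simps algebra_simps del: mult_pCons_left mult_pCons_right)
  next
    case down: False
    then have "len (s \<otimes> w) < len (s \<otimes> (s \<otimes> w))" using len_mult_cases[OF True s] ss by auto
    then show ?thesis
      using True ss down
      by (simp add: lam_single pm_scale_simps single_add[symmetric] single_diff algebra_simps del: mult_pCons_left mult_pCons_right)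
  qed
qed

text \<open>If \<open>s \<otimes> w = w \<otimes> t\<close>, the two sides are computed directly.
  Otherwise \<open>exchange_commute\<close> excludes the only bad pattern of lengths, so
  \<open>s\<close> is an ascent of \<open>w \<otimes> t\<close> exactly when it is one of
  \<open>w\<close>, and likewise for \<open>t\<close> on the right; the two rules then act
  independently.\<close>

lemma lam_rgt:
  assumes w: "w \<in> carrier W" and s: "s \<in> S" and t: "t \<in> S"
  shows "lam s (rgt t (Poly_Mapping.single w 1)) = rgt t (lam s (Poly_Mapping.single w 1))"
proof -
  have c: "s \<otimes> w \<in> carrier W" "w \<otimes> t \<in> carrier W" using w s t by auto
  have a: "s \<otimes> (w \<otimes> t) = s \<otimes> w \<otimes> t" using w s t by (simp add: m_assoc)
  note L = len_mult_cases[OF w s] len_mult_right_cases[OF w t]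
    len_mult_cases[OF c(2) s, unfolded a] len_mult_right_cases[OF c(1) t]
  show ?thesis
  proof (cases "s \<otimes> w = w \<otimes> t")
    case True
    then have "s \<otimes> w \<otimes> t = w" using w t by simp
    moreover have "s \<otimes> (w \<otimes> t) = w" using True[symmetric] w s by simp
    ultimately show ?thesis
      using w c L True
      by (cases "len w < len (s \<otimes> w)")
        (simp_all add: lam_single algebra_simps del: mult_pCons_left mult_pCons_right)
  next
    case False
    then have "\<not> (len (s \<otimes> w) = len (w \<otimes> t) \<and> len (s \<otimes> w \<otimes> t) = len w)"
      using exchange_commute[OF w s t] by blast
    with L have d: "len (w \<otimes> t) < len (s \<otimes> w \<otimes> t) \<longleftrightarrow> len w < len (s \<otimes> w)"
      "len (s \<otimes> w) < len (s \<otimes> w \<otimes> t) \<longleftrightarrow> len w < len (w \<otimes> t)"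
      by linarith+
    show ?thesis
      using w c d a
      by (cases "len w < len (s \<otimes> w)"; cases "len w < len (w \<otimes> t)")
        (simp_all add: lam_single algebra_simps del: mult_pCons_left mult_pCons_right)
  qed
qed

abbreviation "Lw \<equiv> word_prod (lin_end :: (int poly, ('w \<Rightarrow>\<^sub>0 int poly) \<Rightarrow> _) module) id lam"

lemma Lw_Cons: "Lw (s # u) x = lam s (Lw u x)"
  by (simp add: lin_end_fields)

lemma Lw_lin: "Lw u \<in> carrier lin_end"
proof -
  interpret L: alg "lin_end :: (int poly, ('w \<Rightarrow>\<^sub>0 int poly) \<Rightarrow> _) module" by (rule alg_lin_end)
  show ?thesis using L.one_closed by (intro L.word_prod_closed) (simp_all add: lin_end_fields(3))
qed

lemma keys_lam:
  assumes "s \<in> S" "Poly_Mapping.keys x \<subseteq> carrier W"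
  shows "Poly_Mapping.keys (lam s x) \<subseteq> carrier W" "Poly_Mapping.keys (rgt s x) \<subseteq> carrier W"
  unfolding lam_def rgt_def using assms
  by (intro keys_plext; auto dest!: keys_add[THEN subsetD] split: if_splits)+

lemma Lw_rdc: "rdc u \<Longrightarrow> Lw u (Poly_Mapping.single \<one> c) = Poly_Mapping.single (ev u) c"
proof (induction u)
  case (Cons s u)
  have u: "rdc u" "s \<in> S" "u \<in> lists S" using rdc_ConsD[OF Cons.prems] rdcD(1)[OF Cons.prems] by auto
  have "Lw (s # u) (Poly_Mapping.single \<one> c) = lam s (Poly_Mapping.single (ev u) c)"
    by (simp only: Lw_Cons Cons.IH[OF u(1)])
  also have "\<dots> = Poly_Mapping.single (ev (s # u)) c"
    using rdcD(2)[OF Cons.prems] rdcD(2)[OF u(1)] u by (simp add: lam_single(1))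
  finally show ?case .
qed simp

lemma Lw_rgt:
  assumes "t \<in> S" "u \<in> lists S" "Poly_Mapping.keys x \<subseteq> carrier W"
  shows "Lw u (rgt t x) = rgt t (Lw u x) \<and> Poly_Mapping.keys (Lw u x) \<subseteq> carrier W"
  using assms(2)
proof (induction u rule: list.induct)
  case (Cons s u)
  have s: "s \<in> S" "u \<in> lists S" using Cons.prems by auto
  interpret L: alg "lin_end :: (int poly, ('w \<Rightarrow>\<^sub>0 int poly) \<Rightarrow> _) module" by (rule alg_lin_end)
  have "(lam s \<otimes>\<^bsub>lin_end\<^esub> rgt t) y = (rgt t \<otimes>\<^bsub>lin_end\<^esub> lam s) y" if y: "Poly_Mapping.keys y \<subseteq> carrier W" for y
  proof (rule lin_end_ext[where X = "carrier W", OF _ _ _ y])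
    show "lam s \<otimes>\<^bsub>lin_end\<^esub> rgt t \<in> carrier lin_end" "rgt t \<otimes>\<^bsub>lin_end\<^esub> lam s \<in> carrier lin_end"
      by (rule L.m_closed; simp)+
  qed (use lam_rgt[OF _ s(1) assms(1)] in \<open>simp add: lin_end_fields(2)\<close>)
  then have comm: "lam s (rgt t y) = rgt t (lam s y)" if "Poly_Mapping.keys y \<subseteq> carrier W" for y
    using that by (simp add: lin_end_fields(2))
  show ?case
    unfolding Lw_Cons using Cons.IH[OF s(2)] comm keys_lam(1)[OF s(1)] by metis
qed (use assms in simp)

text \<open>Both words are reduced with the same value, so they agree on the basis vector of the
  identity. The operators \<open>rgt\<close> commute with them and lead from that vector to every
  other group element. Outside the group each letter scales by q, and both words have the same
  length.\<close>

lemma Lw_braid: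
  assumes "p \<in> S" "r \<in> S" "cox_m W p r > 0"
  shows "Lw (alt_word (cox_m W p r) p r) = Lw (alt_word (cox_m W p r) r p)"
proof
  fix x
  let ?u = "alt_word (cox_m W p r) p r" and ?v = "alt_word (cox_m W p r) r p"
  have l: "?u \<in> lists S" "?v \<in> lists S" using assms by (intro alt_word_lists; simp)+
  have r: "rdc ?u" "rdc ?v"
    using alt_word_rdc[OF assms] alt_word_rdc[of r p] assms cox_m_sym[of p r] by auto
  have e: "ev ?u = ev ?v" using ev_alt_word_braid assms by blast
  have out: "Lw u (Poly_Mapping.single w c) = Poly_Mapping.single w (c * qq ^ length u)" if "w \<notin> carrier W" for u w c
  proof (induction u)
    case (Cons s u)
    show ?case
      by (simp only: Lw_Cons Cons lam_single(3)[OF that] list.size power_Suc2 add_0_right add_Suc_right mult.assoc)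
  qed simp
  have inn: "Lw ?u (Poly_Mapping.single (ev z) 1) = Lw ?v (Poly_Mapping.single (ev z) 1)" if "rdc z" for z
    using that
  proof (induction z rule: rev_induct)
    case Nil
    show ?case using Lw_rdc[OF r(1), of 1] Lw_rdc[OF r(2), of 1] e by (simp only: word_prod_simps(1))
  next
    case (snoc t z)
    have z: "t \<in> S" "z \<in> lists S" using rdcD(1)[OF snoc.prems] by auto
    have "Suc (length z) = len (ev z \<otimes> t)" using rdcD(2)[OF snoc.prems] z by simp
    moreover have "len (ev z \<otimes> t) \<le> Suc (len (ev z))"
      using len_mult_right_cases[of "ev z" t] z by auto
    ultimately have rz: "rdc z" "len (ev z) < len (ev z \<otimes> t)"
      using len_le[OF z(2)] z by (auto intro: rdcI)
    then have "Poly_Mapping.single (ev (z @ [t])) 1 = rgt t (Poly_Mapping.single (ev z) 1)"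
      using z by (simp add: lam_single)
    moreover have "Poly_Mapping.keys (Poly_Mapping.single (ev z) (1 :: int poly)) \<subseteq> carrier W"
      using z by simp
    ultimately show ?case
      by (simp only: conjunct1[OF Lw_rgt[OF z(1) l(1)]] conjunct1[OF Lw_rgt[OF z(1) l(2)]] snoc.IH[OF rz(1)])
  qed
  show "Lw ?u x = Lw ?v x"
  proof (rule lin_end_ext[where X = UNIV, OF Lw_lin Lw_lin])
    fix w :: 'w
    show "Lw ?u (Poly_Mapping.single w 1) = Lw ?v (Poly_Mapping.single w 1)"
    proof (cases "w \<in> carrier W")
      case True
      then obtain z where "rdc z" "ev z = w" using reduced_exists by (auto simp: reduced_expr_iff)
      then show ?thesis using inn by blast
    qed (simp add: out)
  qed simp
qed

lemma regular_rep: "\<exists>h. alg_hom H lin_end h \<and> (\<forall>s\<in>S. h (Tg s) = lam s)"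
proof (rule hecke_lift[OF alg_lin_end])
  fix s assume s: "s \<in> S"
  interpret L: alg "lin_end :: (int poly, ('w \<Rightarrow>\<^sub>0 int poly) \<Rightarrow> _) module" by (rule alg_lin_end)
  let ?r = "(qq - 1) \<odot>\<^bsub>lin_end\<^esub> lam s \<oplus>\<^bsub>lin_end\<^esub> qq \<odot>\<^bsub>lin_end\<^esub> \<one>\<^bsub>lin_end\<^esub>"
  show "lam s \<otimes>\<^bsub>lin_end\<^esub> lam s = ?r"
  proof
    fix x
    have "lam s \<otimes>\<^bsub>lin_end\<^esub> lam s \<in> carrier lin_end" "?r \<in> carrier lin_end" by auto
    then show "(lam s \<otimes>\<^bsub>lin_end\<^esub> lam s) x = ?r x"
      by (rule lin_end_ext[where X = UNIV]) (simp_all add: lin_end_fields(2-6) lam_quadratic[OF s])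
  qed
next
  fix p r assume "p \<in> S" "r \<in> S" "p \<noteq> r" "0 < cox_m W p r"
  then show "word_prod lin_end \<one>\<^bsub>lin_end\<^esub> lam (alt_word (cox_m W p r) p r) =
    word_prod lin_end \<one>\<^bsub>lin_end\<^esub> lam (alt_word (cox_m W p r) r p)"
    using Lw_braid by (simp add: lin_end_fields(3))
qed auto

text \<open>In the regular representation a reduced word sends the basis vector of the identity to
  that of its value. Injectivity of \<open>ev\<close> on the support keeps these images distinct, so
  each coefficient can be read off.\<close>

lemma hcls_independent:
  assumes d: "\<And>u. u \<in> Poly_Mapping.keys d \<Longrightarrow> rdc u" and inj: "inj_on ev (Poly_Mapping.keys d)"
    and z: "hcls d = \<zero>\<^bsub>H\<^esub>"
  shows "d = 0"
proof -
  interpret L: alg "lin_end :: (int poly, ('w \<Rightarrow>\<^sub>0 int poly) \<Rightarrow> _) module" by (rule alg_lin_end)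
  obtain h where h: "alg_hom H lin_end h" "\<And>s. s \<in> S \<Longrightarrow> h (Tg s) = lam s" using regular_rep by blast
  have hT: "h (Tw u) = Lw u" if "u \<in> lists S" for u
  proof -
    have "h (Tw u) = word_prod lin_end (h \<one>\<^bsub>H\<^esub>) (\<lambda>s. h (Tg s)) u"
      using that alg_hom_simps(1,2)[OF h(1)] by (intro conjunct1[OF hom_word_prod]) (auto simp: H.monoid_axioms)
    also have "\<dots> = Lw u"
      using that h(2) by (intro word_prod_cong) (auto simp: alg_hom_simps(4)[OF h(1)] lin_end_fields)
    finally show ?thesis .
  qed
  define \<Phi> where "\<Phi> f = h (hcls f) (Poly_Mapping.single \<one> 1)" for f
  have add: "\<Phi> (f + g) = \<Phi> f + \<Phi> g" if "f \<in> carrier FA" "g \<in> carrier FA" for f g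
    using alg_hom_simps(3)[OF hcls_hom that] alg_hom_simps(3)[OF h(1), of "hcls f" "hcls g"]
      alg_hom_simps(1)[OF hcls_hom] that
    by (simp add: \<Phi>_def lin_end_fields(5) free_algebra_fields(5))
  have single: "\<Phi> (Poly_Mapping.single u c) = Poly_Mapping.single (ev u) c" if "rdc u" for u c
    using rdcD(1)[OF that] alg_hom_simps(5)[OF h(1), of "Tw u" c] Lw_rdc[OF that, of 1]
    by (simp add: \<Phi>_def hcls_single hT lin_end_fields(6) pm_scale_simps del: in_lists_conv_set)
  have zero: "\<Phi> 0 = 0"
    using add[of 0 0] by (simp add: free_algebra_fields)
  let ?D = "\<lambda>K. \<Sum>u\<in>K. Poly_Mapping.single u (Poly_Mapping.lookup d u)"
  have "\<Phi> (?D K) = (\<Sum>u\<in>K. Poly_Mapping.single (ev u) (Poly_Mapping.lookup d u))" if "finite K" "K \<subseteq> Poly_Mapping.keys d" for K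
    using that
  proof (induction K rule: finite_induct)
    case (insert u K)
    have "?D K \<in> carrier FA"
      unfolding free_algebra_fields mem_Collect_eq
      using insert.prems d rdcD(1) by (intro keys_sum_subset) (auto split: if_splits)
    moreover have "Poly_Mapping.single u (Poly_Mapping.lookup d u) \<in> carrier FA"
      using insert.prems d[of u] rdcD(1)[of u] by simp
    ultimately show ?case using insert d[of u] by (simp add: add single)
  qed (simp add: zero)
  from this[of "Poly_Mapping.keys d"] have "\<Phi> d = (\<Sum>u\<in>Poly_Mapping.keys d. Poly_Mapping.single (ev u) (Poly_Mapping.lookup d u))"
    by (simp add: pm_sum_single)
  moreover have "\<Phi> d = 0"
  proof -
    have "h \<zero>\<^bsub>H\<^esub> = \<zero>\<^bsub>lin_end\<^esub>"
      using additive_finsum(1)[OF H.ring_axioms L.ring_axioms] alg_hom_simps(1,3)[OF h(1)] by blast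
    then show ?thesis by (simp add: \<Phi>_def z lin_end_fields)
  qed
  ultimately have eq: "(\<Sum>u\<in>Poly_Mapping.keys d. Poly_Mapping.single (ev u) (Poly_Mapping.lookup d u)) = 0" by simp
  have "Poly_Mapping.lookup d v = 0" for v
  proof (cases "v \<in> Poly_Mapping.keys d")
    case True
    have "0 = (\<Sum>u\<in>Poly_Mapping.keys d. Poly_Mapping.lookup (Poly_Mapping.single (ev u) (Poly_Mapping.lookup d u)) (ev v))"
      using arg_cong[OF eq, of "\<lambda>f. Poly_Mapping.lookup f (ev v)"] by (simp add: lookup_sum)
    also have "\<dots> = (\<Sum>u\<in>Poly_Mapping.keys d. if u = v then Poly_Mapping.lookup d v else 0)"
      using inj True by (intro sum.cong) (auto simp: lookup_single when_def inj_on_def)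
    finally show ?thesis using True by simp
  qed (simp add: in_keys_iff)
  then show ?thesis by (intro poly_mapping_eqI) simp
qed

end

subsection \<open>Braid relations from expansions\<close>

context cox
begin

definition alt_span :: "'w \<Rightarrow> 'w \<Rightarrow> nat \<Rightarrow> 'w list set"
  where "alt_span p r n = {alt_word k p r | k. k < n} \<union> {alt_word k r p | k. k < n}"

lemma alt_span_mono: "m \<le> n \<Longrightarrow> alt_span p r m \<subseteq> alt_span p r n"
  by (auto simp: alt_span_def)

lemma alt_span_lists: "p \<in> S \<Longrightarrow> r \<in> S \<Longrightarrow> alt_span p r n \<subseteq> lists S"
  using alt_word_lists[of p S r] alt_word_lists[of r S p] by (auto simp: alt_span_def simp del: in_lists_conv_set)

lemma alt_or_repeat:
  "set u \<subseteq> {p, r} \<Longrightarrow> u = alt_word (length u) p r \<or> u = alt_word (length u) r p \<or>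
    (\<exists>a x b. u = a @ x # x # b)"
proof (induction u rule: list.induct)
  case (Cons x u)
  then consider "\<exists>a y b. u = a @ y # y # b" | "u = alt_word (length u) p r" | "u = alt_word (length u) r p"
    by auto
  then show ?case
  proof cases
    case 1
    then show ?thesis by (metis append_Cons)
  next
    case 2
    show ?thesis
    proof (cases "u = []")
      case False
      then obtain v where "u = p # v" using 2 by (cases u) auto
      then show ?thesis using 2 Cons.prems by (cases "x = p") (auto intro: exI[of _ "[]"])
    qed (use Cons.prems in auto)
  next
    case 3
    show ?thesis
    proof (cases "u = []")
      case False
      then obtain v where "u = r # v" using 3 by (cases u) auto
      then show ?thesis using 3 Cons.prems by (cases "x = r") (auto intro: exI[of _ "[]"])
    qed (use Cons.prems in auto)
  qed
qed simp

text \<open>One combination of alternating words serves for \<open>f\<close> and \<open>g\<close>. With \<open>f\<close> the map to the Hecke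
  algebra, where short alternating words are independent, this transports identities to an algebra \<open>B\<close>
  in which the braid relation is not yet known.\<close>

lemma alternating_normal_form:
  fixes A :: "(int poly, 'a) module" and B :: "(int poly, 'b) module"
  assumes p: "p \<in> S" "r \<in> S"
    and A: "alg A" and f: "alg_hom FA A f"
    and fq: "\<And>s. s \<in> S \<Longrightarrow> f (Poly_Mapping.single [s, s] 1) = f (Poly_Mapping.single [s] (qq - 1) + Poly_Mapping.single [] qq)"
    and B: "alg B" and g: "alg_hom FA B g"
    and gq: "\<And>s. s \<in> S \<Longrightarrow> g (Poly_Mapping.single [s, s] 1) = g (Poly_Mapping.single [s] (qq - 1) + Poly_Mapping.single [] qq)"
    and x: "Poly_Mapping.keys x \<subseteq> {u. set u \<subseteq> {p, r} \<and> length u < n}"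
  shows "\<exists>y. Poly_Mapping.keys y \<subseteq> alt_span p r n \<and> f x = f y \<and> g x = g y"
proof -
  interpret A: alg A by fact
  interpret B: alg B by fact
  have f0: "f 0 = \<zero>\<^bsub>A\<^esub>" and g0: "g 0 = \<zero>\<^bsub>B\<^esub>"
    using additive_finsum(1)[OF HQ.ring_axioms A.ring_axioms] alg_hom_simps(1,3)[OF f]
      additive_finsum(1)[OF HQ.ring_axioms B.ring_axioms] alg_hom_simps(1,3)[OF g]
    by (simp_all add: free_algebra_fields(4))
  have carr: "y \<in> carrier FA" if "Poly_Mapping.keys y \<subseteq> alt_span p r k" for y k
    using that alt_span_lists[OF p] by (auto simp: free_algebra_fields(1) simp del: in_lists_conv_set)
  have add: "f (y + z) = f y \<oplus>\<^bsub>A\<^esub> f z \<and> g (y + z) = g y \<oplus>\<^bsub>B\<^esub> g z" if "y \<in> carrier FA" "z \<in> carrier FA" for y z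
    using alg_hom_simps(3)[OF f that] alg_hom_simps(3)[OF g that] by (simp add: free_algebra_fields)
  have scale: "f (pm_scale c y) = c \<odot>\<^bsub>A\<^esub> f y \<and> g (pm_scale c y) = c \<odot>\<^bsub>B\<^esub> g y" if "y \<in> carrier FA" for y c
    using alg_hom_simps(5)[OF f that] alg_hom_simps(5)[OF g that] by (simp add: free_algebra_fields)
  have word: "\<exists>y. Poly_Mapping.keys y \<subseteq> alt_span p r (Suc (length u)) \<and> f (Poly_Mapping.single u 1) = f y \<and> g (Poly_Mapping.single u 1) = g y"
    if "set u \<subseteq> {p, r}" for u
    using that
  proof (induction "length u" arbitrary: u rule: less_induct)
    case less
    consider "u \<in> alt_span p r (Suc (length u))" | "\<exists>a x b. u = a @ x # x # b"
      using alt_or_repeat[OF less.prems] by (force simp: alt_span_def)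
    then show ?case
    proof cases
      case 1
      then show ?thesis by (intro exI[of _ "Poly_Mapping.single u 1"]) simp
    next
      case 2
      then obtain a s b where u: "u = a @ s # s # b" by blast
      have s: "s \<in> S" and l: "set a \<subseteq> {p, r}" "set b \<subseteq> {p, r}" "s \<in> {p, r}" using less.prems u p by auto
      have ab: "a \<in> lists S" "b \<in> lists S" using l p by auto
      obtain y1 where y1: "Poly_Mapping.keys y1 \<subseteq> alt_span p r (Suc (length (a @ s # b)))"
          "f (Poly_Mapping.single (a @ s # b) 1) = f y1" "g (Poly_Mapping.single (a @ s # b) 1) = g y1"
        using less.hyps[of "a @ s # b"] u l by auto
      obtain y2 where y2: "Poly_Mapping.keys y2 \<subseteq> alt_span p r (Suc (length (a @ b)))"
          "f (Poly_Mapping.single (a @ b) 1) = f y2" "g (Poly_Mapping.single (a @ b) 1) = g y2"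
        using less.hyps[of "a @ b"] u l by auto
      \<comment> \<open>The quadratic relation turns a repeated letter into (q - 1) times one copy
        plus q times none; both resulting words are shorter, so their normal forms \<open>y1\<close>
        and \<open>y2\<close> are already known.\<close>
      let ?y = "pm_scale (qq - 1) y1 + pm_scale qq y2"
      let ?m = "Poly_Mapping.single [s] (qq - 1) + Poly_Mapping.single [] qq :: 'w list \<Rightarrow>\<^sub>0 int poly"
      have yc: "y1 \<in> carrier FA" "y2 \<in> carrier FA" using carr y1(1) y2(1) by blast+
      have mc: "?m \<in> carrier FA"
        using HQ.a_closed[of "Poly_Mapping.single [s] (qq - 1)" "Poly_Mapping.single [] qq"] s by (simp add: free_algebra_fields(5))
      have 1: "Poly_Mapping.single u 1 = Poly_Mapping.single a 1 \<otimes>\<^bsub>FA\<^esub> Poly_Mapping.single [s, s] 1 \<otimes>\<^bsub>FA\<^esub> Poly_Mapping.single b 1"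
        by (simp add: free_algebra_fields(2) u pm_scale_simps)
      have 2: "Poly_Mapping.single a 1 \<otimes>\<^bsub>FA\<^esub> ?m \<otimes>\<^bsub>FA\<^esub> Poly_Mapping.single b 1 =
          pm_scale (qq - 1) (Poly_Mapping.single (a @ s # b) 1) + pm_scale qq (Poly_Mapping.single (a @ b) 1)"
        by (simp only: free_algebra_fields(2) bilinear_ext_add_left bilinear_ext_add_right bilinear_ext_single
            pm_scale_simps mult_1_left mult_1_right append_assoc append_Cons append_Nil append_Nil2)
      have sc: "Poly_Mapping.single a 1 \<in> carrier FA" "Poly_Mapping.single b 1 \<in> carrier FA"
        "Poly_Mapping.single [s, s] 1 \<in> carrier FA" "Poly_Mapping.single (a @ s # b) 1 \<in> carrier FA"
        "Poly_Mapping.single (a @ b) 1 \<in> carrier FA" using ab s by auto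
      have scc: "pm_scale c z \<in> carrier FA" if "z \<in> carrier FA" for c z
        using HQ.smult_closed[OF that, of c] by (simp add: free_algebra_fields(6))
      have "f (Poly_Mapping.single u 1) = f ?y"
      proof -
        have "f (Poly_Mapping.single u 1) = f (Poly_Mapping.single a 1 \<otimes>\<^bsub>FA\<^esub> ?m \<otimes>\<^bsub>FA\<^esub> Poly_Mapping.single b 1)"
          unfolding 1 using sc mc by (simp only: alg_hom_simps(2)[OF f] HQ.m_closed fq[OF s])
        also have "\<dots> = f ?y"
          unfolding 2 using sc yc scc by (simp only: add scale y1(2) y2(2))
        finally show ?thesis .
      qed
      moreover have "g (Poly_Mapping.single u 1) = g ?y"
      proof -
        have "g (Poly_Mapping.single u 1) = g (Poly_Mapping.single a 1 \<otimes>\<^bsub>FA\<^esub> ?m \<otimes>\<^bsub>FA\<^esub> Poly_Mapping.single b 1)"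
          unfolding 1 using sc mc by (simp only: alg_hom_simps(2)[OF g] HQ.m_closed gq[OF s])
        also have "\<dots> = g ?y"
          unfolding 2 using sc yc scc by (simp only: add scale y1(3) y2(3))
        finally show ?thesis .
      qed
      moreover have "Poly_Mapping.keys ?y \<subseteq> alt_span p r (Suc (length u))"
      proof -
        have "alt_span p r (Suc (length (a @ s # b))) \<subseteq> alt_span p r (Suc (length u))"
          "alt_span p r (Suc (length (a @ b))) \<subseteq> alt_span p r (Suc (length u))"
          using u by (intro alt_span_mono; simp)+
        then have "Poly_Mapping.keys (pm_scale (qq - 1) y1) \<subseteq> alt_span p r (Suc (length u))"
          "Poly_Mapping.keys (pm_scale qq y2) \<subseteq> alt_span p r (Suc (length u))"
          using y1(1) y2(1) keys_pm_scale by (meson order_trans)+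
        then show ?thesis using keys_add by (meson Un_least order_trans)
      qed
      ultimately show ?thesis by blast
    qed
  qed
  show ?thesis using x
  proof (induction x rule: pm_induct)
    case zero
    show ?case by (rule exI[of _ 0]) simp
  next
    case (single u c)
    then obtain y where y: "Poly_Mapping.keys y \<subseteq> alt_span p r (Suc (length u))"
      "f (Poly_Mapping.single u 1) = f y" "g (Poly_Mapping.single u 1) = g y" using word by blast
    have *: "Poly_Mapping.single u c = pm_scale c (Poly_Mapping.single u 1)" by (simp add: pm_scale_simps)
    have uc: "Poly_Mapping.single u 1 \<in> carrier FA" using single p by auto
    have "Poly_Mapping.keys (pm_scale c y) \<subseteq> alt_span p r n"
      using keys_pm_scale[of c y] y(1) alt_span_mono[of "Suc (length u)" n p r] single by auto
    then show ?case
      unfolding * using uc carr[OF y(1)] by (intro exI[of _ "pm_scale c y"]) (simp only: scale y(2,3) simp_thms)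
  next
    case (add x z)
    then obtain y y' where y: "Poly_Mapping.keys y \<subseteq> alt_span p r n" "f x = f y" "g x = g y"
      "Poly_Mapping.keys y' \<subseteq> alt_span p r n" "f z = f y'" "g z = g y'" by blast
    have xz: "x \<in> carrier FA" "z \<in> carrier FA" using add p by (auto simp: free_algebra_fields(1))
    have "Poly_Mapping.keys (y + y') \<subseteq> alt_span p r n" using keys_add[of y y'] y by blast
    then show ?case
      using xz carr[OF y(1)] carr[OF y(4)] y
      by (intro exI[of _ "y + y'"]) (simp only: \<open>\<And>y z. y \<in> carrier FA \<Longrightarrow> z \<in> carrier FA \<Longrightarrow> f (y + z) = f y \<oplus>\<^bsub>A\<^esub> f z \<and> g (y + z) = g y \<oplus>\<^bsub>B\<^esub> g z\<close> simp_thms)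
  qed
qed

text \<open>This lifts x_s = 1 + T_s to the free algebra, where no relation between the letters
  holds yet.\<close>

definition fx :: "'w \<Rightarrow> ('w list \<Rightarrow>\<^sub>0 int poly)"
  where "fx s = Poly_Mapping.single [] 1 + Poly_Mapping.single [s] 1"

abbreviation "fxw \<equiv> word_prod FA \<one>\<^bsub>FA\<^esub> fx"

lemma fx_closed: "s \<in> S \<Longrightarrow> fx s \<in> carrier FA"
  using HQ.a_closed[of "Poly_Mapping.single [] 1" "Poly_Mapping.single [s] 1"]
  by (simp add: fx_def free_algebra_fields(5))

lemma fxw_closed: "u \<in> lists S \<Longrightarrow> fxw u \<in> carrier FA"
  using fx_closed by (intro HQ.word_prod_closed) auto

text \<open>Expanding the product of the factors 1 + s gives \<open>u\<close> itself once, when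
  every letter is taken; all other terms drop a letter.\<close>

lemma fxw_leading:
  "\<exists>g. fxw u = Poly_Mapping.single u 1 + g \<and> Poly_Mapping.keys g \<subseteq> {v. set v \<subseteq> set u \<and> length v < length u}"
proof (induction u)
  case Nil
  show ?case by (rule exI[of _ 0]) (simp add: free_algebra_fields)
next
  case (Cons s u)
  then obtain g where g: "fxw u = Poly_Mapping.single u 1 + g" "Poly_Mapping.keys g \<subseteq> {v. set v \<subseteq> set u \<and> length v < length u}"
    by blast
  let ?m = "bilinear_ext (\<lambda>u v. Poly_Mapping.single (u @ v) 1) :: _ \<Rightarrow> _ \<Rightarrow> ('w list \<Rightarrow>\<^sub>0 int poly)"
  have "?m (Poly_Mapping.single [] 1) f = f" for f
    by (simp add: bilinear_ext_superset[where X = "{[]}" and Y = "Poly_Mapping.keys f"] pm_scale_simps pm_sum_single)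
  then have "fxw (s # u) = Poly_Mapping.single (s # u) 1 + (Poly_Mapping.single u 1 + g + ?m (Poly_Mapping.single [s] 1) g)"
    using g(1) by (simp add: free_algebra_fields(2) fx_def bilinear_ext_add_left bilinear_ext_add_right pm_scale_simps ac_simps)
  moreover have "Poly_Mapping.keys (?m (Poly_Mapping.single [s] 1) g) \<subseteq> {v. set v \<subseteq> set (s # u) \<and> length v < length (s # u)}"
    unfolding bilinear_ext_def using g(2)
    by (intro keys_sum_subset order_trans[OF keys_pm_scale]) (auto split: if_splits)
  then have "Poly_Mapping.keys (Poly_Mapping.single u 1 + g + ?m (Poly_Mapping.single [s] 1) g)
      \<subseteq> {v. set v \<subseteq> set (s # u) \<and> length v < length (s # u)}"
    using g(2) keys_add[of "Poly_Mapping.single u 1 + g" "?m (Poly_Mapping.single [s] 1) g"]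
      keys_add[of "Poly_Mapping.single u 1" g] by force
  ultimately show ?case by blast
qed

text \<open>The expansion of x_I in products of the x_s is lifted to the free algebra, so that it
  can be evaluated in algebras where the braid relations are still to be proved.\<close>

definition fexp :: "('w list \<Rightarrow> int poly) \<Rightarrow> 'w list \<Rightarrow> ('w list \<Rightarrow>\<^sub>0 int poly)"
  where "fexp \<alpha> ws = fxw ws + pm_scale qq (\<Sum>y | strict_subseq y ws. pm_scale (\<alpha> y) (fxw y))"

lemma strict_subseq_length: "strict_subseq y ws \<Longrightarrow> length y < length ws"
  by (metis list_emb_length le_neq_implies_less subseq_same_length strict_subseq_def)

lemma strict_subseq_set: "strict_subseq y ws \<Longrightarrow> set y \<subseteq> set ws"
  by (auto simp: strict_subseq_def dest: list_emb_set)

lemma fexp_leading: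
  "\<exists>g. fexp \<alpha> u = Poly_Mapping.single u 1 + g \<and> Poly_Mapping.keys g \<subseteq> {v. set v \<subseteq> set u \<and> length v < length u}"
proof -
  let ?X = "{v. set v \<subseteq> set u \<and> length v < length u}"
  obtain g where g: "fxw u = Poly_Mapping.single u 1 + g" "Poly_Mapping.keys g \<subseteq> ?X"
    using fxw_leading by blast
  let ?h = "pm_scale qq (\<Sum>y | strict_subseq y u. pm_scale (\<alpha> y) (fxw y))"
  have "Poly_Mapping.keys (fxw y) \<subseteq> ?X" if "strict_subseq y u" for y
  proof -
    obtain g' where "fxw y = Poly_Mapping.single y 1 + g'" "Poly_Mapping.keys g' \<subseteq> {v. set v \<subseteq> set y \<and> length v < length y}"
      using fxw_leading by blast
    then show ?thesis
      using strict_subseq_length[OF that] strict_subseq_set[OF that] keys_add[of "Poly_Mapping.single y 1" g'] by force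
  qed
  then have "Poly_Mapping.keys ?h \<subseteq> ?X"
    by (intro order_trans[OF keys_pm_scale] keys_sum_subset) auto
  then have "Poly_Mapping.keys (g + ?h) \<subseteq> ?X" using g(2) keys_add[of g ?h] by blast
  then show ?thesis unfolding fexp_def g(1) by (intro exI[of _ "g + ?h"]) (simp add: ac_simps)
qed

lemma hom_fexp:
  assumes B: "alg B" and h: "alg_hom FA B h" and ws: "ws \<in> lists S"
  shows "h (fexp \<alpha> ws) = word_prod B \<one>\<^bsub>B\<^esub> (\<lambda>s. \<one>\<^bsub>B\<^esub> \<oplus>\<^bsub>B\<^esub> h (Poly_Mapping.single [s] 1)) ws \<oplus>\<^bsub>B\<^esub>
    qq \<odot>\<^bsub>B\<^esub> finsum B (\<lambda>y. \<alpha> y \<odot>\<^bsub>B\<^esub> word_prod B \<one>\<^bsub>B\<^esub> (\<lambda>s. \<one>\<^bsub>B\<^esub> \<oplus>\<^bsub>B\<^esub> h (Poly_Mapping.single [s] 1)) y) {y. strict_subseq y ws}"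
proof -
  interpret B: alg B by fact
  let ?Y = "{y. strict_subseq y ws}"
  have yS: "y \<in> lists S" if "y \<in> ?Y" for y using strict_subseq_set[of y ws] that ws by auto
  have hx: "h (fx s) = \<one>\<^bsub>B\<^esub> \<oplus>\<^bsub>B\<^esub> h (Poly_Mapping.single [s] 1)" if "s \<in> S" for s
    using alg_hom_simps(3)[OF h, of "Poly_Mapping.single [] 1" "Poly_Mapping.single [s] 1"] alg_hom_simps(4)[OF h] that
    by (simp add: fx_def free_algebra_fields(3,5))
  have w: "h (fxw u) = word_prod B \<one>\<^bsub>B\<^esub> (\<lambda>s. \<one>\<^bsub>B\<^esub> \<oplus>\<^bsub>B\<^esub> h (Poly_Mapping.single [s] 1)) u" if "u \<in> lists S" for u
  proof -
    have "h (fxw u) = word_prod B (h \<one>\<^bsub>FA\<^esub>) (\<lambda>s. h (fx s)) u"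
      using that alg_hom_simps(1,2)[OF h] fx_closed by (intro conjunct1[OF hom_word_prod]) (auto simp: HQ.monoid_axioms)
    then show ?thesis using that hx by (simp only: alg_hom_simps(4)[OF h]) (auto intro: word_prod_cong)
  qed
  have c: "(\<lambda>y. \<alpha> y \<odot>\<^bsub>FA\<^esub> fxw y) \<in> ?Y \<rightarrow> carrier FA" using yS fxw_closed by (auto simp del: in_lists_conv_set)
  have "fexp \<alpha> ws = fxw ws \<oplus>\<^bsub>FA\<^esub> qq \<odot>\<^bsub>FA\<^esub> finsum FA (\<lambda>y. \<alpha> y \<odot>\<^bsub>FA\<^esub> fxw y) ?Y"
    using finsum_pm[OF HQ.ring_axioms _ _ c] by (simp add: fexp_def free_algebra_fields(4-6))
  also have "h \<dots> = h (fxw ws) \<oplus>\<^bsub>B\<^esub> qq \<odot>\<^bsub>B\<^esub> h (finsum FA (\<lambda>y. \<alpha> y \<odot>\<^bsub>FA\<^esub> fxw y) ?Y)"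
    using c fxw_closed[OF ws] by (simp add: alg_hom_simps[OF h] HQ.finsum_closed)
  also have "h (finsum FA (\<lambda>y. \<alpha> y \<odot>\<^bsub>FA\<^esub> fxw y) ?Y) = finsum B (\<lambda>y. h (\<alpha> y \<odot>\<^bsub>FA\<^esub> fxw y)) ?Y"
    using additive_finsum(3)[OF HQ.ring_axioms B.ring_axioms _ _ c] alg_hom_simps(1,3)[OF h] by blast
  also have "\<dots> = finsum B (\<lambda>y. \<alpha> y \<odot>\<^bsub>B\<^esub> word_prod B \<one>\<^bsub>B\<^esub> (\<lambda>s. \<one>\<^bsub>B\<^esub> \<oplus>\<^bsub>B\<^esub> h (Poly_Mapping.single [s] 1)) y) ?Y"
  proof (rule B.finsum_cong')
    fix y assume "y \<in> ?Y"
    then show "h (\<alpha> y \<odot>\<^bsub>FA\<^esub> fxw y) = \<alpha> y \<odot>\<^bsub>B\<^esub> word_prod B \<one>\<^bsub>B\<^esub> (\<lambda>s. \<one>\<^bsub>B\<^esub> \<oplus>\<^bsub>B\<^esub> h (Poly_Mapping.single [s] 1)) y"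
      using fxw_closed[OF yS] by (simp only: alg_hom_simps(5)[OF h] w[OF yS])
  next
    show "(\<lambda>y. \<alpha> y \<odot>\<^bsub>B\<^esub> word_prod B \<one>\<^bsub>B\<^esub> (\<lambda>s. \<one>\<^bsub>B\<^esub> \<oplus>\<^bsub>B\<^esub> h (Poly_Mapping.single [s] 1)) y) \<in> ?Y \<rightarrow> carrier B"
    proof
      fix y assume "y \<in> ?Y"
      then show "\<alpha> y \<odot>\<^bsub>B\<^esub> word_prod B \<one>\<^bsub>B\<^esub> (\<lambda>s. \<one>\<^bsub>B\<^esub> \<oplus>\<^bsub>B\<^esub> h (Poly_Mapping.single [s] 1)) y \<in> carrier B"
        using yS[of y] alg_hom_simps(1)[OF h] by (intro B.smult_closed B.word_prod_closed) auto
    qed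
  qed simp
  finally show ?thesis by (simp only: w[OF ws])
qed

text \<open>All these words are reduced, so equal values mean equal lengths; two different
  alternating words of one positive length and equal value would have length
  \<open>cox_m W p r\<close>, which is excluded.\<close>

lemma alt_span_inj:
  assumes "p \<in> S" "r \<in> S" "p \<noteq> r" "0 < cox_m W p r"
  shows "inj_on ev (alt_span p r (cox_m W p r))" "u \<in> alt_span p r (cox_m W p r) \<Longrightarrow> rdc u"
proof -
  let ?m = "cox_m W p r"
  have rd: "rdc (alt_word k p r)" "rdc (alt_word k r p)" if "k < ?m" for k
    using alt_word_rdc[of p r k] alt_word_rdc[of r p k] assms cox_m_sym[of p r] that by auto
  then show "u \<in> alt_span p r ?m \<Longrightarrow> rdc u" by (auto simp: alt_span_def)
  have ne: "ev (alt_word k p r) \<noteq> ev (alt_word k r p)" if "k < ?m" "k > 0" for k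
    using alt_word_braid_len[of p r k] rd that assms by auto
  show "inj_on ev (alt_span p r ?m)"
  proof (rule inj_onI)
    fix u v assume uv: "u \<in> alt_span p r ?m" "v \<in> alt_span p r ?m" "ev u = ev v"
    then have "rdc u" "rdc v" using rd by (auto simp: alt_span_def)
    then have len: "length u = length v" using rdcD(2)[of u] rdcD(2)[of v] uv by simp
    have "u \<in> {alt_word (length u) p r, alt_word (length u) r p}" "length u < ?m"
      "v \<in> {alt_word (length v) p r, alt_word (length v) r p}"
      using uv(1,2) by (auto simp: alt_span_def)
    then show "u = v" using ne[of "length u"] len uv(3) by (cases "length u = 0") auto
  qed
qed

text \<open>The lower terms of the two expansions are first compared in the Hecke algebra, where the
  leading words are known to agree, and the result is then used in \<open>B\<close> to compare the
  leading words. The hypotheses \<open>H\<close> and \<open>B'\<close> quantify over all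
  homomorphisms with given values on the letters, because the one into \<open>B\<close> is only
  obtained inside the proof.\<close>

lemma braid_from_expansions:
  fixes B :: "(int poly, 'b) module"
  assumes pr: "p \<in> S" "r \<in> S" "p \<noteq> r" "0 < cox_m W p r"
    and B: "alg B" and t: "\<And>s. s \<in> S \<Longrightarrow> t s \<in> carrier B"
    and quad: "\<And>s. s \<in> S \<Longrightarrow> t s \<otimes>\<^bsub>B\<^esub> t s = (qq - 1) \<odot>\<^bsub>B\<^esub> t s \<oplus>\<^bsub>B\<^esub> qq \<odot>\<^bsub>B\<^esub> \<one>\<^bsub>B\<^esub>"
    and u: "rdc u" "set u \<subseteq> {p, r}" and v: "rdc v" "set v \<subseteq> {p, r}" and uv: "ev u = ev v" "u \<noteq> v"
    and H: "\<And>f. alg_hom FA H f \<Longrightarrow> (\<And>s. s \<in> S \<Longrightarrow> f (Poly_Mapping.single [s] 1) = Tg s) \<Longrightarrow> f (fexp \<alpha> u) = f (fexp \<beta> v)"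
    and B': "\<And>f. alg_hom FA B f \<Longrightarrow> (\<And>s. s \<in> S \<Longrightarrow> f (Poly_Mapping.single [s] 1) = t s) \<Longrightarrow> f (fexp \<alpha> u) = f (fexp \<beta> v)"
  shows "word_prod B \<one>\<^bsub>B\<^esub> t (alt_word (cox_m W p r) p r) = word_prod B \<one>\<^bsub>B\<^esub> t (alt_word (cox_m W p r) r p)"
proof -
  interpret B: alg B by fact
  let ?m = "cox_m W p r"
  obtain g where g: "alg_hom FA B g"
      "\<And>w c. w \<in> lists S \<Longrightarrow> g (Poly_Mapping.single w c) = c \<odot>\<^bsub>B\<^esub> word_prod B \<one>\<^bsub>B\<^esub> t w"
    using free_algebra_lift[OF B, of t S] t by auto
  have gs: "g (Poly_Mapping.single [s] 1) = t s" if "s \<in> S" for s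
    using g(2)[of "[s]" 1] that t by simp
  have sums: "f (x + y) = f x \<oplus>\<^bsub>A\<^esub> f y" if "alg_hom FA A f" "x \<in> carrier FA" "y \<in> carrier FA" for A :: "(int poly, 'z) module" and f x y
    using alg_hom_simps(3)[OF that] by (simp add: free_algebra_fields)
  have gq: "g (Poly_Mapping.single [s, s] 1) = g (Poly_Mapping.single [s] (qq - 1) + Poly_Mapping.single [] qq)" if s: "s \<in> S" for s
  proof -
    have "g (Poly_Mapping.single [s] (qq - 1) + Poly_Mapping.single [] qq) =
        g (Poly_Mapping.single [s] (qq - 1)) \<oplus>\<^bsub>B\<^esub> g (Poly_Mapping.single [] qq)"
      using s by (intro alg_hom_simps(3)[OF g(1), unfolded free_algebra_fields(5)]) auto
    also have "\<dots> = t s \<otimes>\<^bsub>B\<^esub> t s"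
      using s t quad[OF s] by (subst (1 2) g(2)) simp_all
    also have "\<dots> = g (Poly_Mapping.single [s, s] 1)" using s t by (subst g(2)) simp_all
    finally show ?thesis by simp
  qed
  have hq: "hcls (Poly_Mapping.single [s, s] 1) = hcls (Poly_Mapping.single [s] (qq - 1) + Poly_Mapping.single [] qq)" if s: "s \<in> S" for s
  proof -
    have "hcls (Poly_Mapping.single [s] (qq - 1) + Poly_Mapping.single [] qq) =
        hcls (Poly_Mapping.single [s] (qq - 1)) \<oplus>\<^bsub>H\<^esub> hcls (Poly_Mapping.single [] qq)"
      using s by (intro alg_hom_simps(3)[OF hcls_hom, unfolded free_algebra_fields(5)]) auto
    also have "\<dots> = Tg s \<otimes>\<^bsub>H\<^esub> Tg s"
      using s Tg_quadratic[OF s] by (subst (1 2) hcls_single) simp_all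
    also have "\<dots> = hcls (Poly_Mapping.single [s, s] 1)" using s by (subst hcls_single) simp_all
    finally show ?thesis by simp
  qed
  define n where "n = length u"
  have n: "length v = n" using rdcD(2)[OF u(1)] rdcD(2)[OF v(1)] uv(1) by (simp add: n_def)
  have "n > 0" using uv(2) n by (auto simp: n_def)
  have alt: "u \<in> {alt_word n p r, alt_word n r p}" "v \<in> {alt_word n p r, alt_word n r p}"
    using rdc_dihedral[of p r u] rdc_dihedral[of p r v] u v pr n by (auto simp: n_def)
  have cases: "(u = alt_word n p r \<and> v = alt_word n r p) \<or> (u = alt_word n r p \<and> v = alt_word n p r)"
    using alt uv(2) by auto
  \<comment> \<open>\<open>u\<close> and \<open>v\<close> are thus the two sides of the braid
    relation itself, and all lower terms have fewer than \<open>cox_m W p r\<close> letters, the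
    range in which alternating words are independent.\<close>
  then have nm: "n = ?m"
    using alt_word_braid_len[of p r n] pr u(1) v(1) uv(1) \<open>n > 0\<close> by auto
  obtain x where x: "fexp \<alpha> u = Poly_Mapping.single u 1 + x" "Poly_Mapping.keys x \<subseteq> {w. set w \<subseteq> set u \<and> length w < length u}"
    using fexp_leading by blast
  obtain y where y: "fexp \<beta> v = Poly_Mapping.single v 1 + y" "Poly_Mapping.keys y \<subseteq> {w. set w \<subseteq> set v \<and> length w < length v}"
    using fexp_leading by blast
  have kx: "Poly_Mapping.keys x \<subseteq> {w. set w \<subseteq> {p, r} \<and> length w < ?m}" using x(2) u(2) nm by (auto simp: n_def)
  have ky: "Poly_Mapping.keys y \<subseteq> {w. set w \<subseteq> {p, r} \<and> length w < ?m}" using y(2) v(2) nm n by auto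
  note nf = alternating_normal_form[OF pr(1,2) H.alg_axioms hcls_hom hq B g(1) gq]
  obtain x' where x': "Poly_Mapping.keys x' \<subseteq> alt_span p r ?m" "hcls x = hcls x'" "g x = g x'"
    using nf[OF _ _ kx] by blast
  obtain y' where y': "Poly_Mapping.keys y' \<subseteq> alt_span p r ?m" "hcls y = hcls y'" "g y = g y'"
    using nf[OF _ _ ky] by blast
  have c: "x \<in> carrier FA" "y \<in> carrier FA"
    using kx ky pr by (auto simp: free_algebra_fields(1) subset_iff)
  have c': "x' \<in> carrier FA" "y' \<in> carrier FA"
    using order_trans[OF x'(1) alt_span_lists[OF pr(1,2)]] order_trans[OF y'(1) alt_span_lists[OF pr(1,2)]]
    by (simp_all only: free_algebra_fields(1) mem_Collect_eq)
  have uvS: "u \<in> lists S" "v \<in> lists S" using u v rdcD by auto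
  have uvc: "Poly_Mapping.single u 1 \<in> carrier FA" "Poly_Mapping.single v 1 \<in> carrier FA" using uvS by auto
  \<comment> \<open>In the Hecke algebra the leading terms cancel, and what remains is an equation
    between the normal forms of the lower terms.\<close>
  have "Tw u = Tw v" using cases Tg_braid[OF pr] nm by auto
  moreover have "hcls (fexp \<alpha> u) = hcls (fexp \<beta> v)"
    by (rule H[OF hcls_hom]) (simp add: hecke_gen_def)
  then have "Tw u \<oplus>\<^bsub>H\<^esub> hcls x = Tw v \<oplus>\<^bsub>H\<^esub> hcls y"
    unfolding x(1) y(1) using uvS uvc c
    by (simp only: alg_hom_simps(3)[OF hcls_hom, unfolded free_algebra_fields(5)] hcls_word)
  ultimately have "Tw v \<oplus>\<^bsub>H\<^esub> hcls x' = Tw v \<oplus>\<^bsub>H\<^esub> hcls y'"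
    using x'(2) y'(2) by simp
  then have "hcls x' = hcls y'"
    using Tw_closed[OF uvS(2)] alg_hom_simps(1)[OF hcls_hom c'(1)] alg_hom_simps(1)[OF hcls_hom c'(2)]
    by (simp only: H.add.Units_l_cancel H.add.Units_eq)
  have "x' - y' = 0"
  proof (rule hcls_independent)
    have k: "Poly_Mapping.keys (x' - y') \<subseteq> alt_span p r ?m" using keys_minus[of x' y'] x' y' by blast
    then show "\<And>w. w \<in> Poly_Mapping.keys (x' - y') \<Longrightarrow> rdc w" using alt_span_inj(2)[OF pr] by blast
    show "inj_on ev (Poly_Mapping.keys (x' - y'))" using alt_span_inj(1)[OF pr] k by (rule inj_on_subset)
    show "hcls (x' - y') = \<zero>\<^bsub>H\<^esub>"
      using alg_hom_diff[OF HQ.ring_axioms free_algebra_fields(5) H.ring_axioms hcls_hom c' free_diff[OF c']]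
        \<open>hcls x' = hcls y'\<close> alg_hom_simps(1)[OF hcls_hom c'(2)] by simp
  qed
  then have "x' = y'" by simp
  \<comment> \<open>In \<open>B\<close> the cancellation goes the other way: the lower terms now
    agree, so the leading words must agree as well.\<close>
  have "g (fexp \<alpha> u) = g (fexp \<beta> v)" by (rule B'[OF g(1) gs])
  then have "g (Poly_Mapping.single u 1) \<oplus>\<^bsub>B\<^esub> g x' = g (Poly_Mapping.single v 1) \<oplus>\<^bsub>B\<^esub> g x'"
    unfolding x(1) y(1) using uvS uvc c
    by (simp only: alg_hom_simps(3)[OF g(1), unfolded free_algebra_fields(5)] x'(3) y'(3) \<open>x' = y'\<close>)
  then have "g (Poly_Mapping.single u 1) = g (Poly_Mapping.single v 1)"
    using alg_hom_simps(1)[OF g(1)] uvc c'(1) by simp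
  moreover have "word_prod B \<one>\<^bsub>B\<^esub> t w \<in> carrier B" if "w \<in> lists S" for w
    using that t by (intro B.word_prod_closed) auto
  ultimately have "word_prod B \<one>\<^bsub>B\<^esub> t u = word_prod B \<one>\<^bsub>B\<^esub> t v"
    using g(2)[OF uvS(1), of 1] g(2)[OF uvS(2), of 1] uvS by (simp del: in_lists_conv_set)
  then show ?thesis using cases nm by auto
qed

section \<open>Longest elements and adapted words\<close>

lemma longest_exists:
  assumes "finite (generate W I)"
  shows "longest_elt W S I \<in> generate W I" "w \<in> generate W I \<Longrightarrow> len w \<le> len (longest_elt W S I)"
proof -
  let ?G = "generate W I"
  have "finite (len ` ?G)" "len ` ?G \<noteq> {}" using assms generate.one[of W I] by auto
  then obtain z where z: "z \<in> ?G" "len z = Max (len ` ?G)" by (metis Max_in imageE)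
  then have "is_arg_max len (\<lambda>x. x \<in> ?G) z"
    using assms by (auto simp: is_arg_max_linorder)
  then have "is_arg_max len (\<lambda>x. x \<in> ?G) (longest_elt W S I)"
    unfolding longest_elt_def arg_max_on_def arg_max_def by (rule someI)
  then show "longest_elt W S I \<in> ?G" "w \<in> ?G \<Longrightarrow> len w \<le> len (longest_elt W S I)"
    by (auto simp: is_arg_max_linorder)
qed

lemma longest_single: "s \<in> S \<Longrightarrow> longest_elt W S {s} = s"
  using longest_exists[of "{s}"] len_zero_iff[of s] len_zero_iff[of \<one>] S_not_one[of s] by (auto simp: generate_single)

lemma rdc_suffix: "rdc (u @ v) \<Longrightarrow> rdc v"
  by (induction u) (use rdc_ConsD in auto)

text \<open>The member \<open>{s}\<close> of the chain provides a suffix with value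
  \<open>s\<close>; a suffix of a reduced word is reduced, so it is the single letter
  \<open>s\<close>. Hence the two orderings of a pair have adapted words with different last
  letters.\<close>

lemma adapted_pair:
  assumes "adapted_expr W S [{}, {s}, {s, t}] ws" "s \<in> S" "t \<in> S" "finite (generate W {s, t})"
  shows "rdc ws" "set ws \<subseteq> {s, t}" "ev ws = longest_elt W S {s, t}" "\<exists>us. ws = us @ [s]"
proof -
  have r: "rdc ws" "ev ws = longest_elt W S {s, t}"
    using assms(1) by (auto simp: adapted_expr_def reduced_expr_iff)
  then show "rdc ws" "ev ws = longest_elt W S {s, t}" by auto
  have "ws \<in> lists {s, t}"
    using parabolic_reduced[of "{s, t}" ws] r longest_exists(1)[OF assms(4)] assms(2,3) by simp
  then show "set ws \<subseteq> {s, t}" by auto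
  obtain v where v: "suffix v ws" "ev v = s"
    using assms(1,2) longest_single[of s] by (auto simp: adapted_expr_def)
  then obtain us where us: "ws = us @ v" by (auto simp: suffix_def)
  have "rdc v" using rdc_suffix r us by blast
  moreover have "len s = 1" using rdcD(2)[OF rdc_single[OF assms(2)]] assms(2) by simp
  ultimately have "length v = 1" using rdcD(2)[of v] v by simp
  then obtain x where x: "v = [x]" by (auto simp: length_Suc_conv)
  then have "x \<in> S" using \<open>rdc v\<close> rdcD(1)[of v] by simp
  then have "v = [s]" using v x by simp
  then show "\<exists>us. ws = us @ [s]" using us by blast
qed

end

subsection \<open>Representations of the two quivers\<close>

context alg
begin

lemma idem_comb:
  assumes "P \<in> carrier A" "e \<in> carrier A" "P \<otimes> P = P" "e \<otimes> e = e" "e \<otimes> P = P" "P \<otimes> e = P"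
  shows "(a \<odot> P \<oplus> b \<odot> e) \<otimes> (c \<odot> P \<oplus> d \<odot> e) = (a * c + a * d + b * c) \<odot> P \<oplus> (b * d) \<odot> e"
  using assms by (simp add: l_distr r_distr smult_mult_l smult_mult_r smult_assoc smult_l_distr smult_r_distr
        smult_left_commute[of P c] smult_left_commute[of e d] smult_left_commute[of P d] a_ac)

text \<open>With \<open>P\<close> idempotent, c P - e takes the values c - 1 and -1 on the two parts
  of the corner cut out by \<open>P\<close>, which gives the quadratic equation. For c = 1 + q the
  coefficients become q - 1 and q, those of the Hecke relation.\<close>

lemma idem_quadratic:
  assumes P: "P \<in> carrier A" "e \<in> carrier A" "P \<otimes> P = P" "e \<otimes> e = e" "e \<otimes> P = P" "P \<otimes> e = P"
    and t: "t = c \<odot> P \<ominus> e"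
  shows "t \<otimes> t = (c - 2) \<odot> t \<oplus> (c - 1) \<odot> e" "t \<in> carrier A" "e \<otimes> t = t" "t \<otimes> e = t"
proof -
  have t': "t = c \<odot> P \<oplus> (- 1) \<odot> e"
    using P by (simp add: t a_minus_def smult_minus_l)
  show "t \<in> carrier A" using P by (simp add: t')
  show "e \<otimes> t = t" "t \<otimes> e = t" using P by (simp_all add: t' l_distr r_distr smult_mult_l smult_mult_r)
  have "(c - 2) \<odot> t \<oplus> (c - 1) \<odot> e = ((c - 2) * c) \<odot> P \<oplus> (((c - 2) * (- 1)) \<odot> e \<oplus> (c - 1) \<odot> e)"
    unfolding t' using P by (simp only: smult_r_distr smult_assoc smult_closed a_assoc)
  also have "\<dots> = ((c - 2) * c) \<odot> P \<oplus> ((c - 2) * (- 1) + (c - 1)) \<odot> e"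
    using P by (simp only: smult_l_distr)
  also have "\<dots> = (c * c + c * (- 1) + (- 1) * c) \<odot> P \<oplus> ((- 1) * (- 1)) \<odot> e"
    by (intro arg_cong2[where f = "add A"] arg_cong2[where f = "module.smult A"]) (simp_all add: algebra_simps)
  also have "\<dots> = t \<otimes> t" unfolding t' using idem_comb[OF P] by simp
  finally show "t \<otimes> t = (c - 2) \<odot> t \<oplus> (c - 1) \<odot> e" by simp
qed

end

text \<open>The inclusion of a corner into the algebra is additive, although it does not preserve
  the unit.\<close>

lemma finsum_corner:
  assumes B: "alg B" and C: "ring (corner \<phi> B e)" and f: "f \<in> X \<rightarrow> carrier (corner \<phi> B e)"
  shows "finsum (corner \<phi> B e) f X = finsum B f X"
  using additive_finsum(3)[OF C alg.axioms(1)[OF B], of "\<lambda>x. x", OF _ _ f] by (simp add: corner_fields)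

lemma ordering_snocI: "is_ordering J Is \<Longrightarrow> J \<sqsubset>c K \<Longrightarrow> is_ordering K (Is @ [K])"
  by (auto simp: is_ordering_def successively_append_iff)

lemma ordering_cases [consumes 1, case_names nil snoc]:
  assumes "is_ordering I Is"
  obtains "I = {}" "Is = [{}]" | J Js where "Is = Js @ [I]" "is_ordering J Js" "J \<sqsubset>c I"
proof (cases Is rule: rev_cases)
  case (snoc Js K)
  show ?thesis
  proof (cases "Js = []")
    case True
    then show ?thesis using assms snoc that(1) by (auto simp: is_ordering_def)
  next
    case False
    then show ?thesis using assms snoc that(2)[of Js "last Js"] by (auto simp: is_ordering_def successively_append_iff)
  qed
qed (use assms in \<open>simp add: is_ordering_def\<close>)

lemma ordering_induct [consumes 1, case_names nil snoc]:
  assumes "is_ordering I Is" and "P {} [{}]"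
    and "\<And>J Is K. is_ordering J Is \<Longrightarrow> J \<sqsubset>c K \<Longrightarrow> P J Is \<Longrightarrow> P K (Is @ [K])"
  shows "P I Is"
  using assms(1)
proof (induction "length Is" arbitrary: I Is rule: less_induct)
  case less
  from less.prems show ?case
  proof (cases rule: ordering_cases)
    case (snoc J Js)
    then show ?thesis using less.hyps[of Js J] assms(3)[of J Js I] by simp
  qed (use assms(2) in simp)
qed

lemma ordering_empty: "is_ordering {} Is \<Longrightarrow> Is = [{}]"
  by (cases rule: ordering_cases) (auto simp: covered_def)

lemma ordering_last: "is_ordering I Is \<Longrightarrow> last Is = I" "is_ordering I Is \<Longrightarrow> Is \<noteq> []"
  by (auto simp: is_ordering_def)

lemma ordering_exists: "finite I \<Longrightarrow> \<exists>Is. is_ordering I Is"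
proof (induction I rule: finite_induct)
  case empty
  show ?case by (rule exI[of _ "[{}]"]) (simp add: is_ordering_def)
next
  case (insert x I)
  then obtain Is where "is_ordering I Is" by blast
  moreover have "I \<sqsubset>c insert x I" using insert by (auto simp: covered_def)
  ultimately show ?case using ordering_snocI by blast
qed

definition steps :: "('v \<Rightarrow> 'v \<Rightarrow> 'a) \<Rightarrow> 'v list \<Rightarrow> 'a list"
  where "steps V Is = map (\<lambda>i. V (Is ! i) (Is ! Suc i)) [0..<length Is - 1]"

lemma steps_single [simp]: "steps V [I] = []"
  by (simp add: steps_def)

lemma steps_snoc:
  assumes "Is \<noteq> []" shows "steps V (Is @ [K]) = steps V Is @ [V (last Is) K]"
proof -
  obtain n where n: "length Is = Suc n" using assms by (cases Is) auto
  then show ?thesis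
    using assms by (auto simp: steps_def nth_append last_conv_nth)
qed

lemma map_steps: "map h (steps V Is) = steps (\<lambda>I J. h (V I J)) Is"
  by (simp add: steps_def)

locale coxf = cox W S for W :: "('w, 'm) monoid_scheme" (structure) and S +
  fixes red :: "'w \<Rightarrow> 'w list" and rw :: "'w set list \<Rightarrow> 'w list" and a :: "'w list \<Rightarrow> 'w list \<Rightarrow> int poly"
  assumes finS: "finite S"
    and red: "\<And>w. w \<in> carrier W \<Longrightarrow> reduced_expr W S w (red w)"
    and rw: "\<And>I Is. I \<in> fin_subsets W S \<Longrightarrow> is_ordering I Is \<Longrightarrow> adapted_expr W S Is (rw Is)"
    and a: "\<And>I Is. I \<in> fin_subsets W S \<Longrightarrow> is_ordering I Is \<Longrightarrow> x_expansion W S a I (rw Is)"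
begin

abbreviation "L \<equiv> fin_subsets W S"

lemma L_subset: "J \<in> L \<Longrightarrow> I \<subseteq> J \<Longrightarrow> I \<in> L"
  using mono_generate[of I J] by (auto simp: fin_subsets_def intro: finite_subset)

lemma L_S: "I \<in> L \<Longrightarrow> I \<subseteq> S" and L_fin: "I \<in> L \<Longrightarrow> finite (generate W I)" and L_finite: "I \<in> L \<Longrightarrow> finite I"
  using finS by (auto simp: fin_subsets_def intro: finite_subset)

lemma finite_L: "finite L"
  by (rule finite_subset[of _ "Pow S"]) (auto simp: fin_subsets_def finS)

lemma empty_L [simp]: "{} \<in> L"
  by (simp add: fin_subsets_def generate_empty_set)

lemma single_L [simp]: "s \<in> S \<Longrightarrow> {s} \<in> L"
  by (simp add: fin_subsets_def generate_single)

lemma covered_L: "I \<sqsubset>c J \<Longrightarrow> J \<in> L \<Longrightarrow> I \<in> L"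
  using L_subset by (auto simp: covered_def)

definition piv :: "'w set \<Rightarrow> zq_loc"
  where "piv I = zq_frac 1 (poincare W S I)"

lemma piv: "I \<in> L \<Longrightarrow> piv I * of_zq (poincare W S I) = 1"
  unfolding piv_def using poincare_const L_S L_fin by (intro zq_frac_inverse) auto

lemma rw_lists: "I \<in> L \<Longrightarrow> is_ordering I Is \<Longrightarrow> rw Is \<in> lists S"
  using rw[of I Is] by (auto simp: adapted_expr_def reduced_expr_def)

abbreviation "ax Is \<equiv> fexp (\<lambda>y. a y (rw Is)) (rw Is)"

lemma ax_carrier: "I \<in> L \<Longrightarrow> is_ordering I Is \<Longrightarrow> ax Is \<in> carrier FA"
proof -
  assume I: "I \<in> L" "is_ordering I Is"
  obtain g where g: "ax Is = Poly_Mapping.single (rw Is) 1 + g"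
    "Poly_Mapping.keys g \<subseteq> {v. set v \<subseteq> set (rw Is) \<and> length v < length (rw Is)}"
    using fexp_leading by blast
  have "Poly_Mapping.keys g \<subseteq> lists S"
    using g(2) rw_lists[OF I] by auto
  moreover have "Poly_Mapping.single (rw Is) 1 \<in> carrier FA" using rw_lists[OF I] by (simp del: in_lists_conv_set)
  ultimately show ?thesis
    unfolding g(1) using HQ.a_closed[of "Poly_Mapping.single (rw Is) 1" g] by (simp add: free_algebra_fields)
qed

text \<open>The hypothesis \<open>x_expansion\<close> is exactly the image of \<open>ax Is\<close>
  in the Hecke algebra. Hence all orderings of one set give lifts of the same x_I.\<close>

lemma hom_ax_H:
  assumes f: "alg_hom FA H f" and fs: "\<And>s. s \<in> S \<Longrightarrow> f (Poly_Mapping.single [s] 1) = Tg s"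
    and I: "I \<in> L" "is_ordering I Is"
  shows "f (ax Is) = xx I"
proof -
  note ws = rw_lists[OF I]
  have wp: "word_prod H \<one>\<^bsub>H\<^esub> (\<lambda>s. \<one>\<^bsub>H\<^esub> \<oplus>\<^bsub>H\<^esub> f (Poly_Mapping.single [s] 1)) y = hecke_x_word W S y" if "set y \<subseteq> S" for y
    unfolding hecke_x_word_def using that fs xx_single by (intro word_prod_cong) auto
  have yS: "set y \<subseteq> S" if "strict_subseq y (rw Is)" for y
    using strict_subseq_set[OF that] ws by auto
  have xw: "hecke_x_word W S y \<in> carrier H" if "set y \<subseteq> S" for y
    unfolding hecke_x_word_def using that by (intro H.word_prod_closed) auto
  have "finsum H (\<lambda>y. a y (rw Is) \<odot>\<^bsub>H\<^esub> word_prod H \<one>\<^bsub>H\<^esub> (\<lambda>s. \<one>\<^bsub>H\<^esub> \<oplus>\<^bsub>H\<^esub> f (Poly_Mapping.single [s] 1)) y) {y. strict_subseq y (rw Is)}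
     = finsum H (\<lambda>y. a y (rw Is) \<odot>\<^bsub>H\<^esub> hecke_x_word W S y) {y. strict_subseq y (rw Is)}"
    using wp yS xw by (intro H.finsum_cong') auto
  moreover have "set (rw Is) \<subseteq> S" using ws by auto
  ultimately show ?thesis
    using hom_fexp[OF H.alg_axioms f ws, of "\<lambda>y. a y (rw Is)"] a[OF I] wp by (simp add: x_expansion_def)
qed

text \<open>The right-hand side is the bracket that 1/pi(I) multiplies in the extended braid
  relation. So those relations become statements about the images of \<open>ax Is\<close>.\<close>

lemma hom_ax_corner:
  fixes B :: "(zq_loc, 'b) module"
  assumes B: "alg B" and C: "alg (corner of_zq B e)"
    and t: "\<And>s. s \<in> S \<Longrightarrow> t s \<in> carrier (corner of_zq B e)" "\<And>s. s \<in> S \<Longrightarrow> ch s = e \<oplus>\<^bsub>B\<^esub> t s"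
    and f: "alg_hom FA (corner of_zq B e) f" and fs: "\<And>s. s \<in> S \<Longrightarrow> f (Poly_Mapping.single [s] 1) = t s"
    and I: "I \<in> L" "is_ordering I Is"
  shows "f (ax Is) = word_prod B e ch (rw Is) \<oplus>\<^bsub>B\<^esub> of_zq qq \<odot>\<^bsub>B\<^esub>
    finsum B (\<lambda>y. of_zq (a y (rw Is)) \<odot>\<^bsub>B\<^esub> word_prod B e ch y) {y. strict_subseq y (rw Is)}"
proof -
  let ?C = "corner of_zq B e"
  interpret C: alg ?C by fact
  note ws = rw_lists[OF I]
  have wp: "word_prod ?C \<one>\<^bsub>?C\<^esub> (\<lambda>s. \<one>\<^bsub>?C\<^esub> \<oplus>\<^bsub>?C\<^esub> f (Poly_Mapping.single [s] 1)) y = word_prod B e ch y" if "set y \<subseteq> S" for y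
    unfolding word_prod_corner corner_fields(3,5) using that fs t(2) by (intro word_prod_cong) auto
  have yS: "set y \<subseteq> S" if "strict_subseq y (rw Is)" for y
    using strict_subseq_set[OF that] ws by auto
  have xw: "word_prod B e ch y \<in> carrier ?C" if "set y \<subseteq> S" for y
    using that t C.one_closed C.a_closed[OF C.one_closed t(1)]
    by (subst word_prod_corner[of of_zq B e, symmetric], intro C.word_prod_closed) (auto simp: corner_fields(3,5))
  have "finsum ?C (\<lambda>y. a y (rw Is) \<odot>\<^bsub>?C\<^esub> word_prod ?C \<one>\<^bsub>?C\<^esub> (\<lambda>s. \<one>\<^bsub>?C\<^esub> \<oplus>\<^bsub>?C\<^esub> f (Poly_Mapping.single [s] 1)) y) {y. strict_subseq y (rw Is)}
     = finsum ?C (\<lambda>y. a y (rw Is) \<odot>\<^bsub>?C\<^esub> word_prod B e ch y) {y. strict_subseq y (rw Is)}"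
    using wp yS xw by (intro C.finsum_cong') auto
  also have "\<dots> = finsum B (\<lambda>y. a y (rw Is) \<odot>\<^bsub>?C\<^esub> word_prod B e ch y) {y. strict_subseq y (rw Is)}"
    using xw yS by (intro finsum_corner B C.ring_axioms) auto
  finally have "finsum ?C (\<lambda>y. a y (rw Is) \<odot>\<^bsub>?C\<^esub> word_prod ?C \<one>\<^bsub>?C\<^esub> (\<lambda>s. \<one>\<^bsub>?C\<^esub> \<oplus>\<^bsub>?C\<^esub> f (Poly_Mapping.single [s] 1)) y) {y. strict_subseq y (rw Is)}
     = finsum B (\<lambda>y. of_zq (a y (rw Is)) \<odot>\<^bsub>B\<^esub> word_prod B e ch y) {y. strict_subseq y (rw Is)}"
    by (simp only: corner_fields(6))
  moreover have "set (rw Is) \<subseteq> S" using ws by auto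
  ultimately show ?thesis
    using hom_fexp[OF C f ws, of "\<lambda>y. a y (rw Is)"] wp[of "rw Is"]
    by (simp only: corner_fields(5,6))
qed

lemma corner_gens:
  fixes B :: "(zq_loc, 'b) module"
  assumes B: "alg B" and e: "e \<in> carrier B" "e \<otimes>\<^bsub>B\<^esub> e = e"
    and P: "P \<in> carrier B" "P \<otimes>\<^bsub>B\<^esub> P = P" "e \<otimes>\<^bsub>B\<^esub> P = P" "P \<otimes>\<^bsub>B\<^esub> e = P"
    and t: "t = of_zq (1 + qq) \<odot>\<^bsub>B\<^esub> P \<ominus>\<^bsub>B\<^esub> e"
  shows "t \<in> carrier (corner of_zq B e)"
    and "t \<otimes>\<^bsub>corner of_zq B e\<^esub> t = (qq - 1) \<odot>\<^bsub>corner of_zq B e\<^esub> t \<oplus>\<^bsub>corner of_zq B e\<^esub> qq \<odot>\<^bsub>corner of_zq B e\<^esub> \<one>\<^bsub>corner of_zq B e\<^esub>"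
proof -
  interpret B: alg B by fact
  note q = B.idem_quadratic[OF P(1) e(1) P(2) e(2) P(3,4) t]
  show "t \<in> carrier (corner of_zq B e)" using q by (simp add: corner_fields)
  have "of_zq (1 + qq) - 2 = of_zq (qq - 1)" "of_zq (1 + qq) - 1 = of_zq qq"
    unfolding of_zq_diff of_zq_simps by simp_all
  then show "t \<otimes>\<^bsub>corner of_zq B e\<^esub> t = (qq - 1) \<odot>\<^bsub>corner of_zq B e\<^esub> t \<oplus>\<^bsub>corner of_zq B e\<^esub> qq \<odot>\<^bsub>corner of_zq B e\<^esub> \<one>\<^bsub>corner of_zq B e\<^esub>"
    unfolding corner_fields using q(1) by (simp only:)
qed

lemma alg_corner_zq: "alg B \<Longrightarrow> e \<in> carrier B \<Longrightarrow> e \<otimes>\<^bsub>B\<^esub> e = e \<Longrightarrow> alg (corner of_zq B e)"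
  by (intro alg_corner of_zq_simps)

lemma hom_Tw:
  assumes "alg_hom H B h" "u \<in> lists S"
  shows "h (Tw u) = word_prod B \<one>\<^bsub>B\<^esub> (\<lambda>s. h (Tg s)) u"
proof -
  have "h (Tw u) = word_prod B (h \<one>\<^bsub>H\<^esub>) (\<lambda>s. h (Tg s)) u"
    using assms(2) alg_hom_simps(1,2)[OF assms(1)] by (intro conjunct1[OF hom_word_prod]) (auto simp: H.monoid_axioms)
  then show ?thesis by (simp only: alg_hom_simps(4)[OF assms(1)])
qed

text \<open>Each \<open>red w\<close> is reduced and so computes T_w; the image of x_I is then the
  sum over the subgroup that occurs in the relations of the first quiver.\<close>

lemma hom_xx:
  fixes B :: "(zq_loc, 'b) module"
  assumes B: "ring B" and h: "alg_hom H (corner of_zq B e) h" and t: "\<And>s. s \<in> S \<Longrightarrow> h (Tg s) = t s" and I: "I \<in> L"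
  shows "h (xx I) = finsum B (\<lambda>w. word_prod B e t (red w)) (generate W I)"
proof -
  interpret B: ring B by fact
  note hs = alg_hom_simps[OF h, unfolded corner_fields]
  have w: "h (TT w) = word_prod B e t (red w)" "h (TT w) \<in> carrier B" if w: "w \<in> generate W I" for w
  proof -
    have wc: "w \<in> carrier W" using generate_closed[OF L_S[OF I] w] .
    then have r: "rdc (red w)" "ev (red w) = w" using red by (auto simp: reduced_expr_iff)
    have "h (TT w) = word_prod B e (\<lambda>s. h (Tg s)) (red w)"
      using hom_Tw[OF h rdcD(1)[OF r(1)]] hecke_T_rdc[OF r(1)] r(2) by (simp add: corner_fields)
    also have "\<dots> = word_prod B e t (red w)" using rdcD(1)[OF r(1)] t by (intro word_prod_cong) auto
    finally show "h (TT w) = word_prod B e t (red w)" .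
    show "h (TT w) \<in> carrier B" using wc hs(1) by simp
  qed
  have "h (xx I) = finsum B (\<lambda>w. h (TT w)) (generate W I)"
    unfolding hecke_x_def using generate_closed[OF L_S[OF I]] hs(1,3)
    by (intro additive_finsum(3)[OF H.ring_axioms B.ring_axioms]) auto
  also have "\<dots> = finsum B (\<lambda>w. word_prod B e t (red w)) (generate W I)"
    by (rule B.finsum_cong') (use w in auto)
  finally show ?thesis .
qed

lemma piv_empty: "piv {} = 1"
proof -
  have "poincare W S {} = 1" using len_zero_iff[of \<one>] by (simp add: poincare_def generate_empty_set)
  then show ?thesis using piv[of "{}"] of_zq_simps(3) by simp
qed

lemma poincare_single: "s \<in> S \<Longrightarrow> poincare W S {s} = 1 + qq"
proof -
  assume s: "s \<in> S"
  have "len s = 1" "len \<one> = 0" using len_zero_iff[of \<one>] rdc_single[OF s] by (auto simp: rdc_def reduced_expr_def)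
  then show ?thesis using S_not_one[OF s] by (simp add: poincare_def generate_single[OF s])
qed

end

text \<open>The quiver has no arrows for the empty set; the convention \<open>U {} = D {} = E {}\<close> saves case
  distinctions.\<close>

locale qrep = coxf W S red rw a + B: alg B
  for W :: "('w, 'm) monoid_scheme" (structure) and S red rw a and B :: "(zq_loc, 'b) module" +
  fixes E U D :: "'w set \<Rightarrow> 'b" and ta :: "'w \<Rightarrow> 'b"
  assumes closed [simp]: "I \<in> L \<Longrightarrow> E I \<in> carrier B" "I \<in> L \<Longrightarrow> U I \<in> carrier B" "I \<in> L \<Longrightarrow> D I \<in> carrier B"
    and EE: "\<And>I J. I \<in> L \<Longrightarrow> J \<in> L \<Longrightarrow> E I \<otimes>\<^bsub>B\<^esub> E J = (if I = J then E I else \<zero>\<^bsub>B\<^esub>)"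
    and E1: "finsum B E L = \<one>\<^bsub>B\<^esub>"
    and EU: "I \<in> L \<Longrightarrow> E {} \<otimes>\<^bsub>B\<^esub> U I = U I" "I \<in> L \<Longrightarrow> U I \<otimes>\<^bsub>B\<^esub> E I = U I"
    and ED: "I \<in> L \<Longrightarrow> E I \<otimes>\<^bsub>B\<^esub> D I = D I" "I \<in> L \<Longrightarrow> D I \<otimes>\<^bsub>B\<^esub> E {} = D I"
    and UD0: "U {} = E {}" "D {} = E {}"
    and ta: "\<And>s. ta s = of_zq (1 + qq) \<odot>\<^bsub>B\<^esub> (U {s} \<otimes>\<^bsub>B\<^esub> D {s}) \<ominus>\<^bsub>B\<^esub> E {}"
    and braid: "\<And>p r. p \<in> S \<Longrightarrow> r \<in> S \<Longrightarrow> p \<noteq> r \<Longrightarrow> cox_m W p r > 0 \<Longrightarrow>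
      word_prod B (E {}) ta (alt_word (cox_m W p r) p r) = word_prod B (E {}) ta (alt_word (cox_m W p r) r p)"
    and UD: "I \<in> L \<Longrightarrow> I \<noteq> {} \<Longrightarrow> U I \<otimes>\<^bsub>B\<^esub> D I = piv I \<odot>\<^bsub>B\<^esub> finsum B (\<lambda>w. word_prod B (E {}) ta (red w)) (generate W I)"
    and DU: "I \<in> L \<Longrightarrow> I \<noteq> {} \<Longrightarrow> D I \<otimes>\<^bsub>B\<^esub> U I = E I"

text \<open>The relations of the Hasse quiver, read in an arbitrary algebra: by
  \<open>X3_lift\<close> such data determine a homomorphism from the quotient. Requiring membership
  in \<open>L\<close> for the larger set is enough, as subsets of finitary sets are
  finitary.\<close>

locale hrep = coxf W S red rw a + B: alg B
  for W :: "('w, 'm) monoid_scheme" (structure) and S red rw a and B :: "(zq_loc, 'b) module" +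
  fixes E :: "'w set \<Rightarrow> 'b" and V X :: "'w set \<Rightarrow> 'w set \<Rightarrow> 'b" and ch :: "'w \<Rightarrow> 'b"
  assumes closed [simp]: "I \<in> L \<Longrightarrow> E I \<in> carrier B" "J \<in> L \<Longrightarrow> I \<sqsubset>c J \<Longrightarrow> V I J \<in> carrier B"
      "J \<in> L \<Longrightarrow> I \<sqsubset>c J \<Longrightarrow> X J I \<in> carrier B"
    and EE: "\<And>I J. I \<in> L \<Longrightarrow> J \<in> L \<Longrightarrow> E I \<otimes>\<^bsub>B\<^esub> E J = (if I = J then E I else \<zero>\<^bsub>B\<^esub>)"
    and E1: "finsum B E L = \<one>\<^bsub>B\<^esub>"
    and EV: "J \<in> L \<Longrightarrow> I \<sqsubset>c J \<Longrightarrow> E I \<otimes>\<^bsub>B\<^esub> V I J = V I J" "J \<in> L \<Longrightarrow> I \<sqsubset>c J \<Longrightarrow> V I J \<otimes>\<^bsub>B\<^esub> E J = V I J"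
    and EX: "J \<in> L \<Longrightarrow> I \<sqsubset>c J \<Longrightarrow> E J \<otimes>\<^bsub>B\<^esub> X J I = X J I" "J \<in> L \<Longrightarrow> I \<sqsubset>c J \<Longrightarrow> X J I \<otimes>\<^bsub>B\<^esub> E I = X J I"
    and ch: "\<And>s. ch s = of_zq (qq + 1) \<odot>\<^bsub>B\<^esub> (V {} {s} \<otimes>\<^bsub>B\<^esub> X {s} {})"
    and XV: "J \<in> L \<Longrightarrow> I \<sqsubset>c J \<Longrightarrow> X J I \<otimes>\<^bsub>B\<^esub> V I J = E J"
    and VV: "\<And>I J J' K. K \<in> L \<Longrightarrow> I \<sqsubset>c J \<Longrightarrow> J \<sqsubset>c K \<Longrightarrow> I \<sqsubset>c J' \<Longrightarrow> J' \<sqsubset>c K \<Longrightarrow>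
      V I J \<otimes>\<^bsub>B\<^esub> V J K = V I J' \<otimes>\<^bsub>B\<^esub> V J' K"
    and XX: "\<And>I J J' K. K \<in> L \<Longrightarrow> I \<sqsubset>c J \<Longrightarrow> J \<sqsubset>c K \<Longrightarrow> I \<sqsubset>c J' \<Longrightarrow> J' \<sqsubset>c K \<Longrightarrow>
      X K J \<otimes>\<^bsub>B\<^esub> X J I = X K J' \<otimes>\<^bsub>B\<^esub> X J' I"
    and chain: "\<And>I Is. I \<in> L \<Longrightarrow> card I > 1 \<Longrightarrow> is_ordering I Is \<Longrightarrow>
      word_prod B \<one>\<^bsub>B\<^esub> (\<lambda>x. x) (steps V Is @ rev (steps (\<lambda>I J. X J I) Is)) =
      piv I \<odot>\<^bsub>B\<^esub> (word_prod B (E {}) ch (rw Is) \<oplus>\<^bsub>B\<^esub> of_zq qq \<odot>\<^bsub>B\<^esub>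
        finsum B (\<lambda>y. of_zq (a y (rw Is)) \<odot>\<^bsub>B\<^esub> word_prod B (E {}) ch y) {y. strict_subseq y (rw Is)})"

context qrep
begin

abbreviation "C \<equiv> corner of_zq B (E {})"

lemma DU': "I \<in> L \<Longrightarrow> D I \<otimes>\<^bsub>B\<^esub> U I = E I"
  using DU UD0 EE by (cases "I = {}") auto

lemma alg_C: "alg C"
  using EE[of "{}" "{}"] by (intro alg_corner_zq) (auto simp: B.alg_axioms)

lemma UD_idem:
  assumes "I \<in> L"
  shows "U I \<otimes>\<^bsub>B\<^esub> D I \<in> carrier B" "(U I \<otimes>\<^bsub>B\<^esub> D I) \<otimes>\<^bsub>B\<^esub> (U I \<otimes>\<^bsub>B\<^esub> D I) = U I \<otimes>\<^bsub>B\<^esub> D I"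
    "E {} \<otimes>\<^bsub>B\<^esub> (U I \<otimes>\<^bsub>B\<^esub> D I) = U I \<otimes>\<^bsub>B\<^esub> D I" "(U I \<otimes>\<^bsub>B\<^esub> D I) \<otimes>\<^bsub>B\<^esub> E {} = U I \<otimes>\<^bsub>B\<^esub> D I"
    "U I \<otimes>\<^bsub>B\<^esub> D I \<otimes>\<^bsub>B\<^esub> U I = U I" "D I \<otimes>\<^bsub>B\<^esub> (U I \<otimes>\<^bsub>B\<^esub> D I) = D I"
proof -
  show "U I \<otimes>\<^bsub>B\<^esub> D I \<in> carrier B" using assms by simp
  show 1: "U I \<otimes>\<^bsub>B\<^esub> D I \<otimes>\<^bsub>B\<^esub> U I = U I" using assms by (simp add: B.m_assoc DU' EU)
  show "D I \<otimes>\<^bsub>B\<^esub> (U I \<otimes>\<^bsub>B\<^esub> D I) = D I" using assms by (simp add: B.m_assoc[symmetric] DU' ED)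
  show "(U I \<otimes>\<^bsub>B\<^esub> D I) \<otimes>\<^bsub>B\<^esub> (U I \<otimes>\<^bsub>B\<^esub> D I) = U I \<otimes>\<^bsub>B\<^esub> D I"
    using assms by (simp add: B.m_assoc[of "U I \<otimes>\<^bsub>B\<^esub> D I" "U I" "D I", symmetric] 1)
  show "E {} \<otimes>\<^bsub>B\<^esub> (U I \<otimes>\<^bsub>B\<^esub> D I) = U I \<otimes>\<^bsub>B\<^esub> D I" using assms by (simp add: B.m_assoc[symmetric] EU)
  show "(U I \<otimes>\<^bsub>B\<^esub> D I) \<otimes>\<^bsub>B\<^esub> E {} = U I \<otimes>\<^bsub>B\<^esub> D I" using assms by (simp add: B.m_assoc ED)
qed

lemma iota_exists: "\<exists>h. alg_hom H C h \<and> (\<forall>s\<in>S. h (Tg s) = ta s)"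
proof (rule hecke_lift[OF alg_C])
  fix s assume s: "s \<in> S"
  have e: "E {} \<in> carrier B" "E {} \<otimes>\<^bsub>B\<^esub> E {} = E {}" using EE[of "{}" "{}"] by auto
  note g = corner_gens[OF B.alg_axioms e UD_idem(1-4)[OF single_L[OF s]] ta]
  show "ta s \<in> carrier C" by (rule g(1))
  show "ta s \<otimes>\<^bsub>C\<^esub> ta s = (qq - 1) \<odot>\<^bsub>C\<^esub> ta s \<oplus>\<^bsub>C\<^esub> qq \<odot>\<^bsub>C\<^esub> \<one>\<^bsub>C\<^esub>" by (rule g(2))
qed (use braid in \<open>simp add: corner_fields(3)\<close>)

definition iota :: "_ \<Rightarrow> 'b"
  where "iota = (SOME h. alg_hom H C h \<and> (\<forall>s\<in>S. h (Tg s) = ta s))"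

lemma iota: "alg_hom H C iota" "s \<in> S \<Longrightarrow> iota (Tg s) = ta s"
  using someI_ex[OF iota_exists] unfolding iota_def by auto

lemma iota_simps:
  "h \<in> carrier H \<Longrightarrow> iota h \<in> carrier B" "h \<in> carrier H \<Longrightarrow> E {} \<otimes>\<^bsub>B\<^esub> iota h = iota h"
  "h \<in> carrier H \<Longrightarrow> iota h \<otimes>\<^bsub>B\<^esub> E {} = iota h"
  "h \<in> carrier H \<Longrightarrow> h' \<in> carrier H \<Longrightarrow> iota (h \<otimes>\<^bsub>H\<^esub> h') = iota h \<otimes>\<^bsub>B\<^esub> iota h'"
  "h \<in> carrier H \<Longrightarrow> h' \<in> carrier H \<Longrightarrow> iota (h \<oplus>\<^bsub>H\<^esub> h') = iota h \<oplus>\<^bsub>B\<^esub> iota h'"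
  "iota \<one>\<^bsub>H\<^esub> = E {}" "h \<in> carrier H \<Longrightarrow> iota (c \<odot>\<^bsub>H\<^esub> h) = of_zq c \<odot>\<^bsub>B\<^esub> iota h"
  using alg_hom_simps[OF iota(1)] by (simp_all add: corner_fields)

lemma iota_xx:
  assumes I: "I \<in> L"
  shows "U I \<otimes>\<^bsub>B\<^esub> D I = piv I \<odot>\<^bsub>B\<^esub> iota (xx I)" "iota (xx I) = of_zq (poincare W S I) \<odot>\<^bsub>B\<^esub> (U I \<otimes>\<^bsub>B\<^esub> D I)"
proof -
  have x: "xx I \<in> carrier H" using L_S[OF I] by simp
  note fs = hom_xx[OF B.ring_axioms iota I]
  show 1: "U I \<otimes>\<^bsub>B\<^esub> D I = piv I \<odot>\<^bsub>B\<^esub> iota (xx I)"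
  proof (cases "I = {}")
    case True
    then show ?thesis using UD0 EE[of "{}" "{}"] by (simp add: iota_simps piv_empty)
  next
    case False
    then show ?thesis using UD[OF I False] fs by simp
  qed
  have "of_zq (poincare W S I) \<odot>\<^bsub>B\<^esub> (U I \<otimes>\<^bsub>B\<^esub> D I) = (of_zq (poincare W S I) * piv I) \<odot>\<^bsub>B\<^esub> iota (xx I)"
    unfolding 1 using x by (simp add: B.smult_assoc iota_simps)
  then show "iota (xx I) = of_zq (poincare W S I) \<odot>\<^bsub>B\<^esub> (U I \<otimes>\<^bsub>B\<^esub> D I)"
    using piv[OF I] x by (simp add: mult.commute iota_simps)
qed

text \<open>With P_I = U_I D_I, which is the image of x_I/pi(I), the identities for
  \<open>xx I\<close> and \<open>xx J\<close> say P_I P_J = P_J = P_J P_I. They pass to single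
  arrows through U_J = P_J U_J and D_J = D_J P_J.\<close>

lemma absorb:
  assumes "I \<subseteq> J" "J \<in> L"
  shows "(U I \<otimes>\<^bsub>B\<^esub> D I) \<otimes>\<^bsub>B\<^esub> U J = U J" "D J \<otimes>\<^bsub>B\<^esub> (U I \<otimes>\<^bsub>B\<^esub> D I) = D J"
proof -
  have I: "I \<in> L" using L_subset assms by blast
  have x: "xx I \<in> carrier H" "xx J \<in> carrier H" using L_S I assms(2) by auto
  have P: "U I \<otimes>\<^bsub>B\<^esub> D I \<in> carrier B" "U J \<otimes>\<^bsub>B\<^esub> D J \<in> carrier B" using I assms by auto
  note m = xx_mult[OF assms(1) L_S[OF assms(2)] L_fin[OF assms(2)]]
  have "(U I \<otimes>\<^bsub>B\<^esub> D I) \<otimes>\<^bsub>B\<^esub> (U J \<otimes>\<^bsub>B\<^esub> D J) = (piv I * piv J) \<odot>\<^bsub>B\<^esub> iota (xx I \<otimes>\<^bsub>H\<^esub> xx J)"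
    using x I assms(2) by (simp add: iota_xx(1) iota_simps B.smult_mult_l B.smult_mult_r B.smult_assoc B.smult_left_commute)
  also have "\<dots> = (piv I * of_zq (poincare W S I)) \<odot>\<^bsub>B\<^esub> (piv J \<odot>\<^bsub>B\<^esub> iota (xx J))"
    unfolding m(1) using x by (simp add: iota_simps B.smult_assoc[symmetric] mult.commute mult.left_commute)
  also have "\<dots> = U J \<otimes>\<^bsub>B\<^esub> D J" using piv[OF I] x assms(2) by (simp add: iota_xx(1) iota_simps)
  finally have l: "(U I \<otimes>\<^bsub>B\<^esub> D I) \<otimes>\<^bsub>B\<^esub> (U J \<otimes>\<^bsub>B\<^esub> D J) = U J \<otimes>\<^bsub>B\<^esub> D J" .
  have "(U J \<otimes>\<^bsub>B\<^esub> D J) \<otimes>\<^bsub>B\<^esub> (U I \<otimes>\<^bsub>B\<^esub> D I) = (piv I * piv J) \<odot>\<^bsub>B\<^esub> iota (xx J \<otimes>\<^bsub>H\<^esub> xx I)"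
    using x I assms(2) by (simp add: iota_xx(1) iota_simps B.smult_mult_l B.smult_mult_r B.smult_assoc B.smult_left_commute)
  also have "\<dots> = (piv I * of_zq (poincare W S I)) \<odot>\<^bsub>B\<^esub> (piv J \<odot>\<^bsub>B\<^esub> iota (xx J))"
    unfolding m(2) using x by (simp add: iota_simps B.smult_assoc[symmetric] mult.commute mult.left_commute)
  also have "\<dots> = U J \<otimes>\<^bsub>B\<^esub> D J" using piv[OF I] x assms(2) by (simp add: iota_xx(1) iota_simps)
  finally have r: "(U J \<otimes>\<^bsub>B\<^esub> D J) \<otimes>\<^bsub>B\<^esub> (U I \<otimes>\<^bsub>B\<^esub> D I) = U J \<otimes>\<^bsub>B\<^esub> D J" .
  have "(U I \<otimes>\<^bsub>B\<^esub> D I) \<otimes>\<^bsub>B\<^esub> U J = (U I \<otimes>\<^bsub>B\<^esub> D I) \<otimes>\<^bsub>B\<^esub> ((U J \<otimes>\<^bsub>B\<^esub> D J) \<otimes>\<^bsub>B\<^esub> U J)"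
    using UD_idem(5)[OF assms(2)] by simp
  also have "\<dots> = ((U I \<otimes>\<^bsub>B\<^esub> D I) \<otimes>\<^bsub>B\<^esub> (U J \<otimes>\<^bsub>B\<^esub> D J)) \<otimes>\<^bsub>B\<^esub> U J"
    using P assms(2) by (intro B.m_assoc[symmetric]) auto
  also have "\<dots> = U J" unfolding l by (rule UD_idem(5)[OF assms(2)])
  finally show "(U I \<otimes>\<^bsub>B\<^esub> D I) \<otimes>\<^bsub>B\<^esub> U J = U J" .
  have "D J \<otimes>\<^bsub>B\<^esub> (U I \<otimes>\<^bsub>B\<^esub> D I) = (D J \<otimes>\<^bsub>B\<^esub> (U J \<otimes>\<^bsub>B\<^esub> D J)) \<otimes>\<^bsub>B\<^esub> (U I \<otimes>\<^bsub>B\<^esub> D I)"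
    using UD_idem(6)[OF assms(2)] by simp
  also have "\<dots> = D J \<otimes>\<^bsub>B\<^esub> ((U J \<otimes>\<^bsub>B\<^esub> D J) \<otimes>\<^bsub>B\<^esub> (U I \<otimes>\<^bsub>B\<^esub> D I))"
    using P assms(2) by (intro B.m_assoc) auto
  also have "\<dots> = D J" unfolding r by (rule UD_idem(6)[OF assms(2)])
  finally show "D J \<otimes>\<^bsub>B\<^esub> (U I \<otimes>\<^bsub>B\<^esub> D I) = D J" .
qed

abbreviation "VQ I J \<equiv> D I \<otimes>\<^bsub>B\<^esub> U J"

lemma steps_closed:
  assumes "is_ordering I Is" "I \<in> L"
  shows "set (steps VQ Is) \<subseteq> carrier B \<and> set (steps (\<lambda>I J. VQ J I) Is) \<subseteq> carrier B"
  using assms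
proof (induction rule: ordering_induct)
  case (snoc J Is K)
  then show ?case using covered_L[OF snoc.hyps(2)] by (simp add: steps_snoc ordering_last)
qed simp

text \<open>Along a chain the inner pieces U_J D_J are absorbed by the next arrow, so only the last
  one survives. The factor \<open>E {}\<close> matters for the trivial chain, whose empty product is
  the unit of the algebra and not the idempotent.\<close>

lemma telescope:
  assumes "is_ordering I Is" "I \<in> L"
  shows "E {} \<otimes>\<^bsub>B\<^esub> word_prod B \<one>\<^bsub>B\<^esub> (\<lambda>x. x) (steps VQ Is) = U I \<and>
    word_prod B \<one>\<^bsub>B\<^esub> (\<lambda>x. x) (rev (steps (\<lambda>I J. VQ J I) Is)) \<otimes>\<^bsub>B\<^esub> E {} = D I"
  using assms
proof (induction rule: ordering_induct)
  case (snoc J Is K)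
  have J: "J \<in> L" "J \<subseteq> K" using covered_L snoc by (auto simp: covered_def)
  note c = steps_closed[OF snoc.hyps(1) J(1)]
  let ?u = "word_prod B \<one>\<^bsub>B\<^esub> (\<lambda>x. x) (steps VQ Is)"
  let ?d = "word_prod B \<one>\<^bsub>B\<^esub> (\<lambda>x. x) (rev (steps (\<lambda>I J. VQ J I) Is))"
  have uc: "?u \<in> carrier B" "?d \<in> carrier B" using c by (auto intro!: B.word_prod_closed)
  have jk: "VQ J K \<in> carrier B" "VQ K J \<in> carrier B" using J snoc.prems by auto
  have "word_prod B \<one>\<^bsub>B\<^esub> (\<lambda>x. x) (steps VQ (Is @ [K])) = ?u \<otimes>\<^bsub>B\<^esub> VQ J K"
    using c jk ordering_last[OF snoc.hyps(1)]
    by (simp add: steps_snoc word_prod_append) (intro B.word_prod_unit, auto)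
  then have "E {} \<otimes>\<^bsub>B\<^esub> word_prod B \<one>\<^bsub>B\<^esub> (\<lambda>x. x) (steps VQ (Is @ [K])) = (E {} \<otimes>\<^bsub>B\<^esub> ?u) \<otimes>\<^bsub>B\<^esub> VQ J K"
    using uc jk by (simp add: B.m_assoc)
  also have "\<dots> = U J \<otimes>\<^bsub>B\<^esub> VQ J K" using snoc.IH[OF J(1)] by simp
  also have "\<dots> = U K" using absorb(1)[OF J(2) snoc.prems] J snoc.prems by (simp add: B.m_assoc)
  finally have 1: "E {} \<otimes>\<^bsub>B\<^esub> word_prod B \<one>\<^bsub>B\<^esub> (\<lambda>x. x) (steps VQ (Is @ [K])) = U K" .
  have "word_prod B \<one>\<^bsub>B\<^esub> (\<lambda>x. x) (rev (steps (\<lambda>I J. VQ J I) (Is @ [K]))) \<otimes>\<^bsub>B\<^esub> E {} = VQ K J \<otimes>\<^bsub>B\<^esub> (?d \<otimes>\<^bsub>B\<^esub> E {})"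
    using uc jk ordering_last[OF snoc.hyps(1)] by (simp add: steps_snoc B.m_assoc)
  also have "\<dots> = VQ K J \<otimes>\<^bsub>B\<^esub> D J" using snoc.IH[OF J(1)] by simp
  also have "\<dots> = D K" using absorb(2)[OF J(2) snoc.prems] J snoc.prems by (simp add: B.m_assoc)
  finally show ?case using 1 by blast
qed (simp add: UD0)

lemma hom_ax_iota:
  assumes "\<And>s. ch s = of_zq (qq + 1) \<odot>\<^bsub>B\<^esub> (VQ {} {s} \<otimes>\<^bsub>B\<^esub> VQ {s} {})" "I \<in> L" "is_ordering I Is"
  shows "iota (xx I) = word_prod B (E {}) ch (rw Is) \<oplus>\<^bsub>B\<^esub> of_zq qq \<odot>\<^bsub>B\<^esub>
        finsum B (\<lambda>y. of_zq (a y (rw Is)) \<odot>\<^bsub>B\<^esub> word_prod B (E {}) ch y) {y. strict_subseq y (rw Is)}"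
proof -
  have h: "alg_hom FA C (\<lambda>x. iota (hcls x))" by (rule alg_hom_comp[OF hcls_hom iota(1)])
  have t: "ta s \<in> carrier C" if "s \<in> S" for s
    using alg_hom_simps(1)[OF iota(1), of "Tg s"] iota(2) that by simp
  have ch: "ch s = E {} \<oplus>\<^bsub>B\<^esub> ta s" if s: "s \<in> S" for s
  proof -
    have "VQ {} {s} = U {s}" "VQ {s} {} = D {s}" using s by (simp_all add: UD0 EU ED)
    then have "ch s = of_zq (1 + qq) \<odot>\<^bsub>B\<^esub> (U {s} \<otimes>\<^bsub>B\<^esub> D {s})" using assms(1) by (simp only: add.commute)
    moreover have "of_zq (1 + qq) \<odot>\<^bsub>B\<^esub> (U {s} \<otimes>\<^bsub>B\<^esub> D {s}) \<in> carrier B" using s by simp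
    ultimately show ?thesis
      unfolding ta by (simp add: a_minus_def B.a_lcomm[of "E {}"] B.r_neg)
  qed
  have "iota (hcls (ax Is)) = word_prod B (E {}) ch (rw Is) \<oplus>\<^bsub>B\<^esub> of_zq qq \<odot>\<^bsub>B\<^esub>
        finsum B (\<lambda>y. of_zq (a y (rw Is)) \<odot>\<^bsub>B\<^esub> word_prod B (E {}) ch y) {y. strict_subseq y (rw Is)}"
  proof (rule hom_ax_corner[OF B.alg_axioms alg_C t ch h _ assms(2,3)])
    fix s assume "s \<in> S"
    then show "iota (hcls (Poly_Mapping.single [s] 1)) = ta s" using iota(2) by (simp add: hecke_gen_def)
  qed
  moreover have "hcls (ax Is) = xx I"
    by (rule hom_ax_H[OF hcls_hom _ assms(2,3)]) (simp add: hecke_gen_def)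
  ultimately show ?thesis by simp
qed

lemma hrep_VQ:
  "hrep W S red rw a B E VQ VQ (\<lambda>s. of_zq (qq + 1) \<odot>\<^bsub>B\<^esub> (VQ {} {s} \<otimes>\<^bsub>B\<^esub> VQ {s} {}))"
proof (intro hrep.intro hrep_axioms.intro)
  fix I J assume J: "J \<in> L" "I \<sqsubset>c J"
  then have I: "I \<in> L" "I \<subseteq> J" using covered_L by (auto simp: covered_def)
  show "VQ I J \<in> carrier B" "VQ J I \<in> carrier B" using I J by auto
  show "E I \<otimes>\<^bsub>B\<^esub> VQ I J = VQ I J" "E J \<otimes>\<^bsub>B\<^esub> VQ J I = VQ J I"
    using I J by (simp_all add: B.m_assoc[symmetric] ED)
  show "VQ I J \<otimes>\<^bsub>B\<^esub> E J = VQ I J" "VQ J I \<otimes>\<^bsub>B\<^esub> E I = VQ J I"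
    using I J by (simp_all add: B.m_assoc EU)
  have "VQ J I \<otimes>\<^bsub>B\<^esub> VQ I J = D J \<otimes>\<^bsub>B\<^esub> ((U I \<otimes>\<^bsub>B\<^esub> D I) \<otimes>\<^bsub>B\<^esub> U J)"
    using I J by (simp add: B.m_assoc)
  then show "VQ J I \<otimes>\<^bsub>B\<^esub> VQ I J = E J" using absorb(1)[OF I(2) J(1)] DU' J by simp
next
  fix I J J' K assume K: "K \<in> L" "I \<sqsubset>c J" "J \<sqsubset>c K" "I \<sqsubset>c J'" "J' \<sqsubset>c K"
  have l: "J \<in> L" "J' \<in> L" using covered_L[OF K(3,1)] covered_L[OF K(5,1)] .
  then have l: "J \<in> L" "J' \<in> L" "J \<subseteq> K" "J' \<subseteq> K" "I \<in> L"
    using covered_L[OF K(2)] K(3,5) by (auto simp: covered_def)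
  \<comment> \<open>Both composites collapse to an expression without the middle set
    \<open>M\<close>; this is the sandwich relation.\<close>
  have 1: "VQ I M \<otimes>\<^bsub>B\<^esub> VQ M K = VQ I K" "VQ K M \<otimes>\<^bsub>B\<^esub> VQ M I = VQ K I" if M: "M \<in> L" "M \<subseteq> K" for M
  proof -
    have "VQ I M \<otimes>\<^bsub>B\<^esub> VQ M K = D I \<otimes>\<^bsub>B\<^esub> ((U M \<otimes>\<^bsub>B\<^esub> D M) \<otimes>\<^bsub>B\<^esub> U K)"
      using M K l by (simp add: B.m_assoc)
    then show "VQ I M \<otimes>\<^bsub>B\<^esub> VQ M K = VQ I K" using absorb(1)[OF M(2) K(1)] by simp
    have "VQ K M \<otimes>\<^bsub>B\<^esub> VQ M I = (D K \<otimes>\<^bsub>B\<^esub> (U M \<otimes>\<^bsub>B\<^esub> D M)) \<otimes>\<^bsub>B\<^esub> U I"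
      using M K l by (simp add: B.m_assoc)
    then show "VQ K M \<otimes>\<^bsub>B\<^esub> VQ M I = VQ K I" using absorb(2)[OF M(2) K(1)] by simp
  qed
  show "VQ I J \<otimes>\<^bsub>B\<^esub> VQ J K = VQ I J' \<otimes>\<^bsub>B\<^esub> VQ J' K" "VQ K J \<otimes>\<^bsub>B\<^esub> VQ J I = VQ K J' \<otimes>\<^bsub>B\<^esub> VQ J' I"
    using 1 l by simp_all
next
  fix I Is assume I: "I \<in> L" "1 < card I" "is_ordering I Is"
  let ?u = "word_prod B \<one>\<^bsub>B\<^esub> (\<lambda>x. x) (steps VQ Is)"
  let ?d = "word_prod B \<one>\<^bsub>B\<^esub> (\<lambda>x. x) (rev (steps (\<lambda>I J. VQ J I) Is))"
  note c = steps_closed[OF I(3,1)]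
  have uc: "?u \<in> carrier B" "?d \<in> carrier B" using c by (auto intro!: B.word_prod_closed)
  obtain J Js where J: "Is = Js @ [I]" "is_ordering J Js" "J \<sqsubset>c I"
    using I(3) by (cases rule: ordering_cases) (use I(2) in auto)
  \<comment> \<open>The chain relation speaks of bare products, whereas \<open>telescope\<close>
    carries a factor \<open>E {}\<close>. For nonempty sets the first arrow of the chain already
    absorbs that factor.\<close>
  have abs: "is_ordering I Is \<Longrightarrow> I \<in> L \<Longrightarrow> I \<noteq> {} \<longrightarrow> E {} \<otimes>\<^bsub>B\<^esub> word_prod B \<one>\<^bsub>B\<^esub> (\<lambda>x. x) (steps VQ Is) = word_prod B \<one>\<^bsub>B\<^esub> (\<lambda>x. x) (steps VQ Is) \<and>
    word_prod B \<one>\<^bsub>B\<^esub> (\<lambda>x. x) (rev (steps (\<lambda>I J. VQ J I) Is)) \<otimes>\<^bsub>B\<^esub> E {} = word_prod B \<one>\<^bsub>B\<^esub> (\<lambda>x. x) (rev (steps (\<lambda>I J. VQ J I) Is))" for I Is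
  proof (induction rule: ordering_induct)
    case (snoc J Is K)
    have J: "J \<in> L" "J \<subseteq> K" using covered_L snoc by (auto simp: covered_def)
    note c = steps_closed[OF snoc.hyps(1) J(1)]
    let ?u = "word_prod B \<one>\<^bsub>B\<^esub> (\<lambda>x. x) (steps VQ Is)"
    let ?d = "word_prod B \<one>\<^bsub>B\<^esub> (\<lambda>x. x) (rev (steps (\<lambda>I J. VQ J I) Is))"
    have uc: "?u \<in> carrier B" "?d \<in> carrier B" using c by (auto intro!: B.word_prod_closed)
    have jk: "VQ J K \<in> carrier B" "VQ K J \<in> carrier B" using J snoc.prems by auto
    have u: "word_prod B \<one>\<^bsub>B\<^esub> (\<lambda>x. x) (steps VQ (Is @ [K])) = ?u \<otimes>\<^bsub>B\<^esub> VQ J K"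
      using c jk ordering_last[OF snoc.hyps(1)]
      by (simp add: steps_snoc word_prod_append) (intro B.word_prod_unit, auto)
    have d: "word_prod B \<one>\<^bsub>B\<^esub> (\<lambda>x. x) (rev (steps (\<lambda>I J. VQ J I) (Is @ [K]))) = VQ K J \<otimes>\<^bsub>B\<^esub> ?d"
      using ordering_last[OF snoc.hyps(1)] by (simp add: steps_snoc)
    show ?case
    proof (cases "J = {}")
      case True
      then have "Is = [{}]" using ordering_empty snoc.hyps by blast
      then show ?thesis unfolding u d using True jk snoc.prems
        by (simp add: UD0 EU ED)
    next
      case False
      then have ih: "E {} \<otimes>\<^bsub>B\<^esub> ?u = ?u" "?d \<otimes>\<^bsub>B\<^esub> E {} = ?d" using snoc.IH[OF J(1)] by auto
      have "E {} \<otimes>\<^bsub>B\<^esub> (?u \<otimes>\<^bsub>B\<^esub> VQ J K) = (E {} \<otimes>\<^bsub>B\<^esub> ?u) \<otimes>\<^bsub>B\<^esub> VQ J K"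
        "(VQ K J \<otimes>\<^bsub>B\<^esub> ?d) \<otimes>\<^bsub>B\<^esub> E {} = VQ K J \<otimes>\<^bsub>B\<^esub> (?d \<otimes>\<^bsub>B\<^esub> E {})"
        using uc jk by (simp_all only: B.m_assoc closed(1) empty_L)
      then show ?thesis unfolding u d ih by simp
    qed
  qed simp
  have "I \<noteq> {}" using I(2) by auto
  then have "?u = U I" "?d = D I" using abs[OF I(3,1)] telescope[OF I(3,1)] by auto
  moreover have "word_prod B \<one>\<^bsub>B\<^esub> (\<lambda>x. x) (steps VQ Is @ rev (steps (\<lambda>I J. VQ J I) Is)) = ?u \<otimes>\<^bsub>B\<^esub> ?d"
    unfolding word_prod_append using c uc by (intro B.word_prod_unit) auto
  ultimately show "word_prod B \<one>\<^bsub>B\<^esub> (\<lambda>x. x) (steps VQ Is @ rev (steps (\<lambda>I J. VQ J I) Is)) =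
    piv I \<odot>\<^bsub>B\<^esub> (word_prod B (E {}) (\<lambda>s. of_zq (qq + 1) \<odot>\<^bsub>B\<^esub> (VQ {} {s} \<otimes>\<^bsub>B\<^esub> VQ {s} {})) (rw Is) \<oplus>\<^bsub>B\<^esub>
      of_zq qq \<odot>\<^bsub>B\<^esub> finsum B (\<lambda>y. of_zq (a y (rw Is)) \<odot>\<^bsub>B\<^esub>
        word_prod B (E {}) (\<lambda>s. of_zq (qq + 1) \<odot>\<^bsub>B\<^esub> (VQ {} {s} \<otimes>\<^bsub>B\<^esub> VQ {s} {})) y) {y. strict_subseq y (rw Is)})"
    using iota_xx(1)[OF I(1)] hom_ax_iota[OF refl I(1,3)] by simp
qed (use EE E1 in \<open>simp_all add: coxf_axioms B.alg_axioms\<close>)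

end

section \<open>From the Hasse relations to those of the first quiver\<close>

context hrep
begin

abbreviation "C \<equiv> corner of_zq B (E {})"
abbreviation "wU Is \<equiv> word_prod B \<one>\<^bsub>B\<^esub> (\<lambda>x. x) (steps V Is)"
abbreviation "wD Is \<equiv> word_prod B \<one>\<^bsub>B\<^esub> (\<lambda>x. x) (rev (steps (\<lambda>I J. X J I) Is))"
text \<open>The factor \<open>E {}\<close> changes the product only for the trivial ordering, which
  must give the idempotent and not the unit of the algebra; this allows inductions on orderings to
  start at the empty set.\<close>

abbreviation "Uc Is \<equiv> E {} \<otimes>\<^bsub>B\<^esub> wU Is"
abbreviation "Dc Is \<equiv> wD Is \<otimes>\<^bsub>B\<^esub> E {}"

lemma E_empty: "E {} \<in> carrier B" "E {} \<otimes>\<^bsub>B\<^esub> E {} = E {}"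
  using EE[of "{}" "{}"] by auto

lemma alg_C: "alg C"
  by (intro alg_corner_zq B.alg_axioms E_empty)

lemma steps_closed:
  assumes "is_ordering I Is" "I \<in> L"
  shows "set (steps V Is) \<subseteq> carrier B \<and> set (steps (\<lambda>I J. X J I) Is) \<subseteq> carrier B"
  using assms
proof (induction rule: ordering_induct)
  case (snoc J Is K)
  then show ?case using covered_L[OF snoc.hyps(2)] by (simp add: steps_snoc ordering_last)
qed simp

lemma w_closed:
  assumes "is_ordering I Is" "I \<in> L"
  shows "wU Is \<in> carrier B" "wD Is \<in> carrier B"
  using steps_closed[OF assms] by (auto intro!: B.word_prod_closed)

lemma UD_snoc:
  assumes Is: "is_ordering J Is" and K: "J \<sqsubset>c K" "K \<in> L"
  shows "Uc (Is @ [K]) = Uc Is \<otimes>\<^bsub>B\<^esub> V J K" "Dc (Is @ [K]) = X K J \<otimes>\<^bsub>B\<^esub> Dc Is"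
proof -
  have J: "J \<in> L" using covered_L K by blast
  note c = steps_closed[OF Is J] and w = w_closed[OF Is J]
  have jk: "V J K \<in> carrier B" "X K J \<in> carrier B" using K by auto
  have "wU (Is @ [K]) = wU Is \<otimes>\<^bsub>B\<^esub> V J K"
    using c jk ordering_last[OF Is]
    by (simp add: steps_snoc word_prod_append) (intro B.word_prod_unit, auto)
  then show "Uc (Is @ [K]) = Uc Is \<otimes>\<^bsub>B\<^esub> V J K" using w jk by (simp add: B.m_assoc)
  show "Dc (Is @ [K]) = X K J \<otimes>\<^bsub>B\<^esub> Dc Is"
    using w jk ordering_last[OF Is] by (simp add: steps_snoc B.m_assoc)
qed

lemma UD_props:
  assumes "is_ordering I Is" "I \<in> L"
  shows "Uc Is \<in> carrier B \<and> Dc Is \<in> carrier B \<and> E {} \<otimes>\<^bsub>B\<^esub> Uc Is = Uc Is \<and> Uc Is \<otimes>\<^bsub>B\<^esub> E I = Uc Is \<and>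
    E I \<otimes>\<^bsub>B\<^esub> Dc Is = Dc Is \<and> Dc Is \<otimes>\<^bsub>B\<^esub> E {} = Dc Is \<and> Dc Is \<otimes>\<^bsub>B\<^esub> Uc Is = E I"
  using assms
proof (induction rule: ordering_induct)
  case nil
  then show ?case using E_empty by simp
next
  case (snoc J Is K)
  have J: "J \<in> L" using covered_L snoc by blast
  have IH: "Uc Is \<in> carrier B" "Dc Is \<in> carrier B" "E {} \<otimes>\<^bsub>B\<^esub> Uc Is = Uc Is" "Uc Is \<otimes>\<^bsub>B\<^esub> E J = Uc Is"
    "E J \<otimes>\<^bsub>B\<^esub> Dc Is = Dc Is" "Dc Is \<otimes>\<^bsub>B\<^esub> E {} = Dc Is" "Dc Is \<otimes>\<^bsub>B\<^esub> Uc Is = E J"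
    using snoc.IH[OF J] by auto
  define u where "u = Uc Is"
  define d where "d = Dc Is"
  note IH = IH[folded u_def d_def]
  have VX: "V J K \<in> carrier B" "X K J \<in> carrier B" "V J K \<otimes>\<^bsub>B\<^esub> E K = V J K" "E K \<otimes>\<^bsub>B\<^esub> X K J = X K J"
    "E J \<otimes>\<^bsub>B\<^esub> V J K = V J K" "X K J \<otimes>\<^bsub>B\<^esub> V J K = E K" "E K \<in> carrier B" "E J \<in> carrier B"
    using snoc EV EX XV J by auto
  have "(X K J \<otimes>\<^bsub>B\<^esub> d) \<otimes>\<^bsub>B\<^esub> (u \<otimes>\<^bsub>B\<^esub> V J K) = X K J \<otimes>\<^bsub>B\<^esub> ((d \<otimes>\<^bsub>B\<^esub> u) \<otimes>\<^bsub>B\<^esub> V J K)"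
    using IH(1,2) VX(1,2) by (simp add: B.m_assoc)
  also have "\<dots> = E K" using IH VX by simp
  finally have du: "(X K J \<otimes>\<^bsub>B\<^esub> d) \<otimes>\<^bsub>B\<^esub> (u \<otimes>\<^bsub>B\<^esub> V J K) = E K" .
  have "E {} \<otimes>\<^bsub>B\<^esub> (u \<otimes>\<^bsub>B\<^esub> V J K) = (E {} \<otimes>\<^bsub>B\<^esub> u) \<otimes>\<^bsub>B\<^esub> V J K"
    "E K \<otimes>\<^bsub>B\<^esub> (X K J \<otimes>\<^bsub>B\<^esub> d) = (E K \<otimes>\<^bsub>B\<^esub> X K J) \<otimes>\<^bsub>B\<^esub> d"
    using IH(1,2) VX(1,2,7,8) E_empty(1) by (simp_all only: B.m_assoc)
  moreover have "u \<otimes>\<^bsub>B\<^esub> V J K \<otimes>\<^bsub>B\<^esub> E K = u \<otimes>\<^bsub>B\<^esub> (V J K \<otimes>\<^bsub>B\<^esub> E K)"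
    "X K J \<otimes>\<^bsub>B\<^esub> d \<otimes>\<^bsub>B\<^esub> E {} = X K J \<otimes>\<^bsub>B\<^esub> (d \<otimes>\<^bsub>B\<^esub> E {})"
    using IH(1,2) VX(1,2,7,8) E_empty(1) by (simp_all only: B.m_assoc)
  ultimately show ?case
    unfolding UD_snoc[OF snoc.hyps snoc.prems] u_def[symmetric] d_def[symmetric]
    using IH VX du by simp
qed

lemma UD_indep:
  assumes "is_ordering I Is" "is_ordering I Js" "I \<in> L"
  shows "Uc Is = Uc Js \<and> Dc Is = Dc Js"
  using assms
proof (induction "card I" arbitrary: I Is Js rule: less_induct)
  case less
  show ?case
    using less.prems(1)
  proof (cases rule: ordering_cases)
    case nil
    then have "Js = [{}]" using less.prems ordering_empty by blast
    then show ?thesis using nil by simp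
  next
    case (snoc J Is')
    note J = snoc
    show ?thesis using less.prems(2)
    proof (cases rule: ordering_cases)
      case nil
      then show ?thesis using J by (simp add: covered_def)
    next
      case (snoc J' Js')
      note J' = snoc
      have l: "J \<in> L" "J' \<in> L" using covered_L J J' less.prems(3) by blast+
      have fin: "finite I" "finite J" "finite J'" using L_finite l less.prems(3) by auto
      have cJ: "card J < card I" "card J' < card I" using J(3) J'(3) by (auto simp: covered_def)
      show ?thesis
      proof (cases "J = J'")
        case True
        then show ?thesis
          using less.hyps[OF cJ(1) J(2) _ l(1), of Js'] J'(2) UD_snoc[OF J(2,3) less.prems(3)]
            UD_snoc[OF J'(2,3) less.prems(3)] J(1) J'(1) by simp
      next
        case False
        define K where "K = J \<inter> J'"
        have sub: "J \<subset> I" "J' \<subset> I" "card I = card J + 1" "card I = card J' + 1"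
          using J(3) J'(3) by (auto simp: covered_def)
        have "J \<union> J' = I"
        proof (rule card_seteq[OF fin(1)])
          show "J \<union> J' \<subseteq> I" using sub by auto
          have "J \<subset> J \<union> J'"
          proof (rule ccontr)
            assume "\<not> J \<subset> J \<union> J'"
            then have "J' \<subseteq> J" by auto
            then have "J' = J" using card_subset_eq[OF fin(2)] sub by simp
            then show False using False by simp
          qed
          then have "card J < card (J \<union> J')" using fin by (intro psubset_card_mono) auto
          then show "card I \<le> card (J \<union> J')" using sub by simp
        qed
        then have "card I + card K = card J + card J'"
          using card_Un_Int[OF fin(2,3)] by (simp add: K_def)
        then have KJ: "card J = card K + 1" "card J' = card K + 1" using sub by auto
        have "K \<subseteq> J" "K \<subseteq> J'" by (auto simp: K_def)
        moreover have "K \<noteq> J" "K \<noteq> J'" using KJ by auto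
        ultimately have cov: "K \<sqsubset>c J" "K \<sqsubset>c J'" using KJ unfolding covered_def by blast+
        have KL: "K \<in> L" using covered_L cov(1) l(1) by blast
        \<comment> \<open>By the induction hypothesis the orderings of J and J' may be replaced by
          extensions of one common ordering of K; the products then differ only in their last two
          arrows, where the sandwich relation applies.\<close>
        obtain Ks where Ks: "is_ordering K Ks" using ordering_exists L_finite KL by blast
        note oJ = ordering_snocI[OF Ks cov(1)] and oJ' = ordering_snocI[OF Ks cov(2)]
        have c: "Uc Ks \<in> carrier B" "Dc Ks \<in> carrier B" using UD_props[OF Ks KL] by auto
        have 1: "Uc Is' = Uc Ks \<otimes>\<^bsub>B\<^esub> V K J" "Dc Is' = X J K \<otimes>\<^bsub>B\<^esub> Dc Ks"
          using less.hyps[OF cJ(1) J(2) oJ l(1)] UD_snoc[OF Ks cov(1) l(1)] by auto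
        have 2: "Uc Js' = Uc Ks \<otimes>\<^bsub>B\<^esub> V K J'" "Dc Js' = X J' K \<otimes>\<^bsub>B\<^esub> Dc Ks"
          using less.hyps[OF cJ(2) J'(2) oJ' l(2)] UD_snoc[OF Ks cov(2) l(2)] by auto
        have v: "V K J \<in> carrier B" "V K J' \<in> carrier B" "V J I \<in> carrier B" "V J' I \<in> carrier B"
          "X J K \<in> carrier B" "X J' K \<in> carrier B" "X I J \<in> carrier B" "X I J' \<in> carrier B"
          using cov l J(3) J'(3) less.prems(3) by auto
        have "Uc Is = Uc Ks \<otimes>\<^bsub>B\<^esub> (V K J \<otimes>\<^bsub>B\<^esub> V J I)"
          unfolding J(1) UD_snoc[OF J(2,3) less.prems(3)] 1 using c v by (simp only: B.m_assoc)
        moreover have "Uc Js = Uc Ks \<otimes>\<^bsub>B\<^esub> (V K J' \<otimes>\<^bsub>B\<^esub> V J' I)"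
          unfolding J'(1) UD_snoc[OF J'(2,3) less.prems(3)] 2 using c v by (simp only: B.m_assoc)
        moreover have "Dc Is = (X I J \<otimes>\<^bsub>B\<^esub> X J K) \<otimes>\<^bsub>B\<^esub> Dc Ks"
          unfolding J(1) UD_snoc[OF J(2,3) less.prems(3)] 1 using c v by (simp only: B.m_assoc)
        moreover have "Dc Js = (X I J' \<otimes>\<^bsub>B\<^esub> X J' K) \<otimes>\<^bsub>B\<^esub> Dc Ks"
          unfolding J'(1) UD_snoc[OF J'(2,3) less.prems(3)] 2 using c v by (simp only: B.m_assoc)
        ultimately show ?thesis
          using VV[OF less.prems(3) cov(1) J(3) cov(2) J'(3)] XX[OF less.prems(3) cov(1) J(3) cov(2) J'(3)] by simp
      qed
    qed
  qed
qed

definition oo :: "'w set \<Rightarrow> 'w set list"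
  where "oo I = (SOME Is. is_ordering I Is)"

lemma oo: "I \<in> L \<Longrightarrow> is_ordering I (oo I)"
  unfolding oo_def using ordering_exists[OF L_finite] by (rule someI_ex)

definition Uh :: "'w set \<Rightarrow> 'b" where "Uh I = Uc (oo I)"
definition Dh :: "'w set \<Rightarrow> 'b" where "Dh I = Dc (oo I)"

lemma UDh_props:
  assumes "I \<in> L"
  shows "Uh I \<in> carrier B" "Dh I \<in> carrier B" "E {} \<otimes>\<^bsub>B\<^esub> Uh I = Uh I" "Uh I \<otimes>\<^bsub>B\<^esub> E I = Uh I"
    "E I \<otimes>\<^bsub>B\<^esub> Dh I = Dh I" "Dh I \<otimes>\<^bsub>B\<^esub> E {} = Dh I" "Dh I \<otimes>\<^bsub>B\<^esub> Uh I = E I"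
  using UD_props[OF oo[OF assms] assms] unfolding Uh_def Dh_def by auto

lemma UDh_eq: "is_ordering I Is \<Longrightarrow> I \<in> L \<Longrightarrow> Uc Is = Uh I" "is_ordering I Is \<Longrightarrow> I \<in> L \<Longrightarrow> Dc Is = Dh I"
  using UD_indep[of I Is "oo I"] oo[of I] unfolding Uh_def Dh_def by auto

text \<open>The first two equations only extend an ordering by one set. The other two follow from
  \<open>UDh_props\<close>, which turns \<open>Dh I \<otimes> Uh I\<close> into \<open>E I\<close>;
  they recover the Hasse arrows from \<open>Uh\<close> and \<open>Dh\<close>, as the round trip
  between the quotients requires.\<close>

lemma UDh_step:
  assumes "I \<sqsubset>c J" "J \<in> L"
  shows "Uh J = Uh I \<otimes>\<^bsub>B\<^esub> V I J" "Dh J = X J I \<otimes>\<^bsub>B\<^esub> Dh I"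
    "Dh I \<otimes>\<^bsub>B\<^esub> Uh J = V I J" "Dh J \<otimes>\<^bsub>B\<^esub> Uh I = X J I"
proof -
  have I: "I \<in> L" using covered_L assms by blast
  note o = oo[OF I]
  show 1: "Uh J = Uh I \<otimes>\<^bsub>B\<^esub> V I J" "Dh J = X J I \<otimes>\<^bsub>B\<^esub> Dh I"
    using UDh_eq[OF ordering_snocI[OF o assms(1)] assms(2)] UD_snoc[OF o assms] unfolding Uh_def[of I] Dh_def[of I] by auto
  note p = UDh_props[OF I] and c = closed(2,3)[OF assms(2,1)]
  have "Dh I \<otimes>\<^bsub>B\<^esub> Uh J = (Dh I \<otimes>\<^bsub>B\<^esub> Uh I) \<otimes>\<^bsub>B\<^esub> V I J" unfolding 1 using p(1,2) c by (simp only: B.m_assoc)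
  then show "Dh I \<otimes>\<^bsub>B\<^esub> Uh J = V I J" using p(7) EV(1) assms by simp
  have "Dh J \<otimes>\<^bsub>B\<^esub> Uh I = X J I \<otimes>\<^bsub>B\<^esub> (Dh I \<otimes>\<^bsub>B\<^esub> Uh I)" unfolding 1 using p(1,2) c by (simp only: B.m_assoc)
  then show "Dh J \<otimes>\<^bsub>B\<^esub> Uh I = X J I" using p(7) EX(2) assms by simp
qed

lemma UDh_empty: "Uh {} = E {}" "Dh {} = E {}"
  using UDh_eq[of "{}" "[{}]"] E_empty by (auto simp: is_ordering_def)

lemma UDh_single: "s \<in> S \<Longrightarrow> Uh {s} = V {} {s}" "s \<in> S \<Longrightarrow> Dh {s} = X {s} {}"
  using UDh_step(1,2)[of "{}" "{s}"] EV(1)[of "{s}" "{}"] EX(2)[of "{s}" "{}"]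
  by (auto simp: UDh_empty covered_def)

definition tah :: "'w \<Rightarrow> 'b"
  where "tah s = of_zq (1 + qq) \<odot>\<^bsub>B\<^esub> (Uh {s} \<otimes>\<^bsub>B\<^esub> Dh {s}) \<ominus>\<^bsub>B\<^esub> E {}"

lemma tah_corner:
  assumes s: "s \<in> S"
  shows "tah s \<in> carrier C" "tah s \<otimes>\<^bsub>C\<^esub> tah s = (qq - 1) \<odot>\<^bsub>C\<^esub> tah s \<oplus>\<^bsub>C\<^esub> qq \<odot>\<^bsub>C\<^esub> \<one>\<^bsub>C\<^esub>"
    "ch s = E {} \<oplus>\<^bsub>B\<^esub> tah s"
proof -
  let ?P = "Uh {s} \<otimes>\<^bsub>B\<^esub> Dh {s}"
  note p = UDh_props[OF single_L[OF s]]
  have 1: "?P \<in> carrier B" using p by simp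
  have "?P \<otimes>\<^bsub>B\<^esub> ?P = Uh {s} \<otimes>\<^bsub>B\<^esub> ((Dh {s} \<otimes>\<^bsub>B\<^esub> Uh {s}) \<otimes>\<^bsub>B\<^esub> Dh {s})" using p(1,2) by (simp add: B.m_assoc)
  then have 2: "?P \<otimes>\<^bsub>B\<^esub> ?P = ?P" using p by simp
  have 3: "E {} \<otimes>\<^bsub>B\<^esub> ?P = ?P" using p E_empty by (simp add: B.m_assoc[symmetric])
  have 4: "?P \<otimes>\<^bsub>B\<^esub> E {} = ?P" using p E_empty by (simp add: B.m_assoc)
  note g = corner_gens[OF B.alg_axioms E_empty 1 2 3 4 tah_def]
  show "tah s \<in> carrier C" "tah s \<otimes>\<^bsub>C\<^esub> tah s = (qq - 1) \<odot>\<^bsub>C\<^esub> tah s \<oplus>\<^bsub>C\<^esub> qq \<odot>\<^bsub>C\<^esub> \<one>\<^bsub>C\<^esub>" by (rule g)+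
  have "ch s = of_zq (1 + qq) \<odot>\<^bsub>B\<^esub> ?P" using ch[of s] UDh_single[OF s] by (simp only: add.commute)
  moreover have "of_zq (1 + qq) \<odot>\<^bsub>B\<^esub> ?P \<in> carrier B" using 1 by simp
  ultimately show "ch s = E {} \<oplus>\<^bsub>B\<^esub> tah s"
    unfolding tah_def using E_empty by (simp add: a_minus_def B.a_lcomm[of "E {}"] B.r_neg)
qed

text \<open>The extended braid relation is multiplied by \<open>E {}\<close> on both sides. Solved
  for the image of \<open>ax Is\<close>, it has a right-hand side that does not mention the
  ordering, so different orderings of one set have equal images although their words differ.\<close>

lemma hom_ax_UD:
  assumes f: "alg_hom FA C f" and fs: "\<And>s. s \<in> S \<Longrightarrow> f (Poly_Mapping.single [s] 1) = tah s"
    and I: "I \<in> L" "card I > 1" and Is: "is_ordering I Is"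
  shows "Uh I \<otimes>\<^bsub>B\<^esub> Dh I = piv I \<odot>\<^bsub>B\<^esub> f (ax Is)" "f (ax Is) = of_zq (poincare W S I) \<odot>\<^bsub>B\<^esub> (Uh I \<otimes>\<^bsub>B\<^esub> Dh I)"
proof -
  note c = steps_closed[OF Is I(1)] and w = w_closed[OF Is I(1)]
  have fc: "f (ax Is) \<in> carrier C" using alg_hom_simps(1)[OF f ax_carrier[OF I(1) Is]] .
  then have fc': "f (ax Is) \<in> carrier B" "E {} \<otimes>\<^bsub>B\<^esub> f (ax Is) = f (ax Is)" "f (ax Is) \<otimes>\<^bsub>B\<^esub> E {} = f (ax Is)"
    by (simp_all add: corner_fields)
  have "wU Is \<otimes>\<^bsub>B\<^esub> wD Is = word_prod B \<one>\<^bsub>B\<^esub> (\<lambda>x. x) (steps V Is @ rev (steps (\<lambda>I J. X J I) Is))"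
    unfolding word_prod_append using c w by (intro B.word_prod_unit[symmetric]) auto
  also have "\<dots> = piv I \<odot>\<^bsub>B\<^esub> f (ax Is)"
    using chain[OF I Is] hom_ax_corner[OF B.alg_axioms alg_C tah_corner(1,3) f fs I(1) Is] by simp
  finally have ww: "wU Is \<otimes>\<^bsub>B\<^esub> wD Is = piv I \<odot>\<^bsub>B\<^esub> f (ax Is)" .
  have "Uh I \<otimes>\<^bsub>B\<^esub> Dh I = Uc Is \<otimes>\<^bsub>B\<^esub> Dc Is" using UDh_eq[OF Is I(1)] by simp
  also have "\<dots> = E {} \<otimes>\<^bsub>B\<^esub> (wU Is \<otimes>\<^bsub>B\<^esub> wD Is) \<otimes>\<^bsub>B\<^esub> E {}" using w E_empty(1) by (simp add: B.m_assoc)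
  also have "\<dots> = piv I \<odot>\<^bsub>B\<^esub> f (ax Is)"
    unfolding ww using fc' E_empty by (simp add: B.smult_mult_l B.smult_mult_r)
  finally show 1: "Uh I \<otimes>\<^bsub>B\<^esub> Dh I = piv I \<odot>\<^bsub>B\<^esub> f (ax Is)" .
  show "f (ax Is) = of_zq (poincare W S I) \<odot>\<^bsub>B\<^esub> (Uh I \<otimes>\<^bsub>B\<^esub> Dh I)"
    unfolding 1 B.smult_assoc[OF fc'(1), symmetric] using piv[OF I(1)] fc'(1) by (simp add: mult.commute)
qed

lemma tah_braid:
  assumes pr: "p \<in> S" "r \<in> S" "p \<noteq> r" "cox_m W p r > 0"
  shows "word_prod B (E {}) tah (alt_word (cox_m W p r) p r) = word_prod B (E {}) tah (alt_word (cox_m W p r) r p)"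
proof -
  let ?I = "{p, r}"
  let ?Is = "[{}, {p}, {p, r}]" and ?Js = "[{}, {r}, {p, r}]"
  have fin: "finite (generate W ?I)" using finite_dihedral pr by blast
  then have I: "?I \<in> L" "card ?I > 1" using pr by (auto simp: fin_subsets_def)
  have o0: "is_ordering {} [{}]" by (simp add: is_ordering_def)
  have "is_ordering ?I (([{}] @ [{p}]) @ [?I])" "is_ordering ?I (([{}] @ [{r}]) @ [?I])"
    using pr(3) by (intro ordering_snocI[OF ordering_snocI[OF o0]]; auto simp: covered_def)+
  then have o: "is_ordering ?I ?Is" "is_ordering ?I ?Js" by simp_all
  have rp: "{r, p} = {p, r}" by auto
  note ap = adapted_pair[OF rw[OF I(1) o(1)] pr(1,2) fin]
  note ar = adapted_pair[of r p "rw ?Js", unfolded rp, OF rw[OF I(1) o(2)] pr(2,1) fin]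
  \<comment> \<open>The two words end in p and r respectively, so a comparison of their leading
    terms has content.\<close>
  have "rw ?Is \<noteq> rw ?Js" using ap(4) ar(4) pr(3) by auto
  have "word_prod C \<one>\<^bsub>C\<^esub> tah (alt_word (cox_m W p r) p r) = word_prod C \<one>\<^bsub>C\<^esub> tah (alt_word (cox_m W p r) r p)"
  proof (rule braid_from_expansions[OF pr alg_C tah_corner(1,2) ap(1,2) ar(1,2) _ \<open>rw ?Is \<noteq> rw ?Js\<close>])
    show "ev (rw ?Is) = ev (rw ?Js)" using ap(3) ar(3) by simp
    show "f (ax ?Is) = f (ax ?Js)" if "alg_hom FA H f" "\<And>s. s \<in> S \<Longrightarrow> f (Poly_Mapping.single [s] 1) = Tg s" for f
      using hom_ax_H[OF that I(1) o(1)] hom_ax_H[OF that I(1) o(2)] by simp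
    show "f (ax ?Is) = f (ax ?Js)" if "alg_hom FA C f" "\<And>s. s \<in> S \<Longrightarrow> f (Poly_Mapping.single [s] 1) = tah s" for f
      using hom_ax_UD(2)[OF that I o(1)] hom_ax_UD(2)[OF that I o(2)] by simp
  qed
  then show ?thesis by (simp add: corner_fields(3))
qed

lemma UDh_finsum:
  assumes I: "I \<in> L" "I \<noteq> {}"
  shows "Uh I \<otimes>\<^bsub>B\<^esub> Dh I = piv I \<odot>\<^bsub>B\<^esub> finsum B (\<lambda>w. word_prod B (E {}) tah (red w)) (generate W I)"
proof -
  have "\<exists>h. alg_hom H C h \<and> (\<forall>s\<in>S. h (Tg s) = tah s)"
    by (rule hecke_lift[OF alg_C tah_corner(1,2)]) (use tah_braid in \<open>simp_all add: corner_fields(3)\<close>)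
  then obtain h where h: "alg_hom H C h" "\<And>s. s \<in> S \<Longrightarrow> h (Tg s) = tah s" by blast
  note hx = hom_xx[OF B.ring_axioms h I(1)]
  show ?thesis
  proof (cases "card I > 1")
    case True
    have f: "alg_hom FA C (\<lambda>x. h (hcls x))" by (rule alg_hom_comp[OF hcls_hom h(1)])
    have fs: "h (hcls (Poly_Mapping.single [s] 1)) = tah s" if "s \<in> S" for s
      using h(2)[OF that] by (simp add: hecke_gen_def)
    have "hcls (ax (oo I)) = xx I"
      by (rule hom_ax_H[OF hcls_hom _ I(1) oo[OF I(1)]]) (simp add: hecke_gen_def)
    then show ?thesis using hom_ax_UD(1)[OF f fs I(1) True oo[OF I(1)]] hx by simp
  next
    \<comment> \<open>There is no extended braid relation for singletons. Here the identity is the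
      definition of \<open>tah\<close>, because x_s = 1 + T_s and pi({s}) = 1 + q.\<close>
    case False
    then have "card I = 1" using I L_finite[OF I(1)] card_gt_0_iff[of I] by linarith
    then obtain s where s: "I = {s}" by (auto simp: card_1_singleton_iff)
    have sS: "s \<in> S" using L_S[OF I(1)] s by simp
    have P: "Uh {s} \<otimes>\<^bsub>B\<^esub> Dh {s} \<in> carrier B" using UDh_props[OF single_L[OF sS]] by simp
    have "h (xx I) = E {} \<oplus>\<^bsub>B\<^esub> tah s"
      unfolding s xx_single[OF sS] using alg_hom_simps[OF h(1)] h(2) sS by (simp add: corner_fields)
    also have "\<dots> = of_zq (1 + qq) \<odot>\<^bsub>B\<^esub> (Uh {s} \<otimes>\<^bsub>B\<^esub> Dh {s})"
      using tah_corner(3)[OF sS] ch[of s] UDh_single[OF sS] by (simp only: add.commute)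
    also have "1 + qq = poincare W S {s}" by (rule poincare_single[OF sS, symmetric])
    finally have "piv I \<odot>\<^bsub>B\<^esub> h (xx I) = (piv I * of_zq (poincare W S I)) \<odot>\<^bsub>B\<^esub> (Uh {s} \<otimes>\<^bsub>B\<^esub> Dh {s})"
      using P by (simp only: s B.smult_assoc)
    then show ?thesis using piv[OF I(1)] P s hx by simp
  qed
qed

lemma qrep_UDh: "qrep W S red rw a B E Uh Dh tah"
proof (intro qrep.intro qrep_axioms.intro)
  show "coxf W S red rw a" by (rule coxf_axioms)
  show "alg B" by (rule B.alg_axioms)
qed (use EE E1 UDh_props UDh_empty tah_def tah_braid UDh_finsum in auto)

end

lemma word_prod_map: "word_prod A e f (map g xs) = word_prod A e (\<lambda>x. f (g x)) xs"
  by (induction xs) auto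

lemma minus_pm:
  fixes A :: "('b \<Rightarrow>\<^sub>0 'k::comm_ring_1, 'm) ring_scheme"
  assumes "ring A" "add A = (+)" "zero A = 0" "x \<in> carrier A" "y \<in> carrier A" "- y \<in> carrier A"
  shows "x \<ominus>\<^bsub>A\<^esub> y = x - y"
proof -
  interpret ring A by fact
  have "\<ominus>\<^bsub>A\<^esub> y = - y" using assms by (intro minus_equality) auto
  then show ?thesis using assms(2) by (simp add: a_minus_def)
qed

section \<open>Quotients of path algebras\<close>

context fin_quiver
begin

abbreviation "PA \<equiv> (path_algebra G :: ('k::comm_ring_1, ('v \<times> 'e list \<times> 'v) \<Rightarrow>\<^sub>0 'k) module)"

lemma path_diff_closed: "x \<in> carrier PA \<Longrightarrow> y \<in> carrier PA \<Longrightarrow> x - y \<in> carrier PA"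
  using keys_minus[of x y] by (auto simp: path_algebra_fields(1))

lemma path_diff_hom:
  fixes h :: "(('v \<times> 'e list \<times> 'v) \<Rightarrow>\<^sub>0 'k::comm_ring_1) \<Rightarrow> 'a"
  assumes "alg B" "alg_hom PA B h" "x \<in> carrier PA" "y \<in> carrier PA"
  shows "h (x - y) = h x \<ominus>\<^bsub>B\<^esub> h y"
  by (rule alg_hom_diff[OF alg.axioms(1)[OF alg_path] path_algebra_fields(5) alg.axioms(1)[OF assms(1)]
        assms(2-4) path_diff_closed[OF assms(3,4)]])

lemma path_minus:
  assumes "x \<in> carrier PA" "y \<in> carrier PA"
  shows "x \<ominus>\<^bsub>PA\<^esub> y = x - (y :: _ \<Rightarrow>\<^sub>0 'k::comm_ring_1)"
  using assms by (intro minus_pm alg.axioms(1)[OF alg_path]) (auto simp: path_algebra_fields)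

lemma path_quot_lift:
  fixes B :: "('k::comm_ring_1, 'a) module"
  assumes B: "alg B" and E: "E \<in> verts G \<rightarrow> carrier B" and F: "F \<in> arcs G \<rightarrow> carrier B"
    and EE: "\<And>u v. u \<in> verts G \<Longrightarrow> v \<in> verts G \<Longrightarrow> E u \<otimes>\<^bsub>B\<^esub> E v = (if u = v then E u else \<zero>\<^bsub>B\<^esub>)"
    and E1: "finsum B E (verts G) = \<one>\<^bsub>B\<^esub>"
    and FE: "\<And>a. a \<in> arcs G \<Longrightarrow> F a \<otimes>\<^bsub>B\<^esub> E (tail G a) = F a"
    and EF: "\<And>a. a \<in> arcs G \<Longrightarrow> E (head G a) \<otimes>\<^bsub>B\<^esub> F a = F a"
    and X: "X \<subseteq> carrier PA"
    and kill: "\<And>h x. alg_hom PA B h \<Longrightarrow> (\<And>v. v \<in> verts G \<Longrightarrow> h (triv_path v) = E v) \<Longrightarrow>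
      (\<And>a. a \<in> arcs G \<Longrightarrow> h (arrow G a) = F a) \<Longrightarrow> x \<in> X \<Longrightarrow> h x = \<zero>\<^bsub>B\<^esub>"
  shows "\<exists>h. alg_hom (quot_algebra PA X) B h \<and> (\<forall>v\<in>verts G. h (quot_class PA X (triv_path v)) = E v) \<and>
    (\<forall>a\<in>arcs G. h (quot_class PA X (arrow G a)) = F a)"
proof -
  interpret quot_alg' PA X using alg_path X by (intro quot_alg'.intro quot_alg'_axioms.intro)
  obtain h where h: "alg_hom PA B h" "\<And>v. v \<in> verts G \<Longrightarrow> h (triv_path v) = E v"
      "\<And>a. a \<in> arcs G \<Longrightarrow> h (arrow G a) = F a"
    using path_algebra_lift[OF B E F EE E1 FE EF] by blast
  obtain h' where h': "alg_hom (quot_algebra PA X) B h'" "\<And>x. x \<in> carrier PA \<Longrightarrow> h' (quot_class PA X x) = h x"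
    using lift_alg_hom[OF B h(1) kill[OF h]] by blast
  show ?thesis
    using h'(1) by (intro exI[of _ h']) (simp add: h'(2) h(2,3))
qed

lemma path_quot_ext:
  fixes B :: "('k::comm_ring_1, 'a) module"
  assumes B: "alg B" and X: "X \<subseteq> carrier PA"
    and f: "alg_hom (quot_algebra PA X) B f" and g: "alg_hom (quot_algebra PA X) B g"
    and v: "\<And>v. v \<in> verts G \<Longrightarrow> f (quot_class PA X (triv_path v)) = g (quot_class PA X (triv_path v))"
    and a: "\<And>a. a \<in> arcs G \<Longrightarrow> f (quot_class PA X (arrow G a)) = g (quot_class PA X (arrow G a))"
    and y: "y \<in> carrier (quot_algebra PA X)"
  shows "f y = g y"
proof -
  interpret quot_alg' PA X using alg_path X by (intro quot_alg'.intro quot_alg'_axioms.intro)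
  obtain x where x: "x \<in> carrier PA" "y = quot_class PA X x" using cls_surj[OF y] by blast
  show ?thesis
    unfolding x(2) by (rule path_algebra_ext[OF B alg_hom_comp[OF alg_hom_cls f] alg_hom_comp[OF alg_hom_cls g] v a x(1)])
qed

lemma path_quot_units:
  fixes X :: "(('v \<times> 'e list \<times> 'v) \<Rightarrow>\<^sub>0 'k::comm_ring_1) set"
  assumes X: "X \<subseteq> carrier PA"
  defines "Q \<equiv> quot_algebra PA X" and "c \<equiv> quot_class PA X"
  shows "u \<in> verts G \<Longrightarrow> v \<in> verts G \<Longrightarrow> c (triv_path u) \<otimes>\<^bsub>Q\<^esub> c (triv_path v) = (if u = v then c (triv_path u) else \<zero>\<^bsub>Q\<^esub>)"
    and "finsum Q (\<lambda>v. c (triv_path v)) (verts G) = \<one>\<^bsub>Q\<^esub>"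
    and "b \<in> arcs G \<Longrightarrow> c (arrow G b) \<otimes>\<^bsub>Q\<^esub> c (triv_path (tail G b)) = c (arrow G b)"
    and "b \<in> arcs G \<Longrightarrow> c (triv_path (head G b)) \<otimes>\<^bsub>Q\<^esub> c (arrow G b) = c (arrow G b)"
proof -
  interpret quot_alg' PA X using alg_path X by (intro quot_alg'.intro quot_alg'_axioms.intro)
  interpret Q: alg Q unfolding Q_def by (rule alg_Q)
  have hom: "alg_hom PA Q c" unfolding Q_def c_def by (rule alg_hom_cls)
  have c0: "c \<zero>\<^bsub>PA\<^esub> = \<zero>\<^bsub>Q\<^esub>"
    using additive_finsum(1)[OF ring_axioms Q.ring_axioms] alg_hom_simps(1,3)[OF hom] by blast
  have "triv_path u \<otimes>\<^bsub>PA\<^esub> triv_path v = (if u = v then triv_path u else (\<zero>\<^bsub>PA\<^esub> :: _ \<Rightarrow>\<^sub>0 'k))"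
    by (simp add: path_algebra_fields(2,4) triv_path_def path_mult_def pm_scale_simps)
  then show "u \<in> verts G \<Longrightarrow> v \<in> verts G \<Longrightarrow> c (triv_path u) \<otimes>\<^bsub>Q\<^esub> c (triv_path v) = (if u = v then c (triv_path u) else \<zero>\<^bsub>Q\<^esub>)"
    using c0 alg_hom_simps(2)[OF hom, of "triv_path u" "triv_path v"] by (simp split: if_splits)
  have "arrow G b \<otimes>\<^bsub>PA\<^esub> triv_path (tail G b) = (arrow G b :: _ \<Rightarrow>\<^sub>0 'k)"
    "triv_path (head G b) \<otimes>\<^bsub>PA\<^esub> arrow G b = (arrow G b :: _ \<Rightarrow>\<^sub>0 'k)"
    by (simp_all add: path_algebra_fields(2) triv_path_def arrow_def path_mult_def pm_scale_simps)
  then show "b \<in> arcs G \<Longrightarrow> c (arrow G b) \<otimes>\<^bsub>Q\<^esub> c (triv_path (tail G b)) = c (arrow G b)"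
    "b \<in> arcs G \<Longrightarrow> c (triv_path (head G b)) \<otimes>\<^bsub>Q\<^esub> c (arrow G b) = c (arrow G b)"
    using alg_hom_simps(2)[OF hom, of "arrow G b" "triv_path (tail G b)"]
      alg_hom_simps(2)[OF hom, of "triv_path (head G b)" "arrow G b"] by simp_all
  have t: "triv_path \<in> verts G \<rightarrow> carrier PA" by simp
  have "finsum PA triv_path (verts G) = (\<one>\<^bsub>PA\<^esub> :: _ \<Rightarrow>\<^sub>0 'k)"
    using finsum_pm[OF ring_axioms path_algebra_fields(4,5) t] by (simp add: path_algebra_fields(3))
  then show "finsum Q (\<lambda>v. c (triv_path v)) (verts G) = \<one>\<^bsub>Q\<^esub>"
    using additive_finsum(3)[OF ring_axioms Q.ring_axioms _ _ t, of c] alg_hom_simps(1,3,4)[OF hom] by simp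
qed

end

context coxf
begin

subsection \<open>The first quiver\<close>

lemma q_quiver_fields:
  "verts (q_quiver W S) = L" "arcs (q_quiver W S) = Ups ` (L - {{}}) \<union> Del ` (L - {{}})"
  "tail (q_quiver W S) (Ups I) = I" "head (q_quiver W S) (Ups I) = {}"
  "tail (q_quiver W S) (Del I) = {}" "head (q_quiver W S) (Del I) = I"
  by (simp_all add: q_quiver_def)

lemma quiver_q: "fin_quiver (q_quiver W S)"
proof (intro fin_quiver.intro fin_quiver_axioms.intro)
  show "wf_digraph (q_quiver W S)"
    by standard (auto simp: q_quiver_fields)
qed (simp add: q_quiver_fields finite_L)

end

sublocale coxf \<subseteq> GQ: fin_quiver "q_quiver W S"
  by (rule quiver_q)

context coxf
begin

abbreviation "AQ \<equiv> RQ W S"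

lemma alg_AQ: "alg AQ"
  unfolding RQ_def by (rule GQ.alg_path)

lemma AQ_diff: "x \<in> carrier AQ \<Longrightarrow> y \<in> carrier AQ \<Longrightarrow> x - y \<in> carrier AQ"
  unfolding RQ_def by (rule GQ.path_diff_closed)

lemma AQ_gens:
  "I \<in> L \<Longrightarrow> triv_path I \<in> carrier AQ" "I \<in> L \<Longrightarrow> I \<noteq> {} \<Longrightarrow> ups W S I \<in> carrier AQ"
  "I \<in> L \<Longrightarrow> I \<noteq> {} \<Longrightarrow> del W S I \<in> carrier AQ"
  using GQ.path_gens by (auto simp: RQ_def ups_def del_def q_quiver_fields)

lemma tau_closed: "s \<in> S \<Longrightarrow> tau W S s \<in> carrier AQ"
proof -
  assume s: "s \<in> S"
  interpret A: alg AQ by (rule alg_AQ)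
  show ?thesis unfolding tau_def using s by (intro AQ_diff A.smult_closed A.m_closed AQ_gens) auto
qed

lemma tau_word_closed: "u \<in> lists S \<Longrightarrow> tau_word W S u \<in> carrier AQ"
proof -
  assume u: "u \<in> lists S"
  interpret A: alg AQ by (rule alg_AQ)
  show ?thesis unfolding tau_word_def using u tau_closed by (intro A.word_prod_closed AQ_gens) auto
qed

lemma red_lists: "I \<in> L \<Longrightarrow> w \<in> generate W I \<Longrightarrow> red w \<in> lists S"
  using red[OF generate_closed[OF L_S]] unfolding reduced_expr_def by blast

lemma p_at_tau_eq:
  assumes "I \<in> L"
  shows "p_at_tau W S red I = piv I \<odot>\<^bsub>AQ\<^esub> finsum AQ (\<lambda>w. tau_word W S (red w)) (generate W I)"
proof -
  interpret A: alg AQ by (rule alg_AQ)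
  have "finsum AQ (\<lambda>w. tau_word W S (red w)) (generate W I) = (\<Sum>w\<in>generate W I. tau_word W S (red w))"
    using red_lists[OF assms] tau_word_closed
    by (intro finsum_pm[OF A.ring_axioms]) (auto simp: RQ_def path_algebra_fields simp del: in_lists_conv_set)
  then show ?thesis by (simp add: p_at_tau_def piv_def)
qed

lemma p_at_tau_closed: "I \<in> L \<Longrightarrow> p_at_tau W S red I \<in> carrier AQ"
proof -
  assume I: "I \<in> L"
  interpret A: alg AQ by (rule alg_AQ)
  show ?thesis
    unfolding p_at_tau_eq[OF I] using red_lists[OF I] tau_word_closed
    by (intro A.smult_closed A.finsum_closed) (auto simp del: in_lists_conv_set)
qed

lemma alt_lists: "s \<in> S \<Longrightarrow> t \<in> S \<Longrightarrow> alt_word n s t \<in> lists S"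
  by (rule alt_word_lists)

lemma J_relations_closed: "J_relations W S red \<subseteq> carrier (path_algebra (q_quiver W S))"
proof -
  interpret A: alg AQ by (rule alg_AQ)
  have "J_relations W S red \<subseteq> carrier AQ"
    unfolding J_relations_def
    using alt_lists by (auto intro!: AQ_diff tau_word_closed p_at_tau_closed A.m_closed AQ_gens simp del: in_lists_conv_set)
  then show ?thesis by (simp add: RQ_def)
qed

lemma hom_tau:
  assumes B: "alg B" and h: "alg_hom AQ B h" and s: "s \<in> S"
  shows "h (tau W S s) = of_zq (1 + qq) \<odot>\<^bsub>B\<^esub> (h (ups W S {s}) \<otimes>\<^bsub>B\<^esub> h (del W S {s})) \<ominus>\<^bsub>B\<^esub> h (triv_path {})"
proof -
  interpret A: alg AQ by (rule alg_AQ)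
  have c: "ups W S {s} \<in> carrier AQ" "del W S {s} \<in> carrier AQ" "triv_path {} \<in> carrier AQ" using s AQ_gens by auto
  then have "of_zq (1 + qq) \<odot>\<^bsub>AQ\<^esub> (ups W S {s} \<otimes>\<^bsub>AQ\<^esub> del W S {s}) \<in> carrier AQ" by auto
  from GQ.path_diff_hom[OF B h[unfolded RQ_def] this[unfolded RQ_def] c(3)[unfolded RQ_def], folded RQ_def]
  show ?thesis unfolding tau_def using c by (simp only: alg_hom_simps(2,5)[OF h] A.m_closed)
qed

lemma hom_tau_word:
  assumes "alg_hom AQ B h" "u \<in> lists S"
  shows "h (tau_word W S u) = word_prod B (h (triv_path {})) (\<lambda>s. h (tau W S s)) u"
proof -
  interpret A: alg AQ by (rule alg_AQ)
  show ?thesis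
    unfolding tau_word_def using assms(2) alg_hom_simps(1,2)[OF assms(1)] tau_closed AQ_gens(1)
    by (intro conjunct1[OF hom_word_prod]) (auto simp: A.monoid_axioms)
qed

lemma hom_p_at_tau:
  assumes B: "alg B" and h: "alg_hom AQ B h" and I: "I \<in> L"
  shows "h (p_at_tau W S red I) = piv I \<odot>\<^bsub>B\<^esub> finsum B (\<lambda>w. word_prod B (h (triv_path {})) (\<lambda>s. h (tau W S s)) (red w)) (generate W I)"
proof -
  interpret A: alg AQ by (rule alg_AQ)
  interpret B: alg B by fact
  have c: "(\<lambda>w. tau_word W S (red w)) \<in> generate W I \<rightarrow> carrier AQ"
    using red_lists[OF I] tau_word_closed by (auto simp del: in_lists_conv_set)
  have "h (p_at_tau W S red I) = piv I \<odot>\<^bsub>B\<^esub> h (finsum AQ (\<lambda>w. tau_word W S (red w)) (generate W I))"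
    unfolding p_at_tau_eq[OF I] by (rule alg_hom_simps(5)[OF h A.finsum_closed[OF c]])
  also have "h (finsum AQ (\<lambda>w. tau_word W S (red w)) (generate W I)) = finsum B (\<lambda>w. h (tau_word W S (red w))) (generate W I)"
    using additive_finsum(3)[OF A.ring_axioms B.ring_axioms _ _ c] alg_hom_simps(1,3)[OF h] by blast
  also have "\<dots> = finsum B (\<lambda>w. word_prod B (h (triv_path {})) (\<lambda>s. h (tau W S s)) (red w)) (generate W I)"
  proof (rule B.finsum_cong')
    show "(\<lambda>w. word_prod B (h (triv_path {})) (\<lambda>s. h (tau W S s)) (red w)) \<in> generate W I \<rightarrow> carrier B"
    proof
      fix w assume w: "w \<in> generate W I"
      show "word_prod B (h (triv_path {})) (\<lambda>s. h (tau W S s)) (red w) \<in> carrier B"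
        using alg_hom_simps(1)[OF h tau_word_closed[OF red_lists[OF I w]]] hom_tau_word[OF h red_lists[OF I w]] by simp
    qed
  qed (simp_all add: hom_tau_word[OF h red_lists[OF I]])
  finally show ?thesis .
qed

abbreviation "X2 \<equiv> quot_algebra (RQ W S) (J_relations W S red)"
abbreviation "cl2 \<equiv> quot_class (RQ W S) (J_relations W S red)"

text \<open>The locale \<open>qrep\<close> is cut to fit: its assumptions are the block conditions
  on idempotents and arrows together with the vanishing of each element of
  \<open>J_relations\<close>.\<close>

lemma X2_lift:
  assumes q: "qrep W S red rw a B E U D ta"
  shows "\<exists>h. alg_hom X2 B h \<and> (\<forall>I\<in>L. h (cl2 (triv_path I)) = E I) \<and>
    (\<forall>I\<in>L - {{}}. h (cl2 (ups W S I)) = U I \<and> h (cl2 (del W S I)) = D I)"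
proof -
  interpret q: qrep W S red rw a B E U D ta by fact
  define F where "F = (\<lambda>e. case e of Ups I \<Rightarrow> U I | Del I \<Rightarrow> D I)"
  have FF: "F (Ups I) = U I" "F (Del I) = D I" for I by (simp_all add: F_def)
  have "\<exists>h. alg_hom (quot_algebra (path_algebra (q_quiver W S)) (J_relations W S red)) B h \<and>
    (\<forall>v\<in>verts (q_quiver W S). h (quot_class (path_algebra (q_quiver W S)) (J_relations W S red) (triv_path v)) = E v) \<and>
    (\<forall>a\<in>arcs (q_quiver W S). h (quot_class (path_algebra (q_quiver W S)) (J_relations W S red) (arrow (q_quiver W S) a)) = F a)"
  proof (rule GQ.path_quot_lift[OF q.B.alg_axioms _ _ _ _ _ _ J_relations_closed])
    fix h x
    assume h: "alg_hom (path_algebra (q_quiver W S)) B h"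
      and hv: "\<And>v. v \<in> verts (q_quiver W S) \<Longrightarrow> h (triv_path v) = E v"
      and ha: "\<And>e. e \<in> arcs (q_quiver W S) \<Longrightarrow> h (arrow (q_quiver W S) e) = F e"
      and x: "x \<in> J_relations W S red"
    note h' = h[folded RQ_def]
    interpret A: alg AQ by (rule alg_AQ)
    have h0: "h (triv_path I) = E I" if "I \<in> L" for I using hv that by (simp add: q_quiver_fields)
    have hu: "h (ups W S I) = U I" "h (del W S I) = D I" if "I \<in> L" "I \<noteq> {}" for I
      using ha[of "Ups I"] ha[of "Del I"] that by (auto simp: q_quiver_fields ups_def del_def FF)
    have ht: "h (tau W S s) = ta s" if "s \<in> S" for s
      using hom_tau[OF q.B.alg_axioms h' that] hu[of "{s}"] h0[of "{}"] that by (simp add: q.ta)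
    have hw: "h (tau_word W S u) = word_prod B (E {}) ta u" if "u \<in> lists S" for u
      using hom_tau_word[OF h' that] that ht h0 by (auto intro!: word_prod_cong)
    have wc: "word_prod B (E {}) ta u \<in> carrier B" if "u \<in> lists S" for u
      using alg_hom_simps(1)[OF h' tau_word_closed[OF that]] hw[OF that] by simp
    have diff: "h (x - y) = h x \<ominus>\<^bsub>B\<^esub> h y" if "x \<in> carrier AQ" "y \<in> carrier AQ" for x y
      using GQ.path_diff_hom[OF q.B.alg_axioms h] that by (simp add: RQ_def)
    from x show "h x = \<zero>\<^bsub>B\<^esub>" unfolding J_relations_def
    proof (elim UnE CollectE exE conjE)
      fix s t assume st: "s \<in> S" "t \<in> S" "s \<noteq> t" "0 < cox_m W s t"
        and x: "x = tau_word W S (alt_word (cox_m W s t) s t) - tau_word W S (alt_word (cox_m W s t) t s)"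
      note l = alt_lists[OF st(1,2), of "cox_m W s t"] alt_lists[OF st(2,1), of "cox_m W s t"]
      show ?thesis
        unfolding x diff[OF tau_word_closed[OF l(1)] tau_word_closed[OF l(2)]] hw[OF l(1)] hw[OF l(2)] q.braid[OF st]
        using wc[OF l(2)] by simp
    next
      fix I assume I: "I \<in> L - {{}}" and x: "x = ups W S I \<otimes>\<^bsub>AQ\<^esub> del W S I - p_at_tau W S red I"
      have I': "I \<in> L" "I \<noteq> {}" using I by auto
      have "h (p_at_tau W S red I) = piv I \<odot>\<^bsub>B\<^esub> finsum B (\<lambda>w. word_prod B (E {}) ta (red w)) (generate W I)"
      proof -
        have "word_prod B (h (triv_path {})) (\<lambda>s. h (tau W S s)) (red w) = word_prod B (E {}) ta (red w)" if "w \<in> generate W I" for w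
          using red_lists[OF I'(1) that] ht h0 by (intro word_prod_cong) auto
        then show ?thesis
          unfolding hom_p_at_tau[OF q.B.alg_axioms h' I'(1)] using wc[OF red_lists[OF I'(1)]]
          by (intro arg_cong2[where f = "module.smult B"] q.B.finsum_cong') auto
      qed
      also have "\<dots> = U I \<otimes>\<^bsub>B\<^esub> D I" using q.UD[OF I'] by simp
      finally have "h (p_at_tau W S red I) = U I \<otimes>\<^bsub>B\<^esub> D I" .
      moreover have "h (ups W S I \<otimes>\<^bsub>AQ\<^esub> del W S I) = U I \<otimes>\<^bsub>B\<^esub> D I"
        using alg_hom_simps(2)[OF h'] AQ_gens(2,3)[OF I'] hu[OF I'] by simp
      ultimately show ?thesis
        unfolding x using diff[OF A.m_closed[OF AQ_gens(2,3)[OF I']] p_at_tau_closed[OF I'(1)]] I' by simp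
    next
      fix I assume I: "I \<in> L - {{}}" and x: "x = del W S I \<otimes>\<^bsub>AQ\<^esub> ups W S I - triv_path I"
      have I': "I \<in> L" "I \<noteq> {}" using I by auto
      have "h (del W S I \<otimes>\<^bsub>AQ\<^esub> ups W S I) = D I \<otimes>\<^bsub>B\<^esub> U I"
        using alg_hom_simps(2)[OF h'] AQ_gens(2,3)[OF I'] hu[OF I'] by simp
      then show ?thesis
        unfolding x using diff[OF A.m_closed[OF AQ_gens(3,2)[OF I']] AQ_gens(1)[OF I'(1)]] I' q.DU h0 by simp
    qed
  qed (auto simp: q_quiver_fields FF q.EE q.E1 q.EU q.ED)
  then obtain h where h: "alg_hom X2 B h" "\<And>I. I \<in> L \<Longrightarrow> h (cl2 (triv_path I)) = E I"
    "\<And>e. e \<in> arcs (q_quiver W S) \<Longrightarrow> h (cl2 (arrow (q_quiver W S) e)) = F e"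
    by (auto simp: RQ_def q_quiver_fields)
  have "h (cl2 (ups W S I)) = U I \<and> h (cl2 (del W S I)) = D I" if "I \<in> L - {{}}" for I
    using h(3)[of "Ups I"] h(3)[of "Del I"] that by (auto simp: q_quiver_fields ups_def del_def FF)
  then show ?thesis using h(1,2) by blast
qed

lemma X2_ext:
  assumes B: "alg B" and f: "alg_hom X2 B f" and g: "alg_hom X2 B g"
    and v: "\<And>I. I \<in> L \<Longrightarrow> f (cl2 (triv_path I)) = g (cl2 (triv_path I))"
    and u: "\<And>I. I \<in> L \<Longrightarrow> I \<noteq> {} \<Longrightarrow> f (cl2 (ups W S I)) = g (cl2 (ups W S I))"
    and d: "\<And>I. I \<in> L \<Longrightarrow> I \<noteq> {} \<Longrightarrow> f (cl2 (del W S I)) = g (cl2 (del W S I))"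
    and y: "y \<in> carrier X2"
  shows "f y = g y"
proof (rule GQ.path_quot_ext[OF B J_relations_closed f[unfolded RQ_def] g[unfolded RQ_def] _ _ y[unfolded RQ_def]])
  show "f (quot_class (path_algebra (q_quiver W S)) (J_relations W S red) (triv_path I)) =
    g (quot_class (path_algebra (q_quiver W S)) (J_relations W S red) (triv_path I))" if "I \<in> verts (q_quiver W S)" for I
    using v[of I] that by (simp add: RQ_def q_quiver_fields(1))
  show "f (quot_class (path_algebra (q_quiver W S)) (J_relations W S red) (arrow (q_quiver W S) e)) =
    g (quot_class (path_algebra (q_quiver W S)) (J_relations W S red) (arrow (q_quiver W S) e))" if "e \<in> arcs (q_quiver W S)" for e
    using that u d by (auto simp: RQ_def q_quiver_fields(2) ups_def del_def)
qed

definition "E2 I = cl2 (triv_path I)"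
definition "U2 I = (if I = {} then cl2 (triv_path {}) else cl2 (ups W S I))"
definition "D2 I = (if I = {} then cl2 (triv_path {}) else cl2 (del W S I))"
definition "ta2 s = of_zq (1 + qq) \<odot>\<^bsub>X2\<^esub> (U2 {s} \<otimes>\<^bsub>X2\<^esub> D2 {s}) \<ominus>\<^bsub>X2\<^esub> E2 {}"

lemma quot_X2: "quot_alg' AQ (J_relations W S red)"
  using alg_AQ J_relations_closed by (intro quot_alg'.intro quot_alg'_axioms.intro) (simp_all add: RQ_def)

text \<open>Path multiplication gives the block conditions and the generators of the ideal vanish in
  the quotient. Everything derived inside \<open>qrep\<close>, in particular the map from the Hecke
  algebra into the corner, thereby holds in \<open>X2\<close>.\<close>

lemma qrep_X2: "qrep W S red rw a X2 E2 U2 D2 ta2"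
proof -
  interpret A: quot_alg' AQ "J_relations W S red" by (rule quot_X2)
  interpret Q: alg X2 by (rule A.alg_Q)
  note hom = A.alg_hom_cls
  note un = GQ.path_quot_units[OF J_relations_closed, folded RQ_def]
  have eq: "cl2 x = cl2 y" if "x \<in> carrier AQ" "y \<in> carrier AQ" "x - y \<in> J_relations W S red" for x y
    using A.cls_diff[OF that(1,2)] GQ.path_minus[of x y] that by (simp add: RQ_def)
  have uc: "cl2 (ups W S I) \<in> carrier X2" "cl2 (del W S I) \<in> carrier X2" "cl2 (triv_path I) \<in> carrier X2"
    if "I \<in> L" "I \<noteq> {}" for I
    using alg_hom_simps(1)[OF hom] AQ_gens that by auto
  have ec: "E2 I \<in> carrier X2" if "I \<in> L" for I
    using alg_hom_simps(1)[OF hom] AQ_gens that by (auto simp: E2_def)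
  have EE: "E2 I \<otimes>\<^bsub>X2\<^esub> E2 J = (if I = J then E2 I else \<zero>\<^bsub>X2\<^esub>)" if "I \<in> L" "J \<in> L" for I J
    using un(1) that by (simp add: E2_def q_quiver_fields)
  have U2s: "U2 {} = E2 {}" "D2 {} = E2 {}" by (simp_all add: U2_def D2_def E2_def)
  have EU: "E2 {} \<otimes>\<^bsub>X2\<^esub> U2 I = U2 I" "U2 I \<otimes>\<^bsub>X2\<^esub> E2 I = U2 I"
    "E2 I \<otimes>\<^bsub>X2\<^esub> D2 I = D2 I" "D2 I \<otimes>\<^bsub>X2\<^esub> E2 {} = D2 I" if I: "I \<in> L" for I
    using un(3)[of "Ups I"] un(4)[of "Ups I"] un(3)[of "Del I"] un(4)[of "Del I"] EE[of "{}" "{}"] U2s I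
    by (cases "I = {}"; simp add: q_quiver_fields ups_def[symmetric] del_def[symmetric] E2_def U2_def D2_def)+
  have ta: "cl2 (tau W S s) = ta2 s" if "s \<in> S" for s
    using hom_tau[OF Q.alg_axioms hom that] by (simp add: ta2_def U2_def D2_def E2_def)
  have tw: "cl2 (tau_word W S u) = word_prod X2 (E2 {}) ta2 u" if "u \<in> lists S" for u
    unfolding hom_tau_word[OF hom that] using that ta by (intro word_prod_cong) (auto simp: E2_def)
  have pt: "cl2 (p_at_tau W S red I) = piv I \<odot>\<^bsub>X2\<^esub> finsum X2 (\<lambda>w. word_prod X2 (E2 {}) ta2 (red w)) (generate W I)" if I: "I \<in> L" for I
  proof -
    have "word_prod X2 (cl2 (triv_path {})) (\<lambda>s. cl2 (tau W S s)) (red w) = word_prod X2 (E2 {}) ta2 (red w)"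
      "word_prod X2 (E2 {}) ta2 (red w) \<in> carrier X2" if "w \<in> generate W I" for w
    proof -
      note l = red_lists[OF I that]
      show "word_prod X2 (cl2 (triv_path {})) (\<lambda>s. cl2 (tau W S s)) (red w) = word_prod X2 (E2 {}) ta2 (red w)"
        using l ta by (intro word_prod_cong) (auto simp: E2_def)
      show "word_prod X2 (E2 {}) ta2 (red w) \<in> carrier X2"
        using alg_hom_simps(1)[OF hom tau_word_closed[OF l]] tw[OF l] by simp
    qed
    then show ?thesis
      unfolding hom_p_at_tau[OF Q.alg_axioms hom I]
      by (intro arg_cong2[where f = "module.smult X2"] Q.finsum_cong') auto
  qed
  show ?thesis
  proof (intro qrep.intro qrep_axioms.intro)
    fix I assume I: "I \<in> L"
    show "E2 I \<in> carrier X2" "U2 I \<in> carrier X2" "D2 I \<in> carrier X2"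
      using uc[OF I] ec[OF I] ec[of "{}"] by (auto simp: U2_def D2_def E2_def)
    assume I0: "I \<noteq> {}"
    have c: "ups W S I \<otimes>\<^bsub>AQ\<^esub> del W S I \<in> carrier AQ" "del W S I \<otimes>\<^bsub>AQ\<^esub> ups W S I \<in> carrier AQ"
      using AQ_gens I I0 by auto
    have "cl2 (ups W S I \<otimes>\<^bsub>AQ\<^esub> del W S I) = cl2 (p_at_tau W S red I)"
      using I I0 by (intro eq c p_at_tau_closed) (auto simp: J_relations_def)
    then show "U2 I \<otimes>\<^bsub>X2\<^esub> D2 I = piv I \<odot>\<^bsub>X2\<^esub> finsum X2 (\<lambda>w. word_prod X2 (E2 {}) ta2 (red w)) (generate W I)"
      using pt[OF I] alg_hom_simps(2)[OF hom AQ_gens(2,3)[OF I I0]] I0 by (simp add: U2_def D2_def)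
    have "cl2 (del W S I \<otimes>\<^bsub>AQ\<^esub> ups W S I) = cl2 (triv_path I)"
      using I I0 by (intro eq c AQ_gens) (auto simp: J_relations_def)
    then show "D2 I \<otimes>\<^bsub>X2\<^esub> U2 I = E2 I"
      using alg_hom_simps(2)[OF hom AQ_gens(3,2)[OF I I0]] I0 by (simp add: U2_def D2_def E2_def)
  next
    fix p r assume pr: "p \<in> S" "r \<in> S" "p \<noteq> r" "0 < cox_m W p r"
    note l = alt_lists[OF pr(1,2), of "cox_m W p r"] alt_lists[OF pr(2,1), of "cox_m W p r"]
    have "cl2 (tau_word W S (alt_word (cox_m W p r) p r)) = cl2 (tau_word W S (alt_word (cox_m W p r) r p))"
      using pr l by (intro eq tau_word_closed) (auto simp: J_relations_def simp del: in_lists_conv_set)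
    then show "word_prod X2 (E2 {}) ta2 (alt_word (cox_m W p r) p r) = word_prod X2 (E2 {}) ta2 (alt_word (cox_m W p r) r p)"
      using tw l by (simp del: in_lists_conv_set)
  next
    show "finsum X2 E2 L = \<one>\<^bsub>X2\<^esub>" using un(2) by (simp add: E2_def[abs_def] q_quiver_fields)
  qed (use EE EU U2s in \<open>simp_all add: coxf_axioms Q.alg_axioms ta2_def\<close>)
qed

end

context coxf
begin

subsection \<open>The Hasse quiver\<close>

lemma hasse_fields:
  "verts (hasse_quiver W S) = L"
  "arcs (hasse_quiver W S) = {HUps I J | I J. I \<in> L \<and> J \<in> L \<and> I \<sqsubset>c J} \<union> {HDel J I | I J. I \<in> L \<and> J \<in> L \<and> I \<sqsubset>c J}"
  "tail (hasse_quiver W S) (HUps I J) = J" "head (hasse_quiver W S) (HUps I J) = I"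
  "tail (hasse_quiver W S) (HDel J I) = I" "head (hasse_quiver W S) (HDel J I) = J"
  by (simp_all add: hasse_quiver_def)

lemma quiver_h: "fin_quiver (hasse_quiver W S)"
proof (intro fin_quiver.intro fin_quiver_axioms.intro)
  show "wf_digraph (hasse_quiver W S)"
    by standard (auto simp: hasse_fields)
qed (simp add: hasse_fields finite_L)

end

sublocale coxf \<subseteq> GH: fin_quiver "hasse_quiver W S"
  by (rule quiver_h)

context coxf
begin

abbreviation "AH \<equiv> RHasse W S"

lemma alg_AH: "alg AH"
  unfolding RHasse_def by (rule GH.alg_path)

lemma AH_diff: "x \<in> carrier AH \<Longrightarrow> y \<in> carrier AH \<Longrightarrow> x - y \<in> carrier AH"
  unfolding RHasse_def by (rule GH.path_diff_closed)

lemma AH_gens: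
  "I \<in> L \<Longrightarrow> triv_path I \<in> carrier AH" "J \<in> L \<Longrightarrow> I \<sqsubset>c J \<Longrightarrow> hups W S I J \<in> carrier AH"
  "J \<in> L \<Longrightarrow> I \<sqsubset>c J \<Longrightarrow> hdel W S J I \<in> carrier AH"
  using GH.path_gens(1)[of I] GH.path_gens(2)[of "HUps I J"] GH.path_gens(2)[of "HDel J I"] covered_L
  by (auto simp: RHasse_def hups_def hdel_def hasse_fields)

lemma empty_covered [simp]: "{} \<sqsubset>c {s}"
  by (auto simp: covered_def)

lemma chi_closed: "s \<in> S \<Longrightarrow> chi W S s \<in> carrier AH"
proof -
  assume s: "s \<in> S"
  interpret A: alg AH by (rule alg_AH)
  show ?thesis unfolding chi_def using s by (intro A.smult_closed A.m_closed AH_gens) auto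
qed

lemma chi_word_closed: "u \<in> lists S \<Longrightarrow> chi_word W S u \<in> carrier AH"
proof -
  assume u: "u \<in> lists S"
  interpret A: alg AH by (rule alg_AH)
  show ?thesis unfolding chi_word_def using u chi_closed by (intro A.word_prod_closed AH_gens) auto
qed

lemma subseq_lists: "ws \<in> lists S \<Longrightarrow> strict_subseq y ws \<Longrightarrow> y \<in> lists S"
  using strict_subseq_set[of y ws] by auto

lemma rho_eq:
  assumes "ws \<in> lists S"
  shows "rho W S a I ws = piv I \<odot>\<^bsub>AH\<^esub> (chi_word W S ws \<oplus>\<^bsub>AH\<^esub> of_zq qq \<odot>\<^bsub>AH\<^esub>
    finsum AH (\<lambda>y. of_zq (a y ws) \<odot>\<^bsub>AH\<^esub> chi_word W S y) {y. strict_subseq y ws})"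
    "(\<lambda>y. of_zq (a y ws) \<odot>\<^bsub>AH\<^esub> chi_word W S y) \<in> {y. strict_subseq y ws} \<rightarrow> carrier AH"
proof -
  interpret A: alg AH by (rule alg_AH)
  show c: "(\<lambda>y. of_zq (a y ws) \<odot>\<^bsub>AH\<^esub> chi_word W S y) \<in> {y. strict_subseq y ws} \<rightarrow> carrier AH"
    using chi_word_closed subseq_lists[OF assms] by blast
  show "rho W S a I ws = piv I \<odot>\<^bsub>AH\<^esub> (chi_word W S ws \<oplus>\<^bsub>AH\<^esub> of_zq qq \<odot>\<^bsub>AH\<^esub>
    finsum AH (\<lambda>y. of_zq (a y ws) \<odot>\<^bsub>AH\<^esub> chi_word W S y) {y. strict_subseq y ws})"
    using finsum_pm[OF A.ring_axioms _ _ c] by (simp add: rho_def piv_def RHasse_def path_algebra_fields(4,5))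
qed

lemma rho_closed:
  assumes "ws \<in> lists S"
  shows "rho W S a I ws \<in> carrier AH"
proof -
  interpret A: alg AH by (rule alg_AH)
  show ?thesis
    unfolding rho_eq(1)[OF assms] using rho_eq(2)[OF assms] chi_word_closed[OF assms] by auto
qed

lemma chain_path_eq:
  "chain_path W S Is = word_prod AH \<one>\<^bsub>AH\<^esub> (\<lambda>x. x) (steps (hups W S) Is @ rev (steps (\<lambda>I J. hdel W S J I) Is))"
  by (simp add: chain_path_def steps_def rev_map)

lemma steps_cong:
  assumes "is_ordering I Is" "I \<in> L" and eq: "\<And>J K. K \<in> L \<Longrightarrow> J \<sqsubset>c K \<Longrightarrow> V J K = V' J K"
  shows "steps V Is = steps V' Is"
  using assms(1,2)
proof (induction rule: ordering_induct)
  case (snoc J Is K)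
  then show ?case using covered_L[OF snoc.hyps(2)] eq ordering_last[OF snoc.hyps(1)] by (simp add: steps_snoc)
qed simp

lemma steps_mem:
  assumes "is_ordering I Is" "I \<in> L" and mem: "\<And>J K. K \<in> L \<Longrightarrow> J \<sqsubset>c K \<Longrightarrow> V J K \<in> X"
  shows "set (steps V Is) \<subseteq> X"
  using assms(1,2)
proof (induction rule: ordering_induct)
  case (snoc J Is K)
  then show ?case using covered_L[OF snoc.hyps(2)] mem ordering_last[OF snoc.hyps(1)] by (simp add: steps_snoc)
qed simp

lemma chain_path_closed: "is_ordering I Is \<Longrightarrow> I \<in> L \<Longrightarrow> chain_path W S Is \<in> carrier AH"
proof -
  assume o: "is_ordering I Is" "I \<in> L"
  interpret A: alg AH by (rule alg_AH)
  have "set (steps (hups W S) Is) \<subseteq> carrier AH" "set (steps (\<lambda>I J. hdel W S J I) Is) \<subseteq> carrier AH"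
    by (rule steps_mem[OF o]; simp add: AH_gens(2,3))+
  then show ?thesis unfolding chain_path_eq by (intro A.word_prod_closed) auto
qed

lemma hom_chain_path:
  assumes h: "alg_hom AH B h" and o: "is_ordering I Is" "I \<in> L"
    and V: "\<And>J K. K \<in> L \<Longrightarrow> J \<sqsubset>c K \<Longrightarrow> h (hups W S J K) = V J K"
    and X: "\<And>J K. K \<in> L \<Longrightarrow> J \<sqsubset>c K \<Longrightarrow> h (hdel W S K J) = X K J"
  shows "h (chain_path W S Is) = word_prod B \<one>\<^bsub>B\<^esub> (\<lambda>x. x) (steps V Is @ rev (steps (\<lambda>I J. X J I) Is))"
proof -
  interpret A: alg AH by (rule alg_AH)
  let ?l = "steps (hups W S) Is @ rev (steps (\<lambda>I J. hdel W S J I) Is)"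
  have "set (steps (hups W S) Is) \<subseteq> carrier AH" "set (steps (\<lambda>I J. hdel W S J I) Is) \<subseteq> carrier AH"
    by (rule steps_mem[OF o]; simp add: AH_gens(2,3))+
  then have "h (chain_path W S Is) = word_prod B (h \<one>\<^bsub>AH\<^esub>) (\<lambda>x. h x) ?l"
    unfolding chain_path_eq using alg_hom_simps(1,2)[OF h]
    by (intro conjunct1[OF hom_word_prod]) (auto simp: A.monoid_axioms)
  also have "\<dots> = word_prod B \<one>\<^bsub>B\<^esub> (\<lambda>x. x) (map h ?l)"
    by (simp only: word_prod_map alg_hom_simps(4)[OF h])
  also have "map h ?l = steps (\<lambda>I J. h (hups W S I J)) Is @ rev (steps (\<lambda>I J. h (hdel W S J I)) Is)"
    by (simp add: map_steps rev_map[symmetric])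
  also have "steps (\<lambda>I J. h (hups W S I J)) Is = steps V Is" using V by (intro steps_cong[OF o]) auto
  also have "steps (\<lambda>I J. h (hdel W S J I)) Is = steps (\<lambda>I J. X J I) Is" using X by (intro steps_cong[OF o]) auto
  finally show ?thesis .
qed

lemma hom_chi:
  assumes "alg_hom AH B h" "s \<in> S"
  shows "h (chi W S s) = of_zq (qq + 1) \<odot>\<^bsub>B\<^esub> (h (hups W S {} {s}) \<otimes>\<^bsub>B\<^esub> h (hdel W S {s} {}))"
proof -
  interpret A: alg AH by (rule alg_AH)
  show ?thesis
    using AH_gens(2,3)[OF single_L[OF assms(2)] empty_covered]
    by (simp only: chi_def alg_hom_simps(2,5)[OF assms(1)] A.m_closed)
qed

lemma hom_chi_word:
  assumes h: "alg_hom AH B h" and u: "u \<in> lists S" and ch: "\<And>s. s \<in> S \<Longrightarrow> h (chi W S s) = ch s" and e: "h (triv_path {}) = e"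
  shows "h (chi_word W S u) = word_prod B e ch u"
proof -
  interpret A: alg AH by (rule alg_AH)
  have "h (chi_word W S u) = word_prod B (h (triv_path {})) (\<lambda>s. h (chi W S s)) u"
    unfolding chi_word_def using u alg_hom_simps(1,2)[OF h] chi_closed AH_gens(1)
    by (intro conjunct1[OF hom_word_prod]) (auto simp: A.monoid_axioms)
  also have "\<dots> = word_prod B e ch u" using u ch e by (intro word_prod_cong) auto
  finally show ?thesis .
qed

lemma hom_rho:
  assumes B: "alg B" and h: "alg_hom AH B h" and ws: "ws \<in> lists S"
    and ch: "\<And>s. s \<in> S \<Longrightarrow> h (chi W S s) = ch s" and e: "h (triv_path {}) = e"
  shows "h (rho W S a I ws) = piv I \<odot>\<^bsub>B\<^esub> (word_prod B e ch ws \<oplus>\<^bsub>B\<^esub> of_zq qq \<odot>\<^bsub>B\<^esub>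
    finsum B (\<lambda>y. of_zq (a y ws) \<odot>\<^bsub>B\<^esub> word_prod B e ch y) {y. strict_subseq y ws})"
proof -
  interpret A: alg AH by (rule alg_AH)
  interpret B: alg B by fact
  note c = rho_eq(2)[OF ws]
  have cw: "chi_word W S ws \<in> carrier AH" using chi_word_closed[OF ws] .
  let ?f = "finsum AH (\<lambda>y. of_zq (a y ws) \<odot>\<^bsub>AH\<^esub> chi_word W S y) {y. strict_subseq y ws}"
  have fc: "?f \<in> carrier AH" by (rule A.finsum_closed[OF c])
  have "h (rho W S a I ws) = piv I \<odot>\<^bsub>B\<^esub> (h (chi_word W S ws) \<oplus>\<^bsub>B\<^esub> of_zq qq \<odot>\<^bsub>B\<^esub> h ?f)"
    unfolding rho_eq(1)[OF ws] using cw fc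
    by (simp only: alg_hom_simps(3,5)[OF h] A.smult_closed A.a_closed)
  also have "h ?f = finsum B (\<lambda>y. h (of_zq (a y ws) \<odot>\<^bsub>AH\<^esub> chi_word W S y)) {y. strict_subseq y ws}"
    using additive_finsum(3)[OF A.ring_axioms B.ring_axioms _ _ c] alg_hom_simps(1,3)[OF h] by blast
  also have "\<dots> = finsum B (\<lambda>y. of_zq (a y ws) \<odot>\<^bsub>B\<^esub> word_prod B e ch y) {y. strict_subseq y ws}"
  proof (rule B.finsum_cong')
    fix y assume "y \<in> {y. strict_subseq y ws}"
    then have y: "y \<in> lists S" using subseq_lists[OF ws] by blast
    show "h (of_zq (a y ws) \<odot>\<^bsub>AH\<^esub> chi_word W S y) = of_zq (a y ws) \<odot>\<^bsub>B\<^esub> word_prod B e ch y"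
      using hom_chi_word[OF h y ch e] alg_hom_simps(5)[OF h chi_word_closed[OF y]] by simp
  next
    show "(\<lambda>y. of_zq (a y ws) \<odot>\<^bsub>B\<^esub> word_prod B e ch y) \<in> {y. strict_subseq y ws} \<rightarrow> carrier B"
    proof
      fix y assume "y \<in> {y. strict_subseq y ws}"
      then have y: "y \<in> lists S" using subseq_lists[OF ws] by blast
      show "of_zq (a y ws) \<odot>\<^bsub>B\<^esub> word_prod B e ch y \<in> carrier B"
        using hom_chi_word[OF h y ch e] alg_hom_simps(1)[OF h chi_word_closed[OF y]] by simp
    qed
  qed simp
  finally show ?thesis by (simp only: hom_chi_word[OF h ws ch e])
qed

lemma HJ_relations_eq: "HJ_relations W S rw a =
    {hdel W S J I \<otimes>\<^bsub>AH\<^esub> hups W S I J - triv_path J | I J. I \<in> L \<and> J \<in> L \<and> I \<sqsubset>c J} \<union>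
    {hups W S I J \<otimes>\<^bsub>AH\<^esub> hups W S J K - hups W S I J' \<otimes>\<^bsub>AH\<^esub> hups W S J' K | I J J' K.
         {I, J, J', K} \<subseteq> L \<and> I \<sqsubset>c J \<and> J \<sqsubset>c K \<and> I \<sqsubset>c J' \<and> J' \<sqsubset>c K} \<union>
    {hdel W S K J \<otimes>\<^bsub>AH\<^esub> hdel W S J I - hdel W S K J' \<otimes>\<^bsub>AH\<^esub> hdel W S J' I | I J J' K.
         {I, J, J', K} \<subseteq> L \<and> I \<sqsubset>c J \<and> J \<sqsubset>c K \<and> I \<sqsubset>c J' \<and> J' \<sqsubset>c K} \<union>
    {chain_path W S Is - rho W S a I (rw Is) | I Is. I \<in> L \<and> card I > 1 \<and> is_ordering I Is}"
  by (simp only: HJ_relations_def Let_def)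

lemma HJ_relations_closed: "HJ_relations W S rw a \<subseteq> carrier (path_algebra (hasse_quiver W S))"
proof -
  interpret A: alg AH by (rule alg_AH)
  have "HJ_relations W S rw a \<subseteq> carrier AH"
    unfolding HJ_relations_eq
    using rw_lists by (auto intro!: AH_diff A.m_closed AH_gens chain_path_closed rho_closed simp del: in_lists_conv_set)
  then show ?thesis by (simp add: RHasse_def)
qed

abbreviation "X3 \<equiv> quot_algebra (RHasse W S) (HJ_relations W S rw a)"
abbreviation "cl3 \<equiv> quot_class (RHasse W S) (HJ_relations W S rw a)"

lemma X3_lift:
  assumes q: "hrep W S red rw a B E V X ch"
  shows "\<exists>h. alg_hom X3 B h \<and> (\<forall>I\<in>L. h (cl3 (triv_path I)) = E I) \<and>
    (\<forall>I J. J \<in> L \<longrightarrow> I \<sqsubset>c J \<longrightarrow> h (cl3 (hups W S I J)) = V I J \<and> h (cl3 (hdel W S J I)) = X J I)"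
proof -
  interpret q: hrep W S red rw a B E V X ch by fact
  define F where "F = (\<lambda>e. case e of HUps I J \<Rightarrow> V I J | HDel J I \<Rightarrow> X J I)"
  have FF: "F (HUps I J) = V I J" "F (HDel J I) = X J I" for I J by (simp_all add: F_def)
  have "\<exists>h. alg_hom (quot_algebra (path_algebra (hasse_quiver W S)) (HJ_relations W S rw a)) B h \<and>
    (\<forall>v\<in>verts (hasse_quiver W S). h (quot_class (path_algebra (hasse_quiver W S)) (HJ_relations W S rw a) (triv_path v)) = E v) \<and>
    (\<forall>e\<in>arcs (hasse_quiver W S). h (quot_class (path_algebra (hasse_quiver W S)) (HJ_relations W S rw a) (arrow (hasse_quiver W S) e)) = F e)"
  proof (rule GH.path_quot_lift[OF q.B.alg_axioms _ _ _ _ _ _ HJ_relations_closed])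
    fix h x
    assume h: "alg_hom (path_algebra (hasse_quiver W S)) B h"
      and hv: "\<And>v. v \<in> verts (hasse_quiver W S) \<Longrightarrow> h (triv_path v) = E v"
      and ha: "\<And>e. e \<in> arcs (hasse_quiver W S) \<Longrightarrow> h (arrow (hasse_quiver W S) e) = F e"
      and x: "x \<in> HJ_relations W S rw a"
    note h' = h[folded RHasse_def]
    interpret A: alg AH by (rule alg_AH)
    have h0: "h (triv_path I) = E I" if "I \<in> L" for I using hv that by (simp add: hasse_fields)
    have hu: "h (hups W S I J) = V I J" "h (hdel W S J I) = X J I" if "J \<in> L" "I \<sqsubset>c J" for I J
      using ha[of "HUps I J"] ha[of "HDel J I"] that covered_L[of I J] by (auto simp: hasse_fields hups_def hdel_def FF)
    have hc: "h (chi W S s) = ch s" if "s \<in> S" for s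
      using hom_chi[OF h' that] hu[OF single_L[OF that] empty_covered] by (simp add: q.ch)
    have diff: "h (x - y) = h x \<ominus>\<^bsub>B\<^esub> h y" if "x \<in> carrier AH" "y \<in> carrier AH" for x y
      using GH.path_diff_hom[OF q.B.alg_axioms h] that by (simp add: RHasse_def)
    have zero: "h (x - y) = \<zero>\<^bsub>B\<^esub>" if "x \<in> carrier AH" "y \<in> carrier AH" "h x = h y" for x y
      using diff[OF that(1,2)] alg_hom_simps(1)[OF h' that(2)] that(3) by simp
    note hm = alg_hom_simps(2)[OF h']
    from x show "h x = \<zero>\<^bsub>B\<^esub>" unfolding HJ_relations_eq
    proof (elim UnE CollectE exE conjE)
      fix I J assume J: "I \<in> L" "J \<in> L" "I \<sqsubset>c J" and x: "x = hdel W S J I \<otimes>\<^bsub>AH\<^esub> hups W S I J - triv_path J"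
      show ?thesis
        unfolding x using J AH_gens hu h0 q.XV
        by (intro zero A.m_closed AH_gens) (simp_all add: hm)
    next
      fix I J J' K assume l: "{I, J, J', K} \<subseteq> L" "I \<sqsubset>c J" "J \<sqsubset>c K" "I \<sqsubset>c J'" "J' \<sqsubset>c K"
        and x: "x = hups W S I J \<otimes>\<^bsub>AH\<^esub> hups W S J K - hups W S I J' \<otimes>\<^bsub>AH\<^esub> hups W S J' K"
      then show ?thesis
        unfolding x using AH_gens hu q.VV[of K I J J'] by (intro zero A.m_closed AH_gens) (simp_all add: hm)
    next
      fix I J J' K assume l: "{I, J, J', K} \<subseteq> L" "I \<sqsubset>c J" "J \<sqsubset>c K" "I \<sqsubset>c J'" "J' \<sqsubset>c K"
        and x: "x = hdel W S K J \<otimes>\<^bsub>AH\<^esub> hdel W S J I - hdel W S K J' \<otimes>\<^bsub>AH\<^esub> hdel W S J' I"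
      then show ?thesis
        unfolding x using AH_gens hu q.XX[of K I J J'] by (intro zero A.m_closed AH_gens) (simp_all add: hm)
    next
      fix I Is assume I: "I \<in> L" "1 < card I" "is_ordering I Is" and x: "x = chain_path W S Is - rho W S a I (rw Is)"
      show ?thesis
        unfolding x
      proof (rule zero[OF chain_path_closed[OF I(3,1)] rho_closed[OF rw_lists[OF I(1,3)]]])
        show "h (chain_path W S Is) = h (rho W S a I (rw Is))"
          using hom_chain_path[OF h' I(3,1) hu] hom_rho[OF q.B.alg_axioms h' rw_lists[OF I(1,3)] hc h0[OF empty_L], of I]
            q.chain[OF I] by simp
      qed
    qed
  qed (auto simp: hasse_fields FF q.EE q.E1 q.EV q.EX)
  then obtain h where h: "alg_hom X3 B h" "\<And>I. I \<in> L \<Longrightarrow> h (cl3 (triv_path I)) = E I"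
    "\<And>e. e \<in> arcs (hasse_quiver W S) \<Longrightarrow> h (cl3 (arrow (hasse_quiver W S) e)) = F e"
    by (auto simp: RHasse_def hasse_fields(1))
  have "h (cl3 (hups W S I J)) = V I J \<and> h (cl3 (hdel W S J I)) = X J I" if "J \<in> L" "I \<sqsubset>c J" for I J
    using h(3)[of "HUps I J"] h(3)[of "HDel J I"] that covered_L[of I J] by (auto simp: hasse_fields hups_def hdel_def FF)
  then show ?thesis using h(1,2) by blast
qed

lemma X3_ext:
  assumes B: "alg B" and f: "alg_hom X3 B f" and g: "alg_hom X3 B g"
    and v: "\<And>I. I \<in> L \<Longrightarrow> f (cl3 (triv_path I)) = g (cl3 (triv_path I))"
    and u: "\<And>I J. J \<in> L \<Longrightarrow> I \<sqsubset>c J \<Longrightarrow> f (cl3 (hups W S I J)) = g (cl3 (hups W S I J))"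
    and d: "\<And>I J. J \<in> L \<Longrightarrow> I \<sqsubset>c J \<Longrightarrow> f (cl3 (hdel W S J I)) = g (cl3 (hdel W S J I))"
    and y: "y \<in> carrier X3"
  shows "f y = g y"
proof (rule GH.path_quot_ext[OF B HJ_relations_closed f[unfolded RHasse_def] g[unfolded RHasse_def] _ _ y[unfolded RHasse_def]])
  show "f (quot_class (path_algebra (hasse_quiver W S)) (HJ_relations W S rw a) (triv_path I)) =
    g (quot_class (path_algebra (hasse_quiver W S)) (HJ_relations W S rw a) (triv_path I))" if "I \<in> verts (hasse_quiver W S)" for I
    using v[of I] that by (simp add: RHasse_def hasse_fields(1))
  show "f (quot_class (path_algebra (hasse_quiver W S)) (HJ_relations W S rw a) (arrow (hasse_quiver W S) e)) =
    g (quot_class (path_algebra (hasse_quiver W S)) (HJ_relations W S rw a) (arrow (hasse_quiver W S) e))" if "e \<in> arcs (hasse_quiver W S)" for e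
    using that u d by (auto simp: RHasse_def hasse_fields(2) hups_def hdel_def)
qed

definition "E3 I = cl3 (triv_path I)"
definition "V3 I J = cl3 (hups W S I J)"
definition "D3 J I = cl3 (hdel W S J I)"
definition "ch3 s = of_zq (qq + 1) \<odot>\<^bsub>X3\<^esub> (V3 {} {s} \<otimes>\<^bsub>X3\<^esub> D3 {s} {})"

lemma quot_X3: "quot_alg' AH (HJ_relations W S rw a)"
  using alg_AH HJ_relations_closed by (intro quot_alg'.intro quot_alg'_axioms.intro) (simp_all add: RHasse_def)

lemma hrep_X3: "hrep W S red rw a X3 E3 V3 D3 ch3"
proof -
  interpret A: quot_alg' AH "HJ_relations W S rw a" by (rule quot_X3)
  interpret Q: alg X3 by (rule A.alg_Q)
  note hom = A.alg_hom_cls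
  note un = GH.path_quot_units[OF HJ_relations_closed, folded RHasse_def]
  have eq: "cl3 x = cl3 y" if "x \<in> carrier AH" "y \<in> carrier AH" "x - y \<in> HJ_relations W S rw a" for x y
    using A.cls_diff[OF that(1,2)] GH.path_minus[of x y] that by (simp add: RHasse_def)
  have hm: "cl3 (x \<otimes>\<^bsub>AH\<^esub> y) = cl3 x \<otimes>\<^bsub>X3\<^esub> cl3 y" if "x \<in> carrier AH" "y \<in> carrier AH" for x y
    using alg_hom_simps(2)[OF hom that] .
  have hc: "cl3 (chi W S s) = ch3 s" if "s \<in> S" for s
    using hom_chi[OF hom that] by (simp add: ch3_def V3_def D3_def)
  show ?thesis
  proof (intro hrep.intro hrep_axioms.intro)
    fix I assume "I \<in> L"
    then show "E3 I \<in> carrier X3" using alg_hom_simps(1)[OF hom] AH_gens by (simp add: E3_def)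
  next
    fix I J assume J: "J \<in> L" "I \<sqsubset>c J"
    then have I: "I \<in> L" using covered_L by blast
    note g = AH_gens(2,3)[OF J]
    show "V3 I J \<in> carrier X3" "D3 J I \<in> carrier X3" using alg_hom_simps(1)[OF hom] g by (simp_all add: V3_def D3_def)
    have "HUps I J \<in> arcs (hasse_quiver W S)" "HDel J I \<in> arcs (hasse_quiver W S)" using J I by (auto simp: hasse_fields)
    then show "E3 I \<otimes>\<^bsub>X3\<^esub> V3 I J = V3 I J" "V3 I J \<otimes>\<^bsub>X3\<^esub> E3 J = V3 I J"
      "E3 J \<otimes>\<^bsub>X3\<^esub> D3 J I = D3 J I" "D3 J I \<otimes>\<^bsub>X3\<^esub> E3 I = D3 J I"
      using un(3)[of "HUps I J"] un(4)[of "HUps I J"] un(3)[of "HDel J I"] un(4)[of "HDel J I"]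
      by (simp_all add: E3_def V3_def D3_def hups_def hdel_def hasse_fields(3-6))
    have "cl3 (hdel W S J I \<otimes>\<^bsub>AH\<^esub> hups W S I J) = cl3 (triv_path J)"
      using I J g AH_gens(1) by (intro eq A.m_closed) (auto simp: HJ_relations_eq)
    then show "D3 J I \<otimes>\<^bsub>X3\<^esub> V3 I J = E3 J" using hm g by (simp add: E3_def V3_def D3_def)
  next
    fix I J J' K assume K: "K \<in> L" "I \<sqsubset>c J" "J \<sqsubset>c K" "I \<sqsubset>c J'" "J' \<sqsubset>c K"
    have l: "J \<in> L" "J' \<in> L" using covered_L[OF K(3,1)] covered_L[OF K(5,1)] .
    then have I: "I \<in> L" using covered_L[OF K(2)] by blast
    have g: "hups W S I J \<in> carrier AH" "hups W S I J' \<in> carrier AH" "hups W S J K \<in> carrier AH" "hups W S J' K \<in> carrier AH"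
      "hdel W S J I \<in> carrier AH" "hdel W S J' I \<in> carrier AH" "hdel W S K J \<in> carrier AH" "hdel W S K J' \<in> carrier AH"
      using AH_gens(2,3) K l by auto
    have r: "{I, J, J', K} \<subseteq> L \<and> I \<sqsubset>c J \<and> J \<sqsubset>c K \<and> I \<sqsubset>c J' \<and> J' \<sqsubset>c K" using I l K by simp
    have "cl3 (hups W S I J \<otimes>\<^bsub>AH\<^esub> hups W S J K) = cl3 (hups W S I J' \<otimes>\<^bsub>AH\<^esub> hups W S J' K)"
    proof (rule eq)
      show "hups W S I J \<otimes>\<^bsub>AH\<^esub> hups W S J K - hups W S I J' \<otimes>\<^bsub>AH\<^esub> hups W S J' K \<in> HJ_relations W S rw a"
        unfolding HJ_relations_eq
        by (rule UnI1, rule UnI1, rule UnI2, rule CollectI, rule exI[of _ I], rule exI[of _ J],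
            rule exI[of _ J'], rule exI[of _ K], rule conjI[OF refl r])
    qed (use g in auto)
    then show "V3 I J \<otimes>\<^bsub>X3\<^esub> V3 J K = V3 I J' \<otimes>\<^bsub>X3\<^esub> V3 J' K" using hm g by (simp add: V3_def)
    have "cl3 (hdel W S K J \<otimes>\<^bsub>AH\<^esub> hdel W S J I) = cl3 (hdel W S K J' \<otimes>\<^bsub>AH\<^esub> hdel W S J' I)"
    proof (rule eq)
      show "hdel W S K J \<otimes>\<^bsub>AH\<^esub> hdel W S J I - hdel W S K J' \<otimes>\<^bsub>AH\<^esub> hdel W S J' I \<in> HJ_relations W S rw a"
        unfolding HJ_relations_eq
        by (rule UnI1, rule UnI2, rule CollectI, rule exI[of _ I], rule exI[of _ J],
            rule exI[of _ J'], rule exI[of _ K], rule conjI[OF refl r])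
    qed (use g in auto)
    then show "D3 K J \<otimes>\<^bsub>X3\<^esub> D3 J I = D3 K J' \<otimes>\<^bsub>X3\<^esub> D3 J' I" using hm g by (simp add: D3_def)
  next
    fix I Is assume I: "I \<in> L" "1 < card I" "is_ordering I Is"
    have "cl3 (chain_path W S Is) = cl3 (rho W S a I (rw Is))"
    proof (rule eq[OF chain_path_closed[OF I(3,1)] rho_closed[OF rw_lists[OF I(1,3)]]])
      show "chain_path W S Is - rho W S a I (rw Is) \<in> HJ_relations W S rw a"
        unfolding HJ_relations_eq
        by (rule UnI2, rule CollectI, rule exI[of _ I], rule exI[of _ Is]) (use I in simp)
    qed
    moreover have "cl3 (chain_path W S Is) = word_prod X3 \<one>\<^bsub>X3\<^esub> (\<lambda>x. x) (steps V3 Is @ rev (steps (\<lambda>I J. D3 J I) Is))"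
      by (rule hom_chain_path[OF hom I(3,1)]) (simp_all add: V3_def D3_def)
    moreover have "cl3 (rho W S a I (rw Is)) = piv I \<odot>\<^bsub>X3\<^esub> (word_prod X3 (E3 {}) ch3 (rw Is) \<oplus>\<^bsub>X3\<^esub> of_zq qq \<odot>\<^bsub>X3\<^esub>
        finsum X3 (\<lambda>y. of_zq (a y (rw Is)) \<odot>\<^bsub>X3\<^esub> word_prod X3 (E3 {}) ch3 y) {y. strict_subseq y (rw Is)})"
      by (rule hom_rho[OF Q.alg_axioms hom rw_lists[OF I(1,3)] hc]) (simp_all add: E3_def)
    ultimately show "word_prod X3 \<one>\<^bsub>X3\<^esub> (\<lambda>x. x) (steps V3 Is @ rev (steps (\<lambda>I J. D3 J I) Is)) =
      piv I \<odot>\<^bsub>X3\<^esub> (word_prod X3 (E3 {}) ch3 (rw Is) \<oplus>\<^bsub>X3\<^esub> of_zq qq \<odot>\<^bsub>X3\<^esub>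
        finsum X3 (\<lambda>y. of_zq (a y (rw Is)) \<odot>\<^bsub>X3\<^esub> word_prod X3 (E3 {}) ch3 y) {y. strict_subseq y (rw Is)})"
      by simp
  next
    show "finsum X3 E3 L = \<one>\<^bsub>X3\<^esub>" using un(2) by (simp add: E3_def[abs_def] hasse_fields(1))
    show "E3 I \<otimes>\<^bsub>X3\<^esub> E3 J = (if I = J then E3 I else \<zero>\<^bsub>X3\<^esub>)" if "I \<in> L" "J \<in> L" for I J
      using un(1)[of I J] that by (simp add: E3_def hasse_fields(1))
  qed (simp_all add: coxf_axioms Q.alg_axioms ch3_def)
qed

text \<open>The maps exist because \<open>X3\<close> carries the data of \<open>qrep\<close> and
  \<open>X2\<close> those of \<open>hrep\<close>. Both composites are homomorphisms, so it suffices
  that they fix the vertices and arrows: one way by \<open>telescope\<close>, the other way by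
  \<open>UDh_step\<close>.\<close>

theorem X2_iso_X3: "alg_isomorphic X2 X3"
proof -
  interpret q: qrep W S red rw a X2 E2 U2 D2 ta2 by (rule qrep_X2)
  interpret h: hrep W S red rw a X3 E3 V3 D3 ch3 by (rule hrep_X3)
  obtain f where f: "alg_hom X2 X3 f" "\<And>I. I \<in> L \<Longrightarrow> f (E2 I) = E3 I"
    "\<And>I. I \<in> L \<Longrightarrow> I \<noteq> {} \<Longrightarrow> f (cl2 (ups W S I)) = h.Uh I \<and> f (cl2 (del W S I)) = h.Dh I"
    using X2_lift[OF h.qrep_UDh] by (auto simp: E2_def)
  have f': "f (U2 I) = h.Uh I" "f (D2 I) = h.Dh I" if "I \<in> L" for I
    using f(2)[of "{}"] f(3)[OF that] h.UDh_empty by (auto simp: U2_def D2_def E2_def)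
  obtain g where g: "alg_hom X3 X2 g" "\<And>I. I \<in> L \<Longrightarrow> g (E3 I) = E2 I"
    "\<And>I J. J \<in> L \<Longrightarrow> I \<sqsubset>c J \<Longrightarrow> g (V3 I J) = q.VQ I J"
    "\<And>I J. J \<in> L \<Longrightarrow> I \<sqsubset>c J \<Longrightarrow> g (D3 J I) = q.VQ J I"
    using X3_lift[OF q.hrep_VQ] unfolding E3_def V3_def D3_def by blast
  have gs: "g (word_prod X3 \<one>\<^bsub>X3\<^esub> (\<lambda>x. x) l) = word_prod X2 \<one>\<^bsub>X2\<^esub> (\<lambda>x. x) (map g l)" if "set l \<subseteq> carrier X3" for l
  proof -
    have "g (word_prod X3 \<one>\<^bsub>X3\<^esub> (\<lambda>x. x) l) = word_prod X2 (g \<one>\<^bsub>X3\<^esub>) (\<lambda>x. g x) l"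
      using that alg_hom_simps(1,2)[OF g(1)] by (intro conjunct1[OF hom_word_prod]) (auto simp: h.B.monoid_axioms)
    then show ?thesis by (simp add: word_prod_map alg_hom_simps(4)[OF g(1)])
  qed
  \<comment> \<open>The map \<open>g\<close> sends a chain of Hasse arrows to the corresponding
    chain of products of arrows in \<open>X2\<close>, and \<open>telescope\<close> collapses this
    chain.\<close>
  have gU: "g (h.Uh I) = U2 I" "g (h.Dh I) = D2 I" if I: "I \<in> L" for I
  proof -
    note o = h.oo[OF I]
    note c = h.steps_closed[OF o I] and w = h.w_closed[OF o I]
    have "map g (steps V3 (h.oo I)) = steps q.VQ (h.oo I)"
      unfolding map_steps using g(3) by (intro steps_cong[OF o I]) auto
    then have 1: "g (h.wU (h.oo I)) = word_prod X2 \<one>\<^bsub>X2\<^esub> (\<lambda>x. x) (steps q.VQ (h.oo I))"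
      using gs c by simp
    have "map g (steps (\<lambda>I J. D3 J I) (h.oo I)) = steps (\<lambda>I J. q.VQ J I) (h.oo I)"
      unfolding map_steps using g(4) by (intro steps_cong[OF o I]) auto
    then have 2: "g (h.wD (h.oo I)) = word_prod X2 \<one>\<^bsub>X2\<^esub> (\<lambda>x. x) (rev (steps (\<lambda>I J. q.VQ J I) (h.oo I)))"
      using gs[of "rev (steps (\<lambda>I J. D3 J I) (h.oo I))"] c by (simp add: rev_map[symmetric])
    show "g (h.Uh I) = U2 I" "g (h.Dh I) = D2 I"
      unfolding h.Uh_def h.Dh_def using q.telescope[OF o I] w h.E_empty(1) 1 2 g(2)[of "{}"]
      by (simp_all add: alg_hom_simps(2)[OF g(1)])
  qed
  show ?thesis
  proof (rule alg_isomorphicI[OF f(1) g(1)])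
    fix x assume x: "x \<in> carrier X2"
    show "g (f x) = x"
    proof (rule X2_ext[OF q.B.alg_axioms alg_hom_comp[OF f(1) g(1)] alg_hom_id[OF q.B.alg_axioms] _ _ _ x])
      show "g (f (cl2 (triv_path I))) = cl2 (triv_path I)" if "I \<in> L" for I
        using f(2) g(2) that by (simp add: E2_def)
      show "g (f (cl2 (ups W S I))) = cl2 (ups W S I)" "g (f (cl2 (del W S I))) = cl2 (del W S I)" if "I \<in> L" "I \<noteq> {}" for I
        using f(3)[OF that] gU[OF that(1)] that(2) by (simp_all add: U2_def D2_def)
    qed
  next
    fix x assume x: "x \<in> carrier X3"
    show "f (g x) = x"
    proof (rule X3_ext[OF h.B.alg_axioms alg_hom_comp[OF g(1) f(1)] alg_hom_id[OF h.B.alg_axioms] _ _ _ x])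
      show "f (g (cl3 (triv_path I))) = cl3 (triv_path I)" if "I \<in> L" for I
        using f(2) g(2) that by (simp add: E3_def)
      fix I J assume J: "J \<in> L" "I \<sqsubset>c J"
      then have I: "I \<in> L" using covered_L by blast
      show "f (g (cl3 (hups W S I J))) = cl3 (hups W S I J)"
        using g(3)[OF J] f'[OF I] f'[OF J(1)] h.UDh_step(3)[OF J(2,1)] I J
        by (simp add: V3_def[symmetric] alg_hom_simps(2)[OF f(1)])
      show "f (g (cl3 (hdel W S J I))) = cl3 (hdel W S J I)"
        using g(4)[OF J] f'[OF I] f'[OF J(1)] h.UDh_step(4)[OF J(2,1)] I J
        by (simp add: D3_def[symmetric] alg_hom_simps(2)[OF f(1)])
    qed
  qed
qed

end

subsection \<open>Extension of scalars\<close>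

locale scalar_ext = A: alg A for A :: "('k::comm_ring_1, 'a) module" +
  fixes \<phi> :: "'k \<Rightarrow> 'r::comm_ring_1"
  assumes \<phi>: "\<phi> (x + y) = \<phi> x + \<phi> y" "\<phi> (x * y) = \<phi> x * \<phi> y" "\<phi> 1 = 1"
begin

abbreviation "TF \<equiv> (tensor_free A :: ('r, ('r \<times> 'a) \<Rightarrow>\<^sub>0 int) module)"
abbreviation "TR \<equiv> tensor_relations \<phi> A"
abbreviation "TE \<equiv> extend_scalars \<phi> A"
abbreviation "pt r a \<equiv> (Poly_Mapping.single (r, a) 1 :: ('r \<times> 'a) \<Rightarrow>\<^sub>0 int)"

lemma TF_fields:
  "carrier TF = {f. Poly_Mapping.keys f \<subseteq> UNIV \<times> carrier A}"
  "monoid.mult TF = bilinear_ext (\<lambda>(r, a) (r', a'). Poly_Mapping.single (r * r', a \<otimes>\<^bsub>A\<^esub> a') 1)"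
  "one TF = pt 1 \<one>\<^bsub>A\<^esub>" "zero TF = 0" "add TF = (+)"
  "module.smult TF = (\<lambda>r f. \<Sum>(r', a)\<in>Poly_Mapping.keys f. Poly_Mapping.single (r * r', a) (Poly_Mapping.lookup f (r', a)))"
  by (simp_all add: tensor_free_def)

lemma ring_TF: "ring TF"
  by (rule ring_pmI[OF TF_fields(1-5)]) (auto simp: pm_scale_simps A.m_assoc mult.assoc)

lemma pt_closed [simp]: "a \<in> carrier A \<Longrightarrow> Poly_Mapping.single (r, a) n \<in> carrier TF"
  by (simp add: TF_fields(1))

lemma TF_diff: "x \<in> carrier TF \<Longrightarrow> y \<in> carrier TF \<Longrightarrow> x - y \<in> carrier TF"
  using keys_minus[of x y] by (auto simp: TF_fields(1))

lemma TR_closed: "TR \<subseteq> carrier TF"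
  unfolding tensor_relations_def Let_def by (auto intro!: TF_diff)

lemma TF_smult: assumes "x \<in> carrier TF" shows "r \<odot>\<^bsub>TF\<^esub> x = pt r \<one>\<^bsub>A\<^esub> \<otimes>\<^bsub>TF\<^esub> x"
proof -
  have "pt r \<one>\<^bsub>A\<^esub> \<otimes>\<^bsub>TF\<^esub> x = (\<Sum>y\<in>Poly_Mapping.keys x. pm_scale (Poly_Mapping.lookup x y)
      ((\<lambda>(r, a) (r', a'). Poly_Mapping.single (r * r', a \<otimes>\<^bsub>A\<^esub> a') 1) (r, \<one>\<^bsub>A\<^esub>) y))"
    unfolding TF_fields(2) by (subst bilinear_ext_superset[where X = "{(r, \<one>\<^bsub>A\<^esub>)}" and Y = "Poly_Mapping.keys x"]) auto
  also have "\<dots> = r \<odot>\<^bsub>TF\<^esub> x"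
    unfolding TF_fields(6) using assms by (intro sum.cong) (auto simp: pm_scale_simps TF_fields(1) subset_iff)
  finally show ?thesis by simp
qed

end

sublocale scalar_ext \<subseteq> T: quot_alg "tensor_free A :: ('r::comm_ring_1, ('r \<times> 'a) \<Rightarrow>\<^sub>0 int) module"
    "tensor_relations \<phi> A" "\<lambda>r. Poly_Mapping.single (r, \<one>\<^bsub>A\<^esub>) 1"
  using ring_TF TR_closed TF_smult by (intro quot_alg.intro quot_alg_axioms.intro) auto

context scalar_ext
begin

lemma TE_eq: "quot_algebra TF TR = TE"
  by (simp add: extend_scalars_def)

definition pure :: "'r \<Rightarrow> 'a \<Rightarrow> (('r \<times> 'a) \<Rightarrow>\<^sub>0 int) set"
  where "pure r a = quot_class TF TR (pt r a)"

lemma TE_ring: "ring TE"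
  using T.ring_Q by (simp add: TE_eq)

end

sublocale scalar_ext \<subseteq> TE: ring "extend_scalars \<phi> A"
  by (rule TE_ring)

context scalar_ext
begin

lemma tcls_hom: "alg_hom TF TE (quot_class TF TR)"
  using T.cls_hom T.cls_smult by (simp add: alg_hom_def TE_eq)

lemma pure_closed [simp]: "a \<in> carrier A \<Longrightarrow> pure r a \<in> carrier TE"
  unfolding pure_def by (rule alg_hom_simps(1)[OF tcls_hom]) simp

lemma tensor_relation:
  assumes "x - y - z \<in> TR" "x \<in> carrier TF" "y \<in> carrier TF" "z \<in> carrier TF"
  shows "quot_class TF TR x = quot_class TF TR y \<oplus>\<^bsub>TE\<^esub> quot_class TF TR z"
proof -
  let ?c = "quot_class TF TR"
  have c: "?c x \<in> carrier TE" "?c y \<in> carrier TE" "?c z \<in> carrier TE"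
    using alg_hom_simps(1)[OF tcls_hom] assms by auto
  have "\<zero>\<^bsub>TE\<^esub> = ?c (x - y - z)" using T.cls_zero[OF assms(1)] by (simp add: TE_eq)
  also have "\<dots> = ?c x \<ominus>\<^bsub>TE\<^esub> ?c y \<ominus>\<^bsub>TE\<^esub> ?c z"
    using alg_hom_diff[OF T.ring_axioms TF_fields(5) TE.ring_axioms tcls_hom] assms TF_diff by simp
  finally have "?c x \<ominus>\<^bsub>TE\<^esub> ?c y \<ominus>\<^bsub>TE\<^esub> ?c z = \<zero>\<^bsub>TE\<^esub>" by (rule sym)
  then have "?c x \<ominus>\<^bsub>TE\<^esub> ?c y = ?c z" using TE.r_right_minus_eq TE.minus_closed c by blast
  then have "?c z = ?c x \<ominus>\<^bsub>TE\<^esub> ?c y" by (rule sym)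
  then show ?thesis using c by (simp add: a_minus_def TE.a_lcomm[of "?c y" "?c x"] TE.r_neg)
qed

lemma pure_simps:
  "a \<in> carrier A \<Longrightarrow> pure (r + r') a = pure r a \<oplus>\<^bsub>TE\<^esub> pure r' a"
  "a \<in> carrier A \<Longrightarrow> a' \<in> carrier A \<Longrightarrow> pure r (a \<oplus>\<^bsub>A\<^esub> a') = pure r a \<oplus>\<^bsub>TE\<^esub> pure r a'"
  "a \<in> carrier A \<Longrightarrow> pure (r * \<phi> c) a = pure r (c \<odot>\<^bsub>A\<^esub> a)"
  "a \<in> carrier A \<Longrightarrow> a' \<in> carrier A \<Longrightarrow> pure r a \<otimes>\<^bsub>TE\<^esub> pure r' a' = pure (r * r') (a \<otimes>\<^bsub>A\<^esub> a')"
  "pure 1 \<one>\<^bsub>A\<^esub> = \<one>\<^bsub>TE\<^esub>"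
  "a \<in> carrier A \<Longrightarrow> s \<odot>\<^bsub>TE\<^esub> pure r a = pure (s * r) a"
proof -
  show "pure (r + r') a = pure r a \<oplus>\<^bsub>TE\<^esub> pure r' a" if "a \<in> carrier A"
    unfolding pure_def using that by (intro tensor_relation) (auto simp: tensor_relations_def Let_def)
  show "pure r (a \<oplus>\<^bsub>A\<^esub> a') = pure r a \<oplus>\<^bsub>TE\<^esub> pure r a'" if "a \<in> carrier A" "a' \<in> carrier A"
    unfolding pure_def using that by (intro tensor_relation) (auto simp: tensor_relations_def Let_def)
  show "pure (r * \<phi> c) a = pure r (c \<odot>\<^bsub>A\<^esub> a)" if a: "a \<in> carrier A"
  proof -
    have "pt (r * \<phi> c) a - pt r (c \<odot>\<^bsub>A\<^esub> a) \<in> TR" using a by (auto simp: tensor_relations_def Let_def)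
    then have "\<zero>\<^bsub>TE\<^esub> = quot_class TF TR (pt (r * \<phi> c) a - pt r (c \<odot>\<^bsub>A\<^esub> a))" using T.cls_zero by (simp add: TE_eq)
    also have "\<dots> = pure (r * \<phi> c) a \<ominus>\<^bsub>TE\<^esub> pure r (c \<odot>\<^bsub>A\<^esub> a)"
      unfolding pure_def using a
      by (intro alg_hom_diff[OF T.ring_axioms TF_fields(5) TE.ring_axioms tcls_hom] TF_diff) auto
    finally have "pure (r * \<phi> c) a \<ominus>\<^bsub>TE\<^esub> pure r (c \<odot>\<^bsub>A\<^esub> a) = \<zero>\<^bsub>TE\<^esub>" by (rule sym)
    then show ?thesis using a by (subst (asm) TE.r_right_minus_eq) auto
  qed
  show "pure r a \<otimes>\<^bsub>TE\<^esub> pure r' a' = pure (r * r') (a \<otimes>\<^bsub>A\<^esub> a')" if "a \<in> carrier A" "a' \<in> carrier A"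
    unfolding pure_def using alg_hom_simps(2)[OF tcls_hom, of "pt r a" "pt r' a'"] that
    by (simp add: TF_fields(2) pm_scale_simps)
  show "pure 1 \<one>\<^bsub>A\<^esub> = \<one>\<^bsub>TE\<^esub>"
    unfolding pure_def using alg_hom_simps(4)[OF tcls_hom] by (simp add: TF_fields(3))
  show "s \<odot>\<^bsub>TE\<^esub> pure r a = pure (s * r) a" if "a \<in> carrier A"
    unfolding pure_def using alg_hom_simps(5)[OF tcls_hom, of "pt r a" s] that by (simp add: TF_fields(6))
qed

lemma pure_zero: "a \<in> carrier A \<Longrightarrow> pure 0 a = \<zero>\<^bsub>TE\<^esub>" "pure r \<zero>\<^bsub>A\<^esub> = \<zero>\<^bsub>TE\<^esub>"
  using pure_simps(1)[of a 0 0] pure_simps(2)[of "\<zero>\<^bsub>A\<^esub>" "\<zero>\<^bsub>A\<^esub>" r] by simp_all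

lemma pure_neg: "a \<in> carrier A \<Longrightarrow> pure (- r) a = \<ominus>\<^bsub>TE\<^esub> pure r a"
  using pure_simps(1)[of a "- r" r] pure_zero(1)[of a] by (intro TE.minus_equality[symmetric]) auto

text \<open>Coefficients in the free group are integers, so a multiple of a pure tensor is built by
  repeatedly adding \<open>pure r a\<close> or \<open>pure (- r) a\<close>. The negative of a pure
  tensor is again pure, so closure under sums is enough.\<close>

lemma tensor_induct [consumes 1, case_names pure add]:
  assumes y: "y \<in> carrier TE"
    and P: "\<And>r a. a \<in> carrier A \<Longrightarrow> P (pure r a)"
    and add: "\<And>x y. x \<in> carrier TE \<Longrightarrow> y \<in> carrier TE \<Longrightarrow> P x \<Longrightarrow> P y \<Longrightarrow> P (x \<oplus>\<^bsub>TE\<^esub> y)"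
  shows "P y"
proof -
  obtain x where x: "x \<in> carrier TF" "y = quot_class TF TR x"
    using T.cls_surj y by (auto simp: TE_eq)
  let ?c = "quot_class TF TR"
  have hadd: "?c (f + g) = ?c f \<oplus>\<^bsub>TE\<^esub> ?c g" if "f \<in> carrier TF" "g \<in> carrier TF" for f g
    using alg_hom_simps(3)[OF tcls_hom that] by (simp add: TF_fields(5))
  have c0: "?c 0 = \<zero>\<^bsub>TE\<^esub>"
    using additive_finsum(1)[OF T.ring_axioms TE.ring_axioms] alg_hom_simps(1,3)[OF tcls_hom]
    by (metis TF_fields(4))
  have P0: "P \<zero>\<^bsub>TE\<^esub>" using P[of "\<one>\<^bsub>A\<^esub>" 0] by (simp add: pure_zero)
  have "Poly_Mapping.keys x \<subseteq> UNIV \<times> carrier A" using x by (simp add: TF_fields(1))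
  then have "P (?c x)"
  proof (induction x rule: pm_induct)
    case zero
    then show ?case using c0 P0 by simp
  next
    case (single k n)
    obtain r a where k: "k = (r, a)" "a \<in> carrier A" using single by (cases k) auto
    show ?case
    proof (induction n rule: int_induct[where k = 0])
      case base
      then show ?case using c0 P0 by simp
    next
      case (step1 i)
      have "?c (Poly_Mapping.single k (i + 1)) = ?c (Poly_Mapping.single k i) \<oplus>\<^bsub>TE\<^esub> pure r a"
        unfolding single_add pure_def k using k by (intro hadd) auto
      then show ?case using step1 k alg_hom_simps(1)[OF tcls_hom] P by (auto intro!: add)
    next
      case (step2 i)
      have "?c (Poly_Mapping.single k i) = ?c (Poly_Mapping.single k (i - 1)) \<oplus>\<^bsub>TE\<^esub> pure r a"
        using hadd[of "Poly_Mapping.single k (i - 1)" "pt r a"] k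
        by (simp add: pure_def single_add[symmetric])
      then have "?c (Poly_Mapping.single k (i - 1)) = ?c (Poly_Mapping.single k i) \<oplus>\<^bsub>TE\<^esub> pure (- r) a"
        using k alg_hom_simps(1)[OF tcls_hom, of "Poly_Mapping.single k (i - 1)"]
        by (simp add: pure_neg TE.a_assoc TE.r_neg)
      then show ?case using step2 k alg_hom_simps(1)[OF tcls_hom] P by (auto intro!: add)
    qed
  next
    case (add f g)
    then show ?case
      using hadd[of f g] alg_hom_simps(1)[OF tcls_hom] by (auto simp: TF_fields(1) intro!: assms(3))
  qed
  then show ?thesis using x by simp
qed

lemma TE_smult: "y \<in> carrier TE \<Longrightarrow> r \<odot>\<^bsub>TE\<^esub> y = pure r \<one>\<^bsub>A\<^esub> \<otimes>\<^bsub>TE\<^esub> y"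
proof -
  assume "y \<in> carrier TE"
  then obtain x where x: "x \<in> carrier TF" "y = quot_class TF TR x" using T.cls_surj by (auto simp: TE_eq)
  show ?thesis
    using alg_hom_simps(5)[OF tcls_hom x(1), of r] alg_hom_simps(2)[OF tcls_hom, of "pt r \<one>\<^bsub>A\<^esub>" x] x
    by (simp add: TF_smult pure_def)
qed

text \<open>On pure tensors this is commutativity of the scalars and the unit law in
  \<open>A\<close>, and sums follow by distributivity. It supplies the scalar law for the right
  factor, which left multiplication by \<open>pure r 1\<close> does not give by itself.\<close>

lemma pure_central: "y \<in> carrier TE \<Longrightarrow> pure r \<one>\<^bsub>A\<^esub> \<otimes>\<^bsub>TE\<^esub> y = y \<otimes>\<^bsub>TE\<^esub> pure r \<one>\<^bsub>A\<^esub>"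
  by (induction y rule: tensor_induct) (simp_all add: pure_simps(4) mult.commute TE.l_distr TE.r_distr)

lemma alg_TE: "alg TE"
proof
  fix x y r s
  assume x: "x \<in> carrier TE"
  have one: "pure (r * s) \<one>\<^bsub>A\<^esub> = pure r \<one>\<^bsub>A\<^esub> \<otimes>\<^bsub>TE\<^esub> pure s \<one>\<^bsub>A\<^esub>" by (simp add: pure_simps(4))
  show rx: "r \<odot>\<^bsub>TE\<^esub> x \<in> carrier TE" using x by (simp add: TE_smult)
  show "(r + s) \<odot>\<^bsub>TE\<^esub> x = r \<odot>\<^bsub>TE\<^esub> x \<oplus>\<^bsub>TE\<^esub> s \<odot>\<^bsub>TE\<^esub> x"
    using x by (simp add: TE_smult pure_simps(1) TE.l_distr)
  show "1 \<odot>\<^bsub>TE\<^esub> x = x" using x by (simp add: TE_smult pure_simps(5))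
  show "(r * s) \<odot>\<^bsub>TE\<^esub> x = r \<odot>\<^bsub>TE\<^esub> (s \<odot>\<^bsub>TE\<^esub> x)"
    using x by (simp add: TE_smult one TE.m_assoc)
  assume y: "y \<in> carrier TE"
  show "r \<odot>\<^bsub>TE\<^esub> (x \<oplus>\<^bsub>TE\<^esub> y) = r \<odot>\<^bsub>TE\<^esub> x \<oplus>\<^bsub>TE\<^esub> r \<odot>\<^bsub>TE\<^esub> y"
    using x y by (simp add: TE_smult TE.r_distr)
  show "(r \<odot>\<^bsub>TE\<^esub> x) \<otimes>\<^bsub>TE\<^esub> y = r \<odot>\<^bsub>TE\<^esub> (x \<otimes>\<^bsub>TE\<^esub> y)"
    using x y by (simp add: TE_smult TE.m_assoc)
  have "x \<otimes>\<^bsub>TE\<^esub> (pure r \<one>\<^bsub>A\<^esub> \<otimes>\<^bsub>TE\<^esub> y) = (x \<otimes>\<^bsub>TE\<^esub> pure r \<one>\<^bsub>A\<^esub>) \<otimes>\<^bsub>TE\<^esub> y"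
    using x y by (simp add: TE.m_assoc)
  also have "\<dots> = pure r \<one>\<^bsub>A\<^esub> \<otimes>\<^bsub>TE\<^esub> (x \<otimes>\<^bsub>TE\<^esub> y)"
    using x y by (simp add: pure_central[symmetric] TE.m_assoc)
  finally show "x \<otimes>\<^bsub>TE\<^esub> (r \<odot>\<^bsub>TE\<^esub> y) = r \<odot>\<^bsub>TE\<^esub> (x \<otimes>\<^bsub>TE\<^esub> y)"
    using x y by (simp add: TE_smult)
qed

lemma TE_lift:
  fixes B :: "('r, 'b) module"
  assumes B: "alg B" and gc: "\<And>a. a \<in> carrier A \<Longrightarrow> g a \<in> carrier B"
    and g_mult: "\<And>a b. a \<in> carrier A \<Longrightarrow> b \<in> carrier A \<Longrightarrow> g (a \<otimes>\<^bsub>A\<^esub> b) = g a \<otimes>\<^bsub>B\<^esub> g b"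
    and g_add: "\<And>a b. a \<in> carrier A \<Longrightarrow> b \<in> carrier A \<Longrightarrow> g (a \<oplus>\<^bsub>A\<^esub> b) = g a \<oplus>\<^bsub>B\<^esub> g b"
    and g_one: "g \<one>\<^bsub>A\<^esub> = \<one>\<^bsub>B\<^esub>"
    and g_smult: "\<And>c a. a \<in> carrier A \<Longrightarrow> g (c \<odot>\<^bsub>A\<^esub> a) = \<phi> c \<odot>\<^bsub>B\<^esub> g a"
  shows "\<exists>h. alg_hom TE B h \<and> (\<forall>r. \<forall>a\<in>carrier A. h (pure r a) = r \<odot>\<^bsub>B\<^esub> g a)"
proof -
  interpret B: alg B by fact
  \<comment> \<open>\<open>B\<close> as an algebra over the integers, which are the coefficients in \<open>TF\<close>\<close>
  let ?Z = "corner (of_int :: int \<Rightarrow> 'r) B \<one>\<^bsub>B\<^esub>"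
  interpret Z: alg ?Z by (rule alg_corner[OF B]) auto
  define G where "G = (\<lambda>(r, a). r \<odot>\<^bsub>B\<^esub> g a)"
  let ?X = "UNIV \<times> carrier A :: ('r \<times> 'a) set"
  let ?m = "\<lambda>(r, a) (r', a'). Poly_Mapping.single (r * r', a \<otimes>\<^bsub>A\<^esub> a') (1 :: int)"
  have ZB: "carrier ?Z = carrier B" by (auto simp: corner_fields)
  have G: "G \<in> ?X \<rightarrow> carrier ?Z" by (auto simp: G_def gc ZB)
  have Gm: "G x \<otimes>\<^bsub>?Z\<^esub> G y = lext ?Z G (?m x y)" if X: "x \<in> ?X" "y \<in> ?X" for x y
  proof -
    obtain r a r' a' where xy: "x = (r, a)" "y = (r', a')" "a \<in> carrier A" "a' \<in> carrier A"
      using X by (cases x, cases y) auto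
    have "lext ?Z G (?m x y) = G (r * r', a \<otimes>\<^bsub>A\<^esub> a')"
      using xy G by (simp add: Z.lext_single ZB G_def gc corner_fields(6))
    also have "\<dots> = G x \<otimes>\<^bsub>?Z\<^esub> G y"
      using xy by (simp add: G_def g_mult gc corner_fields(2) B.smult_mult_l B.smult_mult_r B.smult_assoc B.smult_left_commute)
    finally show ?thesis by simp
  qed
  have mk: "Poly_Mapping.keys (?m x y) \<subseteq> ?X" if "x \<in> ?X" "y \<in> ?X" for x y using that by auto
  let ?h = "lext ?Z G"
  have hs: "?h (pt r a) = r \<odot>\<^bsub>B\<^esub> g a" if "a \<in> carrier A" for r a
    using that by (subst Z.lext_single) (simp_all add: G_def gc ZB corner_fields(6))
  have hadd: "?h (x + y) = ?h x \<oplus>\<^bsub>B\<^esub> ?h y" if "x \<in> carrier TF" "y \<in> carrier TF" for x y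
    using Z.lext_add[OF G, of x y] that by (simp add: TF_fields(1) corner_fields(5))
  have hc: "?h x \<in> carrier B" if "x \<in> carrier TF" for x
    using Z.lext_closed[OF G, of x] that by (simp add: TF_fields(1) ZB)
  have hom: "?h \<in> ring_hom TF B"
  proof (rule ring_hom_memI)
    fix x y assume xy: "x \<in> carrier TF" "y \<in> carrier TF"
    show "?h x \<in> carrier B" by (rule hc[OF xy(1)])
    show "?h (x \<oplus>\<^bsub>TF\<^esub> y) = ?h x \<oplus>\<^bsub>B\<^esub> ?h y" using hadd[OF xy] by (simp add: TF_fields(5))
    show "?h (x \<otimes>\<^bsub>TF\<^esub> y) = ?h x \<otimes>\<^bsub>B\<^esub> ?h y"
      unfolding TF_fields(2) using Z.lext_mult[OF G mk Gm, of x y] xy by (simp add: TF_fields(1) corner_fields(2))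
  next
    show "?h \<one>\<^bsub>TF\<^esub> = \<one>\<^bsub>B\<^esub>" unfolding TF_fields(3) by (subst hs) (simp_all add: g_one)
  qed
  have hdiff: "?h (x - y) = ?h x \<ominus>\<^bsub>B\<^esub> ?h y" if xy: "x \<in> carrier TF" "y \<in> carrier TF" for x y
  proof -
    have "?h x = ?h (x - y) \<oplus>\<^bsub>B\<^esub> ?h y" using hadd[OF TF_diff[OF xy] xy(2)] by simp
    then show ?thesis using hc xy TF_diff[OF xy] by (simp add: a_minus_def B.a_assoc B.r_neg)
  qed
  have cancel: "x \<oplus>\<^bsub>B\<^esub> y \<ominus>\<^bsub>B\<^esub> x \<ominus>\<^bsub>B\<^esub> y = \<zero>\<^bsub>B\<^esub>" if "x \<in> carrier B" "y \<in> carrier B" for x y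
  proof -
    have "x \<oplus>\<^bsub>B\<^esub> y \<ominus>\<^bsub>B\<^esub> x = y" using that B.r_neg1 by (simp add: a_minus_def B.a_ac B.r_neg2 B.r_neg1)
    then show ?thesis using that by simp
  qed
  have kill: "?h x = \<zero>\<^bsub>B\<^esub>" if "x \<in> TR" for x
    using that unfolding tensor_relations_def Let_def
  proof (elim UnE CollectE exE conjE)
    fix r r' a assume x: "x = pt (r + r') a - pt r a - pt r' a" and a: "a \<in> carrier A"
    have "?h x = (r + r') \<odot>\<^bsub>B\<^esub> g a \<ominus>\<^bsub>B\<^esub> r \<odot>\<^bsub>B\<^esub> g a \<ominus>\<^bsub>B\<^esub> r' \<odot>\<^bsub>B\<^esub> g a"
      unfolding x using a by (simp add: hdiff hs TF_diff)
    then show ?thesis using a gc cancel by (simp add: B.smult_l_distr)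
  next
    fix r a a' assume x: "x = pt r (a \<oplus>\<^bsub>A\<^esub> a') - pt r a - pt r a'" and a: "a \<in> carrier A" "a' \<in> carrier A"
    have "?h x = r \<odot>\<^bsub>B\<^esub> g (a \<oplus>\<^bsub>A\<^esub> a') \<ominus>\<^bsub>B\<^esub> r \<odot>\<^bsub>B\<^esub> g a \<ominus>\<^bsub>B\<^esub> r \<odot>\<^bsub>B\<^esub> g a'"
      unfolding x using a by (simp add: hdiff hs TF_diff)
    then show ?thesis using a gc cancel by (simp add: B.smult_r_distr g_add)
  next
    fix r c a assume x: "x = pt (r * \<phi> c) a - pt r (c \<odot>\<^bsub>A\<^esub> a)" and a: "a \<in> carrier A"
    have "?h x = (r * \<phi> c) \<odot>\<^bsub>B\<^esub> g a \<ominus>\<^bsub>B\<^esub> r \<odot>\<^bsub>B\<^esub> g (c \<odot>\<^bsub>A\<^esub> a)"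
      unfolding x using a by (simp add: hdiff hs TF_diff)
    then show ?thesis using a gc by (simp add: g_smult B.smult_assoc)
  qed
  obtain h where h: "h \<in> ring_hom TE B" "\<And>x. x \<in> carrier TF \<Longrightarrow> h (quot_class TF TR x) = ?h x"
    using T.lift_hom[OF B.ring_axioms hom kill] by (auto simp: TE_eq)
  have hp: "h (pure r a) = r \<odot>\<^bsub>B\<^esub> g a" if "a \<in> carrier A" for r a
    using h(2)[of "pt r a"] hs that by (simp add: pure_def)
  have "h (s \<odot>\<^bsub>TE\<^esub> y) = s \<odot>\<^bsub>B\<^esub> h y" if y: "y \<in> carrier TE" for s y
  proof -
    have hy: "h y \<in> carrier B" using h(1) y by (auto simp: ring_hom_def)
    have "h (s \<odot>\<^bsub>TE\<^esub> y) = h (pure s \<one>\<^bsub>A\<^esub>) \<otimes>\<^bsub>B\<^esub> h y"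
      unfolding TE_smult[OF y] using h(1) y by (auto simp: ring_hom_def)
    then show ?thesis using hp hy by (simp add: g_one B.smult_mult_l)
  qed
  then show ?thesis using h(1) hp by (auto simp: alg_hom_def)
qed

end

subsection \<open>Endomorphisms of a sum of right ideals\<close>

locale ideal_sum = A: alg A for A :: "('k::comm_ring_1, 'h) module" (structure) +
  fixes L :: "'i set" and x :: "'i \<Rightarrow> 'h"
  assumes x [simp]: "I \<in> L \<Longrightarrow> x I \<in> carrier A" and finite_L: "finite L"
begin

abbreviation "M \<equiv> right_ideal_sum A L x"
abbreviation "EA \<equiv> end_algebra A L x"
abbreviation "vplus u v \<equiv> (\<lambda>i\<in>L. u i \<oplus> v i)"
abbreviation "vact v h \<equiv> (\<lambda>i\<in>L. v i \<otimes> h)"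

lemma M_iff: "v \<in> M \<longleftrightarrow> v \<in> extensional L \<and> (\<forall>i\<in>L. \<exists>h\<in>carrier A. v i = x i \<otimes> h)"
  by (auto simp: right_ideal_sum_def PiE_iff)

lemma M_closed: "v \<in> M \<Longrightarrow> i \<in> L \<Longrightarrow> v i \<in> carrier A"
  unfolding M_iff by (metis A.m_closed x)

lemma M_cong: "u \<in> M \<Longrightarrow> v \<in> M \<Longrightarrow> (\<And>i. i \<in> L \<Longrightarrow> u i = v i) \<Longrightarrow> u = v"
  unfolding M_iff by (blast intro: extensionalityI)

lemma M_plus: "u \<in> M \<Longrightarrow> v \<in> M \<Longrightarrow> vplus u v \<in> M"
  unfolding M_iff by simp (metis A.a_closed A.r_distr x)

lemma M_act: "v \<in> M \<Longrightarrow> h \<in> carrier A \<Longrightarrow> vact v h \<in> M"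
  unfolding M_iff by simp (metis A.m_closed A.m_assoc x)

lemma M_zero: "(\<lambda>i\<in>L. \<zero>) \<in> M"
  unfolding M_iff by simp (metis A.r_null x A.zero_closed)

lemma M_smult: "v \<in> M \<Longrightarrow> (\<lambda>i\<in>L. c \<odot> v i) \<in> M"
  unfolding M_iff by simp (metis A.smult_closed A.smult_mult_r x)

lemma EA_iff: "\<phi> \<in> carrier EA \<longleftrightarrow> \<phi> \<in> extensional M \<and> (\<forall>v\<in>M. \<phi> v \<in> M) \<and>
    (\<forall>u\<in>M. \<forall>v\<in>M. \<phi> (vplus u v) = vplus (\<phi> u) (\<phi> v)) \<and>
    (\<forall>v\<in>M. \<forall>h\<in>carrier A. \<phi> (vact v h) = vact (\<phi> v) h)"
  by (auto simp: end_algebra_def Let_def PiE_iff)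

lemma EA_fields:
  "monoid.mult EA = compose M" "one EA = (\<lambda>v\<in>M. v)" "zero EA = (\<lambda>v\<in>M. \<lambda>i\<in>L. \<zero>)"
  "add EA = (\<lambda>\<phi> \<psi>. \<lambda>v\<in>M. vplus (\<phi> v) (\<psi> v))" "module.smult EA = (\<lambda>c \<phi>. \<lambda>v\<in>M. \<lambda>i\<in>L. c \<odot> \<phi> v i)"
  by (simp_all add: end_algebra_def Let_def)

lemma EA_D:
  assumes "\<phi> \<in> carrier EA"
  shows "\<phi> \<in> extensional M" "v \<in> M \<Longrightarrow> \<phi> v \<in> M" "u \<in> M \<Longrightarrow> v \<in> M \<Longrightarrow> \<phi> (vplus u v) = vplus (\<phi> u) (\<phi> v)"
    "v \<in> M \<Longrightarrow> h \<in> carrier A \<Longrightarrow> \<phi> (vact v h) = vact (\<phi> v) h" "v \<in> M \<Longrightarrow> i \<in> L \<Longrightarrow> \<phi> v i \<in> carrier A"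
  using assms M_closed unfolding EA_iff by blast+

lemma EA_I:
  assumes "\<And>v. v \<in> M \<Longrightarrow> f v \<in> M"
    "\<And>u v i. u \<in> M \<Longrightarrow> v \<in> M \<Longrightarrow> i \<in> L \<Longrightarrow> f (vplus u v) i = f u i \<oplus> f v i"
    "\<And>v h i. v \<in> M \<Longrightarrow> h \<in> carrier A \<Longrightarrow> i \<in> L \<Longrightarrow> f (vact v h) i = f v i \<otimes> h"
  shows "(\<lambda>v\<in>M. f v) \<in> carrier EA"
  unfolding EA_iff
proof (intro conjI ballI)
  fix u v assume uv: "u \<in> M" "v \<in> M"
  show "(\<lambda>v\<in>M. f v) (vplus u v) = vplus ((\<lambda>v\<in>M. f v) u) ((\<lambda>v\<in>M. f v) v)"
    using uv M_plus[OF uv] assms(1) by (intro M_cong) (auto simp: assms(2) intro: M_plus)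
next
  fix v h assume vh: "v \<in> M" "h \<in> carrier A"
  show "(\<lambda>v\<in>M. f v) (vact v h) = vact ((\<lambda>v\<in>M. f v) v) h"
    using vh M_act[OF vh] assms(1) by (intro M_cong) (auto simp: assms(3) intro: M_act)
qed (auto simp: assms(1))

lemma EA_eqI:
  assumes "\<phi> \<in> carrier EA" "\<psi> \<in> carrier EA" "\<And>v i. v \<in> M \<Longrightarrow> i \<in> L \<Longrightarrow> \<phi> v i = \<psi> v i"
  shows "\<phi> = \<psi>"
proof (rule extensionalityI[of _ M])
  show "\<phi> v = \<psi> v" if "v \<in> M" for v
    using assms that EA_D(2) by (intro M_cong) auto
qed (use assms EA_D(1) in auto)

lemma EA_apply:
  assumes "v \<in> M"
  shows "(\<phi> \<otimes>\<^bsub>EA\<^esub> \<psi>) v = \<phi> (\<psi> v)" "\<one>\<^bsub>EA\<^esub> v = v" "i \<in> L \<Longrightarrow> \<zero>\<^bsub>EA\<^esub> v i = \<zero>"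
    "i \<in> L \<Longrightarrow> (\<phi> \<oplus>\<^bsub>EA\<^esub> \<psi>) v i = \<phi> v i \<oplus> \<psi> v i" "i \<in> L \<Longrightarrow> (c \<odot>\<^bsub>EA\<^esub> \<phi>) v i = c \<odot> \<phi> v i"
  using assms by (simp_all add: EA_fields compose_def)

lemma EA_closed:
  assumes \<phi>: "\<phi> \<in> carrier EA"
  shows "\<psi> \<in> carrier EA \<Longrightarrow> \<phi> \<otimes>\<^bsub>EA\<^esub> \<psi> \<in> carrier EA" "\<one>\<^bsub>EA\<^esub> \<in> carrier EA" "\<zero>\<^bsub>EA\<^esub> \<in> carrier EA"
    "\<psi> \<in> carrier EA \<Longrightarrow> \<phi> \<oplus>\<^bsub>EA\<^esub> \<psi> \<in> carrier EA" "c \<odot>\<^bsub>EA\<^esub> \<phi> \<in> carrier EA"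
proof -
  show "\<one>\<^bsub>EA\<^esub> \<in> carrier EA" unfolding EA_fields by (rule EA_I) auto
  show "\<zero>\<^bsub>EA\<^esub> \<in> carrier EA" unfolding EA_fields by (rule EA_I) (auto simp: M_zero)
  show "c \<odot>\<^bsub>EA\<^esub> \<phi> \<in> carrier EA" unfolding EA_fields
    by (rule EA_I) (auto simp: M_smult EA_D[OF \<phi>] A.smult_r_distr A.smult_mult_l)
  assume \<psi>: "\<psi> \<in> carrier EA"
  show "\<phi> \<otimes>\<^bsub>EA\<^esub> \<psi> \<in> carrier EA" unfolding EA_fields compose_def
    by (rule EA_I) (auto simp: EA_D[OF \<phi>] EA_D[OF \<psi>])
  show "\<phi> \<oplus>\<^bsub>EA\<^esub> \<psi> \<in> carrier EA" unfolding EA_fields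
    by (rule EA_I) (auto simp: M_plus EA_D[OF \<phi>] EA_D[OF \<psi>] A.a_ac A.l_distr)
qed

lemma EA_one_closed: "\<one>\<^bsub>EA\<^esub> \<in> carrier EA"
  unfolding EA_fields by (rule EA_I) auto

text \<open>A scalar acts as right multiplication by a scalar multiple of the unit. So maps that are
  linear over the right action are linear over the scalars too.\<close>

lemma smult_as_act: "v \<in> M \<Longrightarrow> (\<lambda>i\<in>L. c \<odot> v i) = vact v (c \<odot> \<one>)"
  by (auto simp: fun_eq_iff restrict_def A.smult_mult_r M_closed)

lemma alg_EA: "alg EA"
proof -
  have "ring EA"
  proof (intro ringI abelian_groupI monoidI)
    fix \<phi> assume \<phi>: "\<phi> \<in> carrier EA"
    show "\<exists>\<psi>\<in>carrier EA. \<psi> \<oplus>\<^bsub>EA\<^esub> \<phi> = \<zero>\<^bsub>EA\<^esub>"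
    proof (rule bexI)
      show c: "(- 1) \<odot>\<^bsub>EA\<^esub> \<phi> \<in> carrier EA" using EA_closed(5)[OF \<phi>] .
      show "(- 1) \<odot>\<^bsub>EA\<^esub> \<phi> \<oplus>\<^bsub>EA\<^esub> \<phi> = \<zero>\<^bsub>EA\<^esub>"
        by (rule EA_eqI[OF EA_closed(4)[OF c \<phi>] EA_closed(3)[OF \<phi>]])
          (simp add: EA_apply EA_D[OF \<phi>] A.smult_minus_l A.l_neg)
    qed
  next
    fix a b c assume abc: "a \<in> carrier EA" "b \<in> carrier EA" "c \<in> carrier EA"
    note cl = EA_closed(1,4)
    show "a \<oplus>\<^bsub>EA\<^esub> b \<oplus>\<^bsub>EA\<^esub> c = a \<oplus>\<^bsub>EA\<^esub> (b \<oplus>\<^bsub>EA\<^esub> c)"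
      by (rule EA_eqI) (auto simp: cl abc EA_apply EA_D(5) A.a_assoc)
    show "(a \<oplus>\<^bsub>EA\<^esub> b) \<otimes>\<^bsub>EA\<^esub> c = a \<otimes>\<^bsub>EA\<^esub> c \<oplus>\<^bsub>EA\<^esub> b \<otimes>\<^bsub>EA\<^esub> c"
      by (rule EA_eqI) (auto simp: cl abc EA_apply EA_D(2,5))
    show "a \<otimes>\<^bsub>EA\<^esub> b \<otimes>\<^bsub>EA\<^esub> c = a \<otimes>\<^bsub>EA\<^esub> (b \<otimes>\<^bsub>EA\<^esub> c)"
      by (rule EA_eqI) (auto simp: cl abc EA_apply EA_D(2,5))
    show "c \<otimes>\<^bsub>EA\<^esub> (a \<oplus>\<^bsub>EA\<^esub> b) = c \<otimes>\<^bsub>EA\<^esub> a \<oplus>\<^bsub>EA\<^esub> c \<otimes>\<^bsub>EA\<^esub> b"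
    proof (rule EA_eqI)
      fix v i assume v: "v \<in> M" "i \<in> L"
      have "(a \<oplus>\<^bsub>EA\<^esub> b) v = vplus (a v) (b v)" using v by (simp add: EA_fields)
      then show "(c \<otimes>\<^bsub>EA\<^esub> (a \<oplus>\<^bsub>EA\<^esub> b)) v i = (c \<otimes>\<^bsub>EA\<^esub> a \<oplus>\<^bsub>EA\<^esub> c \<otimes>\<^bsub>EA\<^esub> b) v i"
        using v abc EA_D(3)[OF abc(3) EA_D(2)[OF abc(1)] EA_D(2)[OF abc(2)]] by (simp add: EA_apply)
    qed (auto simp: cl abc)
    show "a \<oplus>\<^bsub>EA\<^esub> b = b \<oplus>\<^bsub>EA\<^esub> a"
      by (rule EA_eqI) (auto simp: cl abc EA_apply EA_D(5) A.a_comm)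
  next
    fix a assume a: "a \<in> carrier EA"
    show "\<zero>\<^bsub>EA\<^esub> \<oplus>\<^bsub>EA\<^esub> a = a"
      by (rule EA_eqI) (auto simp: EA_closed(3,4)[OF EA_closed(3)] EA_closed(3)[OF a] a EA_apply EA_D(5) intro: EA_closed(4)[OF EA_closed(3)[OF a] a])
    show "\<one>\<^bsub>EA\<^esub> \<otimes>\<^bsub>EA\<^esub> a = a"
      by (rule EA_eqI) (auto simp: a EA_apply EA_D(2) intro: EA_closed(1)[OF EA_one_closed a])
    show "a \<otimes>\<^bsub>EA\<^esub> \<one>\<^bsub>EA\<^esub> = a"
      by (rule EA_eqI) (auto simp: a EA_apply intro: EA_closed(1)[OF a EA_one_closed])
  qed (auto simp: EA_closed(1,4) EA_one_closed EA_closed(3)[OF EA_one_closed])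
  then interpret EA: ring EA .
  show ?thesis
  proof
    fix a b r s assume a: "a \<in> carrier EA"
    show "r \<odot>\<^bsub>EA\<^esub> a \<in> carrier EA" using EA_closed(5)[OF a] .
    show "(r + s) \<odot>\<^bsub>EA\<^esub> a = r \<odot>\<^bsub>EA\<^esub> a \<oplus>\<^bsub>EA\<^esub> s \<odot>\<^bsub>EA\<^esub> a" "(r * s) \<odot>\<^bsub>EA\<^esub> a = r \<odot>\<^bsub>EA\<^esub> (s \<odot>\<^bsub>EA\<^esub> a)" "1 \<odot>\<^bsub>EA\<^esub> a = a"
      by (rule EA_eqI; auto simp: EA_closed(5) a EA_apply EA_D(5) A.smult_l_distr A.smult_assoc)+
    assume b: "b \<in> carrier EA"
    show "r \<odot>\<^bsub>EA\<^esub> (a \<oplus>\<^bsub>EA\<^esub> b) = r \<odot>\<^bsub>EA\<^esub> a \<oplus>\<^bsub>EA\<^esub> r \<odot>\<^bsub>EA\<^esub> b" "(r \<odot>\<^bsub>EA\<^esub> a) \<otimes>\<^bsub>EA\<^esub> b = r \<odot>\<^bsub>EA\<^esub> (a \<otimes>\<^bsub>EA\<^esub> b)"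
      by (rule EA_eqI; auto simp: EA_closed(5) a b EA_apply EA_D(2,5) A.smult_r_distr)+
    show "a \<otimes>\<^bsub>EA\<^esub> (r \<odot>\<^bsub>EA\<^esub> b) = r \<odot>\<^bsub>EA\<^esub> (a \<otimes>\<^bsub>EA\<^esub> b)"
    proof (rule EA_eqI)
      fix v i assume v: "v \<in> M" "i \<in> L"
      have bv: "b v \<in> M" using EA_D(2)[OF b v(1)] .
      have "(r \<odot>\<^bsub>EA\<^esub> b) v = vact (b v) (r \<odot> \<one>)" using v smult_as_act[OF bv] by (simp add: EA_fields)
      then show "(a \<otimes>\<^bsub>EA\<^esub> (r \<odot>\<^bsub>EA\<^esub> b)) v i = (r \<odot>\<^bsub>EA\<^esub> (a \<otimes>\<^bsub>EA\<^esub> b)) v i"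
        using v EA_D(4)[OF a bv, of "r \<odot> \<one>"] EA_D(5)[OF a bv v(2)] by (simp add: EA_apply A.smult_mult_r)
    qed (auto simp: EA_closed(5) a b)
  qed
qed

definition unit_vec :: "'i \<Rightarrow> 'h \<Rightarrow> ('i \<Rightarrow> 'h)"
  where "unit_vec I y = (\<lambda>i\<in>L. if i = I then y else \<zero>)"

lemma unit_vec_M: "h \<in> carrier A \<Longrightarrow> unit_vec I (x I \<otimes> h) \<in> M"
  unfolding M_iff unit_vec_def by simp (metis A.r_null x A.zero_closed)

lemma unit_vec_M': "v \<in> M \<Longrightarrow> I \<in> L \<Longrightarrow> unit_vec I (v I) \<in> M"
  using unit_vec_M[of _ I] unfolding M_iff by (metis (no_types, lifting) M_iff)

lemma unit_vec_x: "I \<in> L \<Longrightarrow> unit_vec I (x I) \<in> M"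
  using unit_vec_M[of \<one> I] by simp

lemma EA_decompose:
  assumes \<phi>: "\<phi> \<in> carrier EA" and v: "v \<in> M" and K: "K \<in> L"
  shows "\<phi> v K = finsum A (\<lambda>J. \<phi> (unit_vec J (v J)) K) L"
proof -
  \<comment> \<open>The vector is built up coordinate by coordinate: \<open>w F\<close> keeps the
    entries in \<open>F\<close> and is zero elsewhere.\<close>
  define w where "w F = (\<lambda>i\<in>L. if i \<in> F then v i else \<zero>)" for F
  have wM: "w F \<in> M" for F
    using v unfolding M_iff w_def by simp (metis A.r_null x A.zero_closed)
  have c: "\<phi> (unit_vec J (v J)) K \<in> carrier A" if "J \<in> L" for J
    using EA_D(5)[OF \<phi> unit_vec_M'[OF v that] K] .
  have "\<phi> (w F) K = finsum A (\<lambda>J. \<phi> (unit_vec J (v J)) K) F" if "finite F" "F \<subseteq> L" for F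
    using that
  proof (induction F rule: finite_induct)
    case empty
    \<comment> \<open>The zero vector is itself times the zero of the algebra, so linearity over the
      right action shows that its image is zero.\<close>
    have "w {} = vact (w {}) \<zero>" using M_closed[OF wM] by (auto simp: w_def fun_eq_iff restrict_def)
    then have "\<phi> (w {}) K = vact (\<phi> (w {})) \<zero> K" using EA_D(4)[OF \<phi> wM[of "{}"] A.zero_closed] by metis
    then show ?case using K EA_D(5)[OF \<phi> wM K] by simp
  next
    case (insert J F)
    have J: "J \<in> L" using insert by simp
    have "w (insert J F) = vplus (unit_vec J (v J)) (w F)"
      using insert M_closed[OF v] by (auto simp: w_def unit_vec_def fun_eq_iff restrict_def)
    then have "\<phi> (w (insert J F)) K = \<phi> (unit_vec J (v J)) K \<oplus> \<phi> (w F) K"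
      using EA_D(3)[OF \<phi> unit_vec_M'[OF v J] wM] K by simp
    then show ?case using insert c by (simp add: Pi_iff subset_iff)
  qed
  from this[OF finite_L] have "\<phi> (w L) K = finsum A (\<lambda>J. \<phi> (unit_vec J (v J)) K) L" by simp
  moreover have "w L = v" using v by (auto simp: w_def M_iff extensional_def fun_eq_iff)
  ultimately show ?thesis by simp
qed

text \<open>These are matrix entries, taken at the generators \<open>x I\<close> of the summands; by
  right linearity they determine the endomorphism.\<close>

definition comp :: "(('i \<Rightarrow> 'h) \<Rightarrow> ('i \<Rightarrow> 'h)) \<Rightarrow> 'i \<Rightarrow> 'i \<Rightarrow> 'h"
  where "comp \<phi> K I = \<phi> (unit_vec I (x I)) K"

lemma comp_closed: "\<phi> \<in> carrier EA \<Longrightarrow> K \<in> L \<Longrightarrow> I \<in> L \<Longrightarrow> comp \<phi> K I \<in> carrier A"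
  unfolding comp_def by (rule EA_D(5)[OF _ unit_vec_x])

lemma comp_mem: "\<phi> \<in> carrier EA \<Longrightarrow> K \<in> L \<Longrightarrow> I \<in> L \<Longrightarrow> \<exists>h\<in>carrier A. comp \<phi> K I = x K \<otimes> h"
  using EA_D(2)[OF _ unit_vec_x, of \<phi> I] unfolding comp_def M_iff by blast

lemma comp_act:
  assumes "\<phi> \<in> carrier EA" "K \<in> L" "I \<in> L" "h \<in> carrier A"
  shows "\<phi> (unit_vec I (x I \<otimes> h)) K = comp \<phi> K I \<otimes> h"
proof -
  have "unit_vec I (x I \<otimes> h) = vact (unit_vec I (x I)) h"
    using assms by (auto simp: unit_vec_def fun_eq_iff restrict_def)
  then show ?thesis using EA_D(4)[OF assms(1) unit_vec_x[OF assms(3)] assms(4)] assms(2) by (simp add: comp_def)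
qed

lemma comp_mult:
  assumes "\<psi> \<in> carrier EA" "\<phi> \<in> carrier EA" "K \<in> L" "I \<in> L"
  shows "comp (\<psi> \<otimes>\<^bsub>EA\<^esub> \<phi>) K I = finsum A (\<lambda>J. \<psi> (unit_vec J (comp \<phi> J I)) K) L"
  using EA_decompose[OF assms(1) EA_D(2)[OF assms(2) unit_vec_x[OF assms(4)]] assms(3)] unit_vec_x[OF assms(4)]
  by (simp add: comp_def EA_apply)

text \<open>An endomorphism only under the condition \<open>blk_ok\<close> below.\<close>

definition blk :: "'i \<Rightarrow> 'i \<Rightarrow> 'h \<Rightarrow> (('i \<Rightarrow> 'h) \<Rightarrow> ('i \<Rightarrow> 'h))"
  where "blk K I z = (\<lambda>v\<in>M. unit_vec K (z \<otimes> v I))"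

text \<open>Left multiplication by \<open>z\<close> then maps the summand of \<open>I\<close> into
  that of \<open>K\<close>. Testing the generator \<open>x I\<close> suffices, since left and right
  multiplication commute.\<close>

definition blk_ok :: "'i \<Rightarrow> 'i \<Rightarrow> 'h \<Rightarrow> bool"
  where "blk_ok K I z \<longleftrightarrow> K \<in> L \<and> I \<in> L \<and> z \<in> carrier A \<and> (\<exists>h\<in>carrier A. z \<otimes> x I = x K \<otimes> h)"

lemma blk_M:
  assumes "blk_ok K I z" "v \<in> M"
  shows "unit_vec K (z \<otimes> v I) \<in> M"
proof -
  obtain h where h: "h \<in> carrier A" "v I = x I \<otimes> h" using assms by (auto simp: blk_ok_def M_iff)
  obtain h0 where h0: "h0 \<in> carrier A" "z \<otimes> x I = x K \<otimes> h0" using assms by (auto simp: blk_ok_def)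
  have "z \<otimes> v I = (z \<otimes> x I) \<otimes> h" using assms(1) h by (simp add: blk_ok_def A.m_assoc)
  also have "\<dots> = x K \<otimes> (h0 \<otimes> h)" using assms(1) h h0 by (simp add: blk_ok_def A.m_assoc)
  finally show ?thesis using unit_vec_M[of "h0 \<otimes> h" K] h h0 by simp
qed

lemma blk_closed:
  assumes "blk_ok K I z" shows "blk K I z \<in> carrier EA"
  unfolding blk_def
proof (rule EA_I)
  show "unit_vec K (z \<otimes> v I) \<in> M" if "v \<in> M" for v by (rule blk_M[OF assms that])
qed (use assms in \<open>auto simp: unit_vec_def blk_ok_def M_closed A.r_distr A.m_assoc\<close>)

lemma blk_apply: "v \<in> M \<Longrightarrow> i \<in> L \<Longrightarrow> blk K I z v i = (if i = K then z \<otimes> v I else \<zero>)"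
  by (simp add: blk_def unit_vec_def)

lemma blk_ok_mult: "blk_ok K J z \<Longrightarrow> blk_ok J I z' \<Longrightarrow> blk_ok K I (z \<otimes> z')"
proof -
  assume a: "blk_ok K J z" "blk_ok J I z'"
  then obtain h h' where h: "h \<in> carrier A" "z \<otimes> x J = x K \<otimes> h" "h' \<in> carrier A" "z' \<otimes> x I = x J \<otimes> h'"
    by (auto simp: blk_ok_def)
  have c: "z \<in> carrier A" "z' \<in> carrier A" "x I \<in> carrier A" "x J \<in> carrier A" "x K \<in> carrier A"
    using a by (auto simp: blk_ok_def)
  have "z \<otimes> z' \<otimes> x I = z \<otimes> (x J \<otimes> h')" using c h by (simp add: A.m_assoc)
  also have "\<dots> = (z \<otimes> x J) \<otimes> h'" using c h(1,3) by (simp only: A.m_assoc)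
  also have "\<dots> = x K \<otimes> (h \<otimes> h')" unfolding h(2) using c h by (simp add: A.m_assoc)
  finally show "blk_ok K I (z \<otimes> z')" using a c h by (auto simp: blk_ok_def)
qed

lemma blk_mult:
  assumes "blk_ok K J z" "blk_ok J' I z'"
  shows "blk K J z \<otimes>\<^bsub>EA\<^esub> blk J' I z' = (if J = J' then blk K I (z \<otimes> z') else \<zero>\<^bsub>EA\<^esub>)"
proof -
  interpret EA: alg EA by (rule alg_EA)
  have c: "z \<in> carrier A" "z' \<in> carrier A" "I \<in> L" "J \<in> L" "J' \<in> L" "K \<in> L" using assms by (auto simp: blk_ok_def)
  have ok: "J = J' \<Longrightarrow> blk_ok K I (z \<otimes> z')" using blk_ok_mult assms by blast
  show ?thesis
  proof (rule EA_eqI)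
    show "blk K J z \<otimes>\<^bsub>EA\<^esub> blk J' I z' \<in> carrier EA" using assms by (simp add: blk_closed)
    show "(if J = J' then blk K I (z \<otimes> z') else \<zero>\<^bsub>EA\<^esub>) \<in> carrier EA" using ok by (simp add: blk_closed)
    fix v i assume v: "v \<in> M" "i \<in> L"
    have "blk J' I z' v \<in> M" using EA_D(2)[OF blk_closed[OF assms(2)] v(1)] .
    then show "(blk K J z \<otimes>\<^bsub>EA\<^esub> blk J' I z') v i = (if J = J' then blk K I (z \<otimes> z') else \<zero>\<^bsub>EA\<^esub>) v i"
      using v c M_closed[OF v(1) c(3)] by (auto simp: EA_apply blk_apply A.m_assoc)
  qed
qed

lemma blk_ok_add: "blk_ok K I z \<Longrightarrow> blk_ok K I z' \<Longrightarrow> blk_ok K I (z \<oplus> z')"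
  unfolding blk_ok_def by (metis A.a_closed A.l_distr A.r_distr x)

lemma blk_ok_smult: "blk_ok K I z \<Longrightarrow> blk_ok K I (c \<odot> z)"
  unfolding blk_ok_def by (metis A.smult_closed A.smult_mult_l A.smult_mult_r x)

lemma blk_add:
  assumes "blk_ok K I z" "blk_ok K I z'"
  shows "blk K I (z \<oplus> z') = blk K I z \<oplus>\<^bsub>EA\<^esub> blk K I z'"
proof -
  interpret EA: alg EA by (rule alg_EA)
  have c: "z \<in> carrier A" "z' \<in> carrier A" "I \<in> L" using assms by (auto simp: blk_ok_def)
  show ?thesis
    by (rule EA_eqI) (use c in \<open>auto simp: blk_closed blk_ok_add assms EA_apply blk_apply M_closed A.l_distr\<close>)
qed

lemma blk_smult:
  assumes "blk_ok K I z"
  shows "blk K I (c \<odot> z) = c \<odot>\<^bsub>EA\<^esub> blk K I z"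
proof -
  interpret EA: alg EA by (rule alg_EA)
  have c: "z \<in> carrier A" "I \<in> L" using assms by (auto simp: blk_ok_def)
  show ?thesis
    by (rule EA_eqI) (use c in \<open>auto simp: blk_closed blk_ok_smult assms EA_apply blk_apply M_closed A.smult_mult_l\<close>)
qed

text \<open>Only the effect on the generator \<open>x I\<close> counts. So on the summand of I, left
  multiplication by x_I can be replaced by the scalar pi(I), although the two elements
  differ.\<close>

lemma blk_cong:
  assumes "blk_ok K I z" "blk_ok K I z'" "z \<otimes> x I = z' \<otimes> x I"
  shows "blk K I z = blk K I z'"
proof (rule EA_eqI[OF blk_closed[OF assms(1)] blk_closed[OF assms(2)]])
  fix v i assume v: "v \<in> M" "i \<in> L"
  have c: "z \<in> carrier A" "z' \<in> carrier A" "I \<in> L" using assms by (auto simp: blk_ok_def)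
  obtain h where h: "h \<in> carrier A" "v I = x I \<otimes> h" using v(1) c by (auto simp: M_iff)
  have "z \<otimes> v I = z' \<otimes> v I"
    unfolding h(2) using c h(1) assms(3) by (simp add: A.m_assoc[symmetric])
  then show "blk K I z v i = blk K I z' v i" using v by (simp add: blk_apply)
qed

lemma comp_blk:
  assumes "blk_ok K I z" "K' \<in> L" "I' \<in> L"
  shows "comp (blk K I z) K' I' = (if K' = K \<and> I' = I then z \<otimes> x I else \<zero>)"
  using assms unit_vec_x[OF assms(3)] unfolding comp_def
  by (auto simp: blk_apply unit_vec_def blk_ok_def)

lemma EA_finsum_apply:
  assumes "f \<in> X \<rightarrow> carrier EA" "finite X" "v \<in> M" "i \<in> L"
  shows "finsum EA f X v i = finsum A (\<lambda>j. f j v i) X"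
  using assms(2,1)
proof (induction X rule: finite_induct)
  interpret EA: alg EA by (rule alg_EA)
  case empty
  show ?case using assms by (simp add: EA_apply)
next
  interpret EA: alg EA by (rule alg_EA)
  case (insert j X)
  then show ?case using assms by (simp add: EA_apply EA_D(5) Pi_iff)
qed

lemma blk_sum_one:
  assumes "\<And>I. I \<in> L \<Longrightarrow> blk_ok I I \<one>"
  shows "finsum EA (\<lambda>I. blk I I \<one>) L = \<one>\<^bsub>EA\<^esub>"
proof -
  interpret EA: alg EA by (rule alg_EA)
  have c: "(\<lambda>I. blk I I \<one>) \<in> L \<rightarrow> carrier EA" using assms blk_closed by blast
  show ?thesis
  proof (rule EA_eqI)
    fix v i assume v: "v \<in> M" "i \<in> L"
    have "finsum EA (\<lambda>I. blk I I \<one>) L v i = finsum A (\<lambda>I. if i = I then v I else \<zero>) L"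
      unfolding EA_finsum_apply[OF c finite_L v] using v M_closed
      by (intro A.finsum_cong') (auto simp: blk_apply)
    also have "\<dots> = v i" using A.add.finprod_singleton[OF v(2) finite_L, of v] M_closed[OF v(1)] by (simp add: Pi_iff)
    finally show "finsum EA (\<lambda>I. blk I I \<one>) L v i = \<one>\<^bsub>EA\<^esub> v i" using v by (simp add: EA_apply)
  qed (use c in auto)
qed

end

subsection \<open>The Hecke endomorphism algebra\<close>

context coxf
begin

lemma hecke_ext:
  fixes B :: "(int poly, 'b) module"
  assumes B: "alg B" and f: "alg_hom H B f" and g: "alg_hom H B g"
    and eq: "\<And>s. s \<in> S \<Longrightarrow> f (Tg s) = g (Tg s)" and h: "h \<in> carrier H"
  shows "f h = g h"
proof -
  obtain x where x: "x \<in> carrier FA" "h = hcls x" using HQ.cls_surj h by (auto simp: hecke_eq)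
  have "f (hcls x) = g (hcls x)"
    by (rule free_algebra_ext[OF B alg_hom_comp[OF hcls_hom f] alg_hom_comp[OF hcls_hom g] _ x(1)])
      (use eq in \<open>simp add: hecke_gen_def\<close>)
  then show ?thesis using x by simp
qed

lemma ideal_sum_xx: "ideal_sum H L xx"
  by unfold_locales (use L_S finite_L in auto)

end

sublocale coxf \<subseteq> IS: ideal_sum "hecke W S" "fin_subsets W S" "hecke_x W S"
  by (rule ideal_sum_xx)

sublocale coxf \<subseteq> ES: scalar_ext "end_algebra (hecke W S) (fin_subsets W S) (hecke_x W S)" of_zq
  using IS.alg_EA by (intro scalar_ext.intro scalar_ext_axioms.intro) (auto simp: of_zq_simps)

context coxf
begin

abbreviation "EA \<equiv> end_algebra H L xx"
abbreviation "X1 \<equiv> extend_scalars of_zq EA"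

text \<open>On the left, the entry lies in x_K H and x_K is idempotent up to pi(K). On the right,
  the value of the endomorphism at x_I x_I is computed twice: by right linearity, and from x_I x_I
  being pi(I) times x_I.\<close>

lemma comp_xx:
  assumes \<phi>: "\<phi> \<in> carrier EA" and KI: "K \<in> L" "I \<in> L"
  shows "xx K \<otimes>\<^bsub>H\<^esub> IS.comp \<phi> K I = poincare W S K \<odot>\<^bsub>H\<^esub> IS.comp \<phi> K I"
    "IS.comp \<phi> K I \<otimes>\<^bsub>H\<^esub> xx I = poincare W S I \<odot>\<^bsub>H\<^esub> IS.comp \<phi> K I"
proof -
  have x: "xx I \<in> carrier H" "xx K \<in> carrier H" using KI L_S by auto
  have c: "IS.comp \<phi> K I \<in> carrier H" by (rule IS.comp_closed[OF \<phi> KI])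
  have xI: "xx I \<otimes>\<^bsub>H\<^esub> xx I = poincare W S I \<odot>\<^bsub>H\<^esub> xx I" "xx K \<otimes>\<^bsub>H\<^esub> xx K = poincare W S K \<odot>\<^bsub>H\<^esub> xx K"
    using xx_mult(1)[OF order_refl] L_S L_fin KI by auto
  obtain h where h: "h \<in> carrier H" "IS.comp \<phi> K I = xx K \<otimes>\<^bsub>H\<^esub> h" using IS.comp_mem[OF \<phi> KI] by blast
  have "xx K \<otimes>\<^bsub>H\<^esub> (xx K \<otimes>\<^bsub>H\<^esub> h) = (xx K \<otimes>\<^bsub>H\<^esub> xx K) \<otimes>\<^bsub>H\<^esub> h" using x h(1) by (simp only: H.m_assoc)
  then show "xx K \<otimes>\<^bsub>H\<^esub> IS.comp \<phi> K I = poincare W S K \<odot>\<^bsub>H\<^esub> IS.comp \<phi> K I"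
    unfolding h(2) using xI x h(1) by (simp add: H.smult_mult_l)
  have "IS.comp \<phi> K I \<otimes>\<^bsub>H\<^esub> xx I = \<phi> (IS.unit_vec I (xx I \<otimes>\<^bsub>H\<^esub> xx I)) K"
    by (rule IS.comp_act[OF \<phi> KI x(1), symmetric])
  also have "xx I \<otimes>\<^bsub>H\<^esub> xx I = xx I \<otimes>\<^bsub>H\<^esub> (poincare W S I \<odot>\<^bsub>H\<^esub> \<one>\<^bsub>H\<^esub>)"
    using xI x by (simp add: H.smult_mult_r)
  also have "\<phi> (IS.unit_vec I \<dots>) K = IS.comp \<phi> K I \<otimes>\<^bsub>H\<^esub> (poincare W S I \<odot>\<^bsub>H\<^esub> \<one>\<^bsub>H\<^esub>)"
    by (rule IS.comp_act[OF \<phi> KI]) simp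
  finally show "IS.comp \<phi> K I \<otimes>\<^bsub>H\<^esub> xx I = poincare W S I \<odot>\<^bsub>H\<^esub> IS.comp \<phi> K I"
    using c by (simp add: H.smult_mult_r)
qed

lemma blk_ok_diag: "I \<in> L \<Longrightarrow> IS.blk_ok I I \<one>\<^bsub>H\<^esub>"
  unfolding IS.blk_ok_def using L_S by (auto intro!: bexI[of _ "\<one>\<^bsub>H\<^esub>"])

lemma blk_ok_from: "I \<in> L \<Longrightarrow> z \<in> carrier H \<Longrightarrow> IS.blk_ok {} I z"
  unfolding IS.blk_ok_def using L_S by (auto intro!: bexI[of _ "z \<otimes>\<^bsub>H\<^esub> xx I"])

lemma blk_ok_to: "K \<in> L \<Longrightarrow> h \<in> carrier H \<Longrightarrow> IS.blk_ok K {} (xx K \<otimes>\<^bsub>H\<^esub> h)"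
  unfolding IS.blk_ok_def using L_S by auto

lemma blk_ok_xx: "K \<in> L \<Longrightarrow> IS.blk_ok K {} (xx K)"
  using blk_ok_to[of K "\<one>\<^bsub>H\<^esub>"] L_S by simp

definition "E1 I = ES.pure 1 (IS.blk I I \<one>\<^bsub>H\<^esub>)"
definition "U1 I = ES.pure 1 (IS.blk {} I \<one>\<^bsub>H\<^esub>)"
definition "D1 I = ES.pure (piv I) (IS.blk I {} (xx I))"
definition "ta1 s = of_zq (1 + qq) \<odot>\<^bsub>X1\<^esub> (U1 {s} \<otimes>\<^bsub>X1\<^esub> D1 {s}) \<ominus>\<^bsub>X1\<^esub> E1 {}"
text \<open>The summand of the empty set is the whole Hecke algebra, so there left multiplication by
  every \<open>z\<close> is an endomorphism. This puts a copy of left multiplication into the corner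
  at \<open>E1 {}\<close>.\<close>

definition "la1 z = ES.pure 1 (IS.blk {} {} z)"

lemma X1_mult:
  "IS.blk_ok K J z \<Longrightarrow> IS.blk_ok J' I z' \<Longrightarrow> ES.pure r (IS.blk K J z) \<otimes>\<^bsub>X1\<^esub> ES.pure r' (IS.blk J' I z') =
    (if J = J' then ES.pure (r * r') (IS.blk K I (z \<otimes>\<^bsub>H\<^esub> z')) else \<zero>\<^bsub>X1\<^esub>)"
  by (simp add: ES.pure_simps(4) ES.pure_zero IS.blk_closed IS.blk_mult)

lemma la1: "alg_hom H (corner of_zq X1 (E1 {})) la1"
proof (rule alg_homI)
  note ok = blk_ok_from[OF empty_L]
  fix x y c assume xy: "x \<in> carrier H"
  show "la1 x \<in> carrier (corner of_zq X1 (E1 {}))"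
    using xy ok by (simp add: corner_fields la1_def E1_def X1_mult IS.blk_closed)
  show "la1 (c \<odot>\<^bsub>H\<^esub> x) = c \<odot>\<^bsub>corner of_zq X1 (E1 {})\<^esub> la1 x"
    using xy ok ES.pure_simps(3)[of "IS.blk {} {} x" 1 c]
    by (simp add: corner_fields la1_def IS.blk_smult IS.blk_closed ES.pure_simps(6))
  assume y: "y \<in> carrier H"
  show "la1 (x \<otimes>\<^bsub>H\<^esub> y) = la1 x \<otimes>\<^bsub>corner of_zq X1 (E1 {})\<^esub> la1 y"
    using xy y ok by (simp add: corner_fields la1_def X1_mult)
  show "la1 (x \<oplus>\<^bsub>H\<^esub> y) = la1 x \<oplus>\<^bsub>corner of_zq X1 (E1 {})\<^esub> la1 y"
    using xy y ok by (simp add: corner_fields la1_def IS.blk_add IS.blk_closed ES.pure_simps(2))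
qed (simp add: la1_def E1_def corner_fields)

lemma la1_UD: "I \<in> L \<Longrightarrow> U1 I \<otimes>\<^bsub>X1\<^esub> D1 I = piv I \<odot>\<^bsub>X1\<^esub> la1 (xx I)"
  using L_S unfolding U1_def D1_def la1_def
  by (simp add: X1_mult blk_ok_from blk_ok_xx ES.pure_simps(6) IS.blk_closed)

lemma la1_Tg: "s \<in> S \<Longrightarrow> la1 (Tg s) = ta1 s"
proof -
  assume s: "s \<in> S"
  interpret X: alg X1 by (rule ES.alg_TE)
  note la = alg_hom_simps[OF la1, unfolded corner_fields]
  have "of_zq (1 + qq) \<odot>\<^bsub>X1\<^esub> (U1 {s} \<otimes>\<^bsub>X1\<^esub> D1 {s}) = (of_zq (1 + qq) * piv {s}) \<odot>\<^bsub>X1\<^esub> la1 (xx {s})"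
    using s la(1)[of "xx {s}"] by (simp add: la1_UD X.smult_assoc)
  also have "of_zq (1 + qq) * piv {s} = 1"
    using piv[of "{s}"] s by (simp add: poincare_single mult.commute)
  also have "1 \<odot>\<^bsub>X1\<^esub> la1 (xx {s}) = E1 {} \<oplus>\<^bsub>X1\<^esub> la1 (Tg s)"
    using s la(1)[of "xx {s}"] by (simp add: xx_single[symmetric]) (simp add: xx_single la(3,4))
  finally show "la1 (Tg s) = ta1 s"
    unfolding ta1_def using la(1)[of "Tg s"] la(1)[of "\<one>\<^bsub>H\<^esub>"] s la(4)
    by (simp add: a_minus_def ES.TE.a_comm[of "E1 {}"] ES.TE.a_assoc ES.TE.r_neg)
qed

lemma qrep_X1: "qrep W S red rw a X1 E1 U1 D1 ta1"
proof -
  interpret X: alg X1 by (rule ES.alg_TE)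
  note la = alg_hom_simps[OF la1, unfolded corner_fields]
  note ok = blk_ok_diag blk_ok_from blk_ok_xx
  \<comment> \<open>Words in \<open>ta1\<close> are images of words in the T_s under the
    homomorphism \<open>la1\<close>; the braid relations are thus inherited from the Hecke
    algebra.\<close>
  have wp: "word_prod X1 (E1 {}) ta1 u = la1 (Tw u)" if u: "u \<in> lists S" for u
  proof -
    have "la1 (Tw u) = word_prod X1 (E1 {}) (\<lambda>s. la1 (Tg s)) u"
      using hom_Tw[OF la1 u] by (simp add: corner_fields)
    also have "\<dots> = word_prod X1 (E1 {}) ta1 u" using u la1_Tg by (intro word_prod_cong) auto
    finally show ?thesis by simp
  qed
  show ?thesis
  proof (intro qrep.intro qrep_axioms.intro coxf_axioms ES.alg_TE)
    fix I assume I: "I \<in> L"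
    show c: "E1 I \<in> carrier X1" "U1 I \<in> carrier X1" "D1 I \<in> carrier X1"
      using I ok by (auto simp: E1_def U1_def D1_def IS.blk_closed)
    show "E1 I \<otimes>\<^bsub>X1\<^esub> E1 J = (if I = J then E1 I else \<zero>\<^bsub>X1\<^esub>)" if "J \<in> L" for J
      using I that ok by (simp add: E1_def X1_mult)
    show "E1 {} \<otimes>\<^bsub>X1\<^esub> U1 I = U1 I" "U1 I \<otimes>\<^bsub>X1\<^esub> E1 I = U1 I"
      "E1 I \<otimes>\<^bsub>X1\<^esub> D1 I = D1 I" "D1 I \<otimes>\<^bsub>X1\<^esub> E1 {} = D1 I"
      using I ok L_S[OF I] by (simp_all add: E1_def U1_def D1_def X1_mult)
    show "D1 I \<otimes>\<^bsub>X1\<^esub> U1 I = E1 I"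
    proof -
      have x: "xx I \<in> carrier H" using L_S I by simp
      have ok': "IS.blk_ok I I (xx I)"
        using IS.blk_ok_mult[OF blk_ok_xx[OF I] blk_ok_from[OF I H.one_closed]] x by simp
      \<comment> \<open>The composite is left multiplication by x_I on x_I H, which is
        multiplication by pi(I); the factor \<open>piv I\<close> in \<open>D1\<close> cancels
        it.\<close>
      have "IS.blk I I (xx I) = IS.blk I I (poincare W S I \<odot>\<^bsub>H\<^esub> \<one>\<^bsub>H\<^esub>)"
        using xx_mult(1)[OF order_refl L_S[OF I] L_fin[OF I]] x
        by (intro IS.blk_cong ok' IS.blk_ok_smult blk_ok_diag I) (simp add: H.smult_mult_l)
      also have "\<dots> = poincare W S I \<odot>\<^bsub>EA\<^esub> IS.blk I I \<one>\<^bsub>H\<^esub>"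
        using blk_ok_diag[OF I] by (rule IS.blk_smult)
      finally have "D1 I \<otimes>\<^bsub>X1\<^esub> U1 I = ES.pure (piv I) (poincare W S I \<odot>\<^bsub>EA\<^esub> IS.blk I I \<one>\<^bsub>H\<^esub>)"
        using I ok x by (simp add: D1_def U1_def X1_mult)
      also have "\<dots> = ES.pure 1 (IS.blk I I \<one>\<^bsub>H\<^esub>)"
        using ES.pure_simps(3)[OF IS.blk_closed[OF blk_ok_diag[OF I]], of "piv I" "poincare W S I"] piv[OF I] by simp
      finally show ?thesis by (simp add: E1_def)
    qed
    show "U1 I \<otimes>\<^bsub>X1\<^esub> D1 I = piv I \<odot>\<^bsub>X1\<^esub> finsum X1 (\<lambda>w. word_prod X1 (E1 {}) ta1 (red w)) (generate W I)"
      using hom_xx[OF ES.TE.ring_axioms la1 la1_Tg I] I by (simp add: la1_UD)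
  next
    have "\<one>\<^bsub>X1\<^esub> = ES.pure 1 (finsum EA (\<lambda>I. IS.blk I I \<one>\<^bsub>H\<^esub>) L)"
      using IS.blk_sum_one[OF blk_ok_diag] by (simp add: ES.pure_simps(5))
    also have "\<dots> = finsum X1 E1 L"
      unfolding E1_def using IS.blk_closed[OF blk_ok_diag]
      by (intro additive_finsum(3)[OF ES.A.ring_axioms ES.TE.ring_axioms]) (auto simp: ES.pure_simps(2))
    finally show "finsum X1 E1 L = \<one>\<^bsub>X1\<^esub>" by simp
  next
    show "U1 {} = E1 {}" "D1 {} = E1 {}" by (simp_all add: U1_def D1_def E1_def piv_empty)
    show "ta1 s = of_zq (1 + qq) \<odot>\<^bsub>X1\<^esub> (U1 {s} \<otimes>\<^bsub>X1\<^esub> D1 {s}) \<ominus>\<^bsub>X1\<^esub> E1 {}" for s by (rule ta1_def)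
    fix p r assume pr: "p \<in> S" "r \<in> S" "p \<noteq> r" "cox_m W p r > 0"
    show "word_prod X1 (E1 {}) ta1 (alt_word (cox_m W p r) p r) = word_prod X1 (E1 {}) ta1 (alt_word (cox_m W p r) r p)"
      using wp[OF alt_word_lists] Tg_braid[OF pr] pr by simp
  qed
qed

end

section \<open>From endomorphisms to an algebra with the relations of the first quiver\<close>

context qrep
begin

text \<open>The idempotents sum to 1, so an element is the sum of its Peirce blocks.\<close>

lemma block_eq:
  assumes b: "b \<in> carrier B" "b' \<in> carrier B"
    and eq: "\<And>K I. K \<in> L \<Longrightarrow> I \<in> L \<Longrightarrow> E K \<otimes>\<^bsub>B\<^esub> b \<otimes>\<^bsub>B\<^esub> E I = E K \<otimes>\<^bsub>B\<^esub> b' \<otimes>\<^bsub>B\<^esub> E I"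
  shows "b = b'"
proof -
  have dec: "c = finsum B (\<lambda>I. finsum B (\<lambda>K. E K \<otimes>\<^bsub>B\<^esub> c \<otimes>\<^bsub>B\<^esub> E I) L) L" if c: "c \<in> carrier B" for c
  proof -
    have EL: "E \<in> L \<rightarrow> carrier B" by simp
    have "c = finsum B E L \<otimes>\<^bsub>B\<^esub> c \<otimes>\<^bsub>B\<^esub> finsum B E L" using c by (simp add: E1)
    also have "\<dots> = finsum B (\<lambda>I. finsum B E L \<otimes>\<^bsub>B\<^esub> c \<otimes>\<^bsub>B\<^esub> E I) L"
      using EL c by (intro B.finsum_rdistr finite_L) auto
    also have "\<dots> = finsum B (\<lambda>I. finsum B (\<lambda>K. E K \<otimes>\<^bsub>B\<^esub> c \<otimes>\<^bsub>B\<^esub> E I) L) L"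
      using EL c by (intro B.finsum_cong') (auto simp: B.finsum_ldistr[OF finite_L] Pi_iff)
    finally show ?thesis .
  qed
  have "finsum B (\<lambda>I. finsum B (\<lambda>K. E K \<otimes>\<^bsub>B\<^esub> b \<otimes>\<^bsub>B\<^esub> E I) L) L = finsum B (\<lambda>I. finsum B (\<lambda>K. E K \<otimes>\<^bsub>B\<^esub> b' \<otimes>\<^bsub>B\<^esub> E I) L) L"
    using b eq by (intro B.finsum_cong') auto
  then show ?thesis using dec b by metis
qed

lemma block_sum:
  assumes g: "\<And>K I. K \<in> L \<Longrightarrow> I \<in> L \<Longrightarrow> g K I \<in> carrier B"
    and gE: "\<And>K I. K \<in> L \<Longrightarrow> I \<in> L \<Longrightarrow> E K \<otimes>\<^bsub>B\<^esub> g K I = g K I" "\<And>K I. K \<in> L \<Longrightarrow> I \<in> L \<Longrightarrow> g K I \<otimes>\<^bsub>B\<^esub> E I = g K I"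
    and KI: "K \<in> L" "I \<in> L"
  shows "E K \<otimes>\<^bsub>B\<^esub> finsum B (\<lambda>K. finsum B (g K) L) L \<otimes>\<^bsub>B\<^esub> E I = g K I"
proof -
  have E0: "E K \<otimes>\<^bsub>B\<^esub> g K' I' = (if K = K' then g K' I' else \<zero>\<^bsub>B\<^esub>)" if "K' \<in> L" "I' \<in> L" for K' I'
  proof -
    have "E K \<otimes>\<^bsub>B\<^esub> g K' I' = (E K \<otimes>\<^bsub>B\<^esub> E K') \<otimes>\<^bsub>B\<^esub> g K' I'"
      using that KI g gE(1) by (simp add: B.m_assoc)
    then show ?thesis using that KI g gE(1) by (simp add: EE)
  qed
  have E0': "g K' I' \<otimes>\<^bsub>B\<^esub> E I = (if I' = I then g K' I' else \<zero>\<^bsub>B\<^esub>)" if "K' \<in> L" "I' \<in> L" for K' I'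
  proof -
    have "g K' I' \<otimes>\<^bsub>B\<^esub> E I = g K' I' \<otimes>\<^bsub>B\<^esub> (E I' \<otimes>\<^bsub>B\<^esub> E I)"
      using that KI g gE(2) by (simp add: B.m_assoc[symmetric])
    then show ?thesis using that KI g gE(2) by (simp add: EE)
  qed
  have gc: "g K' \<in> L \<rightarrow> carrier B" if "K' \<in> L" for K' using g that by blast
  have "E K \<otimes>\<^bsub>B\<^esub> finsum B (\<lambda>K. finsum B (g K) L) L = finsum B (\<lambda>K'. E K \<otimes>\<^bsub>B\<^esub> finsum B (g K') L) L"
    using gc KI by (intro B.finsum_rdistr finite_L) auto
  also have "\<dots> = finsum B (\<lambda>K'. if K = K' then finsum B (g K') L else \<zero>\<^bsub>B\<^esub>) L"
  proof (rule B.finsum_cong')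
    show "E K \<otimes>\<^bsub>B\<^esub> finsum B (g K') L = (if K = K' then finsum B (g K') L else \<zero>\<^bsub>B\<^esub>)" if K': "K' \<in> L" for K'
    proof -
      have "E K \<otimes>\<^bsub>B\<^esub> finsum B (g K') L = finsum B (\<lambda>I'. E K \<otimes>\<^bsub>B\<^esub> g K' I') L"
        using gc[OF K'] KI by (intro B.finsum_rdistr finite_L) auto
      also have "\<dots> = finsum B (\<lambda>I'. if K = K' then g K' I' else \<zero>\<^bsub>B\<^esub>) L"
        using E0[OF K'] g K' by (intro B.finsum_cong') auto
      finally show ?thesis by simp
    qed
  qed (use gc in auto)
  also have "\<dots> = finsum B (g K) L"
    using B.add.finprod_singleton[OF KI(1) finite_L, of "\<lambda>K'. finsum B (g K') L"] gc by (simp add: Pi_iff)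
  also have "\<dots> \<otimes>\<^bsub>B\<^esub> E I = finsum B (\<lambda>I'. g K I' \<otimes>\<^bsub>B\<^esub> E I) L"
    using gc KI by (intro B.finsum_ldistr finite_L) auto
  also have "\<dots> = finsum B (\<lambda>I'. if I = I' then g K I' else \<zero>\<^bsub>B\<^esub>) L"
    using E0'[OF KI(1)] g KI by (intro B.finsum_cong') auto
  also have "\<dots> = g K I"
    using B.add.finprod_singleton[OF KI(2) finite_L, of "g K"] gc KI by (simp add: Pi_iff)
  finally show ?thesis .
qed

text \<open>The argument is meant to be a matrix entry, that is, a value at x_I. Such an entry is
  fixed up to pi(I) by right multiplication with x_I, and \<open>piv I\<close> compensates for that
  surplus: x_I itself is sent to the idempotent \<open>E I\<close>.\<close>

definition sand :: "'w set \<Rightarrow> 'w set \<Rightarrow> _ \<Rightarrow> 'b"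
  where "sand K I z = piv I \<odot>\<^bsub>B\<^esub> (D K \<otimes>\<^bsub>B\<^esub> iota z \<otimes>\<^bsub>B\<^esub> U I)"

lemma sand_simps:
  assumes "K \<in> L" "I \<in> L" "z \<in> carrier H"
  shows "sand K I z \<in> carrier B" "E K \<otimes>\<^bsub>B\<^esub> sand K I z = sand K I z" "sand K I z \<otimes>\<^bsub>B\<^esub> E I = sand K I z"
    "z' \<in> carrier H \<Longrightarrow> sand K I (z \<oplus>\<^bsub>H\<^esub> z') = sand K I z \<oplus>\<^bsub>B\<^esub> sand K I z'"
    "sand K I (c \<odot>\<^bsub>H\<^esub> z) = of_zq c \<odot>\<^bsub>B\<^esub> sand K I z" "sand K I \<zero>\<^bsub>H\<^esub> = \<zero>\<^bsub>B\<^esub>"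
proof -
  note c = assms iota_simps(1)
  have cl: "sand K I z \<in> carrier B" if "z \<in> carrier H" for z using that assms iota_simps(1) by (simp add: sand_def)
  from this[OF assms(3)] show "sand K I z \<in> carrier B" .
  have "E K \<otimes>\<^bsub>B\<^esub> (D K \<otimes>\<^bsub>B\<^esub> iota z \<otimes>\<^bsub>B\<^esub> U I) = (E K \<otimes>\<^bsub>B\<^esub> D K) \<otimes>\<^bsub>B\<^esub> iota z \<otimes>\<^bsub>B\<^esub> U I"
    using c closed by (simp only: B.m_assoc B.m_closed)
  then show "E K \<otimes>\<^bsub>B\<^esub> sand K I z = sand K I z" using c by (simp add: sand_def B.smult_mult_r ED)
  have "D K \<otimes>\<^bsub>B\<^esub> iota z \<otimes>\<^bsub>B\<^esub> U I \<otimes>\<^bsub>B\<^esub> E I = D K \<otimes>\<^bsub>B\<^esub> iota z \<otimes>\<^bsub>B\<^esub> (U I \<otimes>\<^bsub>B\<^esub> E I)"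
    using c closed by (simp only: B.m_assoc B.m_closed)
  then show "sand K I z \<otimes>\<^bsub>B\<^esub> E I = sand K I z" using c by (simp add: sand_def B.smult_mult_l EU)
  have add: "sand K I (z \<oplus>\<^bsub>H\<^esub> z') = sand K I z \<oplus>\<^bsub>B\<^esub> sand K I z'" if "z \<in> carrier H" "z' \<in> carrier H" for z z'
    using that assms iota_simps(1) by (simp add: sand_def iota_simps(5) B.l_distr B.r_distr B.smult_r_distr)
  from this[OF assms(3)] show "z' \<in> carrier H \<Longrightarrow> sand K I (z \<oplus>\<^bsub>H\<^esub> z') = sand K I z \<oplus>\<^bsub>B\<^esub> sand K I z'" .
  show "sand K I (c \<odot>\<^bsub>H\<^esub> z) = of_zq c \<odot>\<^bsub>B\<^esub> sand K I z"
    using c by (simp add: sand_def iota_simps(7) B.smult_mult_l B.smult_mult_r B.smult_left_commute)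
  show "sand K I \<zero>\<^bsub>H\<^esub> = \<zero>\<^bsub>B\<^esub>" by (rule additive_finsum(1)[OF H.ring_axioms B.ring_axioms cl add])
qed

definition gam :: "_ \<Rightarrow> 'b"
  where "gam \<phi> = finsum B (\<lambda>K. finsum B (\<lambda>I. sand K I (IS.comp \<phi> K I)) L) L"

lemma gam_block:
  assumes "\<phi> \<in> carrier EA" "K \<in> L" "I \<in> L"
  shows "E K \<otimes>\<^bsub>B\<^esub> gam \<phi> \<otimes>\<^bsub>B\<^esub> E I = sand K I (IS.comp \<phi> K I)"
  unfolding gam_def using assms IS.comp_closed sand_simps(1-3) by (intro block_sum) auto

lemma gam_closed [simp]: "\<phi> \<in> carrier EA \<Longrightarrow> gam \<phi> \<in> carrier B"
  unfolding gam_def by (intro B.finsum_closed Pi_I sand_simps(1) IS.comp_closed)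

lemma gam_eqI:
  assumes "\<phi> \<in> carrier EA" "b \<in> carrier B"
    and "\<And>K I. K \<in> L \<Longrightarrow> I \<in> L \<Longrightarrow> E K \<otimes>\<^bsub>B\<^esub> b \<otimes>\<^bsub>B\<^esub> E I = sand K I (IS.comp \<phi> K I)"
  shows "gam \<phi> = b"
proof (rule block_eq)
  show "E K \<otimes>\<^bsub>B\<^esub> gam \<phi> \<otimes>\<^bsub>B\<^esub> E I = E K \<otimes>\<^bsub>B\<^esub> b \<otimes>\<^bsub>B\<^esub> E I" if "K \<in> L" "I \<in> L" for K I
    unfolding gam_block[OF assms(1) that] by (rule assms(3)[OF that, symmetric])
qed (use assms in auto)

lemma D_iota_xx: "K \<in> L \<Longrightarrow> D K \<otimes>\<^bsub>B\<^esub> iota (xx K) = of_zq (poincare W S K) \<odot>\<^bsub>B\<^esub> D K"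
  by (simp add: iota_xx(2) UD_idem(1,6) B.smult_mult_r)

lemma iota_xx_U: "I \<in> L \<Longrightarrow> iota (xx I) \<otimes>\<^bsub>B\<^esub> U I = of_zq (poincare W S I) \<odot>\<^bsub>B\<^esub> U I"
  by (simp add: iota_xx(2) UD_idem(1,5) B.smult_mult_l)

lemma sand_xx:
  assumes "I \<in> L"
  shows "sand I I (xx I) = E I" "sand {} I (xx I) = U I" "piv I \<odot>\<^bsub>B\<^esub> sand I {} (xx I) = D I"
proof -
  have x: "xx I \<in> carrier H" using L_S assms by simp
  have p: "piv I \<odot>\<^bsub>B\<^esub> (of_zq (poincare W S I) \<odot>\<^bsub>B\<^esub> b) = b" if "b \<in> carrier B" for b
    using that piv[OF assms] B.smult_assoc[OF that, of "piv I" "of_zq (poincare W S I)"] by simp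
  show "sand I I (xx I) = E I"
    using assms p x by (simp add: sand_def D_iota_xx B.smult_mult_l DU')
  show "sand {} I (xx I) = U I"
    using assms p x by (simp add: sand_def UD0 iota_simps iota_xx_U)
  show "piv I \<odot>\<^bsub>B\<^esub> sand I {} (xx I) = D I"
    using assms p x by (simp add: sand_def D_iota_xx piv_empty UD0 ED B.smult_mult_l)
qed

lemma gam_blk:
  assumes ok: "IS.blk_ok K I z" shows "gam (IS.blk K I z) = sand K I (z \<otimes>\<^bsub>H\<^esub> xx I)"
proof (rule gam_eqI[OF IS.blk_closed[OF ok]])
  have c: "K \<in> L" "I \<in> L" "z \<otimes>\<^bsub>H\<^esub> xx I \<in> carrier H" using ok L_S by (auto simp: IS.blk_ok_def)
  note s = sand_simps[OF c]
  show "sand K I (z \<otimes>\<^bsub>H\<^esub> xx I) \<in> carrier B" by (rule s(1))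
  fix K' I' assume L': "K' \<in> L" "I' \<in> L"
  define t where "t = sand K I (z \<otimes>\<^bsub>H\<^esub> xx I)"
  have t: "t \<in> carrier B" "E K \<otimes>\<^bsub>B\<^esub> t = t" "t \<otimes>\<^bsub>B\<^esub> E I = t" using s by (simp_all add: t_def)
  have "E K' \<otimes>\<^bsub>B\<^esub> t \<otimes>\<^bsub>B\<^esub> E I' = E K' \<otimes>\<^bsub>B\<^esub> (E K \<otimes>\<^bsub>B\<^esub> t \<otimes>\<^bsub>B\<^esub> E I) \<otimes>\<^bsub>B\<^esub> E I'" using t by simp
  also have "\<dots> = (E K' \<otimes>\<^bsub>B\<^esub> E K) \<otimes>\<^bsub>B\<^esub> t \<otimes>\<^bsub>B\<^esub> (E I \<otimes>\<^bsub>B\<^esub> E I')"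
    using t(1) c L' closed by (simp only: B.m_assoc B.m_closed)
  also have "\<dots> = sand K' I' (IS.comp (IS.blk K I z) K' I')"
    using L' c t sand_simps(6)[OF L' c(3)] by (auto simp: EE IS.comp_blk[OF ok L'] t_def)
  finally show "E K' \<otimes>\<^bsub>B\<^esub> sand K I (z \<otimes>\<^bsub>H\<^esub> xx I) \<otimes>\<^bsub>B\<^esub> E I' = sand K' I' (IS.comp (IS.blk K I z) K' I')"
    by (simp add: t_def)
qed

text \<open>Write c for the entry of \<open>\<psi>\<close> and x_J h for that of
  \<open>\<phi>\<close>. In the middle, U_J D_J is the image of x_J/pi(J), and c absorbs it since c
  x_J = pi(J) c. What remains is the image of c h, which is the value of \<open>\<psi>\<close> at
  x_J h.\<close>

lemma sand_mult:
  assumes \<psi>: "\<psi> \<in> carrier EA" and \<phi>: "\<phi> \<in> carrier EA" and L: "K \<in> L" "J \<in> L" "I \<in> L"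
  shows "sand K J (IS.comp \<psi> K J) \<otimes>\<^bsub>B\<^esub> sand J I (IS.comp \<phi> J I) = sand K I (\<psi> (IS.unit_vec J (IS.comp \<phi> J I)) K)"
proof -
  define c where "c = IS.comp \<psi> K J"
  obtain h where h: "h \<in> carrier H" "IS.comp \<phi> J I = xx J \<otimes>\<^bsub>H\<^esub> h" using IS.comp_mem[OF \<phi> L(2,3)] by blast
  have x: "xx J \<in> carrier H" using L_S L by simp
  have c: "c \<in> carrier H" "c \<otimes>\<^bsub>H\<^esub> xx J = poincare W S J \<odot>\<^bsub>H\<^esub> c"
    unfolding c_def using IS.comp_closed[OF \<psi> L(1,2)] comp_xx(2)[OF \<psi> L(1,2)] by auto
  have \<iota>: "iota c \<in> carrier B" "iota h \<in> carrier B" "iota (xx J) \<in> carrier B" "iota (c \<otimes>\<^bsub>H\<^esub> h) \<in> carrier B"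
    using c h x iota_simps(1) by auto
  have D\<iota>: "D J \<otimes>\<^bsub>B\<^esub> iota (xx J \<otimes>\<^bsub>H\<^esub> h) = of_zq (poincare W S J) \<odot>\<^bsub>B\<^esub> (D J \<otimes>\<^bsub>B\<^esub> iota h)"
  proof -
    have "D J \<otimes>\<^bsub>B\<^esub> iota (xx J \<otimes>\<^bsub>H\<^esub> h) = (D J \<otimes>\<^bsub>B\<^esub> iota (xx J)) \<otimes>\<^bsub>B\<^esub> iota h"
      unfolding iota_simps(4)[OF x h(1)] using \<iota> L closed by (simp only: B.m_assoc)
    then show ?thesis using D_iota_xx L \<iota> by (simp add: B.smult_mult_l)
  qed
  have "sand K J c \<otimes>\<^bsub>B\<^esub> sand J I (xx J \<otimes>\<^bsub>H\<^esub> h) =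
      (piv J * piv I * of_zq (poincare W S J)) \<odot>\<^bsub>B\<^esub> ((D K \<otimes>\<^bsub>B\<^esub> iota c \<otimes>\<^bsub>B\<^esub> U J) \<otimes>\<^bsub>B\<^esub> (D J \<otimes>\<^bsub>B\<^esub> iota h \<otimes>\<^bsub>B\<^esub> U I))"
    unfolding sand_def D\<iota> using \<iota> L by (simp add: B.smult_mult_l B.smult_mult_r B.smult_assoc B.smult_left_commute)
  also have "piv J * piv I * of_zq (poincare W S J) = piv I" using piv[OF L(2)] by (simp add: mult.commute mult.left_commute)
  also have "(D K \<otimes>\<^bsub>B\<^esub> iota c \<otimes>\<^bsub>B\<^esub> U J) \<otimes>\<^bsub>B\<^esub> (D J \<otimes>\<^bsub>B\<^esub> iota h \<otimes>\<^bsub>B\<^esub> U I) =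
      D K \<otimes>\<^bsub>B\<^esub> (iota c \<otimes>\<^bsub>B\<^esub> (U J \<otimes>\<^bsub>B\<^esub> D J) \<otimes>\<^bsub>B\<^esub> iota h) \<otimes>\<^bsub>B\<^esub> U I"
    using \<iota> L closed by (simp only: B.m_assoc B.m_closed)
  also have "iota c \<otimes>\<^bsub>B\<^esub> (U J \<otimes>\<^bsub>B\<^esub> D J) = iota c"
  proof -
    have "iota c \<otimes>\<^bsub>B\<^esub> (U J \<otimes>\<^bsub>B\<^esub> D J) = piv J \<odot>\<^bsub>B\<^esub> iota (c \<otimes>\<^bsub>H\<^esub> xx J)"
      using \<iota> L c(1) x by (simp add: iota_xx(1) iota_simps(4) B.smult_mult_r)
    also have "\<dots> = (piv J * of_zq (poincare W S J)) \<odot>\<^bsub>B\<^esub> iota c"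
      unfolding c(2) using c(1) \<iota> by (simp add: iota_simps(7) B.smult_assoc)
    finally show ?thesis using piv[OF L(2)] \<iota> by simp
  qed
  also have "piv I \<odot>\<^bsub>B\<^esub> (D K \<otimes>\<^bsub>B\<^esub> (iota c \<otimes>\<^bsub>B\<^esub> iota h) \<otimes>\<^bsub>B\<^esub> U I) = sand K I (c \<otimes>\<^bsub>H\<^esub> h)"
    using c h by (simp add: sand_def iota_simps(4))
  also have "c \<otimes>\<^bsub>H\<^esub> h = \<psi> (IS.unit_vec J (xx J \<otimes>\<^bsub>H\<^esub> h)) K"
    unfolding c_def by (rule IS.comp_act[OF \<psi> L(1,2) h(1), symmetric])
  finally show ?thesis by (simp add: h(2) c_def)
qed

lemma gam_mult:
  assumes \<psi>: "\<psi> \<in> carrier EA" and \<phi>: "\<phi> \<in> carrier EA"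
  shows "gam (\<psi> \<otimes>\<^bsub>EA\<^esub> \<phi>) = gam \<psi> \<otimes>\<^bsub>B\<^esub> gam \<phi>"
proof (rule gam_eqI)
  show "\<psi> \<otimes>\<^bsub>EA\<^esub> \<phi> \<in> carrier EA" "gam \<psi> \<otimes>\<^bsub>B\<^esub> gam \<phi> \<in> carrier B" using assms by simp_all
  fix K I assume L: "K \<in> L" "I \<in> L"
  let ?y = "\<lambda>J. \<psi> (IS.unit_vec J (IS.comp \<phi> J I)) K"
  have y: "?y J \<in> carrier H" if J: "J \<in> L" for J
  proof -
    have "IS.unit_vec J (IS.comp \<phi> J I) \<in> IS.M"
      using IS.comp_mem[OF \<phi> J L(2)] IS.unit_vec_M by auto
    then show ?thesis by (rule IS.EA_D(5)[OF \<psi> _ L(1)])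
  qed
  have g: "gam \<psi> \<in> carrier B" "gam \<phi> \<in> carrier B" using assms by auto
  \<comment> \<open>Inserting 1 as the sum of the \<open>E J\<close> between the factors turns the
    product of the images into a matrix product.\<close>
  have "E K \<otimes>\<^bsub>B\<^esub> (gam \<psi> \<otimes>\<^bsub>B\<^esub> gam \<phi>) \<otimes>\<^bsub>B\<^esub> E I = (E K \<otimes>\<^bsub>B\<^esub> gam \<psi> \<otimes>\<^bsub>B\<^esub> finsum B E L) \<otimes>\<^bsub>B\<^esub> (gam \<phi> \<otimes>\<^bsub>B\<^esub> E I)"
    using g L by (simp add: E1 B.m_assoc)
  also have "E K \<otimes>\<^bsub>B\<^esub> gam \<psi> \<otimes>\<^bsub>B\<^esub> finsum B E L = finsum B (\<lambda>J. E K \<otimes>\<^bsub>B\<^esub> gam \<psi> \<otimes>\<^bsub>B\<^esub> E J) L"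
    using g L by (intro B.finsum_rdistr finite_L) auto
  also have "\<dots> \<otimes>\<^bsub>B\<^esub> (gam \<phi> \<otimes>\<^bsub>B\<^esub> E I) = finsum B (\<lambda>J. E K \<otimes>\<^bsub>B\<^esub> gam \<psi> \<otimes>\<^bsub>B\<^esub> E J \<otimes>\<^bsub>B\<^esub> (gam \<phi> \<otimes>\<^bsub>B\<^esub> E I)) L"
    using g L by (intro B.finsum_ldistr finite_L) auto
  also have "\<dots> = finsum B (\<lambda>J. sand K I (?y J)) L"
  proof (rule B.finsum_cong')
    show "E K \<otimes>\<^bsub>B\<^esub> gam \<psi> \<otimes>\<^bsub>B\<^esub> E J \<otimes>\<^bsub>B\<^esub> (gam \<phi> \<otimes>\<^bsub>B\<^esub> E I) = sand K I (?y J)" if J: "J \<in> L" for J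
    proof -
      have "E K \<otimes>\<^bsub>B\<^esub> gam \<psi> \<otimes>\<^bsub>B\<^esub> E J = (E K \<otimes>\<^bsub>B\<^esub> gam \<psi> \<otimes>\<^bsub>B\<^esub> E J) \<otimes>\<^bsub>B\<^esub> E J"
        using g L J by (simp add: B.m_assoc EE)
      moreover have "\<dots> \<otimes>\<^bsub>B\<^esub> (gam \<phi> \<otimes>\<^bsub>B\<^esub> E I) = (E K \<otimes>\<^bsub>B\<^esub> gam \<psi> \<otimes>\<^bsub>B\<^esub> E J) \<otimes>\<^bsub>B\<^esub> (E J \<otimes>\<^bsub>B\<^esub> gam \<phi> \<otimes>\<^bsub>B\<^esub> E I)"
        using g L J closed by (simp only: B.m_assoc B.m_closed)
      ultimately show ?thesis
        using gam_block[OF \<psi> L(1) J] gam_block[OF \<phi> J L(2)] sand_mult[OF \<psi> \<phi> L(1) J L(2)] by simp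
    qed
  qed (use y L sand_simps(1) in auto)
  also have "\<dots> = sand K I (finsum H ?y L)"
    using y sand_simps(1,4)[OF L]
    by (intro additive_finsum(3)[OF H.ring_axioms B.ring_axioms, symmetric]) auto
  also have "finsum H ?y L = IS.comp (\<psi> \<otimes>\<^bsub>EA\<^esub> \<phi>) K I" by (rule IS.comp_mult[OF \<psi> \<phi> L, symmetric])
  finally show "E K \<otimes>\<^bsub>B\<^esub> (gam \<psi> \<otimes>\<^bsub>B\<^esub> gam \<phi>) \<otimes>\<^bsub>B\<^esub> E I = sand K I (IS.comp (\<psi> \<otimes>\<^bsub>EA\<^esub> \<phi>) K I)" .
qed

lemma gam_hom: "\<exists>g. alg_hom X1 B g \<and> (\<forall>r. \<forall>\<phi>\<in>carrier EA. g (ES.pure r \<phi>) = r \<odot>\<^bsub>B\<^esub> gam \<phi>)"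
proof (rule ES.TE_lift[OF B.alg_axioms])
  fix \<phi> \<psi> assume \<phi>: "\<phi> \<in> carrier EA"
  show "gam \<phi> \<in> carrier B" using \<phi> by simp
  show "gam (c \<odot>\<^bsub>EA\<^esub> \<phi>) = of_zq c \<odot>\<^bsub>B\<^esub> gam \<phi>" for c
  proof (rule gam_eqI)
    fix K I assume L: "K \<in> L" "I \<in> L"
    have "IS.comp (c \<odot>\<^bsub>EA\<^esub> \<phi>) K I = c \<odot>\<^bsub>H\<^esub> IS.comp \<phi> K I"
      unfolding IS.comp_def by (rule IS.EA_apply(5)[OF IS.unit_vec_x[OF L(2)] L(1)])
    then show "E K \<otimes>\<^bsub>B\<^esub> (of_zq c \<odot>\<^bsub>B\<^esub> gam \<phi>) \<otimes>\<^bsub>B\<^esub> E I = sand K I (IS.comp (c \<odot>\<^bsub>EA\<^esub> \<phi>) K I)"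
      using L \<phi> by (simp add: B.smult_mult_r B.smult_mult_l gam_block sand_simps IS.comp_closed)
  qed (use \<phi> in auto)
  assume \<psi>: "\<psi> \<in> carrier EA"
  show "gam (\<phi> \<otimes>\<^bsub>EA\<^esub> \<psi>) = gam \<phi> \<otimes>\<^bsub>B\<^esub> gam \<psi>" by (rule gam_mult[OF \<phi> \<psi>])
  show "gam (\<phi> \<oplus>\<^bsub>EA\<^esub> \<psi>) = gam \<phi> \<oplus>\<^bsub>B\<^esub> gam \<psi>"
  proof (rule gam_eqI)
    fix K I assume L: "K \<in> L" "I \<in> L"
    have "IS.comp (\<phi> \<oplus>\<^bsub>EA\<^esub> \<psi>) K I = IS.comp \<phi> K I \<oplus>\<^bsub>H\<^esub> IS.comp \<psi> K I"
      unfolding IS.comp_def by (rule IS.EA_apply(4)[OF IS.unit_vec_x[OF L(2)] L(1)])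
    then show "E K \<otimes>\<^bsub>B\<^esub> (gam \<phi> \<oplus>\<^bsub>B\<^esub> gam \<psi>) \<otimes>\<^bsub>B\<^esub> E I = sand K I (IS.comp (\<phi> \<oplus>\<^bsub>EA\<^esub> \<psi>) K I)"
      using L \<phi> \<psi> by (simp add: B.l_distr B.r_distr gam_block sand_simps IS.comp_closed)
  qed (use \<phi> \<psi> in auto)
next
  show "gam \<one>\<^bsub>EA\<^esub> = \<one>\<^bsub>B\<^esub>"
  proof (rule gam_eqI)
    fix K I assume L: "K \<in> L" "I \<in> L"
    have "IS.comp \<one>\<^bsub>EA\<^esub> K I = (if K = I then xx I else \<zero>\<^bsub>H\<^esub>)"
      unfolding IS.comp_def IS.EA_apply(2)[OF IS.unit_vec_x[OF L(2)]] using L by (simp add: IS.unit_vec_def)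
    then show "E K \<otimes>\<^bsub>B\<^esub> \<one>\<^bsub>B\<^esub> \<otimes>\<^bsub>B\<^esub> E I = sand K I (IS.comp \<one>\<^bsub>EA\<^esub> K I)"
      using L sand_xx(1) sand_simps(6)[OF L H.one_closed] by (simp add: EE)
  qed auto
qed

end

context coxf
begin

text \<open>Let c be the entry. On a vector with I-component x_I h, left multiplication by x_K c
  gives x_K c x_I h, which is pi(K) pi(I) c h, while \<open>\<phi>\<close> gives c h. Before scalars
  are extended the two polynomials cannot be divided out, so they stay as a factor.\<close>

lemma blk_comp:
  assumes \<phi>: "\<phi> \<in> carrier EA" and L: "K \<in> L" "I \<in> L"
  shows "IS.blk K I (xx K \<otimes>\<^bsub>H\<^esub> IS.comp \<phi> K I) =
    (poincare W S K * poincare W S I) \<odot>\<^bsub>EA\<^esub> (IS.blk K K \<one>\<^bsub>H\<^esub> \<otimes>\<^bsub>EA\<^esub> \<phi> \<otimes>\<^bsub>EA\<^esub> IS.blk I I \<one>\<^bsub>H\<^esub>)"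
proof -
  define c where "c = IS.comp \<phi> K I"
  have c: "c \<in> carrier H" unfolding c_def by (rule IS.comp_closed[OF \<phi> L])
  have xc: "xx K \<otimes>\<^bsub>H\<^esub> c = poincare W S K \<odot>\<^bsub>H\<^esub> c" "c \<otimes>\<^bsub>H\<^esub> xx I = poincare W S I \<odot>\<^bsub>H\<^esub> c"
    unfolding c_def by (rule comp_xx[OF \<phi> L])+
  have x: "xx K \<in> carrier H" "xx I \<in> carrier H" using L_S L by auto
  have ok: "IS.blk_ok K I (xx K \<otimes>\<^bsub>H\<^esub> c)"
    using L x c unfolding IS.blk_ok_def by (auto simp: H.m_assoc intro!: bexI[of _ "c \<otimes>\<^bsub>H\<^esub> xx I"])
  note d = blk_ok_diag[OF L(1)] blk_ok_diag[OF L(2)]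
  show ?thesis
    unfolding c_def[symmetric]
  proof (rule IS.EA_eqI[OF IS.blk_closed[OF ok]])
    show "(poincare W S K * poincare W S I) \<odot>\<^bsub>EA\<^esub> (IS.blk K K \<one>\<^bsub>H\<^esub> \<otimes>\<^bsub>EA\<^esub> \<phi> \<otimes>\<^bsub>EA\<^esub> IS.blk I I \<one>\<^bsub>H\<^esub>) \<in> carrier EA"
      using \<phi> d IS.blk_closed by simp
    fix v i assume v: "v \<in> IS.M" "i \<in> L"
    obtain h where h: "h \<in> carrier H" "v I = xx I \<otimes>\<^bsub>H\<^esub> h" using v(1) L by (auto simp: IS.M_iff)
    have bv: "IS.blk I I \<one>\<^bsub>H\<^esub> v = IS.unit_vec I (xx I \<otimes>\<^bsub>H\<^esub> h)"
      using v h x by (simp add: IS.blk_def)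
    have M: "IS.unit_vec I (xx I \<otimes>\<^bsub>H\<^esub> h) \<in> IS.M" by (rule IS.unit_vec_M[OF h(1)])
    have "c \<otimes>\<^bsub>H\<^esub> (xx I \<otimes>\<^bsub>H\<^esub> h) = (c \<otimes>\<^bsub>H\<^esub> xx I) \<otimes>\<^bsub>H\<^esub> h" using c x h(1) by (simp only: H.m_assoc)
    then have e: "xx K \<otimes>\<^bsub>H\<^esub> c \<otimes>\<^bsub>H\<^esub> (xx I \<otimes>\<^bsub>H\<^esub> h) = (poincare W S K * poincare W S I) \<odot>\<^bsub>H\<^esub> (c \<otimes>\<^bsub>H\<^esub> h)"
      unfolding xc using c x h(1) by (simp add: H.smult_mult_l H.smult_assoc)
    have "\<phi> (IS.unit_vec I (xx I \<otimes>\<^bsub>H\<^esub> h)) K = c \<otimes>\<^bsub>H\<^esub> h"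
      unfolding c_def by (rule IS.comp_act[OF \<phi> L h(1)])
    then show "IS.blk K I (xx K \<otimes>\<^bsub>H\<^esub> c) v i =
        ((poincare W S K * poincare W S I) \<odot>\<^bsub>EA\<^esub> (IS.blk K K \<one>\<^bsub>H\<^esub> \<otimes>\<^bsub>EA\<^esub> \<phi> \<otimes>\<^bsub>EA\<^esub> IS.blk I I \<one>\<^bsub>H\<^esub>)) v i"
      using v h(2) e c h(1) by (simp add: IS.EA_apply IS.blk_apply bv M IS.EA_D(2)[OF \<phi> M])
  qed
qed

text \<open>The map from \<open>X2\<close> comes from the relations, the map back from
  \<open>gam\<close>. On \<open>X2\<close> the composite is tested on vertices and arrows; on
  \<open>X1\<close>, where no presentation is at hand, it is tested on pure tensors, block by
  block.\<close>

theorem X1_iso_X2: "alg_isomorphic X1 X2"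
proof -
  interpret p: qrep W S red rw a X1 E1 U1 D1 ta1 by (rule qrep_X1)
  interpret q: qrep W S red rw a X2 E2 U2 D2 ta2 by (rule qrep_X2)
  obtain f where f: "alg_hom X2 X1 f" "\<And>I. I \<in> L \<Longrightarrow> f (E2 I) = E1 I"
    "\<And>I. I \<in> L \<Longrightarrow> I \<noteq> {} \<Longrightarrow> f (cl2 (ups W S I)) = U1 I \<and> f (cl2 (del W S I)) = D1 I"
    using X2_lift[OF qrep_X1] by (auto simp: E2_def)
  have fUD: "f (U2 I) = U1 I" "f (D2 I) = D1 I" if "I \<in> L" for I
    using f(2)[of "{}"] f(3)[OF that] p.UD0 by (auto simp: U2_def D2_def E2_def)
  note fs = alg_hom_simps[OF f(1)]
  obtain g where g: "alg_hom X1 X2 g" "\<And>r \<phi>. \<phi> \<in> carrier EA \<Longrightarrow> g (ES.pure r \<phi>) = r \<odot>\<^bsub>X2\<^esub> q.gam \<phi>"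
    using q.gam_hom by blast
  \<comment> \<open>Both sides are homomorphisms from the Hecke algebra into the corner at the empty
    set, so it is enough to compare them on the generators T_s.\<close>
  have f\<iota>: "f (q.iota h) = la1 h" if h: "h \<in> carrier H" for h
  proof (rule hecke_ext[OF p.alg_C _ la1 _ h])
    show "alg_hom H p.C (\<lambda>h. f (q.iota h))"
    proof (rule alg_homI)
      fix x assume x: "x \<in> carrier H"
      have i: "q.iota x \<in> carrier X2" "E2 {} \<otimes>\<^bsub>X2\<^esub> q.iota x = q.iota x" "q.iota x \<otimes>\<^bsub>X2\<^esub> E2 {} = q.iota x"
        using x q.iota_simps by auto
      show "f (q.iota x) \<in> carrier p.C"
        using fs(2)[OF q.closed(1)[OF empty_L] i(1)] fs(2)[OF i(1) q.closed(1)[OF empty_L]] fs(1)[OF i(1)] i f(2)[OF empty_L]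
        by (simp add: corner_fields)
    qed (simp_all add: corner_fields q.iota_simps fs f(2))
    show "f (q.iota (Tg s)) = la1 (Tg s)" if s: "s \<in> S" for s
    proof -
      have UD: "U2 {s} \<otimes>\<^bsub>X2\<^esub> D2 {s} \<in> carrier X2" using s by simp
      have c: "f (E2 {}) \<in> carrier X1" "of_zq (1 + qq) \<odot>\<^bsub>X2\<^esub> (U2 {s} \<otimes>\<^bsub>X2\<^esub> D2 {s}) \<in> carrier X2" "E2 {} \<in> carrier X2"
        using UD fs(1) by auto
      have neg: "f (\<ominus>\<^bsub>X2\<^esub> E2 {}) = \<ominus>\<^bsub>X1\<^esub> f (E2 {})"
        by (rule additive_finsum(2)[OF q.B.ring_axioms ES.TE.ring_axioms fs(1) fs(3) c(3)])
      have "f (ta2 s) = of_zq (1 + qq) \<odot>\<^bsub>X1\<^esub> (U1 {s} \<otimes>\<^bsub>X1\<^esub> D1 {s}) \<ominus>\<^bsub>X1\<^esub> E1 {}"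
        using s UD c neg by (simp add: q.ta a_minus_def fs fUD f(2))
      then show ?thesis using s by (simp add: q.iota(2) la1_Tg ta1_def)
    qed
  qed
  have fgam: "f (q.gam \<phi>) = ES.pure 1 \<phi>" if \<phi>: "\<phi> \<in> carrier EA" for \<phi>
  proof (rule p.block_eq)
    show "f (q.gam \<phi>) \<in> carrier X1" "ES.pure 1 \<phi> \<in> carrier X1" using \<phi> fs(1) by auto
    fix K I assume L: "K \<in> L" "I \<in> L"
    define c where "c = IS.comp \<phi> K I"
    have c: "c \<in> carrier H" unfolding c_def by (rule IS.comp_closed[OF \<phi> L])
    have ok: "IS.blk_ok K {} (xx K \<otimes>\<^bsub>H\<^esub> c)" by (rule blk_ok_to[OF L(1) c])
    let ?b = "IS.blk K K \<one>\<^bsub>H\<^esub> \<otimes>\<^bsub>EA\<^esub> \<phi> \<otimes>\<^bsub>EA\<^esub> IS.blk I I \<one>\<^bsub>H\<^esub>"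
    have b: "?b \<in> carrier EA" using \<phi> IS.blk_closed[OF blk_ok_diag] L by simp
    have "E1 K \<otimes>\<^bsub>X1\<^esub> f (q.gam \<phi>) \<otimes>\<^bsub>X1\<^esub> E1 I = f (E2 K \<otimes>\<^bsub>X2\<^esub> q.gam \<phi> \<otimes>\<^bsub>X2\<^esub> E2 I)"
      using L \<phi> by (simp add: fs f(2))
    also have "\<dots> = piv I \<odot>\<^bsub>X1\<^esub> (D1 K \<otimes>\<^bsub>X1\<^esub> la1 c \<otimes>\<^bsub>X1\<^esub> U1 I)"
      unfolding q.gam_block[OF \<phi> L] q.sand_def c_def[symmetric]
      using L c q.iota_simps(1)[OF c] by (simp add: fs fUD f\<iota>)
    also have "D1 K \<otimes>\<^bsub>X1\<^esub> la1 c \<otimes>\<^bsub>X1\<^esub> U1 I = ES.pure (piv K) (IS.blk K I (xx K \<otimes>\<^bsub>H\<^esub> c))"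
      using L c ok L_S[OF L(1)] by (simp add: D1_def la1_def U1_def X1_mult blk_ok_xx blk_ok_from)
    also have "IS.blk K I (xx K \<otimes>\<^bsub>H\<^esub> c) = (poincare W S K * poincare W S I) \<odot>\<^bsub>EA\<^esub> ?b"
      unfolding c_def by (rule blk_comp[OF \<phi> L])
    \<comment> \<open>The polynomials pi(K) and pi(I) slide through the tensor sign to the scalar
      side, where they meet their inverses.\<close>
    also have "piv I \<odot>\<^bsub>X1\<^esub> ES.pure (piv K) \<dots> = ES.pure (piv I * piv K * of_zq (poincare W S K * poincare W S I)) ?b"
      using b ES.pure_simps(3)[OF b, of "piv I * piv K" "poincare W S K * poincare W S I"]
      by (simp add: ES.pure_simps(6))
    also have "piv I * piv K * of_zq (poincare W S K * poincare W S I) =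
        (piv I * of_zq (poincare W S I)) * (piv K * of_zq (poincare W S K))"
      by (simp add: of_zq_simps(2) ac_simps)
    also have "\<dots> = 1" using piv L by simp
    also have "ES.pure 1 ?b = E1 K \<otimes>\<^bsub>X1\<^esub> ES.pure 1 \<phi> \<otimes>\<^bsub>X1\<^esub> E1 I"
      using \<phi> IS.blk_closed[OF blk_ok_diag] L by (simp add: E1_def ES.pure_simps(4))
    finally show "E1 K \<otimes>\<^bsub>X1\<^esub> f (q.gam \<phi>) \<otimes>\<^bsub>X1\<^esub> E1 I = E1 K \<otimes>\<^bsub>X1\<^esub> ES.pure 1 \<phi> \<otimes>\<^bsub>X1\<^esub> E1 I" .
  qed
  \<comment> \<open>The generators are single blocks, and on these \<open>gam\<close> is computed by
    \<open>gam_blk\<close>; the values come from \<open>sand_xx\<close>.\<close>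
  have gE: "g (E1 I) = E2 I" "g (U1 I) = U2 I" "g (D1 I) = D2 I" if I: "I \<in> L" for I
  proof -
    note ok = blk_ok_diag[OF I] blk_ok_from[OF I H.one_closed] blk_ok_xx[OF I]
    have x: "xx I \<in> carrier H" using L_S[OF I] by simp
    show "g (E1 I) = E2 I" "g (U1 I) = U2 I" "g (D1 I) = D2 I"
      using ok x I q.sand_xx[OF I] by (simp_all add: E1_def U1_def D1_def g(2) IS.blk_closed q.gam_blk)
  qed
  show ?thesis
  proof (rule alg_isomorphicI[OF g(1) f(1)])
    fix x assume "x \<in> carrier X1"
    then show "f (g x) = x"
    proof (induction x rule: ES.tensor_induct)
      case (pure r \<phi>)
      then show ?case by (simp add: g(2) fs fgam ES.pure_simps(6))
    next
      case (add x y)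
      then show ?case using alg_hom_simps(1)[OF g(1)] by (simp add: alg_hom_simps(3)[OF g(1)] fs(3))
    qed
  next
    fix x assume x: "x \<in> carrier X2"
    show "g (f x) = x"
    proof (rule X2_ext[OF q.B.alg_axioms alg_hom_comp[OF f(1) g(1)] alg_hom_id[OF q.B.alg_axioms] _ _ _ x])
      show "g (f (cl2 (triv_path I))) = cl2 (triv_path I)" if "I \<in> L" for I
        using f(2) gE(1) that by (simp add: E2_def)
      show "g (f (cl2 (ups W S I))) = cl2 (ups W S I)" "g (f (cl2 (del W S I))) = cl2 (del W S I)" if "I \<in> L" "I \<noteq> {}" for I
        using f(3)[OF that] gE[OF that(1)] that(2) by (simp_all add: U2_def D2_def)
    qed
  qed
qed

end

theorem theorem5p1:
  fixes W :: "('w, 'm) monoid_scheme" and S :: "'w set"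
    and red :: "'w \<Rightarrow> 'w list"
    and rw :: "'w set list \<Rightarrow> 'w list"
    and a :: "'w list \<Rightarrow> 'w list \<Rightarrow> int poly"
  assumes "coxeter_system W S" and "finite S"
    and red: "\<And>w. w \<in> carrier W \<Longrightarrow> reduced_expr W S w (red w)"
    and rw: "\<And>I Is. I \<in> fin_subsets W S \<Longrightarrow> is_ordering I Is \<Longrightarrow> adapted_expr W S Is (rw Is)"
    and a: "\<And>I Is. I \<in> fin_subsets W S \<Longrightarrow> is_ordering I Is \<Longrightarrow> x_expansion W S a I (rw Is)"
  shows "alg_isomorphic (extend_scalars of_zq (hecke_end W S))
           (quot_algebra (RQ W S) (J_relations W S red))
       \<and> alg_isomorphic (quot_algebra (RQ W S) (J_relations W S red))
           (quot_algebra (RHasse W S) (HJ_relations W S rw a))"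
proof -
  have "group W" using assms(1) by (simp add: coxeter_system_def)
  then have "cox W S" using assms(1) by (intro cox.intro cox_axioms.intro)
  then interpret coxf W S red rw a
    using assms(2) red rw a by (intro coxf.intro coxf_axioms.intro)
  show ?thesis
    unfolding hecke_end_def using X1_iso_X2 X2_iso_X3 by blast
qed

end
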